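(* Suppose that $\phi\in L^2(\mathbb{R}\to\mathbb{C})$ is a stationary wave solution of the Hamiltonian flow associated to $\mathcal{H}_6$; that is, $\phi$ satisfies $$\omega\phi(x)=\mathcal{T}_6(\phi,\phi,\phi,\phi,\phi)(x)$$ for some $\omega\in\mathbb{R}$. Then there exist $\alpha>0$ and $\beta>0$ such that $\phi e^{\alpha x^2}\in L^\infty$ and $\widehat{\phi}e^{\beta x^2}\in L^\infty$. As a result, $\phi$ can be extended to an entire function on the complex plane.
   Context: $H=-\Delta+x^2$ on $L^2(\mathbb{R})$, and $e^{itH}$ is the unitary propagator of $iu_t+Hu=0$ (so $e^{itH}\phi_n=e^{it(2n+1)}\phi_n$ for the Hermite functions $\phi_n$, $H\phi_n=(2n+1)\phi_n$). $\mathcal{H}_6(f)=\frac2\pi\int_{-\pi/4}^{\pi/4}\int_{\mathbb{R}}|e^{itH}f|^6\,dx\,dt$, whose Hamiltonian flow is $iu_t=\mathcal{T}_6(u,u,u,u,u)$ with $$\mathcal{T}_6(u,u,u,u,u)=\frac{12}{\pi}\int_{-\pi/4}^{\pi/4}e^{-isH}\left(|e^{isH}u|^4e^{isH}u\right)ds.$$ The Fourier transform is $\widehat{\phi}(\xi)=(2\pi)^{-1/2}\int_{\mathbb{R}} e^{-ix\xi}\phi(x)\,dx$. *)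

theory Defs
  imports "HOL-Probability.Probability"
begin

section \<open>The Hilbert space \<open>L\<^sup>2(\<real> \<rightarrow> \<complex>)\<close>\<close>

definition square_integrable :: "(real \<Rightarrow> complex) \<Rightarrow> bool" where
  "square_integrable f \<longleftrightarrow>
     f \<in> borel_measurable lebesgue \<and> integrable lebesgue (\<lambda>x. (cmod (f x))\<^sup>2)"

definition L2_rel :: "(real \<Rightarrow> complex) \<Rightarrow> (real \<Rightarrow> complex) \<Rightarrow> bool" where
  "L2_rel f g \<longleftrightarrow> square_integrable f \<and> square_integrable g \<and> (AE x in lebesgue. f x = g x)"

lemma square_integrable_measurable [measurable_dest]:
  "square_integrable f \<Longrightarrow> f \<in> borel_measurable lebesgue"
  by (simp add: square_integrable_def)

lemma square_integrable_integrable: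
  "square_integrable f \<Longrightarrow> integrable lebesgue (\<lambda>x. (cmod (f x))\<^sup>2)"
  by (simp add: square_integrable_def)

lemma square_integrable_zero: "square_integrable (\<lambda>_. 0)"
  by (simp add: square_integrable_def)

lemma norm_add_sq_le: "(norm (a + b))\<^sup>2 \<le> 2 * ((norm a)\<^sup>2 + (norm b)\<^sup>2)"
  for a b :: "'a::real_normed_vector"
proof -
  have "(norm (a + b))\<^sup>2 \<le> (norm a + norm b)\<^sup>2"
    by (intro power_mono norm_triangle_ineq norm_ge_zero)
  also have "\<dots> \<le> 2 * ((norm a)\<^sup>2 + (norm b)\<^sup>2)"
    using sum_squares_bound[of "norm a" "norm b"] by (simp add: power2_sum)
  finally show ?thesis .
qed

lemma square_integrable_add:
  assumes f: "square_integrable f" and g: "square_integrable g"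
  shows "square_integrable (\<lambda>x. f x + g x)"
  unfolding square_integrable_def
proof
  note [measurable] = square_integrable_measurable[OF f] square_integrable_measurable[OF g]
  show "(\<lambda>x. f x + g x) \<in> borel_measurable lebesgue" by measurable
  show "integrable lebesgue (\<lambda>x. (cmod (f x + g x))\<^sup>2)"
  proof (rule Bochner_Integration.integrable_bound)
    show "integrable lebesgue (\<lambda>x. 2 * ((cmod (f x))\<^sup>2 + (cmod (g x))\<^sup>2))"
      using f g by (auto simp: square_integrable_def)
    show "AE x in lebesgue. norm ((cmod (f x + g x))\<^sup>2)
            \<le> norm (2 * ((cmod (f x))\<^sup>2 + (cmod (g x))\<^sup>2))"
      using norm_add_sq_le[where 'a=complex] by auto
  qed measurable
qed

lemma square_integrable_mult_const:
  assumes f: "square_integrable f"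
  shows "square_integrable (\<lambda>x. c * f x)"
  using f by (auto simp: square_integrable_def norm_mult power_mult_distrib)

lemma square_integrable_uminus:
  "square_integrable f \<Longrightarrow> square_integrable (\<lambda>x. - f x)"
  using square_integrable_mult_const[of f "-1"] by simp

lemma square_integrable_diff:
  assumes "square_integrable f" "square_integrable g"
  shows "square_integrable (\<lambda>x. f x - g x)"
  using square_integrable_add[OF assms(1) square_integrable_uminus[OF assms(2)]] by simp

lemma square_integrable_scaleR:
  "square_integrable f \<Longrightarrow> square_integrable (\<lambda>x. r *\<^sub>R f x)"
  using square_integrable_mult_const[of f "of_real r"] by (simp add: scaleR_conv_of_real)

lemma integrable_mult_cnj:
  assumes f: "square_integrable f" and g: "square_integrable g"
  shows "integrable lebesgue (\<lambda>x. f x * cnj (g x))"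
proof (rule Bochner_Integration.integrable_bound)
  note [measurable] = square_integrable_measurable[OF f] square_integrable_measurable[OF g]
  show "integrable lebesgue (\<lambda>x. (cmod (f x))\<^sup>2 + (cmod (g x))\<^sup>2)"
    using f g by (auto simp: square_integrable_def)
  have "cmod a * cmod b \<le> (cmod a)\<^sup>2 + (cmod b)\<^sup>2" for a b
    using sum_squares_bound[of "cmod a" "cmod b"]
      mult_nonneg_nonneg[of "cmod a" "cmod b"] by (simp del: mult_nonneg_nonneg)
  then show "AE x in lebesgue. norm (f x * cnj (g x)) \<le> norm ((cmod (f x))\<^sup>2 + (cmod (g x))\<^sup>2)"
    by (auto simp: norm_mult)
  have "cnj \<in> borel_measurable borel"
    by (intro borel_measurable_continuous_onI continuous_intros)
  from measurable_compose[OF square_integrable_measurable[OF g] this]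
  have [measurable]: "(\<lambda>x. cnj (g x)) \<in> borel_measurable lebesgue" .
  show "(\<lambda>x. f x * cnj (g x)) \<in> borel_measurable lebesgue" by measurable
qed

quotient_type L2 = "real \<Rightarrow> complex" / partial: L2_rel
proof (rule part_equivpI)
  show "\<exists>f. L2_rel f f"
    using square_integrable_zero by (auto simp: L2_rel_def)
  show "symp L2_rel"
    by (auto simp: symp_def L2_rel_def elim: eventually_mono)
  show "transp L2_rel"
    unfolding transp_def L2_rel_def by (auto elim: eventually_elim2)
qed

instantiation L2 :: ab_group_add
begin

lift_definition zero_L2 :: L2 is "\<lambda>_. 0"
  by (simp add: L2_rel_def square_integrable_zero)

lift_definition plus_L2 :: "L2 \<Rightarrow> L2 \<Rightarrow> L2" is "\<lambda>f g x. f x + g x"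
  by (auto simp: L2_rel_def square_integrable_add elim: eventually_elim2)

lift_definition uminus_L2 :: "L2 \<Rightarrow> L2" is "\<lambda>f x. - f x"
  by (auto simp: L2_rel_def square_integrable_uminus elim: eventually_mono)

lift_definition minus_L2 :: "L2 \<Rightarrow> L2 \<Rightarrow> L2" is "\<lambda>f g x. f x - g x"
  by (auto simp: L2_rel_def square_integrable_diff elim: eventually_elim2)

instance
  by standard (transfer, auto simp: L2_rel_def square_integrable_zero square_integrable_add
      square_integrable_uminus square_integrable_diff algebra_simps)+

end

text \<open>Complex scalar multiplication, and the inner product, conjugate linear in the second
  argument.\<close>

lift_definition scaleC_L2 :: "complex \<Rightarrow> L2 \<Rightarrow> L2" (infixr \<open>*\<^sub>C\<close> 75) is "\<lambda>c f x. c * f x"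
  by (auto simp: L2_rel_def square_integrable_mult_const elim: eventually_mono)

lift_definition cinner_L2 :: "L2 \<Rightarrow> L2 \<Rightarrow> complex" is
  "\<lambda>f g. integral\<^sup>L lebesgue (\<lambda>x. f x * cnj (g x))"
proof -
  fix f f' g g'
  assume "L2_rel f f'" "L2_rel g g'"
  then have f: "square_integrable f" "square_integrable f'"
    and g: "square_integrable g" "square_integrable g'"
    and eq: "AE x in lebesgue. f x = f' x" "AE x in lebesgue. g x = g' x"
    by (auto simp: L2_rel_def)
  show "integral\<^sup>L lebesgue (\<lambda>x. f x * cnj (g x)) = integral\<^sup>L lebesgue (\<lambda>x. f' x * cnj (g' x))"
  proof (rule integral_cong_AE)
    show "AE x in lebesgue. f x * cnj (g x) = f' x * cnj (g' x)"
      using eq by eventually_elim simp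
  qed (intro borel_measurable_integrable integrable_mult_cnj f g)+
qed

instantiation L2 :: real_vector
begin

lift_definition scaleR_L2 :: "real \<Rightarrow> L2 \<Rightarrow> L2" is "\<lambda>r f x. r *\<^sub>R f x"
  by (auto simp: L2_rel_def square_integrable_scaleR elim: eventually_mono)

instance
  by standard (transfer, auto simp: L2_rel_def square_integrable_scaleR square_integrable_add
      algebra_simps)+

end

instantiation L2 :: real_inner
begin

definition inner_L2 :: "L2 \<Rightarrow> L2 \<Rightarrow> real" where
  "inner_L2 f g = Re (cinner_L2 f g)"

definition norm_L2 :: "L2 \<Rightarrow> real" where
  "norm_L2 f = sqrt (inner f f)"

definition dist_L2 :: "L2 \<Rightarrow> L2 \<Rightarrow> real" where
  "dist_L2 f g = norm (f - g)"

definition sgn_L2 :: "L2 \<Rightarrow> L2" where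
  "sgn_L2 f = f /\<^sub>R norm f"

definition uniformity_L2 :: "(L2 \<times> L2) filter" where
  "uniformity_L2 = (INF e\<in>{0 <..}. principal {(x, y). dist x y < e})"

definition open_L2 :: "L2 set \<Rightarrow> bool" where
  "open_L2 U \<longleftrightarrow> (\<forall>x\<in>U. eventually (\<lambda>(x', y). x' = x \<longrightarrow> y \<in> U) uniformity)"

lemma cinner_L2_commute: "cinner_L2 f g = cnj (cinner_L2 g f)"
proof transfer
  fix f g :: "real \<Rightarrow> complex"
  have "(\<lambda>x. f x * cnj (g x)) = (\<lambda>x. cnj (g x * cnj (f x)))"
    by (simp add: mult.commute)
  then show "integral\<^sup>L lebesgue (\<lambda>x. f x * cnj (g x)) =
      cnj (integral\<^sup>L lebesgue (\<lambda>x. g x * cnj (f x)))"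
    by (simp only: Bochner_Integration.integral_cnj)
qed

lemma cinner_L2_add_left: "cinner_L2 (f + g) h = cinner_L2 f h + cinner_L2 g h"
  by transfer (simp add: L2_rel_def ring_distribs integrable_mult_cnj)

lemma cinner_L2_scaleC_left: "cinner_L2 (c *\<^sub>C f) h = c * cinner_L2 f h"
  by transfer (simp add: mult.assoc)

lemma scaleR_L2_eq: "r *\<^sub>R f = complex_of_real r *\<^sub>C (f :: L2)"
  by transfer (auto simp: L2_rel_def square_integrable_mult_const scaleR_conv_of_real)

lemma integral_mult_cnj_self:
  "integral\<^sup>L lebesgue (\<lambda>x. f x * cnj (f x)) = of_real (integral\<^sup>L lebesgue (\<lambda>x. (cmod (f x))\<^sup>2))"
  by (simp only: complex_norm_square[symmetric] integral_complex_of_real)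

instance
proof
  fix x y z :: L2 and r :: real
  show "dist x y = norm (x - y)" by (rule dist_L2_def)
  show "sgn x = x /\<^sub>R norm x" by (rule sgn_L2_def)
  show "(uniformity :: (L2 \<times> L2) filter) = (INF e\<in>{0 <..}. principal {(x, y). dist x y < e})"
    by (rule uniformity_L2_def)
  show "open U \<longleftrightarrow> (\<forall>x\<in>U. eventually (\<lambda>(x', y). x' = x \<longrightarrow> y \<in> U) uniformity)" for U :: "L2 set"
    by (rule open_L2_def)
  show "inner x y = inner y x"
    by (simp add: inner_L2_def cinner_L2_commute[of x y])
  show "inner (x + y) z = inner x z + inner y z"
    by (simp add: inner_L2_def cinner_L2_add_left)
  show "inner (r *\<^sub>R x) y = r * inner x y"
    by (simp add: inner_L2_def scaleR_L2_eq cinner_L2_scaleC_left)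
  show "0 \<le> inner x x"
    unfolding inner_L2_def by transfer (simp add: integral_mult_cnj_self)
  show "(inner x x = 0) = (x = 0)"
    unfolding inner_L2_def
  proof transfer
    fix f assume f: "L2_rel f f"
    then have i: "integrable lebesgue (\<lambda>x. (cmod (f x))\<^sup>2)"
      by (simp add: L2_rel_def square_integrable_def)
    show "(Re (integral\<^sup>L lebesgue (\<lambda>x. f x * cnj (f x))) = 0) = L2_rel f (\<lambda>_. 0)"
      using f integral_nonneg_eq_0_iff_AE[OF i]
      by (simp add: integral_mult_cnj_self L2_rel_def square_integrable_zero)
  qed
  show "norm x = sqrt (inner x x)" by (rule norm_L2_def)
qed

end

lemma norm_abs_L2_sq:
  assumes "square_integrable f"
  shows "(norm (abs_L2 f))\<^sup>2 = integral\<^sup>L lebesgue (\<lambda>x. (cmod (f x))\<^sup>2)"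
proof -
  have f: "L2_rel f f" using assms by (simp add: L2_rel_def)
  show ?thesis
    by (simp add: power2_norm_eq_inner inner_L2_def cinner_L2.abs_eq[OF f f] integral_mult_cnj_self)
qed

lemma abs_L2_diff:
  "square_integrable f \<Longrightarrow> square_integrable g \<Longrightarrow> abs_L2 f - abs_L2 g = abs_L2 (\<lambda>x. f x - g x)"
  by (intro minus_L2.abs_eq) (auto simp: L2_rel_def)

lemma rep_L2: "square_integrable (rep_L2 f)" "abs_L2 (rep_L2 f) = f"
  using Quotient_rep_reflp[OF Quotient_L2] Quotient_abs_rep[OF Quotient_L2]
  by (auto simp: L2_rel_def)


lemma dist_abs_L2_sq:
  assumes "square_integrable f" "square_integrable g"
  shows "(dist (abs_L2 f) (abs_L2 g))\<^sup>2 = integral\<^sup>L lebesgue (\<lambda>x. (cmod (f x - g x))\<^sup>2)"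
  by (simp add: dist_norm abs_L2_diff assms norm_abs_L2_sq square_integrable_diff)

subsection \<open>Completeness\<close>

instance L2 :: banach
proof
  fix X :: "nat \<Rightarrow> L2" assume X: "Cauchy X"
  have "\<exists>r. \<forall>k. (\<forall>m\<ge>r k. \<forall>n\<ge>r k. dist (X m) (X n) < (1/2)^k) \<and> r k < r (Suc k)"
  proof (rule dependent_nat_choice)
    show "\<exists>N. \<forall>m\<ge>N. \<forall>n\<ge>N. dist (X m) (X n) < (1/2)^0"
      using X[unfolded Cauchy_def] by auto
    fix N0 k
    obtain N where "\<forall>m\<ge>N. \<forall>n\<ge>N. dist (X m) (X n) < (1/2)^Suc k"
      using X[unfolded Cauchy_def, rule_format, of "(1/2)^Suc k"] by auto
    then show "\<exists>N. (\<forall>m\<ge>N. \<forall>n\<ge>N. dist (X m) (X n) < (1/2)^Suc k) \<and> N0 < N"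
      by (intro exI[of _ "max N (Suc N0)"]) auto
  qed
  then obtain r where r: "\<And>k m n. m \<ge> r k \<Longrightarrow> n \<ge> r k \<Longrightarrow> dist (X m) (X n) < (1/2)^k"
    and "\<And>k. r k < r (Suc k)"
    by blast
  then have mono: "strict_mono r" by (simp add: strict_mono_Suc_iff)
  define G where "G k = rep_L2 (X (r k))" for k
  have G: "square_integrable (G k)" "abs_L2 (G k) = X (r k)" for k
    by (simp_all add: G_def rep_L2)
  have Gm [measurable]: "G k \<in> borel_measurable lebesgue" for k
    by (rule square_integrable_measurable[OF G(1)])
  have nn: "(\<integral>\<^sup>+x. ennreal ((cmod (G j x - G k x))\<^sup>2) \<partial>lebesgue) \<le> ennreal ((1/4)^k)" if "k \<le> j" for j k
  proof -
    have "(\<integral>\<^sup>+x. ennreal ((cmod (G j x - G k x))\<^sup>2) \<partial>lebesgue)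
        = ennreal ((dist (X (r j)) (X (r k)))\<^sup>2)"
      using nn_integral_eq_integral[OF square_integrable_integrable[OF square_integrable_diff[OF G(1)[of j] G(1)[of k]]]]
        dist_abs_L2_sq[OF G(1)[of j] G(1)[of k]] by (simp add: G)
    also have "\<dots> \<le> ennreal (((1/2)^k)\<^sup>2)"
      using r[of k "r j" "r k"] strict_mono_less_eq[OF mono, of k j] that
      by (intro ennreal_leI power_mono) auto
    also have "((1/2)^k)\<^sup>2 = (1/4 :: real)^k"
      by (simp add: power2_eq_square flip: power_mult_distrib)
    finally show ?thesis .
  qed
  have "(\<integral>\<^sup>+x. (\<Sum>k. ennreal (2^k * (cmod (G (Suc k) x - G k x))\<^sup>2)) \<partial>lebesgue)
      = (\<Sum>k. \<integral>\<^sup>+x. ennreal (2^k * (cmod (G (Suc k) x - G k x))\<^sup>2) \<partial>lebesgue)"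
    by (intro nn_integral_suminf) measurable
  also have "\<dots> \<le> (\<Sum>k. ennreal ((1/2)^k))"
  proof (intro suminf_le summableI)
    fix k
    have "(\<integral>\<^sup>+x. ennreal (2^k * (cmod (G (Suc k) x - G k x))\<^sup>2) \<partial>lebesgue)
        = ennreal (2^k) * (\<integral>\<^sup>+x. ennreal ((cmod (G (Suc k) x - G k x))\<^sup>2) \<partial>lebesgue)"
      by (subst nn_integral_cmult[symmetric]) (auto simp: ennreal_mult)
    also have "\<dots> \<le> ennreal (2^k) * ennreal ((1/4)^k)"
      by (intro mult_left_mono nn) auto
    also have "\<dots> = ennreal ((1/2)^k)"
      by (simp flip: ennreal_mult power_mult_distrib)
    finally show "(\<integral>\<^sup>+x. ennreal (2^k * (cmod (G (Suc k) x - G k x))\<^sup>2) \<partial>lebesgue) \<le> ennreal ((1/2)^k)" .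
  qed
  also have "\<dots> = ennreal (\<Sum>k. (1/2)^k)"
    by (intro suminf_ennreal2) (auto intro: summable_geometric)
  also have "\<dots> < \<infinity>" by simp
  finally have "AE x in lebesgue. (\<Sum>k. ennreal (2^k * (cmod (G (Suc k) x - G k x))\<^sup>2)) \<noteq> \<infinity>"
    by (intro nn_integral_PInf_AE) auto
  then have "AE x in lebesgue. convergent (\<lambda>k. G k x)"
  proof eventually_elim
    case (elim x)
    have "summable (\<lambda>k. 2^k * (cmod (G (Suc k) x - G k x))\<^sup>2)"
      using elim by (intro summable_suminf_not_top) (auto simp: top_ennreal_def)
    then have "summable (\<lambda>k. 2^k * (cmod (G (Suc k) x - G k x))\<^sup>2 + (1/2)^k)"
      by (intro summable_add summable_geometric) auto
    moreover have "cmod (G (Suc k) x - G k x) \<le> 2^k * (cmod (G (Suc k) x - G k x))\<^sup>2 + (1/2)^k" for k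
    proof -
      define d where "d = cmod (G (Suc k) x - G k x)"
      define a :: real where "a = 2^k"
      have a: "a > 0" "(1/2)^k = 1/a" by (auto simp: a_def power_one_over)
      have "0 \<le> (a * d - 1)\<^sup>2" "0 \<le> a * d" using a by (auto simp: d_def)
      then have "a * d \<le> (a * d)\<^sup>2 + 1" by (simp add: power2_diff)
      then have "d \<le> a * d\<^sup>2 + 1/a" using a by (simp add: field_simps power2_eq_square)
      then show ?thesis using a by (simp add: d_def a_def)
    qed
    ultimately have "summable (\<lambda>k. G (Suc k) x - G k x)"
      by (intro summable_comparison_test[of "\<lambda>k. G (Suc k) x - G k x"]) auto
    then have "convergent (\<lambda>n. G 0 x + (\<Sum>k<n. G (Suc k) x - G k x))"
      by (intro convergent_add convergent_const) (simp add: summable_iff_convergent)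
    then show ?case by (simp add: sum_lessThan_telescope[of "\<lambda>k. G k x"])
  qed
  then have lim: "AE x in lebesgue. (\<lambda>k. G k x) \<longlonglongrightarrow> lim (\<lambda>k. G k x)"
    by (auto elim: eventually_mono simp: convergent_LIMSEQ_iff)
  define F where "F x = lim (\<lambda>k. G k x)" for x
  have [measurable]: "F \<in> borel_measurable lebesgue"
    unfolding F_def by (rule borel_measurable_lim_metric) auto
  have le: "(\<integral>\<^sup>+x. ennreal ((cmod (F x - G k x))\<^sup>2) \<partial>lebesgue) \<le> ennreal ((1/4)^k)" for k
  proof -
    have "(\<integral>\<^sup>+x. ennreal ((cmod (F x - G k x))\<^sup>2) \<partial>lebesgue)
        = (\<integral>\<^sup>+x. liminf (\<lambda>j. ennreal ((cmod (G j x - G k x))\<^sup>2)) \<partial>lebesgue)"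
      using lim
    proof (intro nn_integral_cong_AE, eventually_elim)
      case (elim x)
      have "(\<lambda>j. ennreal ((cmod (G j x - G k x))\<^sup>2)) \<longlonglongrightarrow> ennreal ((cmod (F x - G k x))\<^sup>2)"
        unfolding F_def by (intro tendsto_ennrealI tendsto_intros elim)
      from lim_imp_Liminf[OF _ this] show ?case by simp
    qed
    also have "\<dots> \<le> liminf (\<lambda>j. \<integral>\<^sup>+x. ennreal ((cmod (G j x - G k x))\<^sup>2) \<partial>lebesgue)"
      by (intro nn_integral_liminf) measurable
    also have "\<dots> \<le> ennreal ((1/4)^k)"
      using nn[of k] by (intro Liminf_le) (auto simp: eventually_sequentially)
    finally show ?thesis .
  qed
  have d: "square_integrable (\<lambda>x. F x - G k x)" for k
    unfolding square_integrable_def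
    using le_less_trans[OF le[of k]] by (auto intro!: integrableI_nonneg)
  then have F: "square_integrable F"
    using square_integrable_add[OF d[of 0] G(1)[of 0]] by simp
  have "dist (X (r k)) (abs_L2 F) \<le> (1/2)^k" for k
  proof -
    have "ennreal ((dist (abs_L2 F) (X (r k)))\<^sup>2) \<le> ennreal ((1/4)^k)"
      using le[of k] nn_integral_eq_integral[OF square_integrable_integrable[OF d[of k]]]
        dist_abs_L2_sq[OF F G(1)[of k]] by (simp add: G)
    then have "(dist (abs_L2 F) (X (r k)))\<^sup>2 \<le> ((1/2)^k)\<^sup>2"
      by (simp add: power2_eq_square flip: power_mult_distrib)
    then show ?thesis
      using power2_le_imp_le[of "dist (abs_L2 F) (X (r k))" "(1/2)^k"] by (simp add: dist_commute)
  qed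
  moreover have "(\<lambda>k. (1/2)^k :: real) \<longlonglongrightarrow> 0"
    by (intro LIMSEQ_realpow_zero) auto
  ultimately have "(X \<circ> r) \<longlonglongrightarrow> abs_L2 F"
    by (elim metric_tendsto_imp_tendsto) (simp add: always_eventually)
  from Cauchy_converges_subseq[OF X mono this] show "convergent X"
    by (auto simp: convergent_def)
qed


subsection \<open>Separability\<close>

text \<open>The Bochner integral of the library needs a second countable target space. We show that
  truncated polynomials with complex coefficients are dense.\<close>

lemma dense_imp_countable_subbasis:
  fixes D :: "'a::metric_space set"
  assumes "countable D" and dense: "\<And>x e. e > 0 \<Longrightarrow> \<exists>d\<in>D. dist x d < e"
  shows "\<exists>B::'a set set. countable B \<and> open = generate_topology B"
proof (intro exI conjI)
  let ?B = "(\<lambda>(d, n). ball d (inverse (real (Suc n)))) ` (D \<times> (UNIV :: nat set))"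
  show "countable ?B" using assms(1) by auto
  have "topological_basis ?B"
  proof (rule topological_basisI)
    fix U :: "'a set" and x assume U: "open U" "x \<in> U"
    then obtain e where e: "e > 0" "ball x e \<subseteq> U" by (auto simp: open_contains_ball)
    then obtain n where n: "inverse (real (Suc n)) < e / 2"
      using reals_Archimedean[of "e/2"] by auto
    obtain d where d: "d \<in> D" "dist x d < inverse (real (Suc n))"
      using dense[of "inverse (real (Suc n))" x] by auto
    have "ball d (inverse (real (Suc n))) \<subseteq> ball x e"
    proof
      fix y assume "y \<in> ball d (inverse (real (Suc n)))"
      then show "y \<in> ball x e"
        using d n dist_triangle[of x y d] by (simp del: of_nat_Suc)
    qed
    with e d show "\<exists>B'\<in>?B. x \<in> B' \<and> B' \<subseteq> U"
      by (intro bexI[of _ "ball d (inverse (real (Suc n)))"]) (auto simp: dist_commute)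
  qed auto
  then show "open = generate_topology ?B" by (rule topological_basis_imp_subbasis)
qed

lemma countable_span_imp_countable_subbasis:
  fixes S :: "'a::real_normed_vector set"
  assumes S: "countable S" and dense: "closure (span S) = UNIV"
  shows "\<exists>B::'a set set. countable B \<and> open = generate_topology B"
proof -
  define D where "D = (\<lambda>xs. \<Sum>(q, b)\<leftarrow>xs. of_rat q *\<^sub>R b) ` lists ((UNIV :: rat set) \<times> S)"
  have D0: "0 \<in> D" unfolding D_def by (rule image_eqI[of _ _ "[]"]) auto
  have Dadd: "of_rat q *\<^sub>R b + d \<in> D" if b: "b \<in> S" and d: "d \<in> D" for q b d
  proof -
    obtain xs where "xs \<in> lists (UNIV \<times> S)" "d = (\<Sum>(q, b)\<leftarrow>xs. of_rat q *\<^sub>R b)"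
      using d unfolding D_def by blast
    then show ?thesis using b unfolding D_def by (intro image_eqI[of _ _ "(q, b) # xs"]) auto
  qed
  have "x \<in> closure D" if "x \<in> span S" for x
    using that
  proof (induction rule: span_induct_alt)
    case base
    show ?case using D0 closure_subset by blast
  next
    case (step c b y)
    show ?case
      unfolding closure_approachable
    proof (intro allI impI)
      fix e :: real assume e: "e > 0"
      obtain d where d: "d \<in> D" "dist d y < e / 2"
        using step(2) e by (meson closure_approachable half_gt_zero)
      have "0 < e / (2 * (norm b + 1))"
        using e by (intro divide_pos_pos) (auto intro: add_nonneg_pos)
      from Rats_dense_in_real[of c "c + e / (2 * (norm b + 1))"] this
      obtain q where q: "c < of_rat q" "of_rat q < c + e / (2 * (norm b + 1))"
        by (auto elim!: Rats_cases)
      have "norm ((of_rat q - c) *\<^sub>R b) \<le> e / (2 * (norm b + 1)) * norm b"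
        unfolding norm_scaleR by (intro mult_right_mono) (use q in auto)
      also have "\<dots> \<le> e / 2"
        using e by (simp add: field_simps add_pos_nonneg)
      finally have 1: "norm ((of_rat q - c) *\<^sub>R b) \<le> e / 2" .
      have "dist (of_rat q *\<^sub>R b + d) (c *\<^sub>R b + y) = norm ((of_rat q - c) *\<^sub>R b + (d - y))"
        by (simp add: dist_norm algebra_simps)
      also have "\<dots> \<le> norm ((of_rat q - c) *\<^sub>R b) + norm (d - y)"
        by (rule norm_triangle_ineq)
      also have "\<dots> < e" using 1 d(2) by (simp add: dist_norm)
      finally show "\<exists>d\<in>D. dist d (c *\<^sub>R b + y) < e"
        using Dadd[OF step(1) d(1)] by blast
    qed
  qed
  then have "closure (span S) \<subseteq> closure D"
    by (intro closure_minimal) auto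
  then have "closure D = UNIV" using dense by auto
  then have "\<exists>d\<in>D. dist x d < e" if "e > 0" for x e
    using that closure_approachable[of x D] by (auto simp: dist_commute)
  moreover have "countable D"
    unfolding D_def using S by (intro countable_image countable_lists) auto
  ultimately show ?thesis by (intro dense_imp_countable_subbasis)
qed

lemma abs_L2_tendsto:
  assumes F: "square_integrable F" and G: "\<And>n. square_integrable (G n)"
    and lim: "AE x in lebesgue. (\<lambda>n. G n x) \<longlonglongrightarrow> F x"
    and w: "integrable lebesgue w" "\<And>n. AE x in lebesgue. (cmod (G n x - F x))\<^sup>2 \<le> w x"
  shows "(\<lambda>n. abs_L2 (G n)) \<longlonglongrightarrow> abs_L2 F"
proof -
  note [measurable] = square_integrable_measurable[OF F] square_integrable_measurable[OF G]
  have "(\<lambda>n. integral\<^sup>L lebesgue (\<lambda>x. (cmod (G n x - F x))\<^sup>2)) \<longlonglongrightarrow> integral\<^sup>L lebesgue (\<lambda>x::real. 0)"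
  proof (rule integral_dominated_convergence[where w=w])
    show "AE x in lebesgue. (\<lambda>n. (cmod (G n x - F x))\<^sup>2) \<longlonglongrightarrow> 0"
      using lim
    proof eventually_elim
      case (elim x)
      then have "(\<lambda>n. (cmod (G n x - F x))\<^sup>2) \<longlonglongrightarrow> (cmod (F x - F x))\<^sup>2"
        by (intro tendsto_intros)
      then show ?case by simp
    qed
  qed (use w in auto)
  then have "(\<lambda>n. sqrt ((dist (abs_L2 (G n)) (abs_L2 F))\<^sup>2)) \<longlonglongrightarrow> sqrt 0"
    by (intro tendsto_intros) (simp add: dist_abs_L2_sq F G)
  then show ?thesis by (simp add: tendsto_dist_iff[of _ "abs_L2 F"])
qed

lemma square_integrable_bounded_support:
  assumes [measurable]: "f \<in> borel_measurable lebesgue"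
    and "\<And>x. cmod (f x) \<le> c * indicator {-b..b} x"
  shows "square_integrable f"
  unfolding square_integrable_def
proof
  have "integrable lebesgue (\<lambda>x::real. c\<^sup>2 * indicator {-b..b} x)"
    by (intro integrable_mult_right integrable_real_indicator) (auto simp: emeasure_lborel_Icc_eq)
  then show "integrable lebesgue (\<lambda>x. (cmod (f x))\<^sup>2)"
  proof (rule Bochner_Integration.integrable_bound)
    have "(cmod (f x))\<^sup>2 \<le> c\<^sup>2 * indicator {-b..b} x" for x
      using assms(2)[of x] power_mono[OF assms(2)[of x], of 2]
      by (auto simp: indicator_def split: if_splits)
    then show "AE x in lebesgue. norm ((cmod (f x))\<^sup>2) \<le> norm (c\<^sup>2 * indicator {-b..b} x)"
      by (auto simp: abs_of_nonneg)
  qed measurable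
qed simp

definition trunc_poly :: "(complex \<times> nat \<times> nat) \<Rightarrow> real \<Rightarrow> complex" where
  "trunc_poly = (\<lambda>(c, k, n) x. c * of_real (x ^ k) * indicator {- real n..real n} x)"

lemma borel_measurable_continuous_lebesgue:
  fixes f :: "real \<Rightarrow> complex"
  assumes "continuous_on UNIV f" shows "f \<in> borel_measurable lebesgue"
  by (rule measurable_completion) (use borel_measurable_continuous_onI[OF assms] in simp)

lemma square_integrable_cut:
  assumes "continuous_on UNIV f"
  shows "square_integrable (\<lambda>x. f x * indicator {-b..b} x)"
proof -
  have "compact (f ` {-b..b})"
    by (intro compact_continuous_image continuous_on_subset[OF assms]) auto
  then obtain c where c: "\<And>x. x \<in> {-b..b} \<Longrightarrow> cmod (f x) \<le> c"
    using compact_imp_bounded bounded_iff by (metis imageI)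
  have "(\<lambda>x. f x * indicator {-b..b} x) \<in> borel_measurable lebesgue"
    by (intro borel_measurable_times borel_measurable_indicator
        borel_measurable_continuous_lebesgue assms) auto
  then show ?thesis
    by (rule square_integrable_bounded_support[of _ c b]) (use c in \<open>auto simp: indicator_def\<close>)
qed

lemma trunc_poly_span:
  assumes "real_polynomial_function p"
  shows "abs_L2 (\<lambda>x. c * of_real (p x) * indicator {- real n..real n} x)
           \<in> span ((\<lambda>i. abs_L2 (trunc_poly (c, i, n))) ` UNIV)"
proof -
  obtain a m where p: "p = (\<lambda>x. \<Sum>i\<le>m. a i * x ^ i)"
    using assms by (auto simp: real_polynomial_function_iff_sum)
  have sq: "square_integrable (\<lambda>x. c * of_real (q x) * indicator {- real n..real n} x)"
    if "continuous_on UNIV q" for q :: "real \<Rightarrow> real"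
    by (intro square_integrable_cut continuous_intros that)
  have "abs_L2 (\<lambda>x. c * of_real (\<Sum>i\<le>m. a i * x ^ i) * indicator {- real n..real n} x)
      = (\<Sum>i\<le>m. a i *\<^sub>R abs_L2 (trunc_poly (c, i, n)))" for m
  proof (induction m)
    case 0
    have "L2_rel (trunc_poly (c, 0, n)) (trunc_poly (c, 0, n))"
      using sq[of "\<lambda>x. x ^ 0"] by (simp add: L2_rel_def trunc_poly_def)
    from scaleR_L2.abs_eq[OF this, of "a 0"] show ?case
      by (simp add: trunc_poly_def scaleR_conv_of_real mult_ac)
  next
    case (Suc m)
    have r: "L2_rel (trunc_poly (c, Suc m, n)) (trunc_poly (c, Suc m, n))"
      using sq[of "\<lambda>x. x ^ Suc m"] by (simp add: L2_rel_def trunc_poly_def continuous_intros)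
    have r': "L2_rel (\<lambda>x. a (Suc m) *\<^sub>R trunc_poly (c, Suc m, n) x) (\<lambda>x. a (Suc m) *\<^sub>R trunc_poly (c, Suc m, n) x)"
      using r by (simp add: L2_rel_def square_integrable_scaleR)
    have s: "L2_rel (\<lambda>x. c * of_real (\<Sum>i\<le>m. a i * x ^ i) * indicator {- real n..real n} x)
       (\<lambda>x. c * of_real (\<Sum>i\<le>m. a i * x ^ i) * indicator {- real n..real n} x)"
      unfolding L2_rel_def by (intro conjI sq continuous_intros) auto
    have "(\<lambda>x. c * of_real (\<Sum>i\<le>Suc m. a i * x ^ i) * indicator {- real n..real n} x)
      = (\<lambda>x. c * of_real (\<Sum>i\<le>m. a i * x ^ i) * indicator {- real n..real n} x
          + a (Suc m) *\<^sub>R trunc_poly (c, Suc m, n) x)"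
      by (rule ext) (simp add: trunc_poly_def scaleR_conv_of_real algebra_simps)
    then show ?case
      using Suc plus_L2.abs_eq[OF s r'] scaleR_L2.abs_eq[OF r, of "a (Suc m)"] by simp
  qed
  then show ?thesis
    unfolding p by (simp only:) (intro span_sum span_scale span_base rangeI)
qed

lemma closure_span_trunc_poly:
  "closure (span ((\<lambda>i. abs_L2 (trunc_poly i)) ` ({1, \<i>} \<times> UNIV \<times> UNIV))) = UNIV"
    (is "closure (span ?S) = _")
proof -
  let ?V = "closure (span ?S)"
  let ?I = "\<lambda>n::nat. indicator {- real n..real n} :: real \<Rightarrow> complex"
  have V: "l \<in> ?V" if "\<And>n. u n \<in> ?V" "u \<longlonglongrightarrow> l" for u l
    using that closed_sequentially[OF closed_closure] by metis
  have poly: "abs_L2 (\<lambda>x. p x * ?I n x) \<in> ?V" if p: "polynomial_function p" for p n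
  proof -
    have rp: "real_polynomial_function (\<lambda>x. Re (p x))" "real_polynomial_function (\<lambda>x. Im (p x))"
      using p bounded_linear_Re bounded_linear_Im
      by (auto simp: polynomial_function_def o_def)
    have pc: "continuous_on UNIV p" by (rule continuous_on_polymonial_function[OF p])
    have "abs_L2 (\<lambda>x. c * of_real (q x) * ?I n x) \<in> span ?S"
      if "c \<in> {1, \<i>}" "real_polynomial_function q" for c q
      using trunc_poly_span[OF that(2), of c n]
      by (rule subsetD[OF span_mono, rotated]) (use that in auto)
    from span_add[OF this[OF _ rp(1), of 1] this[OF _ rp(2), of \<i>]]
    have "abs_L2 (\<lambda>x. 1 * of_real (Re (p x)) * ?I n x) + abs_L2 (\<lambda>x. \<i> * of_real (Im (p x)) * ?I n x)
        \<in> span ?S" by simp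
    also have "abs_L2 (\<lambda>x. 1 * of_real (Re (p x)) * ?I n x) + abs_L2 (\<lambda>x. \<i> * of_real (Im (p x)) * ?I n x)
      = abs_L2 (\<lambda>x. 1 * of_real (Re (p x)) * ?I n x + \<i> * of_real (Im (p x)) * ?I n x)"
      by (intro plus_L2.abs_eq)
         (auto simp: L2_rel_def intro!: square_integrable_cut continuous_intros pc)
    also have "(\<lambda>x. 1 * of_real (Re (p x)) * ?I n x + \<i> * of_real (Im (p x)) * ?I n x) = (\<lambda>x. p x * ?I n x)"
      by (rule ext) (simp add: complex_eq_iff indicator_def)
    finally show ?thesis using closure_subset by blast
  qed
  have cont: "abs_L2 (\<lambda>x. g x * ?I n x) \<in> ?V" if g: "continuous_on UNIV g" for g n
  proof -
    have "\<exists>p. polynomial_function p \<and> (\<forall>x\<in>{- real n..real n}. norm (g x - p x) < inverse (real (Suc k)))" for k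
      by (rule Stone_Weierstrass_polynomial_function) (auto intro: continuous_on_subset[OF g])
    then obtain p where p: "\<And>k. polynomial_function (p k)"
      "\<And>k x. x \<in> {- real n..real n} \<Longrightarrow> norm (g x - p k x) < inverse (real (Suc k))" by metis
    have "(\<lambda>k. abs_L2 (\<lambda>x. p k x * ?I n x)) \<longlonglongrightarrow> abs_L2 (\<lambda>x. g x * ?I n x)"
    proof (rule abs_L2_tendsto)
      show "square_integrable (\<lambda>x. p k x * ?I n x)" for k
        by (intro square_integrable_cut continuous_on_polymonial_function p)
      show "square_integrable (\<lambda>x. g x * ?I n x)"
        by (intro square_integrable_cut g)
      have "(\<lambda>k. p k x * ?I n x) \<longlonglongrightarrow> g x * ?I n x" for x
      proof (cases "x \<in> {- real n..real n}")
        case True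
        have "(\<lambda>k. g x - p k x) \<longlonglongrightarrow> 0"
          by (rule Lim_null_comparison[OF _ LIMSEQ_inverse_real_of_nat])
             (use p(2)[OF True] in \<open>auto intro!: always_eventually less_imp_le\<close>)
        from tendsto_diff[OF tendsto_const[of "g x"] this] show ?thesis using True by simp
      qed simp
      then show "AE x in lebesgue. (\<lambda>k. p k x * ?I n x) \<longlonglongrightarrow> g x * ?I n x" by simp
      show "integrable lebesgue (indicator {- real n..real n} :: real \<Rightarrow> real)"
        by (intro integrable_real_indicator) (auto simp: emeasure_lborel_Icc_eq)
      have "(cmod (p k x * ?I n x - g x * ?I n x))\<^sup>2 \<le> indicator {- real n..real n} x" for k x
      proof (cases "x \<in> {- real n..real n}")
        case True
        have "cmod (g x - p k x) \<le> 1"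
          using p(2)[OF True, of k] inverse_le_1_iff[of "real (Suc k)"] by linarith
        then show ?thesis using True by (simp add: norm_minus_commute power_le_one)
      qed simp
      then show "AE x in lebesgue. (cmod (p k x * ?I n x - g x * ?I n x))\<^sup>2 \<le> indicator {- real n..real n} x" for k
        by simp
    qed
    then show ?thesis by (rule V[rotated]) (intro poly p)
  qed
  have bdd: "abs_L2 f \<in> ?V"
    if n: "n > 0" and f: "f \<in> borel_measurable lebesgue"
      and b: "\<And>x. cmod (f x) \<le> real n * indicator {- real n..real n} x"
    for f n
  proof -
    have "f measurable_on UNIV"
      by (rule lebesgue_measurable_imp_measurable_on[OF f]) simp
    then obtain N g where N: "negligible N" and g: "\<And>k. continuous_on UNIV (g k)"
      and lim: "\<And>x. x \<notin> N \<Longrightarrow> (\<lambda>k. g k x) \<longlonglongrightarrow> f x"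
      unfolding measurable_on_def if_P[OF UNIV_I] by blast
    define h where "h k x = g k x / of_real (max 1 (cmod (g k x) / real n))" for k x
    have h: "continuous_on UNIV (h k)" for k
      unfolding h_def by (intro continuous_intros g) (use n in auto)
    have hb: "cmod (h k x) \<le> real n" for k x
    proof -
      have "cmod (h k x) = cmod (g k x) / max 1 (cmod (g k x) / real n)"
        by (simp add: h_def norm_divide)
      also have "\<dots> \<le> real n"
        using n by (subst pos_divide_le_eq) (auto simp: max_def field_simps)
      finally show ?thesis .
    qed
    have sf: "square_integrable f"
      by (rule square_integrable_bounded_support[OF f b])
    have "(\<lambda>k. abs_L2 (\<lambda>x. h k x * ?I n x)) \<longlonglongrightarrow> abs_L2 f"
    proof (rule abs_L2_tendsto[OF sf])
      show "square_integrable (\<lambda>x. h k x * ?I n x)" for k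
        by (intro square_integrable_cut h)
      have "(\<lambda>k. h k x * ?I n x) \<longlonglongrightarrow> f x" if "x \<notin> N" for x
      proof (cases "x \<in> {- real n..real n}")
        case True
        have "(\<lambda>k. h k x) \<longlonglongrightarrow> f x / of_real (max 1 (cmod (f x) / real n))"
          unfolding h_def by (intro tendsto_intros lim that) (use n in auto)
        moreover have "max 1 (cmod (f x) / real n) = 1"
          using b[of x] True n by (auto simp: max_def field_simps)
        ultimately show ?thesis using True by simp
      next
        case False
        then show ?thesis using b[of x] by simp
      qed
      moreover have "AE x in lebesgue. x \<notin> N"
        using N by (simp add: AE_not_in negligible_iff_null_sets)
      ultimately show "AE x in lebesgue. (\<lambda>k. h k x * ?I n x) \<longlonglongrightarrow> f x"
        by (auto elim: eventually_mono)
      show "integrable lebesgue (\<lambda>x::real. (2 * real n)\<^sup>2 * indicator {- real n..real n} x :: real)"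
        by (intro integrable_mult_right integrable_real_indicator) (auto simp: emeasure_lborel_Icc_eq)
      have "(cmod (h k x * ?I n x - f x))\<^sup>2 \<le> (2 * real n)\<^sup>2 * indicator {- real n..real n} x" for k x
      proof (cases "x \<in> {- real n..real n}")
        case True
        have "cmod (h k x - f x) \<le> 2 * real n"
          using norm_triangle_ineq4[of "h k x" "f x"] hb[of k x] b[of x] True by simp
        from power_mono[OF this, of 2] show ?thesis using True by simp
      next
        case False
        then show ?thesis using b[of x] by simp
      qed
      then show "AE x in lebesgue. (cmod (h k x * ?I n x - f x))\<^sup>2
          \<le> (2 * real n)\<^sup>2 * indicator {- real n..real n} x" for k
        by simp
    qed
    then show ?thesis
      by (rule V[rotated]) (intro cont h)
  qed
  have "abs_L2 f \<in> ?V" if f: "square_integrable f" for f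
  proof -
    note [measurable] = square_integrable_measurable[OF f]
    define A where "A n = {x \<in> space lebesgue. cmod (f x) \<le> real (Suc n) \<and> \<bar>x\<bar> \<le> real (Suc n)}" for n
    have [measurable]: "(\<lambda>x::real. x) \<in> borel_measurable lebesgue"
      by (rule measurable_completion) simp
    have [measurable]: "A n \<in> sets lebesgue" for n
      unfolding A_def by measurable
    have gb: "cmod (f x * indicator (A n) x) \<le> real (Suc n) * indicator {- real (Suc n)..real (Suc n)} x" for n x
      by (auto simp: A_def indicator_def abs_le_iff simp del: of_nat_Suc)
    have gm: "(\<lambda>x. f x * indicator (A n) x) \<in> borel_measurable lebesgue" for n
      by measurable
    have "(\<lambda>n. abs_L2 (\<lambda>x. f x * indicator (A n) x)) \<longlonglongrightarrow> abs_L2 f"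
    proof (rule abs_L2_tendsto[OF f])
      show "square_integrable (\<lambda>x. f x * indicator (A n) x)" for n
        by (rule square_integrable_bounded_support[OF gm gb])
      have "(\<lambda>n. f x * indicator (A n) x) \<longlonglongrightarrow> f x" for x
      proof (rule tendsto_eventually)
        obtain m where m: "max (cmod (f x)) \<bar>x\<bar> \<le> real m"
          using real_arch_simple by blast
        show "eventually (\<lambda>n. f x * indicator (A n) x = f x) sequentially"
          using eventually_ge_at_top[of m] by eventually_elim (use m in \<open>auto simp: A_def\<close>)
      qed
      then show "AE x in lebesgue. (\<lambda>n. f x * indicator (A n) x) \<longlonglongrightarrow> f x" by simp
      show "integrable lebesgue (\<lambda>x. (cmod (f x))\<^sup>2)"
        by (rule square_integrable_integrable[OF f])
      show "AE x in lebesgue. (cmod (f x * indicator (A n) x - f x))\<^sup>2 \<le> (cmod (f x))\<^sup>2" for n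
        by (auto simp: indicator_def)
    qed
    then show ?thesis by (rule V[rotated]) (rule bdd[OF _ gm gb], simp)
  qed
  then have "f \<in> ?V" for f
    using rep_L2[of f] by metis
  then show ?thesis by auto
qed

instance L2 :: second_countable_topology
  by standard
     (rule countable_span_imp_countable_subbasis[OF _ closure_span_trunc_poly], auto)


section \<open>The harmonic oscillator\<close>

text \<open>Physicists' Hermite polynomials, and the \<open>L\<^sup>2\<close>-normalised Hermite functions.\<close>

fun hermite_poly :: "nat \<Rightarrow> real \<Rightarrow> real" where
  "hermite_poly 0 x = 1"
| "hermite_poly (Suc 0) x = 2 * x"
| "hermite_poly (Suc (Suc n)) x =
     2 * x * hermite_poly (Suc n) x - 2 * real (Suc n) * hermite_poly n x"

definition hermite_fun :: "nat \<Rightarrow> real \<Rightarrow> real" where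
  "hermite_fun n x = hermite_poly n x * exp (- x\<^sup>2 / 2) / sqrt (2 ^ n * fact n * sqrt pi)"

lemma hermite_poly_has_derivative:
  "(hermite_poly n has_real_derivative 2 * real n * hermite_poly (n - 1) x) (at x)"
proof (induction n x rule: hermite_poly.induct)
  case (1 x)
  have "hermite_poly 0 = (\<lambda>_. 1)" by (rule ext) simp
  then show ?case by simp
next
  case (2 x)
  have "hermite_poly (Suc 0) = (\<lambda>x. 2 * x)" by (rule ext) simp
  then show ?case by (auto intro!: derivative_eq_intros)
next
  case (3 n x)
  have eq: "hermite_poly (Suc (Suc n)) =
    (\<lambda>x. 2 * x * hermite_poly (Suc n) x - 2 * real (Suc n) * hermite_poly n x)"
    by (rule ext) simp
  have rec: "hermite_poly (Suc n) x = 2 * x * hermite_poly n x - 2 * real n * hermite_poly (n - 1) x"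
    by (cases n) auto
  show ?case
    unfolding eq by (rule derivative_eq_intros 3 refl)+ (simp add: rec algebra_simps)
qed

lemma hermite_fun_eigenfunction:
  "- deriv (deriv (hermite_fun n)) x + x\<^sup>2 * hermite_fun n x = (2 * real n + 1) * hermite_fun n x"
proof -
  define c where "c = 1 / sqrt (2 ^ n * fact n * sqrt pi)"
  have eq: "hermite_fun n = (\<lambda>x. c * (hermite_poly n x * exp (- x\<^sup>2 / 2)))"
    by (rule ext) (simp add: hermite_fun_def c_def)
  have d1: "deriv (hermite_fun n) =
    (\<lambda>x. c * ((2 * real n * hermite_poly (n - 1) x - x * hermite_poly n x) * exp (- x\<^sup>2 / 2)))"
    unfolding eq
    by (rule ext, rule DERIV_imp_deriv)
       (auto intro!: derivative_eq_intros hermite_poly_has_derivative simp: algebra_simps)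
  have d2: "deriv (deriv (hermite_fun n)) x =
    c * ((2 * real n * (2 * real (n - 1) * hermite_poly (n - 1 - 1) x) - hermite_poly n x
       - x * (2 * real n * hermite_poly (n - 1) x)
       - x * (2 * real n * hermite_poly (n - 1) x - x * hermite_poly n x)) * exp (- x\<^sup>2 / 2))"
    unfolding d1
    by (rule DERIV_imp_deriv)
       (auto intro!: derivative_eq_intros hermite_poly_has_derivative simp: algebra_simps)
  have rec: "2 * real n * (2 * real (n - 1) * hermite_poly (n - 1 - 1) x)
      = 2 * real n * (2 * x * hermite_poly (n - 1) x - hermite_poly n x)"
  proof (cases n)
    case (Suc m)
    then show ?thesis by (cases m) auto
  qed simp
  show ?thesis
    unfolding d2 rec by (simp add: eq algebra_simps power2_eq_square)
qed

lemma real_polynomial_function_hermite_poly: "real_polynomial_function (hermite_poly n)"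
proof -
  have "real_polynomial_function (\<lambda>x. hermite_poly n x)
      \<and> real_polynomial_function (\<lambda>x. hermite_poly (Suc n) x)"
  proof (induction n)
    case 0
    have "real_polynomial_function (\<lambda>x::real. 2 * x)"
      by (intro real_polynomial_function.intros(1) bounded_linear_mult_right)
    then show ?case by (simp add: real_polynomial_function.intros(2))
  next
    case (Suc n)
    have "real_polynomial_function (\<lambda>x::real. 2 * x)"
      by (intro real_polynomial_function.intros(1) bounded_linear_mult_right)
    with Suc have "real_polynomial_function
        (\<lambda>x. (2 * x) * hermite_poly (Suc n) x - (2 * real (Suc n)) * hermite_poly n x)"
      by (intro real_polynomial_function_diff real_polynomial_function.intros(4)
          real_polynomial_function.intros(2)) auto
    with Suc show ?case by simp
  qed
  then show ?thesis by simp
qed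

lemma square_integrable_hermite_fun: "square_integrable (\<lambda>x. complex_of_real (hermite_fun n x))"
proof -
  define c where "c = 1 / (2 ^ n * fact n * sqrt pi)"
  have "real_polynomial_function (\<lambda>x. hermite_poly n x * hermite_poly n x)"
    by (intro real_polynomial_function.intros real_polynomial_function_hermite_poly)
  then obtain a m where a: "\<And>x. hermite_poly n x * hermite_poly n x = (\<Sum>i\<le>m. a i * x ^ i)"
    unfolding real_polynomial_function_iff_sum by metis
  have "integrable lborel (\<lambda>x::real. exp (- x\<^sup>2) * x ^ i)" for i
  proof -
    have "normal_density 0 (sqrt (1/2)) x * (x - 0) ^ i = (1 / sqrt pi) * (exp (- x\<^sup>2) * x ^ i)" for x
      by (simp add: normal_density_def)
    with integrable_normal_moment[of "sqrt (1/2)" 0 i]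
    have "integrable lborel (\<lambda>x. (1 / sqrt pi) * (exp (- x\<^sup>2) * x ^ i))" by simp
    then have "integrable lborel (\<lambda>x. sqrt pi * ((1 / sqrt pi) * (exp (- x\<^sup>2) * x ^ i)))"
      by (rule integrable_mult_right)
    also have "(\<lambda>x. sqrt pi * ((1 / sqrt pi) * (exp (- x\<^sup>2) * x ^ i))) = (\<lambda>x. exp (- x\<^sup>2) * x ^ i)"
      by (rule ext) simp
    finally show ?thesis .
  qed
  then have "integrable lborel (\<lambda>x. \<Sum>i\<le>m. c * a i * (exp (- x\<^sup>2) * x ^ i))"
    by (intro Bochner_Integration.integrable_sum integrable_mult_right)
  also have "(\<lambda>x. \<Sum>i\<le>m. c * a i * (exp (- x\<^sup>2) * x ^ i)) = (\<lambda>x. (hermite_fun n x)\<^sup>2)"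
  proof
    fix x :: real
    have "exp (- x\<^sup>2) = (exp (- x\<^sup>2 / 2))\<^sup>2"
      by (simp flip: exp_double)
    then have "(hermite_fun n x)\<^sup>2 = c * (hermite_poly n x * hermite_poly n x) * exp (- x\<^sup>2)"
      by (simp add: hermite_fun_def c_def power_divide power_mult_distrib power2_eq_square)
    then show "(\<Sum>i\<le>m. c * a i * (exp (- x\<^sup>2) * x ^ i)) = (hermite_fun n x)\<^sup>2"
      by (simp add: a sum_distrib_left sum_distrib_right mult_ac)
  qed
  finally have i: "integrable lborel (\<lambda>x. (hermite_fun n x)\<^sup>2)" .
  have "continuous_on UNIV (\<lambda>x. complex_of_real (hermite_fun n x))"
    unfolding hermite_fun_def
    by (intro continuous_intros continuous_on_subset[OF DERIV_continuous_on[OF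
          has_field_derivative_at_within[OF hermite_poly_has_derivative]]]) auto
  then show ?thesis
    using i borel_measurable_integrable[OF i]
    by (simp add: square_integrable_def borel_measurable_continuous_lebesgue integrable_completion)
qed

definition hermite_L2 :: "nat \<Rightarrow> L2" where
  "hermite_L2 n = abs_L2 (\<lambda>x. complex_of_real (hermite_fun n x))"

text \<open>\<open>e\<^bsup>itH\<^esup>\<close> for \<open>H = -\<Delta> + x\<^sup>2\<close>, through the spectral decomposition of \<open>H\<close>.\<close>

definition osc_propagator :: "real \<Rightarrow> L2 \<Rightarrow> L2" where
  "osc_propagator t f =
     (\<Sum>n. (exp (\<i> * of_real (t * (2 * real n + 1))) * cinner_L2 f (hermite_L2 n)) *\<^sub>C hermite_L2 n)"

text \<open>The nonlinearity \<open>\<bar>u\<bar>\<^sup>4 u\<close>, set to \<open>0\<close> if this function is not in \<open>L\<^sup>2\<close>. For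
  \<open>u = e\<^bsup>isH\<^esup> f\<close> with \<open>f \<in> L\<^sup>2\<close> the exceptional times \<open>s\<close> form a null set, by the
  \<open>L\<^sup>5\<^sub>t L\<^sup>1\<^sup>0\<^sub>x\<close> Strichartz estimate, which also makes the integrand of \<open>T6\<close> Bochner
  integrable in \<open>L\<^sup>2\<close>.\<close>

lift_definition quintic :: "L2 \<Rightarrow> L2" is
  "\<lambda>f. if square_integrable (\<lambda>x. of_real (cmod (f x) ^ 4) * f x)
       then (\<lambda>x. of_real (cmod (f x) ^ 4) * f x) else (\<lambda>_. 0)"
proof -
  fix f g assume "L2_rel f g"
  then have f: "square_integrable f" and g: "square_integrable g"
    and eq: "AE x in lebesgue. f x = g x" by (auto simp: L2_rel_def)
  let ?N = "\<lambda>f x. complex_of_real (cmod (f x) ^ 4) * f x"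
  note [measurable] = square_integrable_measurable[OF f] square_integrable_measurable[OF g]
  have m: "?N f \<in> borel_measurable lebesgue" "?N g \<in> borel_measurable lebesgue"
    by measurable
  have eqN: "AE x in lebesgue. ?N f x = ?N g x"
    using eq by eventually_elim simp
  have "integrable lebesgue (\<lambda>x. (cmod (?N f x))\<^sup>2) \<longleftrightarrow> integrable lebesgue (\<lambda>x. (cmod (?N g x))\<^sup>2)"
    by (rule integrable_cong_AE) (measurable, use eq in \<open>eventually_elim, simp\<close>)
  then have "square_integrable (?N f) \<longleftrightarrow> square_integrable (?N g)"
    using m by (simp add: square_integrable_def)
  then show "L2_rel (if square_integrable (?N f) then ?N f else (\<lambda>_. 0))
      (if square_integrable (?N g) then ?N g else (\<lambda>_. 0))"
    using eqN by (auto simp: L2_rel_def square_integrable_zero)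
qed

text \<open>The diagonal \<open>\<T>\<^sub>6(u, u, u, u, u)\<close>, as a Bochner integral in \<open>L\<^sup>2\<close>.\<close>

definition T6 :: "L2 \<Rightarrow> L2" where
  "T6 u = (12 / pi) *\<^sub>R
     (LINT s:{- (pi / 4)..pi / 4}|lebesgue. osc_propagator (- s) (quintic (osc_propagator s u)))"

section \<open>The Fourier transform and \<open>L\<^sup>\<infinity>\<close>\<close>

text \<open>The integral formula, meaningful for \<open>f \<in> L\<^sup>1\<close>; a function \<open>f\<close> with
  \<open>f(x) exp (\<alpha> x\<^sup>2) \<in> L\<^sup>\<infinity>\<close>, \<open>\<alpha> > 0\<close>, is integrable.\<close>

definition fourier :: "(real \<Rightarrow> complex) \<Rightarrow> real \<Rightarrow> complex" where
  "fourier f \<xi> = of_real (1 / sqrt (2 * pi)) *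
     (LINT x|lebesgue. exp (- (\<i> * of_real (x * \<xi>))) * f x)"

definition in_Linfty :: "(real \<Rightarrow> complex) \<Rightarrow> bool" where
  "in_Linfty f \<longleftrightarrow>
     f \<in> borel_measurable lebesgue \<and> esssup lebesgue (\<lambda>x. ereal (cmod (f x))) < \<infinity>"

end

theory Submission
  imports Defs "HOL-Complex_Analysis.Complex_Analysis" "HOL-Real_Asymp.Real_Asymp"
begin

text \<open>Expand \<open>u = abs_L2 \<phi>\<close> in Hermite functions. The six-linear form of \<open>T6\<close> is bounded on
  \<open>L\<^sup>2\<close> by a Strichartz estimate. By orthogonality in time and parity in space, only the
  resonant index tuples (equal sums over the plain and over the conjugated slots) contribute to
  it, so it is invariant under moving \<open>e\<^bsup>-\<mu>H\<^esup>\<close> from the plain to the conjugated slots.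

  Split \<open>u\<close> at a high index \<open>N\<close>. If five slots are close to a vector with modes below \<open>M\<close>, then
  the form against modes above \<open>N\<close> is small: a high mode carries little mass where low modes live.
  For \<open>\<omega> \<noteq> 0\<close> the part of \<open>u\<close> above \<open>N\<close> is therefore the fixed point of a contraction. Conjugating
  the equation by \<open>r\<^sup>n\<close> for \<open>r < 1\<close> close to 1 gives another contraction, whose fixed
  point \<open>\<kappa>\<close> lies in \<open>L\<^sup>2\<close>; by uniqueness \<open>u\<^sub>n = r\<^sup>n \<kappa>\<^sub>n\<close> for \<open>n \<ge> N\<close>. For \<open>\<omega> = 0\<close>
  the form vanishes at \<open>u\<close>, which forces \<open>u = 0\<close>.

  Mehler's formula bounds the Hermite functions by \<open>r\<^bsup>-n/2\<^esup>\<close> times a Gaussian on the real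
  line, and by \<open>r\<^bsup>-n/2\<^esup>\<close> times a locally bounded function on the complex plane. Hence geometric
  decay of the coefficients gives an entire function with Gaussian decay on the real line, and
  the Fourier transform only multiplies the coefficients by \<open>(- \<i>)\<^sup>n\<close>.\<close>

section \<open>Mehler's formula\<close>

text \<open>Hence the detour: \<open>\<kappa>\<close> is built inside \<open>L\<^sup>2\<close>,
  multiplied by \<open>r^n\<close>, and only then compared with \<open>u\<close>. Only the finitely
  many modes below \<open>N\<close> are divided by powers of \<open>r\<close>, and \<open>r\<close>
  is so close to 1 that this costs at most a factor 2; both contractions run with the same
  constants. The exponents come from dimension one. The propagator kernel has size
  \<open>|t|^(-1/2)\<close>, for which Hardy-Littlewood-Sobolev maps \<open>L^(4/3)\<close> to
  \<open>L^4\<close> in time. This gives \<open>L^4\<close> in time with a supremum in space; four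
  such factors and two factors of constant \<open>L\<^sup>2\<close> norm fill the six slots.
  Estimates are made on finite Hermite sums, where waves are bounded functions of time and space and
  the form is a finite sum; the constants do not depend on the truncation. The link with
  \<open>T6\<close>, a Bochner integral of a nonlinearity that may take its default value, needs a
  separate passage to the limit.\<close>

fun hermite_complex :: "nat \<Rightarrow> complex \<Rightarrow> complex" where
  "hermite_complex 0 z = 1"
| "hermite_complex (Suc 0) z = 2 * z"
| "hermite_complex (Suc (Suc n)) z =
     2 * z * hermite_complex (Suc n) z - 2 * of_nat (Suc n) * hermite_complex n z"

lemma hermite_complex_of_real: "hermite_complex n (of_real x) = of_real (hermite_poly n x)"
  by (induction n x rule: hermite_poly.induct) simp_all

lemma hermite_complex_cnj: "hermite_complex n (cnj z) = cnj (hermite_complex n z)"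
  by (induction n z rule: hermite_complex.induct) simp_all

lemma holomorphic_hermite_complex: "hermite_complex n holomorphic_on S"
proof (induction n rule: induct_nat_012)
  case 0
  have "hermite_complex 0 = (\<lambda>_. 1)" by auto
  then show ?case by simp
next
  case 1
  have "hermite_complex (Suc 0) = (\<lambda>z. 2 * z)" by auto
  then show ?case by (auto intro!: holomorphic_intros)
next
  case (ge2 n)
  have "hermite_complex (Suc (Suc n)) = (\<lambda>z. 2 * z * hermite_complex (Suc n) z
      - 2 * of_nat (Suc n) * hermite_complex n z)" by (rule ext) simp
  with ge2 show ?case by (auto intro!: holomorphic_intros simp del: hermite_complex.simps)
qed

definition mehler_coeff :: "complex \<Rightarrow> complex \<Rightarrow> nat \<Rightarrow> complex" where
  "mehler_coeff x y n = hermite_complex n x * hermite_complex n y / (2 ^ n * fact n)"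

text \<open>The form of the recurrence is dictated by the first-order differential equation of
  \<open>mehler_fun\<close>: it is the comparison of the coefficients of \<open>z^(n+3)\<close>
  there. On this side it is a consequence of the three-term recurrence in \<open>x\<close> and in
  \<open>y\<close> separately.\<close>

lemma mehler_coeff_rec:
  "of_nat (n + 4) * mehler_coeff x y (n + 4) =
     2 * x * y * (mehler_coeff x y (n + 3) + mehler_coeff x y (n + 1))
     + (of_nat (2 * n + 5) - 2 * x\<^sup>2 - 2 * y\<^sup>2) * mehler_coeff x y (n + 2)
     - of_nat (n + 1) * mehler_coeff x y n"
proof -
  define a b k :: complex where "a = hermite_complex n x" and "b = hermite_complex (Suc n) x"
    and "k = of_nat n"
  define a' b' :: complex where "a' = hermite_complex n y" and "b' = hermite_complex (Suc n) y"
  define c :: complex where "c = 2 ^ n * fact n"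
  have c: "c \<noteq> 0" by (simp add: c_def)
  have k: "k + 1 \<noteq> 0" "k + 2 \<noteq> 0" "k + 3 \<noteq> 0" "k + 4 \<noteq> 0"
    using of_nat_neq_0[of n, where 'a=complex] of_nat_neq_0[of "n+1", where 'a=complex]
      of_nat_neq_0[of "n+2", where 'a=complex] of_nat_neq_0[of "n+3", where 'a=complex]
    by (simp_all add: k_def add_ac)
  have h: "hermite_complex (n+2) z = 2*z*hermite_complex (Suc n) z - 2*(k+1)*hermite_complex n z"
    "hermite_complex (n+3) z = 2*z*hermite_complex (n+2) z - 2*(k+2)*hermite_complex (Suc n) z"
    "hermite_complex (n+4) z = 2*z*hermite_complex (n+3) z - 2*(k+3)*hermite_complex (n+2) z" for z
    by (simp_all add: k_def numeral_eq_Suc algebra_simps)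
  have f: "2^(n+1) * fact (n+1) = 2*(k+1)*c" "2^(n+2) * fact (n+2) = 4*(k+2)*(k+1)*c"
    "2^(n+3) * fact (n+3) = 8*(k+3)*(k+2)*(k+1)*c"
    "2^(n+4) * fact (n+4) = 16*(k+4)*(k+3)*(k+2)*(k+1)*c"
    by (simp_all add: k_def c_def numeral_eq_Suc algebra_simps)
  define A2 A2' A3 A3' where "A2 = 2*x*b - 2*(k+1)*a" and "A2' = 2*y*b' - 2*(k+1)*a'"
    and "A3 = 2*x*A2 - 2*(k+2)*b" and "A3' = 2*y*A2' - 2*(k+2)*b'"
  have m: "mehler_coeff x y n = a*a'/c" "mehler_coeff x y (n+1) = b*b'/(2*(k+1)*c)"
    "mehler_coeff x y (n+2) = A2*A2'/(4*(k+2)*(k+1)*c)"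
    "mehler_coeff x y (n+3) = A3*A3'/(8*(k+3)*(k+2)*(k+1)*c)"
    "mehler_coeff x y (n+4) = (2*x*A3-2*(k+3)*A2)*(2*y*A3'-2*(k+3)*A2')/(16*(k+4)*(k+3)*(k+2)*(k+1)*c)"
    unfolding mehler_coeff_def f h
    by (simp_all add: a_def b_def a'_def b'_def c_def A2_def A2'_def A3_def A3'_def)
  \<comment> \<open>All values are now polynomials in \<open>x\<close>, \<open>y\<close>,
    \<open>k\<close> and the four independent quantities \<open>a\<close>, \<open>b\<close>,
    \<open>a'\<close>, \<open>b'\<close>; the denominators were cleared so that the claim is a
    polynomial identity.\<close>
  have s: "(2*x*A3-2*(k+3)*A2)*(2*y*A3'-2*(k+3)*A2') = 
     4*x*y*(A3*A3' + 4*(k+3)*(k+2)*b*b') + (2*k+5-2*x\<^sup>2-2*y\<^sup>2)*4*(k+3)*A2*A2' - (k+1)*16*(k+3)*(k+2)*(k+1)*a*a'"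
    unfolding A3_def A3'_def A2_def A2'_def by algebra
  have "(k+4) * mehler_coeff x y (n+4) * (16*(k+3)*(k+2)*(k+1)*c) = (2*x*A3-2*(k+3)*A2)*(2*y*A3'-2*(k+3)*A2')"
    using k c by (simp add: m del: distrib_left_numeral)
  also note s
  also have "4*x*y*(A3*A3' + 4*(k+3)*(k+2)*b*b') + (2*k+5-2*x\<^sup>2-2*y\<^sup>2)*4*(k+3)*A2*A2' - (k+1)*16*(k+3)*(k+2)*(k+1)*a*a'
     = (2*x*y*(mehler_coeff x y (n+3) + mehler_coeff x y (n+1))
     + (2*k+5 - 2*x\<^sup>2 - 2*y\<^sup>2) * mehler_coeff x y (n+2) - (k+1) * mehler_coeff x y n) * (16*(k+3)*(k+2)*(k+1)*c)"
  proof -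
    have "A3*A3' = mehler_coeff x y (n+3) * (8*(k+3)*(k+2)*(k+1)*c)"
      "b*b' = mehler_coeff x y (n+1) * (2*(k+1)*c)"
      "A2*A2' = mehler_coeff x y (n+2) * (4*(k+2)*(k+1)*c)" "a*a' = mehler_coeff x y n * c"
      unfolding m using k c by (simp_all del: distrib_left_numeral)
    then show ?thesis by algebra
  qed
  finally have "(k+4) * mehler_coeff x y (n+4) = 2*x*y*(mehler_coeff x y (n+3) + mehler_coeff x y (n+1))
     + (2*k+5 - 2*x\<^sup>2 - 2*y\<^sup>2) * mehler_coeff x y (n+2) - (k+1) * mehler_coeff x y n"
    using k c by (simp del: distrib_left_numeral)
  then show ?thesis by (simp add: k_def)
qed

text \<open>The recurrence reaches back four places and needs four starting values. Those at 2 and 3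
  are stated in the shape in which the differential equation delivers them.\<close>

lemma mehler_coeff_init:
  "mehler_coeff x y 0 = 1" "mehler_coeff x y (Suc 0) = 2 * x * y"
  "2 * mehler_coeff x y 2 = 2 * x * y * mehler_coeff x y 1 + (1 - 2 * x\<^sup>2 - 2 * y\<^sup>2)"
  "3 * mehler_coeff x y 3 = 2 * x * y * (mehler_coeff x y 2 + 1)
     + (3 - 2 * x\<^sup>2 - 2 * y\<^sup>2) * mehler_coeff x y 1"
  by (simp_all add: mehler_coeff_def numeral_eq_Suc field_simps)

text \<open>The generating function of \<open>mehler_coeff\<close>, that is, Mehler's kernel without
  its Gaussian weight. The principal root is holomorphic on the unit disc because
  \<open>1 - z^2\<close> has positive real part there.\<close>

definition mehler_fun :: "complex \<Rightarrow> complex \<Rightarrow> complex \<Rightarrow> complex" where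
  "mehler_fun x y z = exp ((2 * x * y * z - (x\<^sup>2 + y\<^sup>2) * z\<^sup>2) / (1 - z\<^sup>2)) / csqrt (1 - z\<^sup>2)"

lemma Re_one_minus_square_pos:
  assumes "cmod z < 1" shows "Re (1 - z\<^sup>2) > 0"
proof -
  have "cmod (z\<^sup>2) < 1" using assms by (simp add: norm_power power_less_one_iff)
  then show ?thesis using complex_Re_le_cmod[of "z\<^sup>2"] by simp
qed

lemma mehler_fun_deriv:
  assumes z: "cmod z < 1"
  shows "(mehler_fun x y has_field_derivative
    mehler_fun x y z * (z * (1 - z\<^sup>2) + 2 * x * y * (1 + z\<^sup>2) - 2 * (x\<^sup>2 + y\<^sup>2) * z) / (1 - z\<^sup>2)\<^sup>2) (at z)"
proof -
  have 1: "1 - z\<^sup>2 \<notin> \<real>\<^sub>\<le>\<^sub>0" using Re_one_minus_square_pos[OF z] 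
    by (metis Re_complex_of_real nonpos_Reals_cases not_less)
  then have 2: "1 - z\<^sup>2 \<noteq> 0" by auto
  define w where "w = csqrt (1 - z\<^sup>2)"
  have w: "w\<^sup>2 = 1 - z\<^sup>2" "w \<noteq> 0" using 2 by (auto simp: w_def)
  define e where "e = exp ((2 * x * y * z - (x\<^sup>2 + y\<^sup>2) * z\<^sup>2) / (1 - z\<^sup>2))"
  have d1: "((\<lambda>z. csqrt (1 - z\<^sup>2)) has_field_derivative (- z / w)) (at z)"
    using 1 by (auto intro!: derivative_eq_intros simp: w_def)
  have d2: "((\<lambda>z. exp ((2 * x * y * z - (x\<^sup>2 + y\<^sup>2) * z\<^sup>2) / (1 - z\<^sup>2))) has_field_derivative
     (e * ((2*x*y - 2*(x\<^sup>2+y\<^sup>2)*z) * (1-z\<^sup>2) + 2*z*(2*x*y*z - (x\<^sup>2+y\<^sup>2)*z\<^sup>2)) / (1-z\<^sup>2)\<^sup>2)) (at z)"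
    unfolding e_def by (rule derivative_eq_intros refl 2)+ (use 2 in \<open>simp add: field_simps power2_eq_square\<close>)
  have "(mehler_fun x y has_field_derivative ((e * ((2*x*y - 2*(x\<^sup>2+y\<^sup>2)*z) * (1-z\<^sup>2) + 2*z*(2*x*y*z - (x\<^sup>2+y\<^sup>2)*z\<^sup>2)) / (1-z\<^sup>2)\<^sup>2) * w
      - e * (- z / w)) / (w * w)) (at z)"
    using DERIV_quotient[OF d2 d1] 2 unfolding mehler_fun_def[abs_def] by (simp add: w_def e_def mult_ac)
  also have "((e * ((2*x*y - 2*(x\<^sup>2+y\<^sup>2)*z) * (1-z\<^sup>2) + 2*z*(2*x*y*z - (x\<^sup>2+y\<^sup>2)*z\<^sup>2)) / (1-z\<^sup>2)\<^sup>2) * w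
      - e * (- z / w)) / (w * w) = mehler_fun x y z * (z * (1 - z\<^sup>2) + 2 * x * y * (1 + z\<^sup>2) - 2 * (x\<^sup>2 + y\<^sup>2) * z) / (1 - z\<^sup>2)\<^sup>2"
  proof -
    \<comment> \<open>With \<open>q\<close> for the inverse of the root, all quotients become
      products and the identity is polynomial in \<open>q\<close>, modulo \<open>w * q = 1\<close>
      and the value of \<open>w^2\<close>.\<close>
    define q where "q = inverse w"
    have q: "w * q = 1" using w by (simp add: q_def)
    have m1: "mehler_fun x y z = e * q" by (simp add: mehler_fun_def e_def w_def q_def field_simps)
    have m2: "u / (1 - z\<^sup>2)\<^sup>2 = u * q ^ 4" "u / (w * w) = u * q\<^sup>2" "u / w = u * q" for u
      using w(2) unfolding w(1)[symmetric] by (simp_all add: q_def divide_inverse power2_eq_square numeral_eq_Suc)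
    show ?thesis
      unfolding m1 m2 using q w(1) by algebra
  qed
  finally show ?thesis .
qed

lemma mehler_fun_holomorphic: "mehler_fun x y holomorphic_on ball 0 1"
  unfolding holomorphic_on_def field_differentiable_def
  using has_field_derivative_at_within[OF mehler_fun_deriv[of _ x y]] by (metis mem_ball_0)

text \<open>The logarithmic derivative of \<open>mehler_fun\<close> is rational. Clearing its
  denominator \<open>(1 - z^2)^2\<close> gives an identity of formal power series, whose
  coefficients satisfy the recurrence of \<open>mehler_coeff\<close>.\<close>

lemma mehler_fun_expansion_nth: "fps_nth (fps_expansion (mehler_fun x y) 0) n = mehler_coeff x y n"
proof -
  define g where "g = fps_expansion (mehler_fun x y) 0"
  have e: "mehler_fun x y has_fps_expansion g"
    unfolding g_def using mehler_fun_holomorphic by (intro has_fps_expansion_fps_expansion[of "ball 0 1"]) auto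
  have ev: "eventually (\<lambda>z. cmod z < 1) (nhds 0)"
    using eventually_nhds_in_open[of "ball 0 1" "0::complex"] by simp
  let ?A = "fps_const 1 - fps_const 2 * fps_X^2 + fps_X^4 :: complex fps"
  let ?B = "fps_X - fps_X^3 + fps_const (2*x*y) + fps_const (2*x*y) * fps_X^2 - fps_const (2*(x\<^sup>2+y\<^sup>2)) * fps_X"
  have "(\<lambda>z. deriv (mehler_fun x y) z * (1 - 2 * z^2 + z^4)) has_fps_expansion fps_deriv g * ?A"
    by (intro fps_expansion_intros e has_fps_expansion_deriv)
  moreover have r: "(\<lambda>z. mehler_fun x y z * (z - z^3 + 2*x*y + 2*x*y*z^2 - 2*(x\<^sup>2+y\<^sup>2)*z)) has_fps_expansion g * ?B"
    by (intro fps_expansion_intros e)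
  moreover have evq: "eventually (\<lambda>z. deriv (mehler_fun x y) z * (1 - 2 * z^2 + z^4) 
     = mehler_fun x y z * (z - z^3 + 2*x*y + 2*x*y*z^2 - 2*(x\<^sup>2+y\<^sup>2)*z)) (nhds 0)"
    using ev
  proof eventually_elim
    case (elim z)
    have "1 - z\<^sup>2 \<noteq> 0" using Re_one_minus_square_pos[OF elim] by auto
    moreover have "1 - 2 * z^2 + z^4 = (1 - z\<^sup>2)\<^sup>2" by algebra
    moreover have "z - z^3 + 2*x*y + 2*x*y*z^2 - 2*(x\<^sup>2+y\<^sup>2)*z = z * (1 - z\<^sup>2) + 2 * x * y * (1 + z\<^sup>2) - 2 * (x\<^sup>2 + y\<^sup>2) * z"
      by algebra
    ultimately show ?case by (simp add: DERIV_imp_deriv[OF mehler_fun_deriv[OF elim]])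
  qed
  ultimately have eq: "fps_deriv g * ?A = g * ?B"
    using fps_expansion_unique_complex has_fps_expansion_cong[OF evq refl] by blast
  have eqn: "fps_nth (fps_deriv g * ?A) n = fps_nth (g * ?B) n" for n using eq by simp
  have g0: "fps_nth g 0 = 1"
    using has_fps_expansion_imp_0_eq_fps_nth_0[OF e] by (simp add: mehler_fun_def)
  have L: "fps_nth (fps_deriv g * ?A) n = of_nat (n+1) * fps_nth g (n+1)
       - (if n < 2 then 0 else 2 * of_nat (n-1) * fps_nth g (n-1))
       + (if n < 4 then 0 else of_nat (n-3) * fps_nth g (n-3))" for n
    by (simp add: algebra_simps fps_X_power_mult_right_nth fps_X_power_mult_nth numeral_eq_Suc Suc_diff_Suc) 
  have B: "g * ?B = g * fps_X - g * fps_X^3 + fps_const (2*x*y) * g + fps_const (2*x*y) * (g * fps_X^2)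
      - fps_const (2*(x\<^sup>2+y\<^sup>2)) * (g * fps_X)"
    by (simp only: ring_distribs mult_ac)
  have R: "fps_nth (g * ?B) n = 2*x*y * fps_nth g n + (if n < 1 then 0 else (1 - 2*(x\<^sup>2+y\<^sup>2)) * fps_nth g (n-1))
     + (if n < 2 then 0 else 2*x*y * fps_nth g (n-2)) - (if n < 3 then 0 else fps_nth g (n-3))" for n
    unfolding B by (simp add: fps_X_power_mult_right_nth ring_distribs)
  have "fps_nth g n = mehler_coeff x y n"
  proof (induction n rule: less_induct)
    case (less n)
    \<comment> \<open>Differentiation shifts the index by one, so the coefficient at
      \<open>m + 3\<close> is the one that determines \<open>g\<close> at
      \<open>m + 4\<close>.\<close>
    have rec: "of_nat (m+4) * fps_nth g (m+4) = 2*x*y*(fps_nth g (m+3) + fps_nth g (m+1))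
        + (of_nat (2*m+5) - 2*x\<^sup>2 - 2*y\<^sup>2) * fps_nth g (m+2) - of_nat (m+1) * fps_nth g m" for m
      using eqn[of "m+3"] unfolding L R by (cases "m = 0") (simp_all add: algebra_simps numeral_eq_Suc)
    have g1: "fps_nth g (Suc 0) = 2*x*y"
      using eqn[of 0] unfolding L R by (simp add: g0)
    have g2: "2 * fps_nth g 2 = 2*x*y*fps_nth g 1 + (1 - 2*x\<^sup>2 - 2*y\<^sup>2)"
      using eqn[of 1] unfolding L R by (simp add: g0 numeral_eq_Suc algebra_simps)
    have g3: "3 * fps_nth g 3 = 2*x*y*(fps_nth g 2 + 1) + (3 - 2*x\<^sup>2 - 2*y\<^sup>2) * fps_nth g 1"
      using eqn[of 2] unfolding L R by (simp add: g0 numeral_eq_Suc algebra_simps)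
    consider "n = 0" | "n = 1" | "n = 2" | "n = 3" | m where "n = m + 4"
      using le_Suc_ex[of 4 n] by (force simp: add.commute not_le)
    then show ?case
    proof cases
      case 5
      have "of_nat (m+4) * fps_nth g (m+4) = of_nat (m+4) * mehler_coeff x y (m+4)"
        unfolding rec mehler_coeff_rec using less by (simp add: 5)
      then show ?thesis unfolding 5 using of_nat_neq_0[of "m+3", where 'a=complex]
        by (simp add: add_ac)
    next
      case 3
      have "2 * fps_nth g 2 = 2 * mehler_coeff x y 2" unfolding g2 mehler_coeff_init
        by (simp add: g1 mehler_coeff_init)
      then show ?thesis by (simp add: 3)
    next
      case 4
      have "3 * fps_nth g 3 = 3 * mehler_coeff x y 3" unfolding g3 mehler_coeff_init
        using less[of 2] by (simp add: 4 g1 mehler_coeff_init)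
      then show ?thesis by (simp add: 4)
    qed (simp_all add: g0 g1 mehler_coeff_init)
  qed
  then show ?thesis by (simp add: g_def)
qed

lemma mehler_sums:
  assumes "cmod z < 1"
  shows "(\<lambda>n. mehler_coeff x y n * z ^ n) sums mehler_fun x y z"
proof -
  have "(\<lambda>n. (deriv ^^ n) (mehler_fun x y) 0 / (fact n) * (z - 0)^n) sums mehler_fun x y z"
    using assms by (intro holomorphic_power_series[OF mehler_fun_holomorphic]) simp
  moreover have "(deriv ^^ n) (mehler_fun x y) 0 / (fact n) = mehler_coeff x y n" for n
    using mehler_fun_expansion_nth[of x y n] by (simp add: fps_expansion_def)
  ultimately show ?thesis by simp
qed

lemma hermite_fun_mult_mehler:
  "complex_of_real (hermite_fun n x * hermite_fun n y)
     = mehler_coeff (of_real x) (of_real y) n * (of_real (exp (- (x\<^sup>2 + y\<^sup>2) / 2) / sqrt pi))"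
proof -
  have "hermite_fun n x * hermite_fun n y
      = hermite_poly n x * hermite_poly n y / (2 ^ n * fact n) * (exp (- (x\<^sup>2 + y\<^sup>2) / 2) / sqrt pi)"
    by (simp add: hermite_fun_def add_divide_distrib diff_divide_distrib flip: exp_add)
  then show ?thesis
    by (simp add: mehler_coeff_def hermite_complex_of_real)
qed

section \<open>The weighted Mehler kernel and the pointwise bounds that follow from it\<close>

definition mehler_kernel :: "complex \<Rightarrow> real \<Rightarrow> real \<Rightarrow> complex" where
  "mehler_kernel z x y = mehler_fun (of_real x) (of_real y) z * (of_real (exp (- (x\<^sup>2 + y\<^sup>2) / 2) / sqrt pi))"

lemma mehler_kernel_sums:
  assumes "cmod z < 1"
  shows "(\<lambda>n. z ^ n * complex_of_real (hermite_fun n x * hermite_fun n y)) sums mehler_kernel z x y"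
  using sums_mult2[OF mehler_sums[OF assms, of "of_real x" "of_real y"], of "of_real (exp (- (x\<^sup>2 + y\<^sup>2) / 2) / sqrt pi)"]
  unfolding hermite_fun_mult_mehler mehler_kernel_def by (simp only: mult_ac)

text \<open>Passing to \<open>x + y\<close> and \<open>x - y\<close> diagonalises the quadratic form
  in the exponent. Its two coefficients are Cayley transforms of \<open>z\<close> and
  \<open>-z\<close>, hence have nonnegative real part on the disc.\<close>

lemma mehler_kernel_eq:
  assumes z: "cmod z < 1"
  shows "mehler_kernel z x y = exp (- (of_real ((x + y)\<^sup>2 / 4) * ((1 - z) / (1 + z)))
     - of_real ((x - y)\<^sup>2 / 4) * ((1 + z) / (1 - z))) / csqrt (1 - z\<^sup>2) / of_real (sqrt pi)"
proof -
  have 1: "1 - z\<^sup>2 \<noteq> 0" using Re_one_minus_square_pos[OF z] by auto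
  have 2: "1 - z \<noteq> 0" "1 + z \<noteq> 0" using 1 by (auto simp: power2_eq_square add_eq_0_iff)
  have "(2 * of_real x * of_real y * z - ((of_real x)\<^sup>2 + (of_real y)\<^sup>2) * z\<^sup>2) / (1 - z\<^sup>2) + of_real (- (x\<^sup>2 + y\<^sup>2) / 2)
      = - (of_real ((x + y)\<^sup>2 / 4) * ((1 - z) / (1 + z))) - of_real ((x - y)\<^sup>2 / 4) * ((1 + z) / (1 - z))" (is "?l = ?r")
  proof -
    define q where "q = inverse (1 - z\<^sup>2)"
    have q: "(1 - z\<^sup>2) * q = 1" using 1 by (simp add: q_def)
    have e: "1 - z\<^sup>2 = (1 - z) * (1 + z)" by algebra
    have "(1 - z) / (1 + z) = (1 - z)\<^sup>2 * q" "(1 + z) / (1 - z) = (1 + z)\<^sup>2 * q"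
    proof -
      have "inverse (1 + z) = (1 - z) * q" "inverse (1 - z) = (1 + z) * q"
        by (rule inverse_unique; use q e in algebra)+
      then show "(1 - z) / (1 + z) = (1 - z)\<^sup>2 * q" "(1 + z) / (1 - z) = (1 + z)\<^sup>2 * q"
        by (simp_all add: divide_inverse power2_eq_square)
    qed
    note d = this
    define X Y where "X = complex_of_real x" and "Y = complex_of_real y"
    have l: "?l = (2 * X * Y * z - (X\<^sup>2 + Y\<^sup>2) * z\<^sup>2) * q - (X\<^sup>2 + Y\<^sup>2) / 2"
      unfolding X_def Y_def q_def divide_inverse[of _ "1 - z\<^sup>2"] by simp (simp add: field_simps)
    have r: "?r = - ((X + Y)\<^sup>2 / 4 * ((1 - z)\<^sup>2 * q)) - (X - Y)\<^sup>2 / 4 * ((1 + z)\<^sup>2 * q)"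
      unfolding d by (simp add: X_def Y_def)
    have "(2 * X * Y * z - (X\<^sup>2 + Y\<^sup>2) * z\<^sup>2) * q - (X\<^sup>2 + Y\<^sup>2) / 2
        = (2 * X * Y * z - (X\<^sup>2 + Y\<^sup>2) * z\<^sup>2) * q - (X\<^sup>2 + Y\<^sup>2) / 2 * ((1 - z\<^sup>2) * q)"
      by (simp add: q)
    also have "\<dots> = - ((X + Y)\<^sup>2 / 4 * ((1 - z)\<^sup>2 * q)) - (X - Y)\<^sup>2 / 4 * ((1 + z)\<^sup>2 * q)"
      by (simp add: power2_eq_square field_simps)
    finally show ?thesis
      unfolding l r .
  qed
  then show ?thesis
    unfolding mehler_kernel_def mehler_fun_def by (simp flip: exp_add exp_of_real)
qed

lemma Re_cayley_nonneg:
  assumes "cmod z < 1"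
  shows "Re ((1 - z) / (1 + z)) \<ge> 0" "Re ((1 + z) / (1 - z)) \<ge> 0"
proof -
  have "(Re z)\<^sup>2 + (Im z)\<^sup>2 \<le> 1"
    using assms by (simp add: cmod_def real_sqrt_le_iff)
  moreover have "Re ((1 - z) / (1 + z)) = (1 - ((Re z)\<^sup>2 + (Im z)\<^sup>2)) / ((1 + Re z)\<^sup>2 + (Im z)\<^sup>2)"
    "Re ((1 + z) / (1 - z)) = (1 - ((Re z)\<^sup>2 + (Im z)\<^sup>2)) / ((1 - Re z)\<^sup>2 + (Im z)\<^sup>2)"
    unfolding Re_divide by (simp_all add: power2_eq_square algebra_simps)
  ultimately show "Re ((1 - z) / (1 + z)) \<ge> 0" "Re ((1 + z) / (1 - z)) \<ge> 0"
    by (simp_all only:) (intro divide_nonneg_nonneg add_nonneg_nonneg; simp)+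
qed

text \<open>The exponential has modulus at most 1, so only the square root remains. The bound is
  uniform in \<open>x\<close> and \<open>y\<close>, which makes it a dispersive estimate as
  \<open>z\<close> approaches the unit circle.\<close>

lemma mehler_kernel_bound:
  assumes z: "cmod z < 1"
  shows "cmod (mehler_kernel z x y) \<le> 1 / sqrt (pi * cmod (1 - z\<^sup>2))"
proof -
  define E where "E = exp (- (of_real ((x + y)\<^sup>2 / 4) * ((1 - z) / (1 + z)))
     - of_real ((x - y)\<^sup>2 / 4) * ((1 + z) / (1 - z)))"
  have "cmod E \<le> 1"
    unfolding E_def
  proof -
    have "(x + y)\<^sup>2 / 4 * Re ((1 - z) / (1 + z)) \<ge> 0" "(x - y)\<^sup>2 / 4 * Re ((1 + z) / (1 - z)) \<ge> 0"
      by (intro mult_nonneg_nonneg Re_cayley_nonneg z; simp)+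
    moreover have R: "Re (complex_of_real a * w) = a * Re w" for a w by simp
    ultimately show "cmod (exp (- (of_real ((x + y)\<^sup>2 / 4) * ((1 - z) / (1 + z)))
     - of_real ((x - y)\<^sup>2 / 4) * ((1 + z) / (1 - z)))) \<le> 1"
      unfolding norm_exp_eq_Re minus_complex.sel uminus_complex.sel R by simp
  qed
  moreover have "cmod (csqrt (1 - z\<^sup>2)) = sqrt (cmod (1 - z\<^sup>2))"
    by (rule norm_csqrt)
  moreover have "cmod (1 - z\<^sup>2) > 0" using Re_one_minus_square_pos[OF z] by auto
  ultimately have "cmod E / cmod (csqrt (1 - z\<^sup>2)) / sqrt pi \<le> 1 / sqrt (cmod (1 - z\<^sup>2)) / sqrt pi"
    unfolding norm_csqrt by (intro divide_right_mono) simp_all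
  also have "\<dots> = 1 / sqrt (pi * cmod (1 - z\<^sup>2))"
    by (simp add: real_sqrt_mult)
  finally have *: "cmod E / cmod (csqrt (1 - z\<^sup>2)) / sqrt pi \<le> 1 / sqrt (pi * cmod (1 - z\<^sup>2))" .
  have p: "cmod (complex_of_real (sqrt pi)) = sqrt pi" by simp
  show ?thesis
    unfolding mehler_kernel_eq[OF z] E_def[symmetric] norm_divide p by (rule *)
qed

lemma le_inverse_multI:
  fixes a b c :: real
  assumes "c * a \<le> b" "c > 0" shows "a \<le> inverse c * b"
  using assms by (simp add: field_simps)

text \<open>On the diagonal \<open>x = y\<close> and for real \<open>r\<close> every term of
  Mehler's series is nonnegative, so one term is at most the whole sum, which is an explicit
  Gaussian.\<close>

lemma hermite_fun_square_le:
  assumes r: "0 < r" "r < 1"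
  shows "(hermite_fun n x)\<^sup>2 \<le> inverse (r ^ n) * (exp (- (x\<^sup>2 * ((1 - r) / (1 + r)))) / sqrt (pi * (1 - r\<^sup>2)))"
proof -
  have s: "(\<lambda>n. (complex_of_real r) ^ n * complex_of_real (hermite_fun n x * hermite_fun n x)) sums mehler_kernel r x x"
    using r by (intro mehler_kernel_sums) auto
  have "r\<^sup>2 < 1" using r by (simp add: abs_square_less_1)
  have nr: "cmod (complex_of_real r) < 1" using r by simp
  have e1: "csqrt (1 - (complex_of_real r)\<^sup>2) = of_real (sqrt (1 - r\<^sup>2))"
    using \<open>r\<^sup>2 < 1\<close> by (subst csqrt_of_real_nonneg) simp_all
  have e2: "- (complex_of_real ((x + x)\<^sup>2 / 4) * ((1 - complex_of_real r) / (1 + complex_of_real r))) 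
        - complex_of_real ((x - x)\<^sup>2 / 4) * ((1 + complex_of_real r) / (1 - complex_of_real r))
        = complex_of_real (- (x\<^sup>2 * ((1 - r) / (1 + r))))"
    by (simp add: power2_eq_square)
  have "mehler_kernel r x x = complex_of_real (exp (- (x\<^sup>2 * ((1 - r) / (1 + r)))) / sqrt (pi * (1 - r\<^sup>2)))"
    unfolding mehler_kernel_eq[OF nr] e1 e2 
    unfolding exp_of_real real_sqrt_mult of_real_mult of_real_divide
    by (simp only: divide_divide_eq_left mult.commute)
  with s have "(\<lambda>n. complex_of_real (r ^ n * (hermite_fun n x)\<^sup>2)) sums complex_of_real (exp (- (x\<^sup>2 * ((1 - r) / (1 + r)))) / sqrt (pi * (1 - r\<^sup>2)))"
    by (simp add: power2_eq_square)
  then have s: "(\<lambda>n. r ^ n * (hermite_fun n x)\<^sup>2) sums (exp (- (x\<^sup>2 * ((1 - r) / (1 + r)))) / sqrt (pi * (1 - r\<^sup>2)))"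
    unfolding sums_of_real_iff .
  have "sum (\<lambda>n. r ^ n * (hermite_fun n x)\<^sup>2) {n} \<le> suminf (\<lambda>n. r ^ n * (hermite_fun n x)\<^sup>2)"
    using r by (intro sum_le_suminf sums_summable[OF s]) auto
  then have "r ^ n * (hermite_fun n x)\<^sup>2 \<le> exp (- (x\<^sup>2 * ((1 - r) / (1 + r)))) / sqrt (pi * (1 - r\<^sup>2))"
    unfolding sums_unique[OF s, symmetric] by simp
  then show ?thesis by (rule le_inverse_multI) (use r in simp)
qed

text \<open>Positivity off the real line: with the conjugate point as second argument, the product
  of the two Hermite values is a squared modulus, and again one term is at most the sum.\<close>

lemma hermite_complex_square_le:
  assumes r: "0 < r" "r < 1"
  shows "(cmod (hermite_complex n z))\<^sup>2 / (2 ^ n * fact n) \<le> inverse (r ^ n) * cmod (mehler_fun z (cnj z) (of_real r))"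
proof -
  have s: "(\<lambda>n. mehler_coeff z (cnj z) n * of_real r ^ n) sums mehler_fun z (cnj z) (of_real r)"
    using r by (intro mehler_sums) auto
  have "mehler_coeff z (cnj z) n * of_real r ^ n = complex_of_real (r ^ n * ((cmod (hermite_complex n z))\<^sup>2 / (2 ^ n * fact n)))" for n
    unfolding mehler_coeff_def hermite_complex_cnj complex_norm_square[symmetric] by simp
  with s have s: "(\<lambda>n. r ^ n * ((cmod (hermite_complex n z))\<^sup>2 / (2 ^ n * fact n))) sums Re (mehler_fun z (cnj z) (of_real r))"
    using sums_Re[OF s] by (simp only: Re_complex_of_real)
  have "sum (\<lambda>n. r ^ n * ((cmod (hermite_complex n z))\<^sup>2 / (2 ^ n * fact n))) {n} \<le> Re (mehler_fun z (cnj z) (of_real r))"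
    unfolding sums_unique[OF s]
    using r by (intro sum_le_suminf sums_summable[OF s]) auto
  then have "r ^ n * ((cmod (hermite_complex n z))\<^sup>2 / (2 ^ n * fact n)) \<le> cmod (mehler_fun z (cnj z) (of_real r))"
    using complex_Re_le_cmod[of "mehler_fun z (cnj z) (of_real r)"]
    by (simp only: sum.insert sum.empty finite.emptyI empty_iff not_False_eq_True add_0_right)
  then show ?thesis by (rule le_inverse_multI) (use r in simp)
qed

section \<open>Integrals of Hermite functions\<close>

lemma gauss_tendsto_0:
  fixes a :: real assumes "a > 0"
  shows "((\<lambda>x. exp (- (a * x\<^sup>2))) \<longlongrightarrow> 0) at_top" "((\<lambda>x. exp (- (a * x\<^sup>2))) \<longlongrightarrow> 0) at_bot"
  using assms by real_asymp+

lemma gauss_has_integral: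
  fixes a :: real assumes a: "a > 0"
  shows "has_bochner_integral lborel (\<lambda>x. exp (- (a * x\<^sup>2))) (sqrt (pi / a))"
proof -
  define s where "s = sqrt (1 / (2 * a))"
  have s: "s > 0" "2 * s\<^sup>2 = 1 / a" "2 * pi * s\<^sup>2 = pi / a" using a by (simp_all add: s_def)
  have eq: "sqrt (pi / a) * normal_density 0 s x = exp (- (a * x\<^sup>2))" for x
  proof -
    have "normal_density 0 s x = 1 / sqrt (pi / a) * exp (- (x\<^sup>2 / (1 / a)))"
      unfolding normal_density_def s by simp
    then show ?thesis using a by (simp add: mult.commute)
  qed
  have "has_bochner_integral lborel (\<lambda>x. sqrt (pi / a) * normal_density 0 s x) (sqrt (pi / a) * 1)"
    using s by (intro has_bochner_integral_mult_right) (simp add: has_bochner_integral_iff)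
  then show ?thesis by (simp add: eq)
qed

text \<open>Integration by parts in the only form used below: boundary terms vanish because the
  primitive is dominated by a Gaussian.\<close>

lemma integral_deriv_eq_0:
  fixes F f :: "real \<Rightarrow> 'a::euclidean_space"
  assumes F: "\<And>x. (F has_vector_derivative f x) (at x)" and f: "continuous_on UNIV f" "integrable lborel f"
    and le: "\<And>x. norm (F x) \<le> C * exp (- (a * x\<^sup>2))" and a: "a > 0"
  shows "integral\<^sup>L lborel f = 0"
proof -
  have "(F \<longlongrightarrow> 0) at_top" "(F \<longlongrightarrow> 0) at_bot"
    by (rule Lim_null_comparison[OF always_eventually tendsto_mult_right_zero[OF gauss_tendsto_0(1)[OF a]]], use le in blast,
        rule Lim_null_comparison[OF always_eventually tendsto_mult_right_zero[OF gauss_tendsto_0(2)[OF a]]], use le in blast)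
  then have "(LBINT x=-\<infinity>..\<infinity>. f x) = 0 - 0"
    using f F
    by (intro interval_integral_FTC_integrable)
       (auto simp: einterval_eq_UNIV set_integrable_def at_right_MInf at_left_PInf filterlim_filtermap comp_def
          continuous_on_eq_continuous_at)
  then show ?thesis
    by (simp add: interval_lebesgue_integral_def einterval_eq_UNIV set_lebesgue_integral_def)
qed

text \<open>Left without the normalising constant so that the ladder relations for multiplication by
  \<open>x\<close> and for the derivative have rational coefficients.\<close>

definition hermite_gauss :: "nat \<Rightarrow> real \<Rightarrow> real" where
  "hermite_gauss n x = hermite_poly n x * exp (- x\<^sup>2 / 2)"

definition hermite_norm :: "nat \<Rightarrow> real" where
  "hermite_norm n = sqrt (2 ^ n * fact n * sqrt pi)"

lemma hermite_norm_pos: "hermite_norm n > 0" "hermite_norm n \<noteq> 0"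
  by (simp_all add: hermite_norm_def)

lemma hermite_norm_square: "(hermite_norm n)\<^sup>2 = 2 ^ n * fact n * sqrt pi"
  by (simp add: hermite_norm_def)

lemma hermite_fun_eq: "hermite_fun n x = hermite_gauss n x / hermite_norm n"
  by (simp add: hermite_fun_def hermite_gauss_def hermite_norm_def)

lemma hermite_gauss_eq: "hermite_gauss n x = hermite_norm n * hermite_fun n x"
  using hermite_norm_pos[of n] by (simp add: hermite_fun_eq)

lemma hermite_gauss_mult: "2 * x * hermite_gauss n x = hermite_gauss (Suc n) x + 2 * real n * hermite_gauss (n - 1) x"
  by (cases n) (simp_all add: hermite_gauss_def algebra_simps)

lemma hermite_gauss_deriv:
  "(hermite_gauss n has_real_derivative real n * hermite_gauss (n - 1) x - hermite_gauss (Suc n) x / 2) (at x)"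
proof -
  have "(hermite_gauss n has_real_derivative 2 * real n * hermite_gauss (n - 1) x - x * hermite_gauss n x) (at x)"
    unfolding hermite_gauss_def[abs_def]
    by (auto intro!: derivative_eq_intros hermite_poly_has_derivative simp: algebra_simps)
  moreover have "2 * real n * hermite_gauss (n - 1) x - x * hermite_gauss n x
      = real n * hermite_gauss (n - 1) x - hermite_gauss (Suc n) x / 2"
    using hermite_gauss_mult[of x n] by simp
  ultimately show ?thesis by (simp only:)
qed

lemma continuous_hermite_gauss [continuous_intros]:
  "continuous_on A f \<Longrightarrow> continuous_on A (\<lambda>x. hermite_gauss n (f x))"
  by (rule continuous_on_compose2[of UNIV "hermite_gauss n"])
     (auto intro: DERIV_continuous_on[OF has_field_derivative_at_within[OF hermite_gauss_deriv]])

lemma continuous_hermite_fun [continuous_intros]: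
  "continuous_on A f \<Longrightarrow> continuous_on A (\<lambda>x. hermite_fun n (f x))"
  unfolding hermite_fun_eq by (intro continuous_intros) (simp_all add: hermite_norm_pos)

lemma borel_measurable_hermite_gauss [measurable]: "hermite_gauss n \<in> borel_measurable borel"
  by (intro borel_measurable_continuous_onI continuous_intros)

lemma borel_measurable_hermite_fun [measurable]: "hermite_fun n \<in> borel_measurable borel"
  by (intro borel_measurable_continuous_onI continuous_intros)

lemma hermite_fun_gauss_bound:
  obtains B where "B \<ge> 0" "\<And>x. \<bar>hermite_fun n x\<bar> \<le> B * exp (- (x\<^sup>2 / 6))"
proof
  \<comment> \<open>The choice \<open>r = 1/2\<close> gives the rate
    \<open>(1 - r)/(1 + r) = 1/3\<close> for the square, hence \<open>1/6\<close> for the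
    function.\<close>
  define D where "D = inverse ((1/2)^n) / sqrt (pi * (1 - (1/2)\<^sup>2))"
  have D: "D \<ge> 0" by (simp add: D_def power2_eq_square)
  then show "sqrt D \<ge> 0" by simp
  fix x :: real
  have "(hermite_fun n x)\<^sup>2 \<le> D * exp (- (x\<^sup>2 / 3))"
    using hermite_fun_square_le[of "1/2" n x] by (simp add: D_def)
  also have "\<dots> = (sqrt D * exp (- (x\<^sup>2 / 6)))\<^sup>2"
    using D by (simp add: power_mult_distrib flip: exp_double)
  finally show "\<bar>hermite_fun n x\<bar> \<le> sqrt D * exp (- (x\<^sup>2 / 6))"
    using D by (intro power2_le_imp_le[of "\<bar>hermite_fun n x\<bar>"]) auto
qed

lemma hermite_gauss_bound:
  obtains B where "B \<ge> 0" "\<And>x. \<bar>hermite_gauss n x\<bar> \<le> B * exp (- (x\<^sup>2 / 6))"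
proof -
  obtain B where B: "B \<ge> 0" "\<And>x. \<bar>hermite_fun n x\<bar> \<le> B * exp (- (x\<^sup>2 / 6))"
    using hermite_fun_gauss_bound by blast
  show ?thesis
  proof (rule that[of "hermite_norm n * B"])
    show "\<bar>hermite_gauss n x\<bar> \<le> hermite_norm n * B * exp (- (x\<^sup>2 / 6))" for x
      unfolding hermite_gauss_eq using mult_left_mono[OF B(2)[of x], of "hermite_norm n"] hermite_norm_pos[of n]
      by (simp add: abs_mult mult_ac)
  qed (use B hermite_norm_pos[of n] in auto)
qed

lemma hermite_gauss_mult_bound:
  assumes "c \<ge> 0"
  obtains B where "\<And>x. \<bar>hermite_gauss m x * hermite_gauss n x * exp (- (c * x\<^sup>2))\<bar> \<le> B * exp (- (1/3 * x\<^sup>2))"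
proof -
  obtain B1 where B1: "B1 \<ge> 0" "\<And>x. \<bar>hermite_gauss m x\<bar> \<le> B1 * exp (- (x\<^sup>2 / 6))"
    using hermite_gauss_bound by blast
  obtain B2 where B2: "B2 \<ge> 0" "\<And>x. \<bar>hermite_gauss n x\<bar> \<le> B2 * exp (- (x\<^sup>2 / 6))"
    using hermite_gauss_bound by blast
  show ?thesis
  proof (rule that[of "B1 * B2"])
    fix x :: real
    have "\<bar>hermite_gauss m x * hermite_gauss n x * exp (- (c * x\<^sup>2))\<bar> \<le>
       (B1 * exp (- (x\<^sup>2 / 6))) * (B2 * exp (- (x\<^sup>2 / 6))) * 1"
      unfolding abs_mult using B1 B2 assms
      by (intro mult_mono) auto
    also have "\<dots> = B1 * B2 * (exp (- (x\<^sup>2 / 6)) * exp (- (x\<^sup>2 / 6)))" by simp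
    also have "exp (- (x\<^sup>2 / 6)) * exp (- (x\<^sup>2 / 6)) = exp (- (1/3 * x\<^sup>2))"
      by (simp flip: exp_add)
    finally show "\<bar>hermite_gauss m x * hermite_gauss n x * exp (- (c * x\<^sup>2))\<bar> \<le> B1 * B2 * exp (- (1/3 * x\<^sup>2))" .
  qed
qed

lemma integrable_hermite_gauss_mult:
  assumes "c \<ge> 0"
  shows "integrable lborel (\<lambda>x. hermite_gauss m x * hermite_gauss n x * exp (- (c * x\<^sup>2)))"
proof -
  obtain B where B: "\<And>x. \<bar>hermite_gauss m x * hermite_gauss n x * exp (- (c * x\<^sup>2))\<bar> \<le> B * exp (- (1/3 * x\<^sup>2))"
    using hermite_gauss_mult_bound[OF assms] by blast
  have "integrable lborel (\<lambda>x::real. B * exp (- (1/3 * x\<^sup>2)))"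
    using gauss_has_integral[of "1/3"] by (intro integrable_mult_right) (simp add: has_bochner_integral_iff)
  then show ?thesis
    by (rule Bochner_Integration.integrable_bound) (use B in \<open>auto intro!: AE_I2 order_trans[OF B]\<close>)
qed

text \<open>The extra weight is kept as a parameter because two values matter: \<open>c = 0\<close>
  gives orthogonality and \<open>c = 1\<close> the mass near the origin.\<close>

definition hermite_int :: "real \<Rightarrow> nat \<Rightarrow> nat \<Rightarrow> real" where
  "hermite_int c m n = integral\<^sup>L lborel (\<lambda>x. hermite_gauss m x * hermite_gauss n x * exp (- (c * x\<^sup>2)))"

lemma hermite_int_commute: "hermite_int c m n = hermite_int c n m"
  by (simp add: hermite_int_def mult.commute)

text \<open>Multiplication by \<open>2 * x\<close> is symmetric, so it can be expanded by the ladder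
  relation on either factor.\<close>

lemma hermite_int_shift:
  assumes c: "c \<ge> 0"
  shows "hermite_int c (Suc m) n + 2 * real m * hermite_int c (m - 1) n
    = hermite_int c m (Suc n) + 2 * real n * hermite_int c m (n - 1)"
proof -
  have *: "hermite_int c (Suc m) n + 2 * real m * hermite_int c (m - 1) n
     = integral\<^sup>L lborel (\<lambda>x. (2 * x * hermite_gauss m x) * hermite_gauss n x * exp (- (c * x\<^sup>2)))" for m n
    unfolding hermite_int_def hermite_gauss_mult
    using integrable_hermite_gauss_mult[OF c, of "Suc m" n] integrable_hermite_gauss_mult[OF c, of "m - 1" n]
    by (simp add: ring_distribs mult.assoc)
  have "integral\<^sup>L lborel (\<lambda>x. (2 * x * hermite_gauss m x) * hermite_gauss n x * exp (- (c * x\<^sup>2)))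
     = integral\<^sup>L lborel (\<lambda>x. (2 * x * hermite_gauss n x) * hermite_gauss m x * exp (- (c * x\<^sup>2)))"
    by (simp only: mult_ac)
  then show ?thesis using *[of m n] *[of n m] by (simp only: hermite_int_commute[of c m])
qed

text \<open>The derivative of the integrand has integral zero. Together with
  \<open>hermite_int_shift\<close> this gives recurrences for the integrals at fixed
  \<open>c\<close>.\<close>

lemma hermite_int_parts:
  assumes c: "c \<ge> 0"
  shows "real m * hermite_int c (m - 1) n - hermite_int c (Suc m) n / 2 + real n * hermite_int c m (n - 1)
    - hermite_int c m (Suc n) / 2 - c * (hermite_int c (Suc m) n + 2 * real m * hermite_int c (m - 1) n) = 0"
proof -
  note i = integrable_hermite_gauss_mult[OF c]
  let ?g = "\<lambda>m n x. hermite_gauss m x * hermite_gauss n x * exp (- (c * x\<^sup>2))"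
  let ?f = "\<lambda>x. real m * ?g (m - 1) n x - ?g (Suc m) n x / 2 + real n * ?g m (n - 1) x
    - ?g m (Suc n) x / 2 - c * (?g (Suc m) n x + 2 * real m * ?g (m - 1) n x)"
  obtain B where B: "\<And>x. \<bar>?g m n x\<bar> \<le> B * exp (- (1/3 * x\<^sup>2))"
    using hermite_gauss_mult_bound[OF c] by blast
  have "integral\<^sup>L lborel ?f = 0"
  proof (rule integral_deriv_eq_0[of "?g m n" _ B "1/3"])
    show "(?g m n has_vector_derivative ?f x) (at x)" for x
      unfolding has_real_derivative_iff_has_vector_derivative[symmetric]
    proof -
      have "(?g m n has_real_derivative 
        (real m * hermite_gauss (m - 1) x - hermite_gauss (Suc m) x / 2) * hermite_gauss n x * exp (- (c * x\<^sup>2))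
        + hermite_gauss m x * (real n * hermite_gauss (n - 1) x - hermite_gauss (Suc n) x / 2) * exp (- (c * x\<^sup>2))
        - c * (2 * x * hermite_gauss m x) * hermite_gauss n x * exp (- (c * x\<^sup>2))) (at x)"
        by (rule derivative_eq_intros hermite_gauss_deriv refl)+ (simp_all add: algebra_simps)
      then show "(?g m n has_real_derivative ?f x) (at x)"
        unfolding hermite_gauss_mult by (simp add: algebra_simps)
    qed
    show "continuous_on UNIV ?f" by (intro continuous_intros) simp_all
    show "integrable lborel ?f"
      by (intro Bochner_Integration.integrable_add Bochner_Integration.integrable_diff integrable_mult_right integrable_divide i)
    show "norm (?g m n x) \<le> B * exp (- (1/3 * x\<^sup>2))" for x using B[of x] by simp
  qed simp
  then show ?thesis
    unfolding hermite_int_def using i[of "m - 1" n] i[of "Suc m" n] i[of m "n - 1"] i[of m "Suc n"]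
    by simp
qed

lemma hermite_int_0_0: "hermite_int c 0 0 = sqrt (pi / (1 + c))" if "c \<ge> 0"
proof -
  have "hermite_gauss 0 x * hermite_gauss 0 x * exp (- (c * x\<^sup>2)) = exp (- ((1 + c) * x\<^sup>2))" for x
    by (simp add: hermite_gauss_def algebra_simps flip: exp_add)
  then show ?thesis
    using gauss_has_integral[of "1 + c"] that by (simp add: hermite_int_def has_bochner_integral_iff)
qed

lemma hermite_int_0_rec: "hermite_int 0 m (Suc n) = 2 * real m * hermite_int 0 (m - 1) n"
  using hermite_int_parts[of 0 m n] hermite_int_shift[of 0 m n] by simp

lemma hermite_int_orth: "hermite_int 0 m n = (if m = n then 2 ^ n * fact n * sqrt pi else 0)"
proof (induction n arbitrary: m)
  case 0
  show ?case
  proof (cases m)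
    case (Suc k)
    then show ?thesis using hermite_int_0_rec[of 0 k] by (simp add: hermite_int_commute)
  qed (simp add: hermite_int_0_0)
next
  case (Suc n)
  show ?case unfolding hermite_int_0_rec Suc by (cases m) auto
qed

lemma hermite_fun_mult_integral:
  assumes "c \<ge> 0"
  shows "has_bochner_integral lborel (\<lambda>x. hermite_fun m x * hermite_fun n x * exp (- (c * x\<^sup>2)))
     (hermite_int c m n / (hermite_norm m * hermite_norm n))"
proof -
  have "has_bochner_integral lborel (\<lambda>x. hermite_gauss m x * hermite_gauss n x * exp (- (c * x\<^sup>2)) / (hermite_norm m * hermite_norm n))
     (hermite_int c m n / (hermite_norm m * hermite_norm n))"
    unfolding hermite_int_def using integrable_hermite_gauss_mult[OF assms]
    by (intro has_bochner_integral_divide has_bochner_integral_integrable)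
  then show ?thesis by (simp add: hermite_fun_eq)
qed

lemma hermite_fun_orthonormal:
  "has_bochner_integral lborel (\<lambda>x. hermite_fun m x * hermite_fun n x) (if m = n then 1 else 0)"
proof -
  have "hermite_int 0 m n / (hermite_norm m * hermite_norm n) = (if m = n then 1 else 0)"
    using hermite_norm_pos[of n] hermite_norm_square[of n]
    by (auto simp: hermite_int_orth power2_eq_square)
  then show ?thesis using hermite_fun_mult_integral[of 0 m n] by simp
qed

text \<open>This is the integral of \<open>exp (- x\<^sup>2)\<close> against the square of the
  normalised Hermite function: the mass it puts near the origin.\<close>

definition hermite_mass :: "nat \<Rightarrow> real" where
  "hermite_mass n = hermite_int 1 n n / (hermite_norm n * hermite_norm n)"

text \<open>At \<open>c = 1\<close> the two relations between the integrals combine so that moving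
  one unit of index from one factor to the other only changes the sign. This closes the recurrence
  on the diagonal.\<close>

lemma hermite_mass_Suc: "hermite_mass (Suc n) = (2 * real n + 1) / (2 * real n + 2) * hermite_mass n"
proof -
  have s: "hermite_int 1 m (Suc n) = - hermite_int 1 (Suc m) n"
    "hermite_int 1 (Suc m) n = real n * hermite_int 1 m (n - 1) - real m * hermite_int 1 (m - 1) n" for m n
    using hermite_int_parts[of 1 m n] hermite_int_shift[of 1 m n] by simp_all
  have "hermite_int 1 (Suc n) (n - 1) = - hermite_int 1 n n" if "n > 0"
    using s(1)[of n "n - 1"] that by simp
  then have "hermite_int 1 (Suc (Suc n)) n = - (2 * real n + 1) * hermite_int 1 n n"
    using s(2)[of "Suc n" n] by (cases "n = 0") (auto simp: algebra_simps)
  then have "hermite_int 1 (Suc n) (Suc n) = (2 * real n + 1) * hermite_int 1 n n"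
    using s(1)[of "Suc n" n] by (simp add: algebra_simps)
  moreover have "hermite_norm (Suc n) * hermite_norm (Suc n) = (2 * real n + 2) * (hermite_norm n * hermite_norm n)"
    using hermite_norm_square[of n] hermite_norm_square[of "Suc n"] by (simp add: power2_eq_square algebra_simps)
  ultimately show ?thesis by (simp add: hermite_mass_def)
qed

lemma hermite_mass_pos: "hermite_mass n > 0"
proof (induction n)
  case 0
  show ?case using hermite_norm_pos[of 0] by (simp add: hermite_mass_def hermite_int_0_0)
qed (simp add: hermite_mass_Suc)

text \<open>The mass is a product of factors \<open>(2k+1)/(2k+2)\<close>, as for central binomial
  coefficients, and so decays like \<open>n^(-1/2)\<close>. The induction step is
  \<open>(t+1)(t+3) \<le> (t+2)^2\<close>.\<close>

lemma hermite_mass_le: "hermite_mass n \<le> hermite_mass 0 / sqrt (2 * real n + 1)"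
proof (induction n)
  case (Suc n)
  define t where "t = 2 * real n"
  have t: "t \<ge> 0" by (simp add: t_def)
  have "hermite_mass (Suc n) \<le> (t + 1) / (t + 2) * (hermite_mass 0 / sqrt (t + 1))"
    unfolding hermite_mass_Suc t_def using Suc by (intro mult_left_mono) auto
  also have "\<dots> = hermite_mass 0 * (((t + 1) / sqrt (t + 1)) / (t + 2))"
    by (simp add: mult_ac)
  also have "(t + 1) / sqrt (t + 1) = sqrt (t + 1)" using t by (simp add: real_div_sqrt)
  also have "sqrt (t + 1) / (t + 2) \<le> 1 / sqrt (t + 3)"
  proof -
    have "(sqrt (t + 1) * sqrt (t + 3)) \<le> t + 2"
      unfolding real_sqrt_mult[symmetric] using t
      by (intro real_le_lsqrt) (auto simp: power2_eq_square algebra_simps)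
    then show ?thesis using t by (simp add: field_simps)
  qed
  then have "hermite_mass 0 * (sqrt (t + 1) / (t + 2)) \<le> hermite_mass 0 * (1 / sqrt (t + 3))"
    using hermite_mass_pos[of 0] by (intro mult_left_mono) auto
  finally show ?case by (simp add: t_def add_ac)
qed simp

lemma hermite_poly_minus: "hermite_poly n (- x) = (- 1) ^ n * hermite_poly n x"
  by (induction n x rule: hermite_poly.induct) (simp_all add: algebra_simps)

lemma hermite_fun_minus: "hermite_fun n (- x) = (- 1) ^ n * hermite_fun n x"
  by (simp add: hermite_fun_def hermite_poly_minus)

section \<open>The Fourier transform of Hermite functions\<close>

lemma integral_lebesgue_eq_lborel:
  fixes f :: "real \<Rightarrow> 'a::{banach, second_countable_topology}"
  assumes "f \<in> borel_measurable borel" 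
  shows "integral\<^sup>L lebesgue f = integral\<^sup>L lborel f"
  using assms by (intro integral_completion) simp

lemma integrable_lebesgue_iff_lborel:
  fixes f :: "real \<Rightarrow> 'a::{banach, second_countable_topology}"
  assumes "f \<in> borel_measurable borel" 
  shows "integrable lebesgue f \<longleftrightarrow> integrable lborel f"
  using assms by (intro integrable_completion) simp

lemma borel_imp_lebesgue_measurable:
  "f \<in> borel_measurable borel \<Longrightarrow> f \<in> borel_measurable (lebesgue :: real measure)"
  by (rule measurable_completion) simp

lemma integrable_hermite_gauss: "integrable lborel (hermite_gauss n)"
proof -
  obtain B where B: "\<And>x. \<bar>hermite_gauss n x\<bar> \<le> B * exp (- (x\<^sup>2 / 6))"
    using hermite_gauss_bound by blast
  have "integrable lborel (\<lambda>x::real. B * exp (- (x\<^sup>2 / 6)))"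
    using gauss_has_integral[of "1/6"] by (intro integrable_mult_right) (simp add: has_bochner_integral_iff)
  then show ?thesis
    by (rule Bochner_Integration.integrable_bound) (use B in \<open>auto intro!: AE_I2 order_trans[OF B]\<close>)
qed

definition fourier_hermite :: "nat \<Rightarrow> real \<Rightarrow> complex" where
  "fourier_hermite n \<xi> = integral\<^sup>L lborel (\<lambda>x. exp (- (\<i> * of_real (x * \<xi>))) * of_real (hermite_gauss n x))"

lemma integrable_exp_hermite_gauss:
  "integrable lborel (\<lambda>x. exp (- (\<i> * of_real (x * \<xi>))) * complex_of_real (hermite_gauss n x))"
proof (rule Bochner_Integration.integrable_bound[OF integrable_hermite_gauss[of n]])
  show "AE x in lborel. norm (exp (- (\<i> * of_real (x * \<xi>))) * complex_of_real (hermite_gauss n x)) \<le> norm (hermite_gauss n x)"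
    by (simp add: norm_mult)
  show "(\<lambda>x. exp (- (\<i> * of_real (x * \<xi>))) * complex_of_real (hermite_gauss n x)) \<in> borel_measurable lborel"
    unfolding measurable_lborel2
    by (intro borel_measurable_continuous_onI continuous_intros)
qed

text \<open>The derivative of the exponential times the Hermite function integrates to zero. Up to
  powers of \<open>- \<i>\<close> the result is the recurrence of \<open>hermite_gauss\<close>
  itself, so the two sequences differ by these powers once they agree up to a constant at 0.\<close>

lemma fourier_hermite_rec:
  "fourier_hermite (Suc n) \<xi> = 2 * of_nat n * fourier_hermite (n - 1) \<xi> - 2 * \<i> * of_real \<xi> * fourier_hermite n \<xi>"
proof -
  note i = integrable_exp_hermite_gauss
  let ?e = "\<lambda>n x. exp (- (\<i> * of_real (x * \<xi>))) * complex_of_real (hermite_gauss n x)"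
  let ?f = "\<lambda>x. of_nat n * ?e (n - 1) x - ?e (Suc n) x / 2 - \<i> * of_real \<xi> * ?e n x"
  obtain B where B: "\<And>x. \<bar>hermite_gauss n x\<bar> \<le> B * exp (- (x\<^sup>2 / 6))"
    using hermite_gauss_bound by blast
  have "integral\<^sup>L lborel ?f = 0"
  proof (rule integral_deriv_eq_0[of "?e n" _ B "1/6"])
    show "(?e n has_vector_derivative ?f x) (at x)" for x
    proof -
      have 1: "((\<lambda>x. exp (- (\<i> * of_real (x * \<xi>)))) has_vector_derivative 
         (- (\<i> * of_real \<xi>)) * exp (- (\<i> * of_real (x * \<xi>)))) (at x)"
      proof -
        have "((\<lambda>z. exp (- (\<i> * (z * of_real \<xi>)))) has_field_derivative 
           (- (\<i> * of_real \<xi>)) * exp (- (\<i> * (of_real x * of_real \<xi>)))) (at (of_real x))"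
          by (auto intro!: derivative_eq_intros)
        from has_vector_derivative_real_field[OF this] show ?thesis by simp
      qed
      have 2: "((\<lambda>x. complex_of_real (hermite_gauss n x)) has_vector_derivative
         of_real (real n * hermite_gauss (n - 1) x - hermite_gauss (Suc n) x / 2)) (at x)"
        using hermite_gauss_deriv has_vector_derivative_of_real
        by (metis has_real_derivative_iff_has_vector_derivative)
      show ?thesis
        by (rule has_vector_derivative_eq_rhs[OF has_vector_derivative_mult[OF 1 2]]) (simp add: algebra_simps)
    qed
    show "continuous_on UNIV ?f" by (intro continuous_intros) simp_all
    show "integrable lborel ?f"
      by (intro Bochner_Integration.integrable_add Bochner_Integration.integrable_diff integrable_mult_right integrable_divide i)
    show "norm (?e n x) \<le> B * exp (- (1/6 * x\<^sup>2))" for x using B[of x] by (simp add: norm_mult)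
  qed simp
  moreover have "integral\<^sup>L lborel ?f = of_nat n * fourier_hermite (n - 1) \<xi> - fourier_hermite (Suc n) \<xi> / 2
     - \<i> * of_real \<xi> * fourier_hermite n \<xi>"
    unfolding fourier_hermite_def using i[of \<xi> "n - 1"] i[of \<xi> "Suc n"] i[of \<xi> n] by simp
  ultimately show ?thesis by (simp add: field_simps)
qed

text \<open>The ground state is a multiple of the standard normal density, whose characteristic
  function is known.\<close>

lemma fourier_hermite_0: "fourier_hermite 0 \<xi> = of_real (sqrt (2 * pi)) * of_real (hermite_gauss 0 \<xi>)"
proof -
  have "complex_of_real (exp (- (\<xi>\<^sup>2) / 2)) = char std_normal_distribution (- \<xi>)"
    by (simp add: char_std_normal_distribution)
  also have "\<dots> = integral\<^sup>L lborel (\<lambda>x. std_normal_density x *\<^sub>R exp (\<i> * of_real (- \<xi> * x)))"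
    unfolding char_def by (subst integral_density) auto
  also have "\<dots> = integral\<^sup>L lborel (\<lambda>x. of_real (1 / sqrt (2 * pi)) * (exp (- (\<i> * of_real (x * \<xi>))) * of_real (hermite_gauss 0 x)))"
    by (intro Bochner_Integration.integral_cong refl)
       (simp add: hermite_gauss_def std_normal_density_def scaleR_conv_of_real mult_ac)
  also have "\<dots> = of_real (1 / sqrt (2 * pi)) * fourier_hermite 0 \<xi>"
    unfolding fourier_hermite_def by (rule integral_mult_right_zero)
  finally have *: "complex_of_real (hermite_gauss 0 \<xi>) = of_real (1 / sqrt (2 * pi)) * fourier_hermite 0 \<xi>"
    by (simp add: hermite_gauss_def)
  have "complex_of_real (sqrt (2 * pi)) * of_real (1 / sqrt (2 * pi)) = 1"
    unfolding of_real_mult[symmetric] by simp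
  then show ?thesis unfolding * mult.assoc[symmetric] by simp
qed

lemma fourier_hermite_eq:
  "fourier_hermite n \<xi> = of_real (sqrt (2 * pi)) * ((- \<i>) ^ n * of_real (hermite_gauss n \<xi>))"
proof (induction n rule: induct_nat_012)
  case 0
  then show ?case by (simp add: fourier_hermite_0)
next
  case 1
  have "hermite_gauss (Suc 0) \<xi> = 2 * \<xi> * hermite_gauss 0 \<xi>"
    using hermite_gauss_mult[of \<xi> 0] by simp
  then show ?case
    using fourier_hermite_rec[of 0 \<xi>] by (simp add: fourier_hermite_0)
next
  case (ge2 n)
  have "hermite_gauss (Suc (Suc n)) \<xi> = 2 * \<xi> * hermite_gauss (Suc n) \<xi> - 2 * real (Suc n) * hermite_gauss n \<xi>"
    using hermite_gauss_mult[of \<xi> "Suc n"] by simp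
  then have eq: "complex_of_real (hermite_gauss (Suc (Suc n)) \<xi>) 
     = 2 * of_real \<xi> * of_real (hermite_gauss (Suc n) \<xi>) - 2 * of_nat (Suc n) * of_real (hermite_gauss n \<xi>)"
    by simp
  then show ?case
    unfolding fourier_hermite_rec[of "Suc n"] diff_Suc_1 ge2 eq power_Suc by (simp add: algebra_simps)
qed

section \<open>Completeness of the Hermite functions\<close>

text \<open>The positive and negative parts of \<open>p\<close> have equal transforms; at
  \<open>t = 0\<close> this says that they have the same mass \<open>c\<close>. Dividing by
  \<open>c\<close> makes them probability densities with the same characteristic function, to which
  Levy's uniqueness theorem applies.\<close>

lemma real_fourier_zero_imp_AE_zero:
  fixes p :: "real \<Rightarrow> real"
  assumes p: "integrable lborel p"
    and zero: "\<And>t. integral\<^sup>L lborel (\<lambda>x. of_real (p x) * exp (\<i> * of_real (t * x))) = 0"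
  shows "AE x in lborel. p x = 0"
proof -
  have [measurable]: "p \<in> borel_measurable borel" using borel_measurable_integrable[OF p] by simp
  define P where "P s x = max 0 (s * p x)" for s x
  define c where "c = integral\<^sup>L lborel (P 1)"
  have Pm [measurable]: "P s \<in> borel_measurable borel" for s unfolding P_def[abs_def] by measurable
  have Pi: "integrable lborel (P s)" for s
    unfolding P_def[abs_def] using p by (intro integrable_max) auto
  have Pn: "P s x \<ge> 0" for s x by (simp add: P_def)
  have PP: "p x = P 1 x - P (- 1) x" for x by (auto simp: P_def max_def)
  have ie: "integrable lborel (\<lambda>x. of_real (P s x) * exp (\<i> * of_real (t * x)))" for s t
    by (rule Bochner_Integration.integrable_bound[OF Pi[of s]]) (auto simp: norm_mult)
  have eq: "integral\<^sup>L lborel (\<lambda>x. of_real (P 1 x) * exp (\<i> * of_real (t * x)))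
      = integral\<^sup>L lborel (\<lambda>x. of_real (P (- 1) x) * exp (\<i> * of_real (t * x)))" for t
    using zero[of t] ie[of 1 t] ie[of "-1" t] unfolding PP by (simp add: algebra_simps)
  have c': "integral\<^sup>L lborel (P (- 1)) = c"
    using eq[of 0] by (simp add: c_def)
  show ?thesis
  proof (cases "c = 0")
    case True
    have "AE x in lborel. P 1 x = 0" "AE x in lborel. P (- 1) x = 0"
      using True c' integral_nonneg_eq_0_iff_AE[OF Pi, of 1] integral_nonneg_eq_0_iff_AE[OF Pi, of "- 1"] Pn
      unfolding c_def by auto
    then show ?thesis by eventually_elim (simp add: PP)
  next
    case False
    have c: "c > 0" using False Pn unfolding c_def by (simp add: integral_nonneg less_le)
    define M where "M s = density lborel (\<lambda>x. ennreal (P s x / c))" for s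
    have R: "real_distribution (M s)" and Ch: "char (M s) t = of_real (1 / c) * integral\<^sup>L lborel (\<lambda>x. of_real (P s x) * exp (\<i> * of_real (t * x)))"
      if s: "s = 1 \<or> s = - 1" for s t
    proof -
      have "(\<integral>\<^sup>+x. ennreal (P s x / c) \<partial>lborel) = ennreal (integral\<^sup>L lborel (\<lambda>x. P s x / c))"
        using Pi[of s] Pn c by (intro nn_integral_eq_integral) auto
      also have "\<dots> = 1" using s c c' by (auto simp: c_def)
      finally have "prob_space (M s)" 
        by (intro prob_spaceI) (simp add: M_def emeasure_density)
      then show "real_distribution (M s)"
        by (simp add: real_distribution_def real_distribution_axioms_def M_def)
      have "char (M s) t = integral\<^sup>L lborel (\<lambda>x. (P s x / c) *\<^sub>R exp (\<i> * of_real (t * x)))"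
        unfolding char_def M_def using Pn c by (subst integral_density) auto
      also have "\<dots> = integral\<^sup>L lborel (\<lambda>x. of_real (1 / c) * (of_real (P s x) * exp (\<i> * of_real (t * x))))"
        by (intro Bochner_Integration.integral_cong refl) (simp add: scaleR_conv_of_real)
      finally show "char (M s) t = of_real (1 / c) * integral\<^sup>L lborel (\<lambda>x. of_real (P s x) * exp (\<i> * of_real (t * x)))"
        by (simp only: integral_mult_right_zero)
    qed
    have "M 1 = M (- 1)"
    proof (intro Levy_uniqueness R ext)
      show "char (M 1) t = char (M (- 1)) t" for t by (metis Ch eq)
    qed auto
    then have "AE x in lborel. ennreal (P 1 x / c) = ennreal (P (- 1) x / c)"
      unfolding M_def by (intro sigma_finite_measure.density_unique sigma_finite_lborel) auto
    then show ?thesis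
    proof eventually_elim
      case (elim x)
      then show ?case using c Pn[of 1 x] Pn[of "- 1" x] by (simp add: PP)
    qed
  qed
qed

text \<open>The transform of the conjugate at \<open>t\<close> is the conjugate of the transform at
  \<open>- t\<close>, so the conjugate has zero transform as well, and with it the real and
  imaginary parts.\<close>

lemma complex_fourier_zero_imp_AE_zero:
  fixes w :: "real \<Rightarrow> complex"
  assumes w: "integrable lborel w"
    and zero: "\<And>t. integral\<^sup>L lborel (\<lambda>x. w x * exp (\<i> * of_real (t * x))) = 0"
  shows "AE x in lborel. w x = 0"
proof -
  have i: "integrable lborel (\<lambda>x. w x * exp (\<i> * of_real (t * x)))" for t
    by (rule Bochner_Integration.integrable_bound[OF w]) (use w in \<open>auto simp: norm_mult\<close>)
  have ic: "integrable lborel (\<lambda>x. cnj (w x) * exp (\<i> * of_real (t * x)))"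
    and zc: "integral\<^sup>L lborel (\<lambda>x. cnj (w x) * exp (\<i> * of_real (t * x))) = 0" for t
  proof -
    have "cnj (w x) * exp (\<i> * of_real (t * x)) = cnj (w x * exp (\<i> * of_real ((- t) * x)))" for x
      by (simp add: exp_cnj)
    then show "integrable lborel (\<lambda>x. cnj (w x) * exp (\<i> * of_real (t * x)))"
      "integral\<^sup>L lborel (\<lambda>x. cnj (w x) * exp (\<i> * of_real (t * x))) = 0"
      using integrable_cnj[of lborel "\<lambda>x. w x * exp (\<i> * of_real ((- t) * x))"] i[of "-t"] 
        Bochner_Integration.integral_cnj[of lborel "\<lambda>x. w x * exp (\<i> * of_real ((- t) * x))"] zero[of "- t"]
      by (simp_all only: complex_cnj_zero)
  qed
  have "AE x in lborel. Re (w x) = 0"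
  proof (rule real_fourier_zero_imp_AE_zero)
    show "integrable lborel (\<lambda>x. Re (w x))" using w by simp
    fix t
    have "of_real (Re (w x)) * exp (\<i> * of_real (t * x))
        = (w x * exp (\<i> * of_real (t * x)) + cnj (w x) * exp (\<i> * of_real (t * x))) / 2" for x
      by (simp add: complex_add_cnj flip: distrib_right)
    then show "integral\<^sup>L lborel (\<lambda>x. of_real (Re (w x)) * exp (\<i> * of_real (t * x))) = 0"
      by (simp only: integral_divide_zero Bochner_Integration.integral_add[OF i ic] zero zc) simp
  qed
  moreover have "AE x in lborel. Im (w x) = 0"
  proof (rule real_fourier_zero_imp_AE_zero)
    show "integrable lborel (\<lambda>x. Im (w x))" using w by simp
    fix t
    have "of_real (Im (w x)) * exp (\<i> * of_real (t * x))
        = (w x * exp (\<i> * of_real (t * x)) - cnj (w x) * exp (\<i> * of_real (t * x))) / (2 * \<i>)" for x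
    proof -
      have eq: "w x - cnj (w x) = of_real (Im (w x)) * (2 * \<i>)" by (simp add: complex_eq_iff)
      show ?thesis unfolding left_diff_distrib[symmetric] eq
        by (subst nonzero_eq_divide_eq) (simp_all only: mult_ac, simp)
    qed
    then show "integral\<^sup>L lborel (\<lambda>x. of_real (Im (w x)) * exp (\<i> * of_real (t * x))) = 0"
      by (simp only: integral_divide_zero Bochner_Integration.integral_diff[OF i ic] zero zc) simp
  qed
  ultimately show ?thesis by eventually_elim (simp add: complex_eq_iff)
qed

lemma lebesgue_ex_borel_complex:
  fixes f :: "real \<Rightarrow> complex"
  assumes "f \<in> borel_measurable lebesgue"
  obtains g where "g \<in> borel_measurable borel" "AE x in lebesgue. f x = g x"
proof -
  have "(\<lambda>x. Re (f x)) \<in> borel_measurable (completion lborel)" "(\<lambda>x. Im (f x)) \<in> borel_measurable (completion lborel)"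
    using assms by measurable
  from completion_ex_borel_measurable_real[OF this(1)] completion_ex_borel_measurable_real[OF this(2)]
  obtain u v where u: "u \<in> borel_measurable lborel" "AE x in lborel. Re (f x) = u x"
    and v: "v \<in> borel_measurable lborel" "AE x in lborel. Im (f x) = v x" by blast
  have [measurable]: "u \<in> borel_measurable borel" "v \<in> borel_measurable borel" using u v by simp_all
  show ?thesis
  proof
    show "(\<lambda>x. Complex (u x) (v x)) \<in> borel_measurable borel"
      unfolding Complex_eq by measurable
    have "AE x in lborel. f x = Complex (u x) (v x)"
      using u(2) v(2) by eventually_elim (simp add: complex_eq_iff)
    then show "AE x in lebesgue. f x = Complex (u x) (v x)" by (rule AE_completion)
  qed
qed

text \<open>The function times \<open>exp (- x\<^sup>2 / 2)\<close> has vanishing moments of every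
  order. It decays fast enough to integrate the exponential series term by term, so its Fourier
  transform vanishes.\<close>

lemma hermite_complete:
  fixes f :: "real \<Rightarrow> complex"
  assumes [measurable]: "f \<in> borel_measurable borel" and f: "integrable lborel (\<lambda>x. (cmod (f x))\<^sup>2)"
    and zero: "\<And>n. integral\<^sup>L lborel (\<lambda>x. f x * of_real (hermite_gauss n x)) = 0"
  shows "AE x in lborel. f x = 0"
proof -
  \<comment> \<open>The linear exponent is absorbed into half of the Gaussian by
    \<open>(t - |x|/2)^2 \<ge> 0\<close>; the result majorises the exponential series for every
    \<open>t\<close>.\<close>
  have exp_le: "cmod (f x) * exp (- x\<^sup>2 / 2 + t * \<bar>x\<bar>) \<le> (cmod (f x))\<^sup>2 + exp (2 * t\<^sup>2) * exp (- (1/2 * x\<^sup>2))" for x t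
  proof -
    have sq: "(t - \<bar>x\<bar> / 2)\<^sup>2 \<ge> 0" by simp
    have "2 * (- x\<^sup>2 / 2 + t * \<bar>x\<bar>) \<le> 2 * t\<^sup>2 + - (1/2 * x\<^sup>2)"
      using sq by (simp add: power2_eq_square algebra_simps abs_mult_self_eq)
    then have "(exp (- x\<^sup>2 / 2 + t * \<bar>x\<bar>))\<^sup>2 \<le> exp (2 * t\<^sup>2) * exp (- (1/2 * x\<^sup>2))"
      unfolding exp_double[symmetric] exp_add[symmetric] exp_le_cancel_iff .
    moreover have "a * b \<le> a\<^sup>2 + b\<^sup>2" if "a \<ge> 0" "b \<ge> 0" for a b :: real
      using that mult_nonneg_nonneg[of a b] sum_squares_bound[of a b] by linarith
    ultimately show ?thesis
      using exp_ge_zero[of "- x\<^sup>2 / 2 + t * \<bar>x\<bar>"] norm_ge_zero[of "f x"] by (meson add_left_mono order_trans)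
  qed
  have ib: "integrable lborel (\<lambda>x. (cmod (f x))\<^sup>2 + exp (2 * t\<^sup>2) * exp (- (1/2 * x\<^sup>2)))" for t
    using f gauss_has_integral[of "1/2"] by (intro Bochner_Integration.integrable_add integrable_mult_right) (auto simp: has_bochner_integral_iff)
  have ie: "integrable lborel (\<lambda>x. cmod (f x) * exp (- x\<^sup>2 / 2 + t * \<bar>x\<bar>))" for t
  proof (rule Bochner_Integration.integrable_bound[OF ib[of t]])
    show "AE x in lborel. norm (cmod (f x) * exp (- x\<^sup>2 / 2 + t * \<bar>x\<bar>))
        \<le> norm ((cmod (f x))\<^sup>2 + exp (2 * t\<^sup>2) * exp (- (1/2 * x\<^sup>2)))"
    proof (rule AE_I2)
      fix x show "norm (cmod (f x) * exp (- x\<^sup>2 / 2 + t * \<bar>x\<bar>))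
        \<le> norm ((cmod (f x))\<^sup>2 + exp (2 * t\<^sup>2) * exp (- (1/2 * x\<^sup>2)))"
        using exp_le[of x t] by simp
    qed
  qed simp
  define w where "w x = f x * of_real (exp (- x\<^sup>2 / 2))" for x
  have [measurable]: "w \<in> borel_measurable borel" unfolding w_def[abs_def] by measurable
  have wn: "cmod (w x) = cmod (f x) * exp (- x\<^sup>2 / 2)" for x by (simp add: w_def norm_mult)
  have iw: "integrable lborel w"
    by (rule Bochner_Integration.integrable_bound[OF ie[of 0]]) (auto simp: wn)
  have ig: "integrable lborel (\<lambda>x. f x * of_real (hermite_gauss n x))" for n
  proof (rule Bochner_Integration.integrable_bound)
    show "integrable lborel (\<lambda>x. (cmod (f x))\<^sup>2 + hermite_gauss n x * hermite_gauss n x * exp (- (0 * x\<^sup>2)))"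
      by (intro Bochner_Integration.integrable_add f integrable_hermite_gauss_mult) simp
    have "a * \<bar>b\<bar> \<le> a\<^sup>2 + b * b" if "a \<ge> 0" for a b :: real
      using that mult_nonneg_nonneg[of a "\<bar>b\<bar>"] sum_squares_bound[of a "\<bar>b\<bar>"]
      unfolding power2_eq_square abs_mult_self_eq by linarith
    then show "AE x in lborel. norm (f x * of_real (hermite_gauss n x)) \<le> norm ((cmod (f x))\<^sup>2 + hermite_gauss n x * hermite_gauss n x * exp (- (0 * x\<^sup>2)))"
      by (auto simp: norm_mult)
  qed simp
  \<comment> \<open>Powers of \<open>x\<close> are traded for Hermite indices through the ladder
    relation, one power at a time; this is why \<open>n\<close> must be arbitrary in the
    induction.\<close>
  have mom: "integrable lborel (\<lambda>x. f x * of_real (x ^ k * hermite_gauss n x)) \<and>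
     integral\<^sup>L lborel (\<lambda>x. f x * of_real (x ^ k * hermite_gauss n x)) = 0" for k n
  proof (induction k arbitrary: n)
    case 0
    then show ?case using ig zero by simp
  next
    case (Suc k)
    have "f x * of_real (x ^ Suc k * hermite_gauss n x)
       = (f x * of_real (x ^ k * hermite_gauss (Suc n) x)) / 2 + of_nat n * (f x * of_real (x ^ k * hermite_gauss (n - 1) x))" for x
    proof -
      have "x ^ Suc k * hermite_gauss n x = x ^ k * (2 * x * hermite_gauss n x) / 2" by simp
      also have "\<dots> = x ^ k * hermite_gauss (Suc n) x / 2 + real n * (x ^ k * hermite_gauss (n - 1) x)"
        unfolding hermite_gauss_mult by (simp add: algebra_simps)
      finally show ?thesis by (simp only:) (simp add: algebra_simps)
    qed
    then show ?case using Suc[of "Suc n"] Suc[of "n - 1"] by simp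
  qed
  have "AE x in lborel. w x = 0"
  proof (rule complex_fourier_zero_imp_AE_zero[OF iw])
    fix t :: real
    define s where "s i x = w x * (\<Sum>k<i. (\<i> * of_real (t * x)) ^ k /\<^sub>R fact k)" for i x
    have se: "s i x = (\<Sum>k<i. (\<i> * of_real t) ^ k / fact k * (f x * of_real (x ^ k * hermite_gauss 0 x)))" for i x
      unfolding s_def sum_distrib_left
      by (intro sum.cong refl) (simp add: w_def hermite_gauss_def power_mult_distrib scaleR_conv_of_real field_simps)
    have si: "integral\<^sup>L lborel (s i) = 0" for i
    proof -
      have "integral\<^sup>L lborel (s i) = (\<Sum>k<i. integral\<^sup>L lborel (\<lambda>x. (\<i> * of_real t) ^ k / fact k * (f x * of_real (x ^ k * hermite_gauss 0 x))))"
        unfolding se[abs_def] using mom by (intro Bochner_Integration.integral_sum integrable_mult_right) blast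
      also have "\<dots> = 0" using mom by (intro sum.neutral ballI) (simp only: integral_mult_right_zero mult_zero_right)
      finally show ?thesis .
    qed
    have "(\<lambda>i. integral\<^sup>L lborel (s i)) \<longlonglongrightarrow> integral\<^sup>L lborel (\<lambda>x. w x * exp (\<i> * of_real (t * x)))"
    proof (rule integral_dominated_convergence[where w="\<lambda>x. cmod (f x) * exp (- x\<^sup>2 / 2 + \<bar>t\<bar> * \<bar>x\<bar>)"])
      show "AE x in lborel. (\<lambda>i. s i x) \<longlonglongrightarrow> w x * exp (\<i> * of_real (t * x))"
        unfolding s_def using exp_converges[of "\<i> * of_real (t * x)" for x, unfolded sums_def]
        by (intro AE_I2 tendsto_mult_left)
      have "norm (s i x) \<le> cmod (f x) * exp (- x\<^sup>2 / 2 + \<bar>t\<bar> * \<bar>x\<bar>)" for i x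
      proof -
        have "norm (\<Sum>k<i. (\<i> * complex_of_real (t * x)) ^ k /\<^sub>R fact k) \<le> (\<Sum>k<i. (\<bar>t\<bar> * \<bar>x\<bar>) ^ k /\<^sub>R fact k)"
          by (intro order_trans[OF norm_sum] sum_mono) (simp add: norm_mult norm_power abs_mult)
        also have "\<dots> \<le> exp (\<bar>t\<bar> * \<bar>x\<bar>)"
          unfolding sums_unique[OF exp_converges] by (intro sum_le_suminf sums_summable[OF exp_converges]) auto
        finally show ?thesis
          unfolding s_def norm_mult wn exp_add by (simp add: mult_left_mono mult.assoc)
      qed
      then show "AE x in lborel. norm (s i x) \<le> cmod (f x) * exp (- x\<^sup>2 / 2 + \<bar>t\<bar> * \<bar>x\<bar>)" for i by simp
      show "s i \<in> borel_measurable lborel" for i unfolding s_def[abs_def] by measurable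
    qed (use ie in auto)
    then show "integral\<^sup>L lborel (\<lambda>x. w x * exp (\<i> * of_real (t * x))) = 0"
      unfolding si using LIMSEQ_unique tendsto_const by blast
  qed
  then show ?thesis by eventually_elim (simp add: w_def)
qed

section \<open>The Hermite basis of \<open>L\<^sup>2\<close>\<close>

lemma cinner_abs_L2:
  "square_integrable f \<Longrightarrow> square_integrable g \<Longrightarrow>
   cinner_L2 (abs_L2 f) (abs_L2 g) = integral\<^sup>L lebesgue (\<lambda>x. f x * cnj (g x))"
  by (intro cinner_L2.abs_eq) (auto simp: L2_rel_def)

lemma cinner_L2_add_right: "cinner_L2 f (g + h) = cinner_L2 f g + cinner_L2 f h"
  using cinner_L2_add_left[of g h f] cinner_L2_commute by (metis complex_cnj_add)

lemma cinner_L2_scaleC_right: "cinner_L2 f (c *\<^sub>C g) = cnj c * cinner_L2 f g"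
  using cinner_L2_scaleC_left[of c g f] cinner_L2_commute by (metis complex_cnj_mult)

lemma scaleC_add_left: "(a + b) *\<^sub>C f = a *\<^sub>C f + b *\<^sub>C (f :: L2)"
  by transfer (auto simp: L2_rel_def ring_distribs intro!: square_integrable_mult_const square_integrable_add)

lemma scaleC_scaleC: "a *\<^sub>C b *\<^sub>C f = (a * b) *\<^sub>C (f :: L2)"
  by transfer (auto simp: L2_rel_def mult.assoc intro!: square_integrable_mult_const)

lemma scaleC_one [simp]: "1 *\<^sub>C f = (f :: L2)"
  by (metis of_real_1 scaleR_L2_eq scaleR_one)

lemma scaleC_zero_left [simp]: "0 *\<^sub>C f = (0 :: L2)"
  by (metis of_real_0 scaleR_L2_eq scaleR_zero_left)

lemma cinner_L2_self: "cinner_L2 f f = of_real ((norm f)\<^sup>2)"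
proof -
  have "Im (cinner_L2 f f) = 0" using cinner_L2_commute[of f f] by (metis complex_cnj_cancel_iff cnj.sel(2) add.inverse_neutral equal_neg_zero)
  then show ?thesis by (simp add: power2_norm_eq_inner inner_L2_def complex_eq_iff)
qed

lemma mult_cnj_cmod: "z * cnj z = (of_real (cmod z))\<^sup>2" "cnj z * z = (of_real (cmod z))\<^sup>2"
  using complex_norm_square[of z] by (simp_all add: mult.commute)

lemma norm_scaleC: "norm (c *\<^sub>C f) = cmod c * norm (f :: L2)"
proof -
  have "complex_of_real ((norm (c *\<^sub>C f))\<^sup>2) = of_real ((cmod c * norm f)\<^sup>2)"
    unfolding cinner_L2_self[symmetric] cinner_L2_scaleC_left cinner_L2_scaleC_right mult.assoc[symmetric] mult_cnj_cmod
    by (simp add: cinner_L2_self power_mult_distrib)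
  then show ?thesis unfolding of_real_eq_iff by (simp add: power2_eq_iff_nonneg)
qed

lemma cinner_L2_bound: "cmod (cinner_L2 f g) \<le> norm f * norm g"
proof (cases "cinner_L2 f g = 0")
  case False
  define u where "u = cnj (sgn (cinner_L2 f g))"
  have "cmod (cinner_L2 f g) = Re (u * cinner_L2 f g)"
  proof -
    have "u * cinner_L2 f g = of_real (cmod (cinner_L2 f g))"
      using False complex_norm_square[of "cinner_L2 f g"]
      by (simp add: u_def sgn_div_norm scaleR_conv_of_real power2_eq_square mult.commute divide_simps)
    then show ?thesis by simp
  qed
  also have "\<dots> = inner (u *\<^sub>C f) g" by (simp add: inner_L2_def cinner_L2_scaleC_left)
  also have "\<dots> \<le> norm (u *\<^sub>C f) * norm g" by (rule norm_cauchy_schwarz)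
  also have "\<dots> = norm f * norm g" using False by (simp add: norm_scaleC u_def norm_sgn)
  finally show ?thesis .
qed simp

lemma bounded_linear_cinner_left: "bounded_linear (\<lambda>f. cinner_L2 f g)"
  by (rule bounded_linear_intro[of _ "norm g"])
     (simp_all add: cinner_L2_add_left scaleR_L2_eq cinner_L2_scaleC_left scaleR_conv_of_real cinner_L2_bound)

lemma bounded_linear_cinner_right: "bounded_linear (\<lambda>g. cinner_L2 f g)"
  by (rule bounded_linear_intro[of _ "norm f"])
     (simp_all add: cinner_L2_add_right scaleR_L2_eq cinner_L2_scaleC_right scaleR_conv_of_real cinner_L2_bound mult.commute[of _ "norm f"])

definition coef :: "L2 \<Rightarrow> nat \<Rightarrow> complex" where
  "coef f n = cinner_L2 f (hermite_L2 n)"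

lemma bounded_linear_coef: "bounded_linear (\<lambda>f. coef f n)"
  unfolding coef_def by (rule bounded_linear_cinner_left)

lemma coef_add [simp]: "coef (f + g) n = coef f n + coef g n"
  by (simp add: coef_def cinner_L2_add_left)

lemma coef_scaleC [simp]: "coef (c *\<^sub>C f) n = c * coef f n"
  by (simp add: coef_def cinner_L2_scaleC_left)

lemma coef_diff [simp]: "coef (f - g) n = coef f n - coef g n"
  by (rule bounded_linear.linear[OF bounded_linear_coef, THEN linear_diff])

lemma coef_zero [simp]: "coef 0 n = 0"
  by (rule bounded_linear.linear[OF bounded_linear_coef, THEN linear_0])

lemma coef_sum: "coef (sum f A) n = (\<Sum>i\<in>A. coef (f i) n)"
  by (rule bounded_linear.linear[OF bounded_linear_coef, THEN linear_sum])

lemma coef_hermite_L2: "coef (hermite_L2 m) n = (if m = n then 1 else 0)"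
proof -
  have "coef (hermite_L2 m) n = integral\<^sup>L lebesgue (\<lambda>x. complex_of_real (hermite_fun m x * hermite_fun n x))"
    unfolding coef_def hermite_L2_def by (simp add: cinner_abs_L2 square_integrable_hermite_fun)
  also have "\<dots> = of_real (integral\<^sup>L lebesgue (\<lambda>x. hermite_fun m x * hermite_fun n x))"
    by (rule integral_complex_of_real)
  also have "\<dots> = (if m = n then 1 else 0)"
    using hermite_fun_orthonormal[of m n]
    by (subst integral_lebesgue_eq_lborel) (auto simp: has_bochner_integral_iff)
  finally show ?thesis .
qed

lemma coef_abs_L2: "square_integrable f \<Longrightarrow> coef (abs_L2 f) n = integral\<^sup>L lebesgue (\<lambda>x. f x * of_real (hermite_fun n x))"
  unfolding coef_def hermite_L2_def by (simp add: cinner_abs_L2 square_integrable_hermite_fun)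

lemma abs_L2_eqI:
  assumes "square_integrable f" "square_integrable g" "AE x in lebesgue. f x = g x"
  shows "abs_L2 f = abs_L2 g"
  using assms Quotient_rel_abs[OF Quotient_L2] by (simp add: L2_rel_def)

lemma abs_L2_eqD:
  assumes "square_integrable f" "square_integrable g" "abs_L2 f = abs_L2 g"
  shows "AE x in lebesgue. f x = g x"
  using assms Quotient_rel[OF Quotient_L2, of f g] by (simp add: L2_rel_def)

text \<open>Completeness is available for Borel functions and \<open>lborel\<close>, so a Borel
  representative of the class is chosen first.\<close>

lemma coef_eq_zero_imp_zero:
  assumes "\<And>n. coef f n = 0" shows "f = 0"
proof -
  define u where "u = rep_L2 f"
  have u: "square_integrable u" "abs_L2 u = f" by (simp_all add: u_def rep_L2)
  obtain g where g [measurable]: "g \<in> borel_measurable borel" and ug: "AE x in lebesgue. u x = g x"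
    using lebesgue_ex_borel_complex[OF square_integrable_measurable[OF u(1)]] .
  have gl: "g \<in> borel_measurable lebesgue" using borel_imp_lebesgue_measurable[OF g] .
  note [measurable] = square_integrable_measurable[OF u(1)]
  have ig: "integrable lebesgue (\<lambda>x. (cmod (g x))\<^sup>2)"
    using square_integrable_integrable[OF u(1)]
    by (rule integrable_cong_AE_imp) (use ug gl in \<open>auto elim: eventually_mono\<close>)
  then have gs: "square_integrable g" using gl by (simp add: square_integrable_def)
  have fg: "f = abs_L2 g" using abs_L2_eqI[OF u(1) gs ug] u(2) by simp
  have "AE x in lborel. g x = 0"
  proof (rule hermite_complete[OF g])
    show "integrable lborel (\<lambda>x. (cmod (g x))\<^sup>2)"
      using ig by (subst (asm) integrable_lebesgue_iff_lborel) auto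
    show "integral\<^sup>L lborel (\<lambda>x. g x * of_real (hermite_gauss n x)) = 0" for n
    proof -
      have "integral\<^sup>L lborel (\<lambda>x. g x * of_real (hermite_fun n x)) = coef f n"
        unfolding fg coef_abs_L2[OF gs] by (subst integral_lebesgue_eq_lborel) auto
      then have "of_real (hermite_norm n) * integral\<^sup>L lborel (\<lambda>x. g x * of_real (hermite_fun n x)) = 0"
        using assms by simp
      then have "integral\<^sup>L lborel (\<lambda>x. of_real (hermite_norm n) * (g x * of_real (hermite_fun n x))) = 0"
        by (simp only: integral_mult_right_zero)
      moreover have "complex_of_real (hermite_norm n) * (g x * of_real (hermite_fun n x)) = g x * of_real (hermite_gauss n x)" for x
        by (simp add: hermite_gauss_eq)
      ultimately show ?thesis by simp
    qed
  qed
  then have "AE x in lebesgue. g x = 0" by (rule AE_completion)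
  then have "abs_L2 g = abs_L2 (\<lambda>_. 0)"
    by (intro abs_L2_eqI gs square_integrable_zero)
  then show ?thesis by (simp add: fg zero_L2.abs_eq)
qed

lemma L2_eqI: "(\<And>n. coef f n = coef g n) \<Longrightarrow> f = g"
  using coef_eq_zero_imp_zero[of "f - g"] by simp

lemma norm_sum_hermite_square: "(norm (\<Sum>n\<in>A. c n *\<^sub>C hermite_L2 n))\<^sup>2 = (\<Sum>n\<in>A. (cmod (c n))\<^sup>2)" if A: "finite A"
proof -
  let ?s = "\<Sum>n\<in>A. c n *\<^sub>C hermite_L2 n"
  have s: "cinner_L2 ?s (c m *\<^sub>C hermite_L2 m) = of_real ((cmod (c m))\<^sup>2)" if "m \<in> A" for m
  proof -
    have "cinner_L2 ?s (c m *\<^sub>C hermite_L2 m) = cnj (c m) * coef ?s m"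
      by (simp add: cinner_L2_scaleC_right coef_def)
    also have "coef ?s m = c m" using A that by (simp add: coef_sum coef_hermite_L2 if_distrib cong: if_cong)
    finally show ?thesis by (simp add: mult_cnj_cmod)
  qed
  have "complex_of_real ((norm ?s)\<^sup>2) = cinner_L2 ?s ?s" by (simp add: cinner_L2_self)
  also have "\<dots> = (\<Sum>m\<in>A. cinner_L2 ?s (c m *\<^sub>C hermite_L2 m))"
    by (rule linear_sum[OF bounded_linear.linear[OF bounded_linear_cinner_right]])
  also have "\<dots> = of_real (\<Sum>m\<in>A. (cmod (c m))\<^sup>2)" by (simp add: s)
  finally show ?thesis unfolding of_real_eq_iff .
qed

text \<open>The inverse of \<open>coef\<close> on square-summable sequences; for other sequences the
  sum carries no information.\<close>

definition synth :: "(nat \<Rightarrow> complex) \<Rightarrow> L2" where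
  "synth c = (\<Sum>n. c n *\<^sub>C hermite_L2 n)"

lemma synth_sums:
  assumes c: "summable (\<lambda>n. (cmod (c n))\<^sup>2)"
  shows "(\<lambda>n. c n *\<^sub>C hermite_L2 n) sums synth c"
proof -
  have "summable (\<lambda>n. c n *\<^sub>C hermite_L2 n)"
    unfolding summable_Cauchy
  proof (intro allI impI)
    fix e :: real assume e: "e > 0"
    then obtain N where N: "\<And>m n. m \<ge> N \<Longrightarrow> norm (\<Sum>k=m..<n. (cmod (c k))\<^sup>2) < e\<^sup>2"
      using c[unfolded summable_Cauchy, rule_format, of "e\<^sup>2"] by auto
    have "norm (\<Sum>k=m..<n. c k *\<^sub>C hermite_L2 k) < e" if "m \<ge> N" for m n
      using N[OF that, of n] e norm_sum_hermite_square[of "{m..<n}" c]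
      by (intro power2_less_imp_less[of _ e]) auto
    then show "\<exists>N. \<forall>m\<ge>N. \<forall>n. norm (\<Sum>k=m..<n. c k *\<^sub>C hermite_L2 k) < e" by blast
  qed
  then show ?thesis unfolding synth_def by (rule summable_sums)
qed

lemma coef_synth:
  assumes c: "summable (\<lambda>n. (cmod (c n))\<^sup>2)"
  shows "coef (synth c) n = c n"
proof -
  have "(\<lambda>m. coef (c m *\<^sub>C hermite_L2 m) n) sums coef (synth c) n"
    by (rule bounded_linear.sums[OF bounded_linear_coef synth_sums[OF c]])
  moreover have "(\<lambda>m. coef (c m *\<^sub>C hermite_L2 m) n) = (\<lambda>m. if m = n then c n else 0)"
    by (rule ext) (simp add: coef_hermite_L2)
  moreover have "(\<lambda>m. if m = n then c n else 0) sums c n"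
    using sums_single[of n "\<lambda>_. c n"] by simp
  ultimately show ?thesis using sums_unique2 by simp
qed

lemma bessel: "(\<Sum>n<K. (cmod (coef f n))\<^sup>2) \<le> (norm f)\<^sup>2"
proof -
  let ?p = "\<Sum>n<K. coef f n *\<^sub>C hermite_L2 n"
  have "cinner_L2 f ?p = (\<Sum>n<K. cinner_L2 f (coef f n *\<^sub>C hermite_L2 n))"
    by (rule linear_sum[OF bounded_linear.linear[OF bounded_linear_cinner_right]])
  also have "\<dots> = of_real (\<Sum>n<K. (cmod (coef f n))\<^sup>2)"
    by (simp add: cinner_L2_scaleC_right coef_def mult_cnj_cmod)
  finally have i: "inner f ?p = (\<Sum>n<K. (cmod (coef f n))\<^sup>2)" by (simp add: inner_L2_def)
  have "0 \<le> (norm (f - ?p))\<^sup>2" by simp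
  also have "\<dots> = (norm f)\<^sup>2 - 2 * inner f ?p + (norm ?p)\<^sup>2"
    by (simp add: power2_norm_eq_inner inner_diff_left inner_diff_right inner_commute)
  finally show ?thesis unfolding i norm_sum_hermite_square[OF finite_lessThan] by simp
qed

lemma summable_coef: "summable (\<lambda>n. (cmod (coef f n))\<^sup>2)"
  by (rule bounded_imp_summable[of _ "(norm f)\<^sup>2"])
     (use bessel[of f "Suc _"] in \<open>auto simp: lessThan_Suc_atMost\<close>)

lemma synth_coef: "synth (coef f) = f"
  by (rule L2_eqI) (simp add: coef_synth summable_coef)

lemma coef_sums: "(\<lambda>n. coef f n *\<^sub>C hermite_L2 n) sums f"
  using synth_sums[OF summable_coef, of f] by (simp add: synth_coef)

lemma parseval: "(\<lambda>n. (cmod (coef f n))\<^sup>2) sums (norm f)\<^sup>2"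
proof -
  have "(\<lambda>K. (norm (\<Sum>n<K. coef f n *\<^sub>C hermite_L2 n))\<^sup>2) \<longlonglongrightarrow> (norm f)\<^sup>2"
    using coef_sums[of f] unfolding sums_def by (intro tendsto_intros)
  then show ?thesis by (simp add: sums_def norm_sum_hermite_square)
qed

lemma norm_le_coefI:
  assumes "\<And>K. (\<Sum>n<K. (cmod (coef f n))\<^sup>2) \<le> B\<^sup>2" "B \<ge> 0"
  shows "norm f \<le> B"
proof -
  have "(norm f)\<^sup>2 \<le> B\<^sup>2"
    by (rule LIMSEQ_le_const2[OF parseval[of f, unfolded sums_def]]) (use assms(1) in blast)
  then show ?thesis using assms(2) by (rule power2_le_imp_le)
qed

text \<open>Propagator, mode cut-offs and dilations are all of this diagonal form, so one
  coefficient rule and one norm bound serve them all.\<close>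

definition multiplier :: "(nat \<Rightarrow> complex) \<Rightarrow> L2 \<Rightarrow> L2" where
  "multiplier m f = synth (\<lambda>n. m n * coef f n)"

lemma summable_mult_coef:
  assumes "\<And>n. cmod (m n) \<le> C"
  shows "summable (\<lambda>n. (cmod (m n * coef f n))\<^sup>2)"
proof (rule summable_comparison_test'[OF summable_mult[OF summable_coef, of "C\<^sup>2" f]])
  show "norm ((cmod (m n * coef f n))\<^sup>2) \<le> C\<^sup>2 * (cmod (coef f n))\<^sup>2" for n
    using assms[of n] by (simp add: norm_mult power_mult_distrib mult_right_mono power_mono)
qed

lemma coef_multiplier:
  assumes "\<And>n. cmod (m n) \<le> C"
  shows "coef (multiplier m f) n = m n * coef f n"
  unfolding multiplier_def by (rule coef_synth[OF summable_mult_coef[OF assms]])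

lemma norm_multiplier:
  assumes m: "\<And>n. cmod (m n) \<le> C"
  shows "norm (multiplier m f) \<le> C * norm f"
proof (rule norm_le_coefI)
  have C: "C \<ge> 0" using m[of 0] norm_ge_zero order_trans by blast
  then show "C * norm f \<ge> 0" by simp
  fix K
  have "(\<Sum>n<K. (cmod (coef (multiplier m f) n))\<^sup>2) \<le> (\<Sum>n<K. C\<^sup>2 * (cmod (coef f n))\<^sup>2)"
    using m by (intro sum_mono) (simp add: coef_multiplier[OF m] norm_mult power_mult_distrib mult_right_mono power_mono)
  also have "\<dots> \<le> C\<^sup>2 * (norm f)\<^sup>2"
    unfolding sum_distrib_left[symmetric] by (intro mult_left_mono bessel) simp
  finally show "(\<Sum>n<K. (cmod (coef (multiplier m f) n))\<^sup>2) \<le> (C * norm f)\<^sup>2" by (simp add: power_mult_distrib)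
qed

section \<open>The propagator as a unitary multiplier\<close>

definition phase :: "real \<Rightarrow> nat \<Rightarrow> complex" where
  "phase t n = exp (\<i> * of_real (t * (2 * real n + 1)))"

lemma norm_phase [simp]: "cmod (phase t n) = 1"
  by (simp add: phase_def)

lemma osc_propagator_eq: "osc_propagator t f = multiplier (phase t) f"
  by (simp add: osc_propagator_def multiplier_def synth_def phase_def coef_def)

lemma coef_osc [simp]: "coef (osc_propagator t f) n = phase t n * coef f n"
  unfolding osc_propagator_eq by (rule coef_multiplier[of _ 1]) simp

lemma norm_osc [simp]: "norm (osc_propagator t f) = norm f"
proof -
  have "(\<lambda>n. (cmod (coef f n))\<^sup>2) sums (norm (osc_propagator t f))\<^sup>2"
    using parseval[of "osc_propagator t f"] by (simp add: norm_mult)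
  from sums_unique2[OF this parseval] show ?thesis by simp
qed

lemma osc_diff: "osc_propagator t (f - g) = osc_propagator t f - osc_propagator t g"
  by (rule L2_eqI) (simp add: algebra_simps)

text \<open>The norm of the tail beyond \<open>K\<close> modes does not depend on \<open>t\<close>
  because the phases are unimodular. The partial sums therefore converge uniformly in time.\<close>

lemma continuous_osc: "continuous_on UNIV (\<lambda>t. osc_propagator t f)"
proof -
  define s where "s K t = (\<Sum>n<K. (phase t n * coef f n) *\<^sub>C hermite_L2 n)" for K t
  have "uniform_limit UNIV s (\<lambda>t. osc_propagator t f) sequentially"
  proof (rule uniform_limitI)
    fix e :: real assume e: "e > 0"
    have "(\<lambda>K. \<Sum>n<K. (cmod (coef f n))\<^sup>2) \<longlonglongrightarrow> (norm f)\<^sup>2" using parseval unfolding sums_def .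
    from tendstoD[OF this, of "e\<^sup>2"] e
    have "\<forall>\<^sub>F K in sequentially. dist (\<Sum>n<K. (cmod (coef f n))\<^sup>2) ((norm f)\<^sup>2) < e\<^sup>2" by simp
    then show "\<forall>\<^sub>F K in sequentially. \<forall>t\<in>UNIV. dist (s K t) (osc_propagator t f) < e"
    proof eventually_elim
      case (elim K)
      have "dist (s K t) (osc_propagator t f) < e" for t
      proof -
        have c: "coef (osc_propagator t f - s K t) n = (if n < K then 0 else phase t n * coef f n)" for n
          by (simp add: s_def coef_sum coef_hermite_L2 if_distrib cong: if_cong)
        have "(\<lambda>n. (cmod (coef f n))\<^sup>2 - (if n < K then (cmod (coef f n))\<^sup>2 else 0)) sums ((norm f)\<^sup>2 - (\<Sum>n<K. (cmod (coef f n))\<^sup>2))"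
          using sums_If_finite_set[of "{..<K}" "\<lambda>n. (cmod (coef f n))\<^sup>2"] by (intro sums_diff parseval) simp
        moreover have "(cmod (coef f n))\<^sup>2 - (if n < K then (cmod (coef f n))\<^sup>2 else 0) = (cmod (coef (osc_propagator t f - s K t) n))\<^sup>2" for n
          unfolding c by (simp add: norm_mult)
        ultimately have "(norm (osc_propagator t f - s K t))\<^sup>2 = (norm f)\<^sup>2 - (\<Sum>n<K. (cmod (coef f n))\<^sup>2)"
          using sums_unique2[OF parseval] by simp
        also have "\<dots> < e\<^sup>2" using elim by (simp add: dist_real_def)
        finally show ?thesis
          using e by (simp add: dist_norm norm_minus_commute power2_less_imp_less)
      qed
      then show ?case by simp
    qed
  qed
  moreover have "continuous_on UNIV (s K)" for K
  proof -
    have "bounded_linear (\<lambda>c. c *\<^sub>C hermite_L2 n)" for n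
      by (rule bounded_linear_intro[of _ "norm (hermite_L2 n)"])
         (simp_all add: scaleC_add_left scaleR_L2_eq scaleC_scaleC norm_scaleC scaleR_conv_of_real)
    note bl = bounded_linear.continuous_on[OF this]
    show ?thesis unfolding s_def[abs_def] phase_def by (intro continuous_intros bl)
  qed
  ultimately show ?thesis by (intro uniform_limit_theorem[of _ s]) auto
qed

section \<open>A Hardy--Littlewood--Sobolev inequality\<close>

lemma nn_integral_inverse_sqrt:
  assumes d: "d \<ge> 0"
  shows "(\<integral>\<^sup>+t. ennreal (indicator {..d} \<bar>t\<bar> * (1 / sqrt \<bar>t\<bar>)) \<partial>lborel) \<le> ennreal (4 * sqrt d)"
proof -
  let ?f = "\<lambda>t. ennreal (indicator {0..d} t * t powr (- 1/2))"
  have "((\<lambda>x. x powr (- 1/2)) has_integral (d powr (- 1/2 + 1) / (- 1/2 + 1))) {0..d}"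
    using d by (intro has_integral_powr_from_0) auto
  from nn_integral_has_integral_lebesgue[OF _ this]
  have f: "integral\<^sup>N lborel ?f = ennreal (2 * sqrt d)"
    using d by (simp add: powr_half_sqrt)
  have m [measurable]: "?f \<in> borel_measurable borel" by measurable
  have f': "(\<integral>\<^sup>+t. ?f (- t) \<partial>lborel) = ennreal (2 * sqrt d)"
    using nn_integral_real_affine[OF m, of "-1" 0] f by simp
  have "(\<integral>\<^sup>+t. ennreal (indicator {..d} \<bar>t\<bar> * (1 / sqrt \<bar>t\<bar>)) \<partial>lborel) \<le> (\<integral>\<^sup>+t. ?f t + ?f (- t) \<partial>lborel)"
  proof (rule nn_integral_mono)
    fix t :: real
    have p: "x powr (- (1/2)) = 1 / sqrt x" if "x \<ge> 0" for x :: real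
      using powr_minus_divide[of x "1/2"] powr_half_sqrt[OF that] by simp
    show "ennreal (indicator {..d} \<bar>t\<bar> * (1 / sqrt \<bar>t\<bar>)) \<le> ?f t + ?f (- t)"
      by (cases "t \<ge> 0") (auto simp: indicator_def p add_increasing add_increasing2)
  qed
  also have "\<dots> = ennreal (2 * sqrt d) + ennreal (2 * sqrt d)"
    by (subst nn_integral_add) (simp_all only: f f', measurable)
  also have "\<dots> = ennreal (4 * sqrt d)" using d by (simp flip: ennreal_plus)
  finally show ?thesis .
qed

lemma nn_integral_inverse_square:
  assumes d: "d > 0"
  shows "(\<integral>\<^sup>+t. ennreal (indicator {d..} \<bar>t\<bar> * (1 / \<bar>t\<bar>\<^sup>2)) \<partial>lborel) \<le> ennreal (2 / d)"
proof -
  let ?f = "\<lambda>t. ennreal (1 / t\<^sup>2) * indicator {d..} t"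
  have f: "integral\<^sup>N lborel ?f = ennreal (0 - (- 1 / d))"
  proof (rule nn_integral_FTC_atLeast)
    show "((\<lambda>t::real. - 1 / t) \<longlongrightarrow> 0) at_top"
      by (rule tendsto_divide_0[of "\<lambda>_. - 1" "- 1" _ "\<lambda>t. t"])
        (auto intro!: filterlim_at_top_imp_at_infinity filterlim_ident)
    show "((\<lambda>t. - 1 / t) has_real_derivative 1 / x\<^sup>2) (at x)" if "d \<le> x" for x
      using that d by (auto intro!: derivative_eq_intros simp: power2_eq_square)
  qed auto
  have m [measurable]: "?f \<in> borel_measurable borel" by measurable
  have f': "(\<integral>\<^sup>+t. ?f (- t) \<partial>lborel) = ennreal (0 - (- 1 / d))"
    using nn_integral_real_affine[OF m, of "-1" 0] f by simp
  have "(\<integral>\<^sup>+t. ennreal (indicator {d..} \<bar>t\<bar> * (1 / \<bar>t\<bar>\<^sup>2)) \<partial>lborel) \<le> (\<integral>\<^sup>+t. ?f t + ?f (- t) \<partial>lborel)"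
    by (intro nn_integral_mono) (auto simp: indicator_def abs_if split: if_splits)
  also have "\<dots> = ennreal (0 - (- 1 / d)) + ennreal (0 - (- 1 / d))"
    by (subst nn_integral_add) (simp_all only: f f', measurable)
  also have "\<dots> = ennreal (2 / d)" using d by (simp flip: ennreal_plus)
  finally show ?thesis .
qed

lemma young_quartic:
  fixes x y l :: real
  assumes "x \<ge> 0" "y \<ge> 0" "l > 0"
  shows "x ^ 3 * y \<le> l * x ^ 4 + y ^ 4 / l ^ 3"
proof (cases "y \<le> l * x")
  case True
  then have "x ^ 3 * y \<le> x ^ 3 * (l * x)" using assms by (intro mult_left_mono) auto
  also have "\<dots> = l * x ^ 4" by (simp add: numeral_eq_Suc)
  moreover have "y ^ 4 / l ^ 3 \<ge> 0" using assms by simp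
  ultimately show ?thesis by linarith
next
  case False
  then have "x \<le> y / l" using assms by (simp add: field_simps)
  then have "x ^ 3 * y \<le> (y / l) ^ 3 * y" using assms by (intro mult_right_mono power_mono) auto
  also have "\<dots> = y ^ 4 / l ^ 3" by (simp add: power_divide numeral_eq_Suc)
  moreover have "l * x ^ 4 \<ge> 0" using assms by simp
  ultimately show ?thesis by linarith
qed

text \<open>Near the singularity, for \<open>|t - s| \<le> d\<close>, the level bound
  \<open>M t \<le> m\<close> is used; further away Young's inequality trades the kernel for its
  fourth power, integrable at infinity. The values of \<open>l\<close> and \<open>d\<close> make the
  three contributions 4, 1 and 2 times \<open>m * sqrt a\<close>.\<close>

lemma hls_inner:
  fixes M :: "real \<Rightarrow> real"
  assumes [measurable]: "M \<in> borel_measurable borel" and M0: "\<And>t. M t \<ge> 0"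
    and a: "(\<integral>\<^sup>+t. ennreal (M t ^ 4) \<partial>lborel) = ennreal a" "a > 0" and m: "m > 0"
  shows "(\<integral>\<^sup>+t. ennreal (if M t \<le> m then M t ^ 3 * (1 / sqrt \<bar>t - s\<bar>) else 0) \<partial>lborel) \<le> ennreal (7 * (m * sqrt a))"
proof -
  define l where "l = m / sqrt a"
  define d where "d = a / m ^ 4"
  have l: "l > 0" and d: "d > 0" using a m by (simp_all add: l_def d_def)
  have e: "4 * sqrt d * m ^ 3 = 4 * (m * sqrt a)" "l * a = m * sqrt a" "(2 / d) / l ^ 3 = 2 * (m * sqrt a)"
  proof -
    have "sqrt (m ^ 4) = m\<^sup>2" using m by (intro real_sqrt_unique) (auto simp flip: power_mult)
    then show "4 * sqrt d * m ^ 3 = 4 * (m * sqrt a)"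
      using m by (simp add: d_def real_sqrt_divide numeral_eq_Suc)
    define q where "q = sqrt a"
    have q: "a = q * q" "q > 0" using a by (simp_all add: q_def)
    show "l * a = m * sqrt a" using q(2) unfolding l_def q_def[symmetric] q(1) by simp
    show "(2 / d) / l ^ 3 = 2 * (m * sqrt a)"
      using q(2) m unfolding l_def d_def q_def[symmetric] q(1) by (simp add: power_divide numeral_eq_Suc)
  qed
  have split: "ennreal (A * B + (C * D + E * F)) = ennreal A * ennreal B + (ennreal C * ennreal D + ennreal E * ennreal F)"
    if "0 \<le> A" "0 \<le> B" "0 \<le> C" "0 \<le> D" "0 \<le> E" "0 \<le> F" for A B C D E F :: real
    using that by (simp add: ennreal_mult)
  let ?g1 = "\<lambda>t::real. ennreal (indicator {..d} \<bar>t\<bar> * (1 / sqrt \<bar>t\<bar>))"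
  let ?g2 = "\<lambda>t::real. ennreal (indicator {d..} \<bar>t\<bar> * (1 / \<bar>t\<bar>\<^sup>2))"
  have gm [measurable]: "?g1 \<in> borel_measurable borel" "?g2 \<in> borel_measurable borel" by measurable
  have shift: "(\<integral>\<^sup>+t. g (t - s) \<partial>lborel) = (\<integral>\<^sup>+t. g t \<partial>lborel)" if "g \<in> borel_measurable borel" for g :: "real \<Rightarrow> ennreal"
    using nn_integral_real_affine[OF that, of 1 "- s"] by simp
  have "(\<integral>\<^sup>+t. ennreal (if M t \<le> m then M t ^ 3 * (1 / sqrt \<bar>t - s\<bar>) else 0) \<partial>lborel)
     \<le> (\<integral>\<^sup>+t. ennreal (m ^ 3) * ?g1 (t - s) + (ennreal l * ennreal (M t ^ 4) + ennreal (1 / l ^ 3) * ?g2 (t - s)) \<partial>lborel)"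
  proof (rule nn_integral_mono)
    fix t
    let ?r = "\<bar>t - s\<bar>"
    have "(if M t \<le> m then M t ^ 3 * (1 / sqrt ?r) else 0) \<le>
       m ^ 3 * (indicator {..d} ?r * (1 / sqrt ?r)) + (l * M t ^ 4 + 1 / l ^ 3 * (indicator {d..} ?r * (1 / ?r\<^sup>2)))"
    proof -
      have n: "l * M t ^ 4 \<ge> 0" "1 / l ^ 3 * (indicator {d..} ?r * (1 / ?r\<^sup>2)) \<ge> 0"
        "m ^ 3 * (indicator {..d} ?r * (1 / sqrt ?r)) \<ge> 0"
        using l m by auto
      show ?thesis
      proof (cases "M t \<le> m")
        case True
        show ?thesis
        proof (cases "?r \<le> d")
          case r: True
          have "M t ^ 3 * (1 / sqrt ?r) \<le> m ^ 3 * (1 / sqrt ?r)"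
            using True M0[of t] by (intro mult_right_mono power_mono) auto
          then show ?thesis using n r True by simp
        next
          case r: False
          have "M t ^ 3 * (1 / sqrt ?r) \<le> l * M t ^ 4 + (1 / sqrt ?r) ^ 4 / l ^ 3"
            using M0[of t] l by (intro young_quartic) auto
          also have "(1 / sqrt ?r) ^ 4 = 1 / ?r\<^sup>2"
          proof -
            have "sqrt ?r ^ 4 = ?r\<^sup>2" using power_mult[of "sqrt ?r" 2 2] by simp
            then show ?thesis by (simp only: power_divide power_one)
          qed
          finally show ?thesis using n r True by (simp add: mult.commute)
        qed
      qed (use n in auto)
    qed
    then have "ennreal (if M t \<le> m then M t ^ 3 * (1 / sqrt ?r) else 0) \<le>
       ennreal (m ^ 3 * (indicator {..d} ?r * (1 / sqrt ?r)) + (l * M t ^ 4 + 1 / l ^ 3 * (indicator {d..} ?r * (1 / ?r\<^sup>2))))"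
      by (rule ennreal_leI)
    also have "\<dots> = ennreal (m ^ 3) * ?g1 (t - s) + (ennreal l * ennreal (M t ^ 4) + ennreal (1 / l ^ 3) * ?g2 (t - s))"
      using l m M0[of t] by (intro split) auto
    finally show "ennreal (if M t \<le> m then M t ^ 3 * (1 / sqrt ?r) else 0) \<le>
      ennreal (m ^ 3) * ?g1 (t - s) + (ennreal l * ennreal (M t ^ 4) + ennreal (1 / l ^ 3) * ?g2 (t - s))" .
  qed
  also have "\<dots> = ennreal (m ^ 3) * integral\<^sup>N lborel ?g1 + (ennreal l * ennreal a + ennreal (1 / l ^ 3) * integral\<^sup>N lborel ?g2)"
  proof -
    have [measurable]: "(\<lambda>t. ?g1 (t - s)) \<in> borel_measurable borel" "(\<lambda>t. ?g2 (t - s)) \<in> borel_measurable borel" by measurable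
    show ?thesis
      using shift[OF gm(1)] shift[OF gm(2)]
      by (simp add: nn_integral_add nn_integral_cmult a(1))
  qed
  also have "\<dots> \<le> ennreal (m ^ 3) * ennreal (4 * sqrt d) + (ennreal l * ennreal a + ennreal (1 / l ^ 3) * ennreal (2 / d))"
    using d by (intro add_mono mult_left_mono nn_integral_inverse_sqrt nn_integral_inverse_square) auto
  also have "\<dots> = ennreal (m ^ 3 * (4 * sqrt d) + (l * a + 1 / l ^ 3 * (2 / d)))"
    using d l m a by (intro split[symmetric]) auto
  also have "m ^ 3 * (4 * sqrt d) + (l * a + 1 / l ^ 3 * (2 / d)) = 7 * (m * sqrt a)"
    using e by (simp add: mult.commute)
  finally show ?thesis .
qed

text \<open>Hardy-Littlewood-Sobolev at \<open>L^(4/3)\<close> for the function \<open>M^3\<close>.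
  By symmetry only pairs with \<open>M t \<le> M s\<close> need to be estimated, at the price of a
  factor 2. There the inner bound with \<open>m = M s\<close> turns the outer integrand into
  \<open>M s ^ 4\<close>.\<close>

lemma hls:
  fixes M :: "real \<Rightarrow> real"
  assumes M [measurable]: "M \<in> borel_measurable borel" and M0: "\<And>t. M t \<ge> 0"
    and a: "(\<integral>\<^sup>+t. ennreal (M t ^ 4) \<partial>lborel) = ennreal a" "a > 0"
  shows "(\<integral>\<^sup>+s. \<integral>\<^sup>+t. ennreal (M s ^ 3 * M t ^ 3 * (1 / sqrt \<bar>t - s\<bar>)) \<partial>lborel \<partial>lborel) \<le> ennreal (14 * (a * sqrt a))"
proof -
  let ?k = "\<lambda>s t. ennreal (if M t \<le> M s then M s ^ 3 * M t ^ 3 * (1 / sqrt \<bar>t - s\<bar>) else 0)"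
  have half: "(\<integral>\<^sup>+s. \<integral>\<^sup>+t. ?k s t \<partial>lborel \<partial>lborel) \<le> ennreal (7 * (a * sqrt a))"
  proof -
    have "(\<integral>\<^sup>+t. ?k s t \<partial>lborel) \<le> ennreal (7 * sqrt a) * ennreal (M s ^ 4)" for s
    proof (cases "M s > 0")
      case False
      then have "M s = 0" using M0[of s] by simp
      then have "?k s t = 0" for t by simp
      then show ?thesis by (simp only: nn_integral_const) simp
    next
      case True
      have "(\<integral>\<^sup>+t. ?k s t \<partial>lborel) = (\<integral>\<^sup>+t. ennreal (M s ^ 3) * ennreal (if M t \<le> M s then M t ^ 3 * (1 / sqrt \<bar>t - s\<bar>) else 0) \<partial>lborel)"
        using M0 by (intro nn_integral_cong) (auto simp: ennreal_mult[symmetric])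
      also have "\<dots> = ennreal (M s ^ 3) * (\<integral>\<^sup>+t. ennreal (if M t \<le> M s then M t ^ 3 * (1 / sqrt \<bar>t - s\<bar>) else 0) \<partial>lborel)"
        by (intro nn_integral_cmult) measurable
      also have "\<dots> \<le> ennreal (M s ^ 3) * ennreal (7 * (M s * sqrt a))"
        by (intro mult_left_mono hls_inner M M0 a True) simp
      also have "\<dots> = ennreal (7 * sqrt a) * ennreal (M s ^ 4)"
        using True a by (simp add: ennreal_mult[symmetric] numeral_eq_Suc)
      finally show ?thesis .
    qed
    then have "(\<integral>\<^sup>+s. \<integral>\<^sup>+t. ?k s t \<partial>lborel \<partial>lborel) \<le> (\<integral>\<^sup>+s. ennreal (7 * sqrt a) * ennreal (M s ^ 4) \<partial>lborel)"
      by (intro nn_integral_mono) auto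
    also have "\<dots> = ennreal (7 * sqrt a) * ennreal a"
      by (subst nn_integral_cmult) (auto simp: a)
    also have "\<dots> = ennreal (7 * (a * sqrt a))" using a by (simp add: ennreal_mult[symmetric])
    finally show ?thesis .
  qed
  have swap: "(\<integral>\<^sup>+s. \<integral>\<^sup>+t. ?k t s \<partial>lborel \<partial>lborel) = (\<integral>\<^sup>+s. \<integral>\<^sup>+t. ?k s t \<partial>lborel \<partial>lborel)"
    by (rule lborel_pair.Fubini') measurable
  have "(\<integral>\<^sup>+s. \<integral>\<^sup>+t. ennreal (M s ^ 3 * M t ^ 3 * (1 / sqrt \<bar>t - s\<bar>)) \<partial>lborel \<partial>lborel)
     \<le> (\<integral>\<^sup>+s. \<integral>\<^sup>+t. ?k s t + ?k t s \<partial>lborel \<partial>lborel)"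
    using M0 by (intro nn_integral_mono) (auto simp: mult_ac abs_minus_commute add_increasing add_increasing2)
  also have "\<dots> = (\<integral>\<^sup>+s. \<integral>\<^sup>+t. ?k s t \<partial>lborel \<partial>lborel) + (\<integral>\<^sup>+s. \<integral>\<^sup>+t. ?k t s \<partial>lborel \<partial>lborel)"
    by (subst nn_integral_add[symmetric]) (auto intro!: nn_integral_cong nn_integral_add)
  also have "\<dots> \<le> ennreal (7 * (a * sqrt a)) + ennreal (7 * (a * sqrt a))"
    unfolding swap by (intro add_mono half)
  also have "\<dots> = ennreal (14 * (a * sqrt a))" using a by (simp flip: ennreal_plus)
  finally show ?thesis .
qed

section \<open>The Strichartz estimate\<close>

text \<open>A genuine function of time and space, not a class, so that its supremum over
  \<open>x\<close> at a given time has a meaning.\<close>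

definition hermite_wave :: "nat \<Rightarrow> (nat \<Rightarrow> complex) \<Rightarrow> real \<Rightarrow> real \<Rightarrow> complex" where
  "hermite_wave K c s x = (\<Sum>n<K. c n * phase s n * of_real (hermite_fun n x))"

lemma continuous_phase [continuous_intros]: "continuous_on A f \<Longrightarrow> continuous_on A (\<lambda>x. phase (f x) n)"
  unfolding phase_def by (intro continuous_intros)

lemma continuous_hermite_wave [continuous_intros]:
  "continuous_on A f \<Longrightarrow> continuous_on A g \<Longrightarrow> continuous_on A (\<lambda>x. hermite_wave K c (f x) (g x))"
  unfolding hermite_wave_def by (intro continuous_intros)

lemma borel_measurable_phase [measurable]: "(\<lambda>s. phase s n) \<in> borel_measurable borel"
  by (intro borel_measurable_continuous_onI continuous_intros)

lemma phase_diff: "phase s n * cnj (phase t n) = exp (\<i> * of_real (s - t)) * (exp (\<i> * of_real (2 * (s - t)))) ^ n"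
  unfolding phase_def exp_cnj exp_of_nat_mult[symmetric] exp_add[symmetric]
  by (simp add: algebra_simps)

lemma hermite_fun_product_le:
  assumes r: "0 < r" "r < 1"
  shows "\<bar>hermite_fun n x * hermite_fun n y\<bar> \<le> inverse (r ^ n) * (1 / sqrt (pi * (1 - r\<^sup>2)))"
proof -
  define D where "D = inverse (r ^ n) * (1 / sqrt (pi * (1 - r\<^sup>2)))"
  have rr: "r\<^sup>2 < 1" using r by (simp add: abs_square_less_1)
  have le: "(hermite_fun n x)\<^sup>2 \<le> D" for x
  proof -
    have "(hermite_fun n x)\<^sup>2 \<le> inverse (r ^ n) * (exp (- (x\<^sup>2 * ((1 - r) / (1 + r)))) / sqrt (pi * (1 - r\<^sup>2)))"
      by (rule hermite_fun_square_le[OF r])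
    also have "\<dots> \<le> D"
      unfolding D_def using r rr by (intro mult_left_mono divide_right_mono) auto
    finally show ?thesis .
  qed
  have "2 * \<bar>hermite_fun n x * hermite_fun n y\<bar> \<le> (hermite_fun n x)\<^sup>2 + (hermite_fun n y)\<^sup>2"
    using sum_squares_bound[of "\<bar>hermite_fun n x\<bar>" "\<bar>hermite_fun n y\<bar>"] by (simp add: abs_mult)
  then have "\<bar>hermite_fun n x * hermite_fun n y\<bar> \<le> D" using le[of x] le[of y] by linarith
  then show ?thesis unfolding D_def .
qed

lemma sin_lower: "x / 2 \<le> sin x" if "0 \<le> x" "x \<le> 1" for x :: real
proof -
  have "sin 0 - 0 / 2 \<le> sin x - x / 2"
  proof (rule DERIV_nonneg_imp_nondecreasing[OF that(1)])
    fix t :: real assume t: "0 \<le> t" "t \<le> x"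
    have "cos (pi / 3) \<le> cos t" using t that pi_gt3 by (intro cos_monotone_0_pi_le) auto
    then have "cos t - 1 / 2 \<ge> 0" by (simp add: cos_60)
    moreover have "((\<lambda>x. sin x - x / 2) has_real_derivative cos t - 1 / 2) (at t)"
      by (auto intro!: derivative_eq_intros)
    ultimately show "\<exists>y. ((\<lambda>x. sin x - x / 2) has_real_derivative y) (at t) \<and> 0 \<le> y" by blast
  qed
  then show ?thesis by simp
qed

text \<open>The squared modulus of \<open>1 - z^2\<close> is \<open>(1 - q)^2 + 4 q S\<close> with
  \<open>q = r^2\<close> and \<open>S\<close> the square of \<open>sin (2 t)\<close>; it is at least
  \<open>S\<close>, uniformly in \<open>r\<close>. This uniformity is what permits the limit
  \<open>r \<rightarrow> 1\<close> in the Strichartz estimate.\<close>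

lemma mehler_kernel_dispersive:
  assumes r: "0 < r" "r < 1" and t: "\<bar>t\<bar> \<le> 1/2" "t \<noteq> 0"
  shows "cmod (mehler_kernel (of_real r * exp (\<i> * of_real (2 * t))) x y) \<le> 1 / sqrt \<bar>t\<bar>"
proof -
  define z where "z = complex_of_real r * exp (\<i> * of_real (2 * t))"
  have z: "cmod z < 1" using r by (simp add: z_def norm_mult)
  define q where "q = r\<^sup>2"
  define S where "S = (sin (2 * t))\<^sup>2"
  have q: "0 \<le> q" "q < 1" using r by (auto simp: q_def abs_square_less_1)
  have S: "0 \<le> S" "S \<le> 1" by (auto simp: S_def abs_square_le_1)
  have "z\<^sup>2 = of_real q * cis (4 * t)"
    by (simp add: z_def q_def power_mult_distrib cis_conv_exp exp_double[symmetric] mult_ac)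
  then have "(cmod (1 - z\<^sup>2))\<^sup>2 = (1 - q * cos (4 * t))\<^sup>2 + (q * sin (4 * t))\<^sup>2"
    by (simp add: cmod_power2)
  also have "\<dots> = 1 - 2 * q * cos (4 * t) + q\<^sup>2 * ((sin (4 * t))\<^sup>2 + (cos (4 * t))\<^sup>2)"
    unfolding power2_eq_square by (simp only: algebra_simps)
  also have "cos (4 * t) = 1 - 2 * S"
    using cos_double_sin[of "2 * t"] by (simp add: S_def)
  also have "1 - 2 * q * (1 - 2 * S) + q\<^sup>2 * ((sin (4 * t))\<^sup>2 + (1 - 2 * S)\<^sup>2) = (1 - q)\<^sup>2 + 4 * q * S"
  proof -
    have "(sin (4 * t))\<^sup>2 + (1 - 2 * S)\<^sup>2 = 1" using \<open>cos (4 * t) = 1 - 2 * S\<close> sin_cos_squared_add[of "4 * t"] by simp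
    then show ?thesis by (simp add: power2_eq_square algebra_simps)
  qed
  \<comment> \<open>For \<open>q \<ge> 1/4\<close> the second summand is enough; below,
    \<open>1 - 4 q \<le> (1 - q)^2\<close> and \<open>S \<le> 1\<close> cover the deficit.\<close>
  also have "\<dots> \<ge> S"
  proof (cases "q \<ge> 1/4")
    case True
    then have "1 * S \<le> 4 * q * S" using S by (intro mult_right_mono) auto
    then show ?thesis using zero_le_power2[of "1 - q"] by linarith
  next
    case False
    then have "(1 - 4 * q) * S \<le> (1 - 4 * q) * 1" using S by (intro mult_left_mono) auto
    moreover have "q\<^sup>2 + 2 * q \<ge> 0" using q by simp
    ultimately show ?thesis by (simp add: power2_eq_square algebra_simps)
  qed
  finally have "\<bar>sin (2 * t)\<bar> \<le> cmod (1 - z\<^sup>2)"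
    unfolding S_def by (intro power2_le_imp_le[of "\<bar>sin (2 * t)\<bar>"]) auto
  moreover have "\<bar>t\<bar> \<le> \<bar>sin (2 * t)\<bar>"
    using sin_lower[of "2 * \<bar>t\<bar>"] t by (cases "t \<ge> 0") auto
  ultimately have le: "\<bar>t\<bar> \<le> cmod (1 - z\<^sup>2)" by linarith
  have "cmod (mehler_kernel z x y) \<le> 1 / sqrt (pi * cmod (1 - z\<^sup>2))"
    by (rule mehler_kernel_bound[OF z])
  also have "\<dots> \<le> 1 / sqrt \<bar>t\<bar>"
  proof -
    have "1 * \<bar>t\<bar> \<le> pi * cmod (1 - z\<^sup>2)" using le pi_gt3 by (intro mult_mono) auto
    then show ?thesis using t by (intro divide_left_mono) auto
  qed
  finally show ?thesis by (simp add: z_def)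
qed

text \<open>The finite sum is the full kernel minus a tail. The weights decay like
  \<open>r^(2n)\<close> while products of Hermite functions grow at most like \<open>r^(-n)\<close>,
  so the tail is of order \<open>r^L\<close>, uniformly in space and time.\<close>

lemma hermite_kernel_partial_bound:
  assumes r: "0 < r" "r < 1" and st: "\<bar>s - t\<bar> \<le> 1/2" "s \<noteq> t"
  shows "cmod (\<Sum>n<L. of_real (r ^ n * r ^ n) * (phase s n * cnj (phase t n)) * of_real (hermite_fun n x * hermite_fun n y))
     \<le> 1 / sqrt \<bar>t - s\<bar> + r ^ L * (1 / sqrt (pi * (1 - r\<^sup>2)) / (1 - r))"
proof -
  define z where "z = complex_of_real (r\<^sup>2) * exp (\<i> * of_real (2 * (s - t)))"
  have r2: "0 < r\<^sup>2" "r\<^sup>2 < 1" using r by (auto simp: abs_square_less_1)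
  have z: "cmod z = r\<^sup>2" "cmod z < 1" using r2 by (simp_all add: z_def norm_mult norm_power)
  define C where "C = 1 / sqrt (pi * (1 - r\<^sup>2))"
  define f where "f n = z ^ n * complex_of_real (hermite_fun n x * hermite_fun n y)" for n
  have fs: "f sums mehler_kernel z x y" unfolding f_def by (rule mehler_kernel_sums[OF z(2)])
  have fn: "cmod (f n) \<le> r ^ n * C" for n
  proof -
    have "cmod (f n) = r ^ n * r ^ n * \<bar>hermite_fun n x * hermite_fun n y\<bar>"
      by (simp add: f_def norm_mult norm_power z(1) abs_mult power2_eq_square power_mult_distrib)
    also have "\<dots> \<le> r ^ n * r ^ n * (inverse (r ^ n) * C)"
      unfolding C_def using r by (intro mult_left_mono hermite_fun_product_le) auto
    also have "\<dots> = r ^ n * C" using r by simp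
    finally show ?thesis .
  qed
  have "(\<Sum>n<L. of_real (r ^ n * r ^ n) * (phase s n * cnj (phase t n)) * of_real (hermite_fun n x * hermite_fun n y))
      = exp (\<i> * of_real (s - t)) * (\<Sum>n<L. f n)"
    unfolding sum_distrib_left f_def z_def
    by (intro sum.cong refl) (simp add: phase_diff power_mult_distrib power2_eq_square mult_ac)
  then have "cmod (\<Sum>n<L. of_real (r ^ n * r ^ n) * (phase s n * cnj (phase t n)) * of_real (hermite_fun n x * hermite_fun n y))
      = cmod (\<Sum>n<L. f n)" by (simp add: norm_mult)
  also have "(\<Sum>n<L. f n) = mehler_kernel z x y - (\<Sum>n. f (n + L))"
    using suminf_split_initial_segment[OF sums_summable[OF fs], of L] sums_unique[OF fs] by simp
  also have "cmod \<dots> \<le> cmod (mehler_kernel z x y) + cmod (\<Sum>n. f (n + L))" by (rule norm_triangle_ineq4)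
  also have "cmod (mehler_kernel z x y) \<le> 1 / sqrt \<bar>s - t\<bar>"
    unfolding z_def using r2 st by (intro mehler_kernel_dispersive) auto
  also have "cmod (\<Sum>n. f (n + L)) \<le> (\<Sum>n. r ^ L * C * r ^ n)"
  proof (rule norm_suminf_le)
    show "summable (\<lambda>n. r ^ L * C * r ^ n)" using r by (intro summable_mult summable_geometric) simp
    show "cmod (f (n + L)) \<le> r ^ L * C * r ^ n" for n using fn[of "n + L"] by (simp add: power_add mult_ac)
  qed
  also have "\<dots> = r ^ L * (C / (1 - r))"
    using r by (subst suminf_mult) (auto simp: summable_geometric suminf_geometric)
  finally show ?thesis by (simp add: C_def abs_minus_commute)
qed

lemma borel_measurable_cnj [measurable]: "cnj \<in> borel_measurable borel"
  by (intro borel_measurable_continuous_onI continuous_intros)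

lemma integrable_bounded_interval:
  fixes f :: "real \<Rightarrow> 'a::{banach, second_countable_topology}"
  assumes "f \<in> borel_measurable borel" and le: "\<And>x. norm (f x) \<le> B * indicator {a..b} x"
  shows "integrable lborel f"
proof (rule Bochner_Integration.integrable_bound)
  show "integrable lborel (\<lambda>x. B * indicator {a..b} x :: real)"
    by (intro integrable_mult_right integrable_real_indicator) (auto simp: emeasure_lborel_Icc_eq)
  show "AE x in lborel. norm (f x) \<le> norm (B * indicator {a..b} x :: real)"
    using le by (auto intro!: AE_I2 order_trans[OF le])
qed (use assms in simp)

lemma hermite_fun_bounded:
  obtains B where "B \<ge> 0" "\<And>x. \<bar>hermite_fun n x\<bar> \<le> B"
proof -
  obtain B where B: "B \<ge> 0" "\<And>x. \<bar>hermite_fun n x\<bar> \<le> B * exp (- (x\<^sup>2 / 6))"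
    using hermite_fun_gauss_bound by blast
  show ?thesis
  proof (rule that[OF B(1)])
    fix x
    have "B * exp (- (x\<^sup>2 / 6)) \<le> B * 1" using B(1) by (intro mult_left_mono) auto
    then show "\<bar>hermite_fun n x\<bar> \<le> B" using B(2)[of x] by simp
  qed
qed

lemma hermite_wave_bounded:
  obtains B where "B \<ge> 0" "\<And>s x. cmod (hermite_wave K c s x) \<le> B"
proof -
  have "\<forall>n. \<exists>B. B \<ge> 0 \<and> (\<forall>x. \<bar>hermite_fun n x\<bar> \<le> B)" using hermite_fun_bounded by metis
  then obtain B where B: "\<And>n. B n \<ge> 0" "\<And>n x. \<bar>hermite_fun n x\<bar> \<le> B n" by metis
  show ?thesis
  proof (rule that[of "\<Sum>n<K. cmod (c n) * B n"])
    show "(\<Sum>n<K. cmod (c n) * B n) \<ge> 0" using B by (intro sum_nonneg) simp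
    show "cmod (hermite_wave K c s x) \<le> (\<Sum>n<K. cmod (c n) * B n)" for s x
      unfolding hermite_wave_def using B
      by (intro order_trans[OF norm_sum] sum_mono) (simp add: norm_mult mult_left_mono)
  qed
qed

text \<open>The \<open>T T\<^sup>*\<close> argument, with the supremum over \<open>x\<close> linearised by a measurable choice
  \<open>X\<close> and the kernel made summable by the damping factors \<open>r\<^sup>n\<close>.\<close>

lemma strichartz_linearized:
  fixes c :: "nat \<Rightarrow> complex" and X :: "real \<Rightarrow> real"
  assumes X [measurable]: "X \<in> borel_measurable borel" and r: "0 < r" "r < 1"
  shows "(\<integral>\<^sup>+s. ennreal ((indicator {t0..t0 + 1/2} s * cmod (hermite_wave K (\<lambda>n. c n * of_real (r ^ n)) s (X s))) ^ 4) \<partial>lborel)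
     \<le> ennreal (196 * (\<Sum>n<K. (cmod (c n))\<^sup>2)\<^sup>2)"
proof -
  define I where "I = {t0..t0 + 1/2}"
  have [measurable]: "I \<in> sets borel" by (simp add: I_def)
  define e where "e n s = phase s n * of_real (hermite_fun n (X s))" for n s
  have [measurable]: "e n \<in> borel_measurable borel" for n unfolding e_def[abs_def] by measurable
  define u where "u s = indicator I s * hermite_wave K (\<lambda>n. c n * of_real (r ^ n)) s (X s)" for s
  have ue: "u s = indicator I s * (\<Sum>n<K. c n * of_real (r ^ n) * e n s)" for s
    unfolding u_def hermite_wave_def e_def by (simp add: mult.assoc)
  have [measurable]: "u \<in> borel_measurable borel" unfolding ue[abs_def] by measurable
  define M where "M s = cmod (u s)" for s
  have [measurable]: "M \<in> borel_measurable borel" unfolding M_def[abs_def] by measurable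
  have M0: "M s \<ge> 0" for s by (simp add: M_def)
  obtain B where B: "B \<ge> 0" "\<And>s x. cmod (hermite_wave K (\<lambda>n. c n * of_real (r ^ n)) s x) \<le> B"
    using hermite_wave_bounded by blast
  have MB: "M s \<le> B * indicator I s" for s
    using B by (auto simp: M_def u_def norm_mult indicator_def)
  have Mpow: "M s ^ k \<le> B ^ k * indicator I s" if "k > 0" for k s
    using power_mono[OF MB M0, of s k] that by (auto simp: indicator_def zero_power split: if_splits)
  \<comment> \<open>The wave is tested against its own dual power: \<open>u * G = |u|^4\<close>.
    This makes the estimate self-improving and avoids a supremum over test functions.\<close>
  define G where "G s = of_real ((M s)\<^sup>2) * cnj (u s)" for s
  have [measurable]: "G \<in> borel_measurable borel" unfolding G_def[abs_def] by measurable
  have nG: "cmod (G s) = M s ^ 3" for s by (simp add: G_def M_def norm_mult norm_power numeral_eq_Suc)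
  have IG: "indicator I s * G s = G s" for s by (simp add: G_def u_def indicator_def)
  have eG: "integrable lborel (\<lambda>s. e n s * G s)" for n
  proof -
    obtain D where D: "D \<ge> 0" "\<And>x. \<bar>hermite_fun n x\<bar> \<le> D" using hermite_fun_bounded by blast
    show ?thesis
    proof (rule integrable_bounded_interval[of _ "D * B ^ 3" t0 "t0 + 1/2"])
      fix s
      have "norm (e n s * G s) \<le> D * (B ^ 3 * indicator I s)"
        unfolding norm_mult nG using D Mpow[of 3 s] M0[of s]
        by (intro mult_mono) (auto simp: e_def norm_mult)
      then show "norm (e n s * G s) \<le> D * B ^ 3 * indicator {t0..t0 + 1/2} s" by (simp add: I_def mult.assoc)
    qed measurable
  qed
  \<comment> \<open>The wave is bounded and the interval is finite, so \<open>a\<close> is a finite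
    number; the last step cancels a power of it.\<close>
  define a where "a = integral\<^sup>L lborel (\<lambda>s. M s ^ 4)"
  have iM: "integrable lborel (\<lambda>s. M s ^ k)" if "k > 0" for k
    by (rule integrable_bounded_interval[of _ "B ^ k" t0 "t0 + 1/2"]) (use Mpow[OF that] M0 in \<open>auto simp: I_def\<close>)
  have nnM: "(\<integral>\<^sup>+s. ennreal (M s ^ k) \<partial>lborel) = ennreal (integral\<^sup>L lborel (\<lambda>s. M s ^ k))" if "k > 0" for k
    using M0 by (intro nn_integral_eq_integral iM that) auto
  have a0: "a \<ge> 0" unfolding a_def using M0 by (intro Bochner_Integration.integral_nonneg) auto
  define S where "S = (\<Sum>n<K. (cmod (c n))\<^sup>2)"
  have S0: "S \<ge> 0" unfolding S_def by (intro sum_nonneg) simp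
  have "a \<le> 196 * S\<^sup>2"
  proof (cases "a = 0")
    case False
    then have a: "a > 0" using a0 by simp
    define g where "g n = integral\<^sup>L lborel (\<lambda>s. e n s * G s)" for n
    define Q where "Q L = (\<Sum>n<L. (r ^ n * cmod (g n))\<^sup>2)" for L
    have "complex_of_real a = integral\<^sup>L lborel (\<lambda>s. complex_of_real (M s ^ 4))"
      unfolding a_def by (rule integral_complex_of_real[symmetric])
    also have "\<dots> = integral\<^sup>L lborel (\<lambda>s. \<Sum>n<K. c n * of_real (r ^ n) * (e n s * G s))"
    proof (rule Bochner_Integration.integral_cong[OF refl])
      fix s
      have "complex_of_real (M s ^ 4) = of_real ((M s)\<^sup>2) * (u s * cnj (u s))"
        by (simp add: mult_cnj_cmod M_def numeral_eq_Suc)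
      also have "\<dots> = u s * G s" by (simp add: G_def mult_ac)
      also have "\<dots> = (\<Sum>n<K. c n * of_real (r ^ n) * e n s) * (indicator I s * G s)"
        unfolding ue by (simp add: mult_ac)
      finally show "complex_of_real (M s ^ 4) = (\<Sum>n<K. c n * of_real (r ^ n) * (e n s * G s))"
        unfolding IG by (simp add: sum_distrib_right mult.assoc)
    qed
    also have "\<dots> = (\<Sum>n<K. c n * of_real (r ^ n) * g n)"
      unfolding g_def using eG by (subst Bochner_Integration.integral_sum) (auto intro!: integrable_mult_right)
    finally have "a = cmod (\<Sum>n<K. c n * of_real (r ^ n) * g n)" using a by (metis abs_of_pos norm_of_real)
    also have "\<dots> \<le> (\<Sum>n<K. cmod (c n) * (r ^ n * cmod (g n)))"
      using r by (intro order_trans[OF norm_sum] sum_mono) (simp add: norm_mult norm_power mult.assoc)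
    finally have "a\<^sup>2 \<le> (\<Sum>n<K. cmod (c n) * (r ^ n * cmod (g n)))\<^sup>2" using a by (intro power_mono) auto
    also have "\<dots> \<le> S * Q K"
      unfolding S_def Q_def by (rule Cauchy_Schwarz_ineq_sum)
    finally have aSQ: "a\<^sup>2 \<le> S * Q K" .
    define b where "b = integral\<^sup>L lborel (\<lambda>s. M s ^ 3)"
    have b0: "b \<ge> 0" unfolding b_def using M0 by (intro Bochner_Integration.integral_nonneg) auto
    define d where "d L = r ^ L * (1 / sqrt (pi * (1 - r\<^sup>2)) / (1 - r))" for L
    have rr: "r\<^sup>2 < 1" using r by (simp add: abs_square_less_1)
    have d0: "d L \<ge> 0" for L unfolding d_def using r rr by (intro mult_nonneg_nonneg divide_nonneg_nonneg) auto
    \<comment> \<open>Writing the squared coefficient as a double integral produces the damped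
      kernel between \<open>(s, X s)\<close> and \<open>(t, X t)\<close>. The interval has length
      1/2, so the dispersive bound applies; \<open>d L\<close> is the kernel tail.\<close>
    have QL: "Q L \<le> 14 * (a * sqrt a) + d L * b\<^sup>2" for L
    proof -
      define H where "H s t = (\<Sum>n<L. of_real (r ^ n * r ^ n) * (e n s * G s) * cnj (e n t * G t))" for s t
      define F where "F s = (\<Sum>n<L. of_real (r ^ n * r ^ n) * (e n s * G s) * cnj (g n))" for s
      have ic: "integrable lborel (\<lambda>t. cnj (e n t * G t))" for n using eG by (rule integrable_cnj)
      have gc: "integral\<^sup>L lborel (\<lambda>t. cnj (e n t * G t)) = cnj (g n)" for n
        unfolding g_def by (rule Bochner_Integration.integral_cnj)
      have FH: "F s = integral\<^sup>L lborel (H s)" and iH: "integrable lborel (H s)" for s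
      proof -
        show "integrable lborel (H s)"
          unfolding H_def[abs_def] by (intro Bochner_Integration.integrable_sum integrable_mult_right ic)
        have "integral\<^sup>L lborel (H s) = (\<Sum>n<L. integral\<^sup>L lborel (\<lambda>t. of_real (r ^ n * r ^ n) * (e n s * G s) * cnj (e n t * G t)))"
          unfolding H_def[abs_def] by (intro Bochner_Integration.integral_sum integrable_mult_right ic)
        then show "F s = integral\<^sup>L lborel (H s)" by (simp only: F_def integral_mult_right_zero gc)
      qed
      have iF: "integrable lborel F"
        unfolding F_def[abs_def] by (intro Bochner_Integration.integrable_sum integrable_mult_left integrable_mult_right eG)
      have "integral\<^sup>L lborel F = (\<Sum>n<L. integral\<^sup>L lborel (\<lambda>s. of_real (r ^ n * r ^ n) * (e n s * G s) * cnj (g n)))"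
        unfolding F_def[abs_def] by (intro Bochner_Integration.integral_sum integrable_mult_left integrable_mult_right eG)
      also have "\<dots> = (\<Sum>n<L. of_real (r ^ n * r ^ n) * g n * cnj (g n))"
        by (simp only: integral_mult_right_zero integral_mult_left_zero g_def)
      also have "\<dots> = of_real (Q L)"
        unfolding Q_def of_real_sum
        by (intro sum.cong refl) (simp add: mult.assoc mult_cnj_cmod power_mult_distrib power2_eq_square)
      finally have "integral\<^sup>L lborel F = of_real (Q L)" .
      then have "ennreal (Q L) = ennreal (norm (integral\<^sup>L lborel F))"
        by (simp only: norm_of_real) (simp add: Q_def sum_nonneg)
      also have "\<dots> \<le> (\<integral>\<^sup>+s. ennreal (norm (F s)) \<partial>lborel)"
        by (rule integral_norm_bound_ennreal[OF iF])
      also have "\<dots> \<le> (\<integral>\<^sup>+s. \<integral>\<^sup>+t. ennreal (norm (H s t)) \<partial>lborel \<partial>lborel)"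
        unfolding FH by (intro nn_integral_mono integral_norm_bound_ennreal iH)
      also have "\<dots> \<le> (\<integral>\<^sup>+s. \<integral>\<^sup>+t. ennreal (M s ^ 3 * M t ^ 3 * (1 / sqrt \<bar>t - s\<bar>)) + ennreal (d L * M s ^ 3) * ennreal (M t ^ 3) \<partial>lborel \<partial>lborel)"
      proof (rule nn_integral_mono)
        fix s
        show "(\<integral>\<^sup>+t. ennreal (norm (H s t)) \<partial>lborel) \<le> (\<integral>\<^sup>+t. ennreal (M s ^ 3 * M t ^ 3 * (1 / sqrt \<bar>t - s\<bar>)) + ennreal (d L * M s ^ 3) * ennreal (M t ^ 3) \<partial>lborel)"
        proof (rule nn_integral_mono_AE)
          show "AE t in lborel. ennreal (norm (H s t)) \<le> ennreal (M s ^ 3 * M t ^ 3 * (1 / sqrt \<bar>t - s\<bar>)) + ennreal (d L * M s ^ 3) * ennreal (M t ^ 3)"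
            using AE_lborel_singleton[of s]
          proof eventually_elim
            case (elim t)
            have "norm (H s t) \<le> M s ^ 3 * M t ^ 3 * (1 / sqrt \<bar>t - s\<bar>) + d L * M s ^ 3 * M t ^ 3"
            proof (cases "s \<in> I \<and> t \<in> I")
              case True
              have "H s t = G s * cnj (G t) * (\<Sum>n<L. of_real (r ^ n * r ^ n) * (phase s n * cnj (phase t n)) * of_real (hermite_fun n (X s) * hermite_fun n (X t)))"
                unfolding H_def e_def sum_distrib_left by (intro sum.cong refl) (simp add: mult_ac)
              then have "norm (H s t) = M s ^ 3 * M t ^ 3 * cmod (\<Sum>n<L. of_real (r ^ n * r ^ n) * (phase s n * cnj (phase t n)) * of_real (hermite_fun n (X s) * hermite_fun n (X t)))"
                by (simp only: norm_mult nG complex_mod_cnj)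
              also have "\<dots> \<le> M s ^ 3 * M t ^ 3 * (1 / sqrt \<bar>t - s\<bar> + d L)"
                unfolding d_def using True elim M0 r
                by (intro mult_left_mono hermite_kernel_partial_bound) (auto simp: I_def abs_if)
              finally show ?thesis by (simp add: algebra_simps)
            next
              case False
              then have "M s ^ 3 = 0 \<or> M t ^ 3 = 0" by (auto simp: M_def u_def)
              then have "G s = 0 \<or> G t = 0" using nG by (metis norm_eq_zero)
              then have "H s t = 0" unfolding H_def by auto
              then show ?thesis using M0 d0 by simp
            qed
            then have "ennreal (norm (H s t)) \<le> ennreal (M s ^ 3 * M t ^ 3 * (1 / sqrt \<bar>t - s\<bar>) + d L * M s ^ 3 * M t ^ 3)"
              by (rule ennreal_leI)
            also have "\<dots> = ennreal (M s ^ 3 * M t ^ 3 * (1 / sqrt \<bar>t - s\<bar>)) + ennreal (d L * M s ^ 3) * ennreal (M t ^ 3)"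
              using M0 d0 by (subst ennreal_plus) (auto simp: ennreal_mult)
            finally show ?case .
          qed
        qed
      qed
      also have "\<dots> = (\<integral>\<^sup>+s. \<integral>\<^sup>+t. ennreal (M s ^ 3 * M t ^ 3 * (1 / sqrt \<bar>t - s\<bar>)) \<partial>lborel \<partial>lborel)
          + (\<integral>\<^sup>+s. ennreal (d L * M s ^ 3) * ennreal b \<partial>lborel)"
        by (subst nn_integral_add[symmetric])
           (auto intro!: nn_integral_cong simp: nn_integral_add nn_integral_cmult nnM[of 3] b_def)
      also have "(\<integral>\<^sup>+s. ennreal (d L * M s ^ 3) * ennreal b \<partial>lborel) = (\<integral>\<^sup>+s. ennreal (d L * b) * ennreal (M s ^ 3) \<partial>lborel)"
        using M0 d0 b0 by (intro nn_integral_cong) (simp add: ennreal_mult[symmetric] mult_ac)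
      also have "\<dots> = ennreal (d L * b\<^sup>2)"
        using b0 d0 nnM[of 3] by (subst nn_integral_cmult) (auto simp: b_def[symmetric] ennreal_mult[symmetric] power2_eq_square mult.assoc)
      also have "(\<integral>\<^sup>+s. \<integral>\<^sup>+t. ennreal (M s ^ 3 * M t ^ 3 * (1 / sqrt \<bar>t - s\<bar>)) \<partial>lborel \<partial>lborel) \<le> ennreal (14 * (a * sqrt a))"
        using nnM[of 4] M0 a by (intro hls) (auto simp: a_def)
      finally have "ennreal (Q L) \<le> ennreal (14 * (a * sqrt a)) + ennreal (d L * b\<^sup>2)" by (simp add: add_right_mono)
      then show ?thesis using a d0[of L] by (simp flip: ennreal_plus)
    qed
    \<comment> \<open>\<open>Q\<close> is increasing, so the number of modes in the kernel may tend
      to infinity while \<open>K\<close> stays fixed; this removes the tail.\<close>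
    have "Q K \<le> 14 * (a * sqrt a)"
    proof (rule LIMSEQ_le_const)
      have "d \<longlonglongrightarrow> 0 * (1 / sqrt (pi * (1 - r\<^sup>2)) / (1 - r))"
        unfolding d_def[abs_def] using r by (intro tendsto_mult tendsto_const LIMSEQ_realpow_zero) auto
      then have "(\<lambda>L. 14 * (a * sqrt a) + d L * b\<^sup>2) \<longlonglongrightarrow> 14 * (a * sqrt a) + 0 * b\<^sup>2"
        by (intro tendsto_intros) simp
      then show "(\<lambda>L. 14 * (a * sqrt a) + d L * b\<^sup>2) \<longlonglongrightarrow> 14 * (a * sqrt a)" by simp
      have "Q K \<le> Q L" if "L \<ge> K" for L
        unfolding Q_def using that by (intro sum_mono2) auto
      then show "\<exists>N. \<forall>L\<ge>N. Q K \<le> 14 * (a * sqrt a) + d L * b\<^sup>2" using QL order_trans by blast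
    qed
    \<comment> \<open>With \<open>aSQ\<close> this reads \<open>a^2 \<le> 14 S a^(3/2)\<close>.
      Cancelling leaves \<open>sqrt a \<le> 14 S\<close>, whence the constant
      \<open>196 = 14^2\<close>.\<close>
    then have "S * Q K \<le> S * (14 * (a * sqrt a))" using S0 by (rule mult_left_mono)
    with aSQ have "a * a \<le> a * (14 * S * sqrt a)" by (simp add: power2_eq_square mult_ac)
    then have "a \<le> 14 * S * sqrt a" using a by (simp only: mult_le_cancel_left_pos)
    moreover have "a = sqrt a * sqrt a" using a by simp
    ultimately have "sqrt a * sqrt a \<le> (14 * S) * sqrt a" by (simp only:)
    then have "sqrt a \<le> 14 * S" using a by (simp only: mult_le_cancel_right_pos real_sqrt_gt_0_iff)
    then have "(sqrt a)\<^sup>2 \<le> (14 * S)\<^sup>2" using a by (intro power_mono) auto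
    then show ?thesis using a by (simp add: power_mult_distrib)
  qed simp
  then have "ennreal a \<le> ennreal (196 * S\<^sup>2)" by (rule ennreal_leI)
  moreover have "M s = indicator {t0..t0 + 1/2} s * cmod (hermite_wave K (\<lambda>n. c n * of_real (r ^ n)) s (X s))" for s
    by (simp add: M_def u_def norm_mult I_def indicator_def)
  ultimately show ?thesis using nnM[of 4] by (simp add: a_def S_def)
qed

text \<open>The damping is undone by dividing the finitely many coefficients by \<open>r^n\<close>
  beforehand; the constant does not depend on \<open>r\<close>, which then tends to 1.\<close>

lemma strichartz_choice:
  fixes c :: "nat \<Rightarrow> complex" and X :: "real \<Rightarrow> real"
  assumes X [measurable]: "X \<in> borel_measurable borel"
  shows "(\<integral>\<^sup>+s. ennreal ((indicator {t0..t0 + 1/2} s * cmod (hermite_wave K c s (X s))) ^ 4) \<partial>lborel)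
     \<le> ennreal (196 * (\<Sum>n<K. (cmod (c n))\<^sup>2)\<^sup>2)"
proof -
  define r where "r j = 1 - 1 / (real j + 2)" for j
  have r: "0 < r j" "r j < 1" for j by (simp_all add: r_def)
  have lim: "(\<lambda>j. 196 * (\<Sum>n<K. (cmod (c n / of_real (r j ^ n)))\<^sup>2)\<^sup>2) \<longlonglongrightarrow> 196 * (\<Sum>n<K. (cmod (c n / of_real (1 ^ n)))\<^sup>2)\<^sup>2"
  proof -
    have "r \<longlonglongrightarrow> 1" unfolding r_def[abs_def] by real_asymp
    then show ?thesis by (intro tendsto_intros) auto
  qed
  have bd: "(\<integral>\<^sup>+s. ennreal ((indicator {t0..t0 + 1/2} s * cmod (hermite_wave K c s (X s))) ^ 4) \<partial>lborel)
     \<le> ennreal (196 * (\<Sum>n<K. (cmod (c n / of_real (r j ^ n)))\<^sup>2)\<^sup>2)" for j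
    using strichartz_linearized[OF X r, of t0 K "\<lambda>n. c n / of_real (r j ^ n)" j] r(1)[of j] by simp
  have "(\<lambda>j. ennreal (196 * (\<Sum>n<K. (cmod (c n / of_real (r j ^ n)))\<^sup>2)\<^sup>2)) \<longlonglongrightarrow> ennreal (196 * (\<Sum>n<K. (cmod (c n))\<^sup>2)\<^sup>2)"
    using lim by (intro tendsto_ennrealI) simp
  then show ?thesis by (rule LIMSEQ_le_const) (use bd in blast)
qed

section \<open>The spatial supremum of a wave and its fourth power in time\<close>

definition wave_sup :: "nat \<Rightarrow> (nat \<Rightarrow> complex) \<Rightarrow> real \<Rightarrow> real" where
  "wave_sup K c s = (SUP x. cmod (hermite_wave K c s x))"

lemma wave_sup_bdd: "bdd_above (range (\<lambda>x. cmod (hermite_wave K c s x)))"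
  using hermite_wave_bounded[of K c] by (metis bdd_aboveI2)

lemma hermite_wave_le_sup: "cmod (hermite_wave K c s x) \<le> wave_sup K c s"
  unfolding wave_sup_def by (intro cSUP_upper wave_sup_bdd) simp

lemma wave_sup_nonneg: "wave_sup K c s \<ge> 0"
  using hermite_wave_le_sup[of K c s 0] norm_ge_zero order_trans by blast

text \<open>\<open>X k s\<close> is a maximiser among the first \<open>k + 1\<close> rationals,
  updated only on strict improvement. It is measurable in \<open>s\<close>, and by continuity in
  \<open>x\<close> the rationals exhaust the supremum.\<close>

lemma wave_sup_approx:
  obtains X :: "nat \<Rightarrow> real \<Rightarrow> real" where "\<And>k. X k \<in> borel_measurable borel"
    "\<And>s. (\<lambda>k. cmod (hermite_wave K c s (X k s))) \<longlonglongrightarrow> wave_sup K c s"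
proof -
  define E :: "nat \<Rightarrow> real" where "E = from_nat_into \<rat>"
  have rE: "range E = \<rat>" unfolding E_def by (rule range_from_nat_into) (auto simp: countable_rat)
  define w where "w s x = cmod (hermite_wave K c s x)" for s x
  define X where "X = rec_nat (\<lambda>s. E 0) (\<lambda>k Y s. if w s (Y s) < w s (E (Suc k)) then E (Suc k) else Y s)"
  have X0: "X 0 = (\<lambda>s. E 0)" unfolding X_def by simp
  have XS: "X (Suc k) = (\<lambda>s. if w s (X k s) < w s (E (Suc k)) then E (Suc k) else X k s)" for k
    unfolding X_def by simp
  have wm: "(\<lambda>s. w s (Y s)) \<in> borel_measurable borel" if [measurable]: "Y \<in> borel_measurable borel" for Y
    unfolding w_def hermite_wave_def by measurable
  have Xm: "X k \<in> borel_measurable borel" for k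
  proof (induction k)
    case (Suc k)
    note [measurable] = Suc wm[OF Suc] wm[of "\<lambda>_. E (Suc k)"]
    show ?case unfolding XS by measurable
  qed (simp add: X0)
  have mono: "w s (X k s) \<le> w s (X (Suc k) s)" and up: "w s (E k) \<le> w s (X k s)" for k s
    by (simp add: XS) (cases k; auto simp: X0 XS)
  have inc: "incseq (\<lambda>k. w s (X k s))" for s by (rule incseq_SucI) (rule mono)
  have ub: "w s x \<le> wave_sup K c s" for s x unfolding w_def by (rule hermite_wave_le_sup)
  have "(\<lambda>k. w s (X k s)) \<longlonglongrightarrow> wave_sup K c s" for s
  proof (rule LIMSEQ_I)
    fix \<epsilon> :: real assume e: "\<epsilon> > 0"
    obtain x where x: "wave_sup K c s - \<epsilon> < w s x"
      using less_cSUP_iff[OF _ wave_sup_bdd, of "wave_sup K c s - \<epsilon>" K c s] e by (auto simp: w_def wave_sup_def)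
    have "open {x. wave_sup K c s - \<epsilon> < w s x}"
      unfolding w_def by (intro open_Collect_less continuous_intros)
    then have "\<exists>q\<in>\<rat>. q \<in> {x. wave_sup K c s - \<epsilon> < w s x}"
      using x Rats_closure_real closure_approachable[of x \<rat>] open_contains_ball[of "{x. wave_sup K c s - \<epsilon> < w s x}"]
      by (metis UNIV_I dist_commute mem_Collect_eq mem_ball subset_eq)
    then obtain k where k: "wave_sup K c s - \<epsilon> < w s (E k)" using rE by (metis image_iff mem_Collect_eq)
    have "norm (w s (X j s) - wave_sup K c s) < \<epsilon>" if "j \<ge> k" for j
      using incseqD[OF inc[of s] that] up[of s k] ub[of s "X j s"] k by simp
    then show "\<exists>N. \<forall>n\<ge>N. norm (w s (X n s) - wave_sup K c s) < \<epsilon>" by blast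
  qed
  then show ?thesis using that[of X] Xm by (simp add: w_def)
qed

lemma borel_measurable_wave_sup [measurable]: "wave_sup K c \<in> borel_measurable borel"
proof -
  obtain X where X: "\<And>k. X k \<in> borel_measurable borel"
    "\<And>s. (\<lambda>k. cmod (hermite_wave K c s (X k s))) \<longlonglongrightarrow> wave_sup K c s" using wave_sup_approx by blast
  note [measurable] = X(1)
  show ?thesis
    by (rule borel_measurable_LIMSEQ_real[OF X(2)]) (unfold hermite_wave_def, measurable)
qed

lemma strichartz_short:
  "(\<integral>\<^sup>+s. ennreal (indicator {t0..t0 + 1/2} s * wave_sup K c s ^ 4) \<partial>lborel)
     \<le> ennreal (196 * (\<Sum>n<K. (cmod (c n))\<^sup>2)\<^sup>2)"
proof -
  obtain X where X: "\<And>k. X k \<in> borel_measurable borel"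
    "\<And>s. (\<lambda>k. cmod (hermite_wave K c s (X k s))) \<longlonglongrightarrow> wave_sup K c s" using wave_sup_approx by blast
  note [measurable] = X(1)
  let ?f = "\<lambda>k s. ennreal ((indicator {t0..t0 + 1/2} s * cmod (hermite_wave K c s (X k s))) ^ 4)"
  have "(\<integral>\<^sup>+s. ennreal (indicator {t0..t0 + 1/2} s * wave_sup K c s ^ 4) \<partial>lborel) = (\<integral>\<^sup>+s. liminf (\<lambda>k. ?f k s) \<partial>lborel)"
  proof (rule nn_integral_cong)
    fix s
    have "(\<lambda>k. ?f k s) \<longlonglongrightarrow> ennreal ((indicator {t0..t0 + 1/2} s * wave_sup K c s) ^ 4)"
      by (intro tendsto_intros X)
    from lim_imp_Liminf[OF _ this]
    show "ennreal (indicator {t0..t0 + 1/2} s * wave_sup K c s ^ 4) = liminf (\<lambda>k. ?f k s)"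
      by (simp add: power_mult_distrib indicator_def)
  qed
  also have "\<dots> \<le> liminf (\<lambda>k. integral\<^sup>N lborel (?f k))"
    by (intro nn_integral_liminf) (unfold hermite_wave_def, measurable)
  also have "\<dots> \<le> ennreal (196 * (\<Sum>n<K. (cmod (c n))\<^sup>2)\<^sup>2)"
    by (intro Liminf_le always_eventually allI strichartz_choice X) simp
  finally show ?thesis .
qed

text \<open>Eight intervals of length 1/2 cover \<open>{-2..2}\<close>, so the constant is
  \<open>8 * 196\<close>. This interval contains the time window, whose endpoints are irrational
  multiples of the step.\<close>

lemma strichartz:
  "(\<integral>\<^sup>+s. ennreal (indicator {-2..2} s * wave_sup K c s ^ 4) \<partial>lborel)
     \<le> ennreal (1568 * (\<Sum>n<K. (cmod (c n))\<^sup>2)\<^sup>2)"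
proof -
  let ?g = "\<lambda>j s. ennreal (indicator {-2 + real j / 2..-2 + real j / 2 + 1/2} s * wave_sup K c s ^ 4)"
  have "ennreal (indicator {-2..2} s * wave_sup K c s ^ 4) \<le> (\<Sum>j<8. ?g j s)" for s
  proof (cases "s \<in> {-2..2}")
    case True
    have "\<exists>j<8. s \<in> {-2 + real j / 2..-2 + real j / 2 + 1/2}"
    proof (cases "s = 2")
      case False
      define F where "F = \<lfloor>2 * (s + 2)\<rfloor>"
      define j where "j = nat F"
      have F: "0 \<le> F" "F < 8" "of_int F \<le> 2 * (s + 2)" "2 * (s + 2) < of_int F + 1"
        unfolding F_def zero_le_floor floor_less_iff using True False by simp_all linarith
      have "real j = of_int F" unfolding j_def by (rule of_nat_nat[OF F(1)])
      moreover have "j < 8" unfolding j_def using F by arith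
      ultimately show ?thesis using F by (intro exI[of _ j]) auto
    qed (auto intro!: exI[of _ 7])
    then obtain j where j: "j < 8" "s \<in> {-2 + real j / 2..-2 + real j / 2 + 1/2}" by blast
    then have "ennreal (indicator {-2..2} s * wave_sup K c s ^ 4) = ?g j s" using True by simp
    also have "\<dots> \<le> (\<Sum>j<8. ?g j s)" using j(1) by (intro member_le_sum) auto
    finally show ?thesis .
  qed simp
  then have "(\<integral>\<^sup>+s. ennreal (indicator {-2..2} s * wave_sup K c s ^ 4) \<partial>lborel) \<le> (\<integral>\<^sup>+s. (\<Sum>j<8. ?g j s) \<partial>lborel)"
    by (intro nn_integral_mono) auto
  also have "\<dots> = (\<Sum>j<8. integral\<^sup>N lborel (?g j))" by (rule nn_integral_sum) measurable
  also have "\<dots> \<le> (\<Sum>j<(8::nat). ennreal (196 * (\<Sum>n<K. (cmod (c n))\<^sup>2)\<^sup>2))"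
    by (intro sum_mono strichartz_short)
  also have "\<dots> = ennreal (1568 * (\<Sum>n<K. (cmod (c n))\<^sup>2)\<^sup>2)"
    by (simp add: ennreal_mult[symmetric] ennreal_numeral[symmetric] del: ennreal_numeral)
  finally show ?thesis .
qed

section \<open>Time and parity integrals\<close>

lemma lborel_integral_odd:
  fixes f :: "real \<Rightarrow> real"
  assumes "\<And>x. f (- x) = - f x"
  shows "integral\<^sup>L lborel f = 0"
  using lborel_integral_real_affine[of "-1" f 0] assms by simp

abbreviation time_window :: "real set" where "time_window \<equiv> {- (pi / 4)..pi / 4}"

lemma time_window_subset: "time_window \<subseteq> {-2..2}"
  using pi_less_4 by auto

text \<open>The window has length \<open>pi / 2\<close>, a period of the exponential only when
  \<open>k\<close> is even. Odd frequencies must be removed by parity in space.\<close>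

lemma time_integral:
  fixes k :: int assumes k: "even k"
  shows "has_bochner_integral lborel (\<lambda>s. indicator time_window s *\<^sub>R exp (2 * \<i> * of_real s * of_int k))
     (if k = 0 then of_real (pi / 2) else 0)"
proof (cases "k = 0")
  case True
  have "has_bochner_integral lborel (\<lambda>s. indicator time_window s *\<^sub>R (1::complex)) (measure lborel time_window *\<^sub>R 1)"
    by (intro has_bochner_integral_indicator) (auto simp: emeasure_lborel_Icc_eq)
  then show ?thesis using True by (simp add: scaleR_conv_of_real)
next
  case False
  let ?F = "\<lambda>s. exp (2 * \<i> * of_real s * of_int k) / (2 * \<i> * of_int k)"
  have "has_bochner_integral lborel (\<lambda>s. indicator time_window s *\<^sub>R exp (2 * \<i> * of_real s * of_int k)) (?F (pi/4) - ?F (- (pi/4)))"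
  proof (rule has_bochner_integral_FTC_Icc)
    fix s :: real
    have "((\<lambda>z. exp (2 * \<i> * z * of_int k) / (2 * \<i> * of_int k)) has_field_derivative exp (2 * \<i> * of_real s * of_int k)) (at (of_real s))"
      using False by (auto intro!: derivative_eq_intros)
    from has_vector_derivative_real_field[OF this]
    show "(?F has_vector_derivative exp (2 * \<i> * of_real s * of_int k)) (at s within time_window)"
      by (rule has_vector_derivative_at_within)
  qed (auto intro!: continuous_intros)
  moreover have "?F (pi/4) = ?F (- (pi/4))"
  proof -
    obtain j where j: "k = 2 * j" using k by (elim evenE)
    have "exp (2 * \<i> * of_real (pi/4) * of_int k) = exp (2 * \<i> * of_real (- (pi/4)) * of_int k)"
      unfolding exp_eq by (rule exI[of _ j]) (simp add: j algebra_simps)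
    then show ?thesis by simp
  qed
  ultimately show ?thesis using False by simp
qed

lemma hermite_wave_square_integral:
  assumes c: "c \<ge> 0"
  shows "has_bochner_integral lborel (\<lambda>x. complex_of_real (exp (- (c * x\<^sup>2)) * (cmod (hermite_wave K a s x))\<^sup>2))
    (\<Sum>n<K. \<Sum>m<K. (a n * cnj (a m)) * (exp (2 * \<i> * of_real s * of_int (int n - int m))
       * of_real (hermite_int c n m / (hermite_norm n * hermite_norm m))))"
proof -
  have eq: "complex_of_real (exp (- (c * x\<^sup>2)) * (cmod (hermite_wave K a s x))\<^sup>2)
     = (\<Sum>n<K. \<Sum>m<K. (a n * cnj (a m) * exp (2 * \<i> * of_real s * of_int (int n - int m))) *
         of_real (hermite_fun n x * hermite_fun m x * exp (- (c * x\<^sup>2))))" for x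
  proof -
    have "complex_of_real (exp (- (c * x\<^sup>2)) * (cmod (hermite_wave K a s x))\<^sup>2)
        = of_real (exp (- (c * x\<^sup>2))) * (hermite_wave K a s x * cnj (hermite_wave K a s x))"
      by (simp add: mult_cnj_cmod)
    also have "\<dots> = (\<Sum>n<K. \<Sum>m<K. of_real (exp (- (c * x\<^sup>2))) * ((a n * phase s n * of_real (hermite_fun n x)) * cnj (a m * phase s m * of_real (hermite_fun m x))))"
      unfolding hermite_wave_def cnj_sum sum_product by (simp only: sum_distrib_left)
    also have "\<dots> = (\<Sum>n<K. \<Sum>m<K. (a n * cnj (a m) * exp (2 * \<i> * of_real s * of_int (int n - int m))) *
         of_real (hermite_fun n x * hermite_fun m x * exp (- (c * x\<^sup>2))))"
    proof (intro sum.cong refl)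
      fix n m
      have ph: "phase s n * cnj (phase s m) = exp (2 * \<i> * of_real s * of_int (int n - int m))"
        unfolding phase_def exp_cnj exp_add[symmetric] by (simp add: algebra_simps)
      then show "of_real (exp (- (c * x\<^sup>2))) * ((a n * phase s n * of_real (hermite_fun n x)) * cnj (a m * phase s m * of_real (hermite_fun m x)))
         = (a n * cnj (a m) * exp (2 * \<i> * of_real s * of_int (int n - int m))) * of_real (hermite_fun n x * hermite_fun m x * exp (- (c * x\<^sup>2)))"
        by (simp add: mult_ac flip: ph)
    qed
    finally show ?thesis .
  qed
  have "has_bochner_integral lborel (\<lambda>x. complex_of_real (hermite_fun n x * hermite_fun m x * exp (- (c * x\<^sup>2))))
     (of_real (hermite_int c n m / (hermite_norm n * hermite_norm m)))" for n m
    using hermite_fun_mult_integral[OF c, of n m] by (rule has_bochner_integral_of_real)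
  then have "has_bochner_integral lborel (\<lambda>x. \<Sum>n<K. \<Sum>m<K. (a n * cnj (a m) * exp (2 * \<i> * of_real s * of_int (int n - int m))) *
         of_real (hermite_fun n x * hermite_fun m x * exp (- (c * x\<^sup>2))))
    (\<Sum>n<K. \<Sum>m<K. (a n * cnj (a m) * exp (2 * \<i> * of_real s * of_int (int n - int m))) *
         of_real (hermite_int c n m / (hermite_norm n * hermite_norm m)))"
    by (intro has_bochner_integral_sum has_bochner_integral_mult_right) auto
  then show ?thesis unfolding eq by (simp only: mult.assoc)
qed

lemma hermite_wave_L2:
  "has_bochner_integral lborel (\<lambda>x. (cmod (hermite_wave K a s x))\<^sup>2) (\<Sum>n<K. (cmod (a n))\<^sup>2)"
proof -
  have d: "complex_of_real (hermite_int 0 n m / (hermite_norm n * hermite_norm m)) = (if n = m then 1 else 0)" for n m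
  proof -
    have "hermite_int 0 n m / (hermite_norm n * hermite_norm m) = (if n = m then 1 else 0)"
      using hermite_norm_square[of n] hermite_norm_pos[of n] by (auto simp: hermite_int_orth power2_eq_square)
    then show ?thesis by simp
  qed
  have "has_bochner_integral lborel (\<lambda>x. complex_of_real ((cmod (hermite_wave K a s x))\<^sup>2)) (\<Sum>n<K. a n * cnj (a n))"
    using hermite_wave_square_integral[of 0 K a s] unfolding d by (simp add: if_distrib cong: if_cong)
  also have "(\<Sum>n<K. a n * cnj (a n)) = of_real (\<Sum>n<K. (cmod (a n))\<^sup>2)" by (simp add: mult_cnj_cmod)
  finally have "has_bochner_integral lborel (\<lambda>x. complex_of_real ((cmod (hermite_wave K a s x))\<^sup>2)) (of_real (\<Sum>n<K. (cmod (a n))\<^sup>2))" .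
  from has_bochner_integral_Re[OF this] show ?thesis unfolding Re_complex_of_real .
qed

text \<open>Averaging over the window diagonalises the weighted mass: a pair of modes with odd
  difference has zero spatial integral, and one with nonzero even difference has zero time
  integral.\<close>

lemma hermite_wave_local_mass:
  "(\<integral>\<^sup>+s. \<integral>\<^sup>+x. ennreal (indicator time_window s * (exp (- x\<^sup>2) * (cmod (hermite_wave K a s x))\<^sup>2)) \<partial>lborel \<partial>lborel)
     = ennreal (pi / 2 * (\<Sum>n<K. (cmod (a n))\<^sup>2 * hermite_mass n))"
proof -
  let ?k = "\<lambda>n m. complex_of_real (hermite_int 1 n m / (hermite_norm n * hermite_norm m))"
  define Z where "Z s = (\<Sum>n<K. \<Sum>m<K. (a n * cnj (a m)) * (exp (2 * \<i> * of_real s * of_int (int n - int m)) * ?k n m))" for s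
  have hZ: "has_bochner_integral lborel (\<lambda>x. complex_of_real (exp (- x\<^sup>2) * (cmod (hermite_wave K a s x))\<^sup>2)) (Z s)" for s
    using hermite_wave_square_integral[of 1 K a s] by (simp add: Z_def)
  have hR: "has_bochner_integral lborel (\<lambda>x. exp (- x\<^sup>2) * (cmod (hermite_wave K a s x))\<^sup>2) (Re (Z s))" for s
    using has_bochner_integral_Re[OF hZ[of s]] unfolding Re_complex_of_real .
  have inner: "(\<integral>\<^sup>+x. ennreal (exp (- x\<^sup>2) * (cmod (hermite_wave K a s x))\<^sup>2) \<partial>lborel) = ennreal (Re (Z s))" for s
    using hR[of s] by (subst nn_integral_eq_integral) (auto simp: has_bochner_integral_iff)
  have Z0: "Re (Z s) \<ge> 0" for s
    unfolding has_bochner_integral_integral_eq[OF hR[of s], symmetric]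
    by (intro Bochner_Integration.integral_nonneg) simp
  have odd0: "?k n m = 0" if "odd (int n - int m)" for n m
  proof -
    have "hermite_int 1 n m / (hermite_norm n * hermite_norm m) = integral\<^sup>L lborel (\<lambda>x. hermite_fun n x * hermite_fun m x * exp (- (1 * x\<^sup>2)))"
      using hermite_fun_mult_integral[of 1 n m] by (simp add: has_bochner_integral_iff)
    also have "\<dots> = 0"
    proof (rule lborel_integral_odd)
      have "(-1::real) ^ n * (-1) ^ m = -1" using that by (cases "even n"; cases "even m") auto
      then show "hermite_fun n (- x) * hermite_fun m (- x) * exp (- (1 * (- x)\<^sup>2)) = - (hermite_fun n x * hermite_fun m x * exp (- (1 * x\<^sup>2)))" for x
        unfolding hermite_fun_minus by (metis (no_types, lifting) mult.assoc mult.left_commute mult_minus1 power2_minus)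
    qed
    finally show ?thesis by simp
  qed
  have trm: "has_bochner_integral lborel (\<lambda>s. (a n * cnj (a m) * ?k n m) * (indicator time_window s *\<^sub>R exp (2 * \<i> * of_real s * of_int (int n - int m))))
      (if n = m then of_real (pi / 2 * ((cmod (a n))\<^sup>2 * hermite_mass n)) else 0)" for n m
  proof (cases "even (int n - int m)")
    case True
    have "has_bochner_integral lborel (\<lambda>s. (a n * cnj (a m) * ?k n m) * (indicator time_window s *\<^sub>R exp (2 * \<i> * of_real s * of_int (int n - int m))))
      ((a n * cnj (a m) * ?k n m) * (if int n - int m = 0 then of_real (pi / 2) else 0))"
      by (intro has_bochner_integral_mult_right time_integral True)
    moreover have "(a n * cnj (a m) * ?k n m) * (if int n - int m = 0 then of_real (pi / 2) else 0)
        = (if n = m then of_real (pi / 2 * ((cmod (a n))\<^sup>2 * hermite_mass n)) else 0)"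
      by (auto simp: mult_cnj_cmod hermite_mass_def)
    ultimately show ?thesis by simp
  next
    case False
    then show ?thesis using odd0[OF False] by auto
  qed
  have "has_bochner_integral lborel (\<lambda>s. \<Sum>n<K. \<Sum>m<K. (a n * cnj (a m) * ?k n m) * (indicator time_window s *\<^sub>R exp (2 * \<i> * of_real s * of_int (int n - int m))))
      (\<Sum>n<K. \<Sum>m<K. (if n = m then of_real (pi / 2 * ((cmod (a n))\<^sup>2 * hermite_mass n)) else 0))"
    by (intro has_bochner_integral_sum trm)
  also have "(\<lambda>s. \<Sum>n<K. \<Sum>m<K. (a n * cnj (a m) * ?k n m) * (indicator time_window s *\<^sub>R exp (2 * \<i> * of_real s * of_int (int n - int m))))
      = (\<lambda>s. indicator time_window s *\<^sub>R Z s)"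
    unfolding Z_def scaleR_sum_right by (intro ext sum.cong refl) (simp add: scaleR_conv_of_real mult_ac)
  also have "(\<Sum>n<K. \<Sum>m<K. (if n = m then complex_of_real (pi / 2 * ((cmod (a n))\<^sup>2 * hermite_mass n)) else 0))
      = of_real (pi / 2 * (\<Sum>n<K. (cmod (a n))\<^sup>2 * hermite_mass n))"
    by (simp add: sum_distrib_left)
  finally have "has_bochner_integral lborel (\<lambda>s. Re (indicator time_window s *\<^sub>R Z s)) (pi / 2 * (\<Sum>n<K. (cmod (a n))\<^sup>2 * hermite_mass n))"
    using has_bochner_integral_Re by fastforce
  then have hs: "has_bochner_integral lborel (\<lambda>s. indicator time_window s * Re (Z s)) (pi / 2 * (\<Sum>n<K. (cmod (a n))\<^sup>2 * hermite_mass n))"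
    by simp
  have "(\<integral>\<^sup>+s. \<integral>\<^sup>+x. ennreal (indicator time_window s * (exp (- x\<^sup>2) * (cmod (hermite_wave K a s x))\<^sup>2)) \<partial>lborel \<partial>lborel)
     = (\<integral>\<^sup>+s. ennreal (indicator time_window s * Re (Z s)) \<partial>lborel)"
    by (intro nn_integral_cong) (auto simp: indicator_def inner)
  also have "\<dots> = ennreal (pi / 2 * (\<Sum>n<K. (cmod (a n))\<^sup>2 * hermite_mass n))"
    unfolding has_bochner_integral_integral_eq[OF hs, symmetric]
    using Z0 by (intro nn_integral_eq_integral integrable.intros[OF hs]) auto
  finally show ?thesis .
qed

section \<open>The resonant six-linear form\<close>

text \<open>Slots 0 to 2 are the plain ones and 3 to 5 the conjugated ones. Slot 5 later takes the
  test vector, so the form is antilinear in it.\<close>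

definition slot_conj :: "nat \<Rightarrow> complex \<Rightarrow> complex" where
  "slot_conj i z = (if i < 3 then z else cnj z)"

lemma slot_conj_simps [simp]:
  "cmod (slot_conj i z) = cmod z" "slot_conj i (x + y) = slot_conj i x + slot_conj i y"
  "slot_conj i (x * y) = slot_conj i x * slot_conj i y" "slot_conj i 0 = 0" "slot_conj i (of_real a) = of_real a"
  by (auto simp: slot_conj_def)

lemma slot_conj_sum: "slot_conj i (sum f A) = (\<Sum>a\<in>A. slot_conj i (f a))"
  by (simp add: slot_conj_def)

definition hermite_six :: "(nat \<Rightarrow> nat) \<Rightarrow> real" where
  "hermite_six \<nu> = integral\<^sup>L lborel (\<lambda>x. \<Prod>i<6. hermite_fun (\<nu> i) x)"

definition resonant :: "(nat \<Rightarrow> nat) \<Rightarrow> bool" where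
  "resonant \<nu> \<longleftrightarrow> \<nu> 0 + \<nu> 1 + \<nu> 2 = \<nu> 3 + \<nu> 4 + \<nu> 5"

abbreviation six_modes :: "nat \<Rightarrow> (nat \<Rightarrow> nat) set" where
  "six_modes K \<equiv> PiE {..<6} (\<lambda>_. {..<K})"

text \<open>The factor 6 is \<open>12 / pi\<close> from \<open>T6\<close> times the length
  \<open>pi / 2\<close> of the time window.\<close>

definition six_trunc :: "nat \<Rightarrow> (nat \<Rightarrow> L2) \<Rightarrow> complex" where
  "six_trunc K F = 6 * (\<Sum>\<nu>\<in>six_modes K. if resonant \<nu>
     then (\<Prod>i<6. slot_conj i (coef (F i) (\<nu> i))) * of_real (hermite_six \<nu>) else 0)"

abbreviation wave :: "nat \<Rightarrow> L2 \<Rightarrow> real \<Rightarrow> real \<Rightarrow> complex" where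
  "wave K f \<equiv> hermite_wave K (coef f)"

lemma six_expand: "(\<Prod>i<6. g i) = g 0 * g 1 * g 2 * g 3 * g 4 * g (5::nat)" for g :: "nat \<Rightarrow> 'a::comm_monoid_mult"
  by (simp add: eval_nat_numeral mult.assoc)

text \<open>Here \<open>r = 1/3\<close> gives rate \<open>1/2\<close> for the square. With rate
  \<open>1/4\<close> for the function, four factors give exactly the weight
  \<open>exp (- x\<^sup>2)\<close> of \<open>hermite_mass\<close>.\<close>

lemma hermite_fun_quarter_bound:
  obtains B where "B \<ge> 0" "\<And>x. \<bar>hermite_fun n x\<bar> \<le> B * exp (- (x\<^sup>2 / 4))"
proof
  define D where "D = inverse ((1/3)^n) / sqrt (pi * (1 - (1/3)\<^sup>2))"
  have D: "D \<ge> 0" by (simp add: D_def power2_eq_square)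
  then show "sqrt D \<ge> 0" by simp
  fix x :: real
  have "(hermite_fun n x)\<^sup>2 \<le> D * exp (- (x\<^sup>2 / 2))"
    using hermite_fun_square_le[of "1/3" n x] by (simp add: D_def)
  also have "\<dots> = (sqrt D * exp (- (x\<^sup>2 / 4)))\<^sup>2"
    using D by (simp add: power_mult_distrib flip: exp_double)
  finally show "\<bar>hermite_fun n x\<bar> \<le> sqrt D * exp (- (x\<^sup>2 / 4))"
    using D by (intro power2_le_imp_le[of "\<bar>hermite_fun n x\<bar>"]) auto
qed

lemma integrable_hermite_six:
  fixes \<nu> :: "nat \<Rightarrow> nat"
  shows "integrable lborel (\<lambda>x. \<Prod>i<6. hermite_fun (\<nu> i) x)"
proof -
  have "\<forall>i. \<exists>B. B \<ge> 0 \<and> (\<forall>x. \<bar>hermite_fun (\<nu> i) x\<bar> \<le> B * exp (- (x\<^sup>2 / 4)))"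
    using hermite_fun_quarter_bound by metis
  then obtain B where B: "\<And>i. B i \<ge> 0" "\<And>i x. \<bar>hermite_fun (\<nu> i) x\<bar> \<le> B i * exp (- (x\<^sup>2 / 4))" by metis
  have "integrable lborel (\<lambda>x::real. (\<Prod>i<6. B i) * exp (- (3/2 * x\<^sup>2)))"
    using gauss_has_integral[of "3/2"] by (intro integrable_mult_right) (simp add: has_bochner_integral_iff)
  then show ?thesis
  proof (rule Bochner_Integration.integrable_bound)
    have "\<bar>\<Prod>i<6. hermite_fun (\<nu> i) x\<bar> \<le> (\<Prod>i<6. B i) * exp (- (3/2 * x\<^sup>2))" for x
    proof -
      have "\<bar>\<Prod>i<6. hermite_fun (\<nu> i) x\<bar> \<le> (\<Prod>i<6. B i * exp (- (x\<^sup>2 / 4)))"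
        unfolding abs_prod using B by (intro prod_mono) auto
      also have "\<dots> = (\<Prod>i<6. B i) * exp (- (3/2 * x\<^sup>2))"
        by (simp add: prod.distrib flip: exp_of_nat_mult)
      finally show ?thesis .
    qed
    then show "AE x in lborel. norm (\<Prod>i<6. hermite_fun (\<nu> i) x) \<le> norm ((\<Prod>i<6. B i) * exp (- (3/2 * x\<^sup>2)))"
      by (auto intro!: AE_I2 order_trans[OF _ abs_ge_self])
  qed measurable
qed

lemma hermite_six_odd:
  assumes "odd (int (\<nu> 0 + \<nu> 1 + \<nu> 2) - int (\<nu> 3 + \<nu> 4 + \<nu> 5))"
  shows "hermite_six \<nu> = 0"
  unfolding hermite_six_def
proof (rule lborel_integral_odd)
  fix x
  have "(\<Prod>i<6. hermite_fun (\<nu> i) (- x)) = (\<Prod>i<6. (-1) ^ \<nu> i) * (\<Prod>i<6. hermite_fun (\<nu> i) x)"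
    by (simp add: hermite_fun_minus prod.distrib)
  also have "(\<Prod>i<6. (-1::real) ^ \<nu> i) = (-1) ^ (\<nu> 0 + \<nu> 1 + \<nu> 2 + \<nu> 3 + \<nu> 4 + \<nu> 5)"
    by (simp add: six_expand power_add)
  also have "\<dots> = -1" using assms by (simp add: minus_one_power_iff) presburger
  finally show "(\<Prod>i<6. hermite_fun (\<nu> i) (- x)) = - (\<Prod>i<6. hermite_fun (\<nu> i) x)" by simp
qed

definition wave_six :: "nat \<Rightarrow> (nat \<Rightarrow> L2) \<Rightarrow> real \<Rightarrow> real \<Rightarrow> complex" where
  "wave_six K F s x = (\<Prod>i<6. slot_conj i (wave K (F i) s x))"

lemma slot_phase_prod:
  "(\<Prod>i<6. slot_conj i (phase s (\<nu> i)))
     = exp (2 * \<i> * of_real s * of_int (int (\<nu> 0 + \<nu> 1 + \<nu> 2) - int (\<nu> 3 + \<nu> 4 + \<nu> 5)))"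
  unfolding six_expand slot_conj_def phase_def exp_cnj
  by (simp add: algebra_simps flip: exp_add)

lemma wave_six_expand:
  "wave_six K F s x = (\<Sum>\<nu>\<in>six_modes K. (\<Prod>i<6. slot_conj i (coef (F i) (\<nu> i)))
     * exp (2 * \<i> * of_real s * of_int (int (\<nu> 0 + \<nu> 1 + \<nu> 2) - int (\<nu> 3 + \<nu> 4 + \<nu> 5)))
     * of_real (\<Prod>i<6. hermite_fun (\<nu> i) x))"
proof -
  have "wave_six K F s x = (\<Prod>i<6. \<Sum>n<K. slot_conj i (coef (F i) n) * slot_conj i (phase s n) * of_real (hermite_fun n x))"
    unfolding wave_six_def hermite_wave_def slot_conj_sum by simp
  also have "\<dots> = (\<Sum>\<nu>\<in>six_modes K. \<Prod>i<6. slot_conj i (coef (F i) (\<nu> i)) * slot_conj i (phase s (\<nu> i)) * of_real (hermite_fun (\<nu> i) x))"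
    by (rule prod_sum_PiE) auto
  also have "\<dots> = (\<Sum>\<nu>\<in>six_modes K. (\<Prod>i<6. slot_conj i (coef (F i) (\<nu> i))) * (\<Prod>i<6. slot_conj i (phase s (\<nu> i)))
     * of_real (\<Prod>i<6. hermite_fun (\<nu> i) x))"
    by (simp only: prod.distrib of_real_prod)
  finally show ?thesis unfolding slot_phase_prod .
qed

lemma finite_six_modes: "finite (six_modes K)"
  by (intro finite_PiE) auto

lemma wave_six_space_integral:
  "has_bochner_integral lborel (wave_six K F s) (\<Sum>\<nu>\<in>six_modes K. (\<Prod>i<6. slot_conj i (coef (F i) (\<nu> i)))
     * exp (2 * \<i> * of_real s * of_int (int (\<nu> 0 + \<nu> 1 + \<nu> 2) - int (\<nu> 3 + \<nu> 4 + \<nu> 5))) * of_real (hermite_six \<nu>))"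
  unfolding wave_six_expand[abs_def] hermite_six_def
  by (intro has_bochner_integral_sum has_bochner_integral_mult_right has_bochner_integral_of_real
      has_bochner_integral_integrable integrable_hermite_six)

text \<open>The bridge between the two descriptions of the form: the resonant sum shows its
  symmetries, the space-time integral allows estimates.\<close>

lemma six_trunc_integral:
  "has_bochner_integral lborel (\<lambda>s. indicator time_window s *\<^sub>R integral\<^sup>L lborel (wave_six K F s)) (of_real (pi / 12) * six_trunc K F)"
proof -
  let ?k = "\<lambda>\<nu>. int (\<nu> 0 + \<nu> 1 + \<nu> 2) - int (\<nu> 3 + \<nu> 4 + \<nu> 5)"
  let ?c = "\<lambda>\<nu>. \<Prod>i<6. slot_conj i (coef (F i) (\<nu> i))"
  have res: "resonant \<nu> \<longleftrightarrow> ?k \<nu> = 0" for \<nu> unfolding resonant_def by linarith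
  have trm: "has_bochner_integral lborel (\<lambda>s. (?c \<nu> * of_real (hermite_six \<nu>)) * (indicator time_window s *\<^sub>R exp (2 * \<i> * of_real s * of_int (?k \<nu>))))
     (of_real (pi / 2) * (if resonant \<nu> then ?c \<nu> * of_real (hermite_six \<nu>) else 0))" for \<nu>
  proof (cases "even (?k \<nu>)")
    case True
    have "has_bochner_integral lborel (\<lambda>s. (?c \<nu> * of_real (hermite_six \<nu>)) * (indicator time_window s *\<^sub>R exp (2 * \<i> * of_real s * of_int (?k \<nu>))))
      ((?c \<nu> * of_real (hermite_six \<nu>)) * (if ?k \<nu> = 0 then of_real (pi / 2) else 0))"
      by (intro has_bochner_integral_mult_right time_integral True)
    moreover have "(?c \<nu> * of_real (hermite_six \<nu>)) * (if ?k \<nu> = 0 then of_real (pi / 2) else 0)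
       = of_real (pi / 2) * (if resonant \<nu> then ?c \<nu> * of_real (hermite_six \<nu>) else 0)"
      unfolding res by (simp add: mult_ac)
    ultimately show ?thesis by (simp only:)
  next
    case False
    then have "hermite_six \<nu> = 0" by (rule hermite_six_odd)
    then show ?thesis by (simp add: has_bochner_integral_zero)
  qed
  have "has_bochner_integral lborel (\<lambda>s. \<Sum>\<nu>\<in>six_modes K. (?c \<nu> * of_real (hermite_six \<nu>)) * (indicator time_window s *\<^sub>R exp (2 * \<i> * of_real s * of_int (?k \<nu>))))
     (\<Sum>\<nu>\<in>six_modes K. of_real (pi / 2) * (if resonant \<nu> then ?c \<nu> * of_real (hermite_six \<nu>) else 0))"
    by (intro has_bochner_integral_sum trm)
  moreover have "(\<Sum>\<nu>\<in>six_modes K. (?c \<nu> * of_real (hermite_six \<nu>)) * (indicator time_window s *\<^sub>R exp (2 * \<i> * of_real s * of_int (?k \<nu>))))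
     = indicator time_window s *\<^sub>R integral\<^sup>L lborel (wave_six K F s)" for s
    unfolding has_bochner_integral_integral_eq[OF wave_six_space_integral] scaleR_sum_right
    by (intro sum.cong refl) (simp add: scaleR_conv_of_real mult_ac)
  moreover have "(\<Sum>\<nu>\<in>six_modes K. of_real (pi / 2) * (if resonant \<nu> then ?c \<nu> * of_real (hermite_six \<nu>) else 0))
     = of_real (pi / 12) * six_trunc K F"
    unfolding six_trunc_def sum_distrib_left[symmetric] by simp
  ultimately show ?thesis by (simp only:)
qed

lemma six_trunc_le_nn:
  "ennreal (pi / 12 * cmod (six_trunc K F))
     \<le> (\<integral>\<^sup>+s. \<integral>\<^sup>+x. ennreal (indicator time_window s * (\<Prod>i<6. cmod (wave K (F i) s x))) \<partial>lborel \<partial>lborel)"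
proof -
  have "ennreal (pi / 12 * cmod (six_trunc K F)) = ennreal (norm (integral\<^sup>L lborel (\<lambda>s. indicator time_window s *\<^sub>R integral\<^sup>L lborel (wave_six K F s))))"
    unfolding has_bochner_integral_integral_eq[OF six_trunc_integral[of K F]] norm_mult norm_of_real by simp
  also have "\<dots> \<le> (\<integral>\<^sup>+s. ennreal (norm (indicator time_window s *\<^sub>R integral\<^sup>L lborel (wave_six K F s))) \<partial>lborel)"
    using six_trunc_integral[of K F] by (intro integral_norm_bound_ennreal) (simp add: has_bochner_integral_iff)
  also have "\<dots> \<le> (\<integral>\<^sup>+s. \<integral>\<^sup>+x. ennreal (indicator time_window s * (\<Prod>i<6. cmod (wave K (F i) s x))) \<partial>lborel \<partial>lborel)"
  proof (rule nn_integral_mono)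
    fix s
    have "ennreal (norm (integral\<^sup>L lborel (wave_six K F s))) \<le> (\<integral>\<^sup>+x. ennreal (norm (wave_six K F s x)) \<partial>lborel)"
      using wave_six_space_integral[of K F s] by (intro integral_norm_bound_ennreal) (simp add: has_bochner_integral_iff)
    also have "\<dots> = (\<integral>\<^sup>+x. ennreal (\<Prod>i<6. cmod (wave K (F i) s x)) \<partial>lborel)"
      by (simp add: wave_six_def prod_norm[symmetric])
    finally show "ennreal (norm (indicator time_window s *\<^sub>R integral\<^sup>L lborel (wave_six K F s)))
       \<le> (\<integral>\<^sup>+x. ennreal (indicator time_window s * (\<Prod>i<6. cmod (wave K (F i) s x))) \<partial>lborel)"
      by (auto simp: indicator_def)
  qed
  finally show ?thesis .
qed

section \<open>Boundedness of the truncated form, uniformly in the truncation\<close>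

lemma sum_coef_le: "(\<Sum>n<K. (cmod (coef f n))\<^sup>2) \<le> 1" if "norm f \<le> 1"
  using bessel[of f K] that power_mono[of "norm f" 1 2] by simp

lemma norm_coef_le: "cmod (coef f n) \<le> norm f"
proof -
  have "(cmod (coef f n))\<^sup>2 \<le> (\<Sum>n<Suc n. (cmod (coef f n))\<^sup>2)" by (intro member_le_sum) auto
  also have "\<dots> \<le> (norm f)\<^sup>2" by (rule bessel)
  finally show ?thesis by (rule power2_le_imp_le) simp
qed

lemma am_gm_4: "a * b * c * d \<le> (a ^ 4 + b ^ 4 + c ^ 4 + d ^ 4) / 4" for a b c d :: real
proof -
  have "2 * (a * b) * (c * d) \<le> (a * b)\<^sup>2 + (c * d)\<^sup>2" by (rule sum_squares_bound)
  moreover have "2 * a\<^sup>2 * b\<^sup>2 \<le> (a\<^sup>2)\<^sup>2 + (b\<^sup>2)\<^sup>2" "2 * c\<^sup>2 * d\<^sup>2 \<le> (c\<^sup>2)\<^sup>2 + (d\<^sup>2)\<^sup>2" by (rule sum_squares_bound)+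
  ultimately show ?thesis by (simp add: power_mult_distrib mult.assoc flip: power_mult)
qed

lemma ennreal_mult_add:
  "0 \<le> a \<Longrightarrow> 0 \<le> b \<Longrightarrow> 0 \<le> c \<Longrightarrow> 0 \<le> d \<Longrightarrow> ennreal a * ennreal b + ennreal c * ennreal d = ennreal (a * b + c * d)"
  by (simp add: ennreal_mult)

definition six_const :: real where "six_const = 12 * 1568 / pi"

lemma six_const_pos: "six_const > 0" by (simp add: six_const_def)

text \<open>Four factors are bounded by their spatial suprema, the other two by their constant
  \<open>L\<^sup>2\<close> norms. Since all vectors lie in the unit ball, the arithmetic-geometric
  mean can stand in for Hoelder's inequality; homogeneity restores the general case.\<close>

lemma six_trunc_bound_unit:
  assumes F: "\<And>i. i < 6 \<Longrightarrow> norm (F i) \<le> 1"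
  shows "cmod (six_trunc K F) \<le> six_const"
proof -
  let ?W = "\<lambda>i s x. cmod (wave K (F i) s x)"
  let ?M = "\<lambda>i s. wave_sup K (coef (F i)) s"
  have inner: "(\<integral>\<^sup>+x. ennreal (\<Prod>i<6. ?W i s x) \<partial>lborel) \<le> (\<Sum>i<4. ennreal (1/4) * ennreal (?M i s ^ 4))" for s
  proof -
    have "(\<integral>\<^sup>+x. ennreal (\<Prod>i<6. ?W i s x) \<partial>lborel) \<le> (\<integral>\<^sup>+x. ennreal ((\<Sum>i<4. ?M i s ^ 4) / 4 * ((?W 4 s x)\<^sup>2 / 2 + (?W 5 s x)\<^sup>2 / 2)) \<partial>lborel)"
    proof (intro nn_integral_mono ennreal_leI)
      fix x
      have "(\<Prod>i<6. ?W i s x) = (?W 0 s x * ?W 1 s x * ?W 2 s x * ?W 3 s x) * (?W 4 s x * ?W 5 s x)"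
        by (simp add: six_expand)
      also have "\<dots> \<le> (?M 0 s * ?M 1 s * ?M 2 s * ?M 3 s) * ((?W 4 s x)\<^sup>2 / 2 + (?W 5 s x)\<^sup>2 / 2)"
        using sum_squares_bound[of "?W 4 s x" "?W 5 s x"]
        by (intro mult_mono mult_nonneg_nonneg wave_sup_nonneg hermite_wave_le_sup) auto
      also have "\<dots> \<le> ((\<Sum>i<4. ?M i s ^ 4) / 4) * ((?W 4 s x)\<^sup>2 / 2 + (?W 5 s x)\<^sup>2 / 2)"
        using am_gm_4[of "?M 0 s" "?M 1 s" "?M 2 s" "?M 3 s"] by (intro mult_right_mono) (auto simp: eval_nat_numeral)
      finally show "(\<Prod>i<6. ?W i s x) \<le> (\<Sum>i<4. ?M i s ^ 4) / 4 * ((?W 4 s x)\<^sup>2 / 2 + (?W 5 s x)\<^sup>2 / 2)" .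
    qed
    also have "\<dots> = ennreal ((\<Sum>i<4. ?M i s ^ 4) / 4 * ((\<Sum>n<K. (cmod (coef (F 4) n))\<^sup>2) / 2 + (\<Sum>n<K. (cmod (coef (F 5) n))\<^sup>2) / 2))"
    proof -
      have h: "has_bochner_integral lborel (\<lambda>x. (\<Sum>i<4. ?M i s ^ 4) / 4 * ((?W 4 s x)\<^sup>2 / 2 + (?W 5 s x)\<^sup>2 / 2))
         ((\<Sum>i<4. ?M i s ^ 4) / 4 * ((\<Sum>n<K. (cmod (coef (F 4) n))\<^sup>2) / 2 + (\<Sum>n<K. (cmod (coef (F 5) n))\<^sup>2) / 2))"
        by (intro has_bochner_integral_mult_right has_bochner_integral_add has_bochner_integral_divide hermite_wave_L2)
      show ?thesis unfolding has_bochner_integral_integral_eq[OF h, symmetric]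
        by (intro nn_integral_eq_integral integrable.intros[OF h] AE_I2 mult_nonneg_nonneg divide_nonneg_nonneg sum_nonneg) auto
    qed
    also have "\<dots> \<le> ennreal ((\<Sum>i<4. ?M i s ^ 4) / 4 * 1)"
      using sum_coef_le[OF F[of 4], of K] sum_coef_le[OF F[of 5], of K]
      by (intro ennreal_leI mult_left_mono) (auto intro!: sum_nonneg)
    also have "\<dots> = ennreal (\<Sum>i<4. 1/4 * ?M i s ^ 4)"
      by (simp add: sum_divide_distrib)
    also have "\<dots> = (\<Sum>i<4. ennreal (1/4) * ennreal (?M i s ^ 4))"
    proof -
      have "(\<Sum>i<4. ennreal (1/4) * ennreal (?M i s ^ 4)) = (\<Sum>i<4. ennreal (1/4 * ?M i s ^ 4))"
        by (intro sum.cong refl ennreal_mult[symmetric]) auto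
      then show ?thesis by (subst (asm) sum_ennreal) auto
    qed
    finally show ?thesis .
  qed
  have "ennreal (pi / 12 * cmod (six_trunc K F))
     \<le> (\<integral>\<^sup>+s. \<integral>\<^sup>+x. ennreal (indicator time_window s * (\<Prod>i<6. ?W i s x)) \<partial>lborel \<partial>lborel)"
    by (rule six_trunc_le_nn)
  also have "\<dots> \<le> (\<integral>\<^sup>+s. (\<Sum>i<4. ennreal (1/4) * ennreal (indicator {-2..2} s * ?M i s ^ 4)) \<partial>lborel)"
    using inner time_window_subset by (intro nn_integral_mono) (auto simp: indicator_def)
  also have "\<dots> = (\<Sum>i<4. ennreal (1/4) * (\<integral>\<^sup>+s. ennreal (indicator {-2..2} s * ?M i s ^ 4) \<partial>lborel))"
    by (subst nn_integral_sum) (auto simp: nn_integral_cmult)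
  also have "\<dots> \<le> (\<Sum>i<(4::nat). ennreal (1/4) * ennreal (1568 * 1))"
  proof (intro sum_mono mult_left_mono order_trans[OF strichartz] ennreal_leI)
    fix i :: nat assume "i \<in> {..<4}"
    then have "(\<Sum>n<K. (cmod (coef (F i) n))\<^sup>2)\<^sup>2 \<le> 1\<^sup>2"
      by (intro power_mono sum_coef_le F sum_nonneg) auto
    then show "(\<Sum>n<K. (cmod (coef (F i) n))\<^sup>2)\<^sup>2 \<le> 1" by simp
  qed simp_all
  also have "\<dots> = ennreal 1568"
  proof -
    have "(\<Sum>i<(4::nat). ennreal (1/4) * ennreal (1568 * 1)) = (\<Sum>i<(4::nat). ennreal 392)"
      by (subst ennreal_mult[symmetric]) simp_all
    also have "\<dots> = ennreal (\<Sum>i<(4::nat). 392)" by (rule sum_ennreal) simp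
    finally show ?thesis by simp
  qed
  finally have "ennreal (pi / 12 * cmod (six_trunc K F)) \<le> ennreal 1568" .
  from ennreal_le_iff[THEN iffD1, OF _ this] have "pi / 12 * cmod (six_trunc K F) \<le> 1568" by simp
  then show ?thesis by (simp add: six_const_def field_simps)
qed

section \<open>Smallness of the form against a high mode\<close>

definition low_modes :: "nat \<Rightarrow> L2 \<Rightarrow> bool" where
  "low_modes M f \<longleftrightarrow> (\<forall>n\<ge>M. coef f n = 0)"

definition high_modes :: "nat \<Rightarrow> L2 \<Rightarrow> bool" where
  "high_modes N f \<longleftrightarrow> (\<forall>n<N. coef f n = 0)"

text \<open>The square root of the decay of \<open>hermite_mass\<close>, since the high factor
  enters the estimate to the first power and its mass is quadratic.\<close>

definition decay_rate :: "nat \<Rightarrow> real" where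
  "decay_rate N = sqrt (1 / sqrt (2 * real N + 1))"

lemma decay_rate_pos: "decay_rate N > 0" by (simp add: decay_rate_def)

lemma decay_rate_tendsto: "decay_rate \<longlonglongrightarrow> 0"
  unfolding decay_rate_def[abs_def] by real_asymp

lemma hermite_mass_le_0: "hermite_mass n \<le> hermite_mass 0"
proof -
  have "hermite_mass n \<le> hermite_mass 0 / sqrt (2 * real n + 1)" by (rule hermite_mass_le)
  also have "\<dots> \<le> hermite_mass 0 / 1" using hermite_mass_pos[of 0] by (intro divide_left_mono) auto
  finally show ?thesis by simp
qed

lemma local_mass_high:
  assumes "high_modes N f" "norm f \<le> 1"
  shows "(\<Sum>n<K. (cmod (coef f n))\<^sup>2 * hermite_mass n) \<le> hermite_mass 0 * (decay_rate N)\<^sup>2"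
proof -
  have "(\<Sum>n<K. (cmod (coef f n))\<^sup>2 * hermite_mass n) \<le> (\<Sum>n<K. (cmod (coef f n))\<^sup>2 * (hermite_mass 0 * (decay_rate N)\<^sup>2))"
  proof (rule sum_mono)
    fix n
    show "(cmod (coef f n))\<^sup>2 * hermite_mass n \<le> (cmod (coef f n))\<^sup>2 * (hermite_mass 0 * (decay_rate N)\<^sup>2)"
    proof (cases "n < N")
      case False
      have "hermite_mass n \<le> hermite_mass 0 / sqrt (2 * real n + 1)" by (rule hermite_mass_le)
      also have "\<dots> \<le> hermite_mass 0 / sqrt (2 * real N + 1)"
        using False hermite_mass_pos[of 0] by (intro divide_left_mono) auto
      also have "\<dots> = hermite_mass 0 * (decay_rate N)\<^sup>2" by (simp add: decay_rate_def)
      finally show ?thesis by (rule mult_left_mono) simp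
    qed (use assms in \<open>simp add: high_modes_def\<close>)
  qed
  also have "\<dots> = (\<Sum>n<K. (cmod (coef f n))\<^sup>2) * (hermite_mass 0 * (decay_rate N)\<^sup>2)"
    by (rule sum_distrib_right[symmetric])
  also have "\<dots> \<le> 1 * (hermite_mass 0 * (decay_rate N)\<^sup>2)"
    using hermite_mass_pos[of 0] by (intro mult_right_mono sum_coef_le assms) auto
  finally show ?thesis by simp
qed

text \<open>The constant depends on \<open>M\<close> alone: only the modes below \<open>M\<close>
  contribute, each with coefficient at most 1, whatever the truncation and the time.\<close>

lemma low_wave_bound:
  obtains A where "A \<ge> 0" "\<And>K f s x. low_modes M f \<Longrightarrow> norm f \<le> 1 \<Longrightarrow> cmod (wave K f s x) \<le> A * exp (- (x\<^sup>2 / 4))"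
proof -
  have "\<forall>n. \<exists>B. B \<ge> 0 \<and> (\<forall>x. \<bar>hermite_fun n x\<bar> \<le> B * exp (- (x\<^sup>2 / 4)))"
    using hermite_fun_quarter_bound by metis
  then obtain B where B: "\<And>n. B n \<ge> 0" "\<And>n x. \<bar>hermite_fun n x\<bar> \<le> B n * exp (- (x\<^sup>2 / 4))" by metis
  show ?thesis
  proof (rule that[of "\<Sum>n<M. B n"])
    show "(\<Sum>n<M. B n) \<ge> 0" using B by (intro sum_nonneg) auto
    fix K f s x assume f: "low_modes M f" "norm f \<le> 1"
    have "cmod (wave K f s x) \<le> (\<Sum>n<K. cmod (coef f n) * \<bar>hermite_fun n x\<bar>)"
      unfolding hermite_wave_def by (intro order_trans[OF norm_sum] sum_mono) (simp add: norm_mult)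
    also have "\<dots> = (\<Sum>n\<in>{..<K} \<inter> {..<M}. cmod (coef f n) * \<bar>hermite_fun n x\<bar>)"
      using f(1) by (intro sum.mono_neutral_right) (auto simp: low_modes_def, meson not_le)
    also have "\<dots> \<le> (\<Sum>n\<in>{..<K} \<inter> {..<M}. 1 * (B n * exp (- (x\<^sup>2 / 4))))"
      using B f(2) by (intro sum_mono mult_mono order_trans[OF norm_coef_le]) auto
    also have "\<dots> \<le> (\<Sum>n<M. 1 * (B n * exp (- (x\<^sup>2 / 4))))"
      using B(1) by (intro sum_mono2) auto
    finally show "cmod (wave K f s x) \<le> (\<Sum>n<M. B n) * exp (- (x\<^sup>2 / 4))" by (simp add: sum_distrib_right)
  qed
qed

text \<open>Against four well-localised factors, a high mode only sees the small mass
  \<open>hermite_mass\<close> that it puts near the origin.\<close>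

lemma six_trunc_small_unit:
  obtains D where "D \<ge> 0" "\<And>K F N i. i < 5 \<Longrightarrow> (\<And>j. j < 6 \<Longrightarrow> norm (F j) \<le> 1) \<Longrightarrow>
     (\<And>j. j < 5 \<Longrightarrow> j \<noteq> i \<Longrightarrow> low_modes M (F j)) \<Longrightarrow> high_modes N (F 5) \<Longrightarrow>
     cmod (six_trunc K F) \<le> D * decay_rate N"
proof -
  obtain A where A: "A \<ge> 0" "\<And>K f s x. low_modes M f \<Longrightarrow> norm f \<le> 1 \<Longrightarrow> cmod (wave K f s x) \<le> A * exp (- (x\<^sup>2 / 4))"
    using low_wave_bound by blast
  define D where "D = 6 * A ^ 4 * hermite_mass 0"
  show ?thesis
  proof (rule that[of D])
    show "D \<ge> 0" using A hermite_mass_pos[of 0] by (simp add: D_def)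
    fix K F N and i :: nat
    assume i: "i < 5" and F: "\<And>j. j < 6 \<Longrightarrow> norm (F j) \<le> 1"
      and low: "\<And>j. j < 5 \<Longrightarrow> j \<noteq> i \<Longrightarrow> low_modes M (F j)" and high: "high_modes N (F 5)"
    define e where "e = decay_rate N"
    have e: "e > 0" by (simp add: e_def decay_rate_pos)
    let ?W = "\<lambda>i s x. cmod (wave K (F i) s x)"
    let ?m = "\<lambda>i s x. indicator time_window s * (exp (- x\<^sup>2) * (?W i s x)\<^sup>2)"
    \<comment> \<open>The four low factors supply the weight \<open>exp (- x\<^sup>2)\<close>. The
      free factor in slot \<open>i\<close> and the high one in slot 5 are separated by a weighted
      mean; the weight \<open>e\<close> makes both resulting terms of order \<open>e\<close>,
      because the mass of the high factor is of order \<open>e^2\<close>.\<close>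
    have "(\<Prod>j<6. ?W j s x) \<le> A ^ 4 * e / 2 * (exp (- x\<^sup>2) * (?W i s x)\<^sup>2) + A ^ 4 / (2 * e) * (exp (- x\<^sup>2) * (?W 5 s x)\<^sup>2)" for s x
    proof -
      have split: "{..<6} = insert i (insert 5 ({..<5} - {i}))" using i by auto
      have "(\<Prod>j<6. ?W j s x) = ?W i s x * (?W 5 s x * (\<Prod>j\<in>{..<5} - {i}. ?W j s x))"
        unfolding split using i by (subst prod.insert; simp)+
      also have "\<dots> \<le> ?W i s x * (?W 5 s x * (\<Prod>j\<in>{..<5} - {i}. A * exp (- (x\<^sup>2 / 4))))"
        using low F by (intro mult_left_mono prod_mono) (auto intro!: A(2))
      also have "(\<Prod>j\<in>{..<5} - {i}. A * exp (- (x\<^sup>2 / 4))) = A ^ 4 * exp (- x\<^sup>2)"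
      proof -
        have "card ({..<5} - {i}) = 4" using i by simp
        moreover have "exp (- (x\<^sup>2 / 4)) ^ 4 = exp (- x\<^sup>2)" by (simp flip: exp_of_nat_mult)
        ultimately show ?thesis by (simp add: power_mult_distrib)
      qed
      also have "?W i s x * (?W 5 s x * (A ^ 4 * exp (- x\<^sup>2))) = A ^ 4 * exp (- x\<^sup>2) * (?W i s x * ?W 5 s x)"
        by (simp add: mult_ac)
      also have "\<dots> \<le> A ^ 4 * exp (- x\<^sup>2) * (e / 2 * (?W i s x)\<^sup>2 + (?W 5 s x)\<^sup>2 / (2 * e))"
      proof (rule mult_left_mono)
        have "2 * (e * ?W i s x) * ?W 5 s x \<le> (e * ?W i s x)\<^sup>2 + (?W 5 s x)\<^sup>2" by (rule sum_squares_bound)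
        then show "?W i s x * ?W 5 s x \<le> e / 2 * (?W i s x)\<^sup>2 + (?W 5 s x)\<^sup>2 / (2 * e)"
          using e by (simp add: field_simps power2_eq_square)
      qed simp
      finally show ?thesis by (simp add: algebra_simps)
    qed
    then have pw: "ennreal (indicator time_window s * (\<Prod>j<6. ?W j s x))
       \<le> ennreal (A ^ 4 * e / 2) * ennreal (?m i s x) + ennreal (A ^ 4 / (2 * e)) * ennreal (?m 5 s x)" for s x
      using e A(1) by (auto simp: indicator_def ennreal_mult[symmetric] ennreal_plus[symmetric] intro!: ennreal_leI simp del: ennreal_plus)
    have mm: "(\<lambda>x. ennreal (?m j s x)) \<in> borel_measurable borel" for j s
      by (intro measurable_compose[OF _ measurable_ennreal] borel_measurable_times borel_measurable_continuous_onI continuous_intros)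
    have mm2: "(\<lambda>(s, x). ennreal (?m j s x)) \<in> borel_measurable (lborel \<Otimes>\<^sub>M lborel)" for j
      unfolding hermite_wave_def by measurable
    have mi: "(\<lambda>s. \<integral>\<^sup>+x. ennreal (?m j s x) \<partial>lborel) \<in> borel_measurable lborel" for j
      using lborel.borel_measurable_nn_integral_fst[OF mm2[of j]] by simp
    have "ennreal (pi / 12 * cmod (six_trunc K F))
       \<le> (\<integral>\<^sup>+s. \<integral>\<^sup>+x. ennreal (indicator time_window s * (\<Prod>j<6. ?W j s x)) \<partial>lborel \<partial>lborel)"
      by (rule six_trunc_le_nn)
    also have "\<dots> \<le> (\<integral>\<^sup>+s. \<integral>\<^sup>+x. ennreal (A ^ 4 * e / 2) * ennreal (?m i s x) + ennreal (A ^ 4 / (2 * e)) * ennreal (?m 5 s x) \<partial>lborel \<partial>lborel)"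
      by (intro nn_integral_mono pw)
    also have "\<dots> = ennreal (A ^ 4 * e / 2) * (\<integral>\<^sup>+s. \<integral>\<^sup>+x. ennreal (?m i s x) \<partial>lborel \<partial>lborel)
        + ennreal (A ^ 4 / (2 * e)) * (\<integral>\<^sup>+s. \<integral>\<^sup>+x. ennreal (?m 5 s x) \<partial>lborel \<partial>lborel)"
      using mm mi by (simp add: nn_integral_add nn_integral_cmult)
    also have "\<dots> = ennreal (A ^ 4 * e / 2) * ennreal (pi / 2 * (\<Sum>n<K. (cmod (coef (F i) n))\<^sup>2 * hermite_mass n))
        + ennreal (A ^ 4 / (2 * e)) * ennreal (pi / 2 * (\<Sum>n<K. (cmod (coef (F 5) n))\<^sup>2 * hermite_mass n))"
      by (simp only: hermite_wave_local_mass)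
    also have "\<dots> \<le> ennreal (A ^ 4 * e / 2) * ennreal (pi / 2 * hermite_mass 0)
        + ennreal (A ^ 4 / (2 * e)) * ennreal (pi / 2 * (hermite_mass 0 * e\<^sup>2))"
    proof (intro add_mono mult_left_mono ennreal_leI)
      have "(\<Sum>n<K. (cmod (coef (F i) n))\<^sup>2 * hermite_mass n) \<le> (\<Sum>n<K. (cmod (coef (F i) n))\<^sup>2 * hermite_mass 0)"
        by (intro sum_mono mult_left_mono hermite_mass_le_0) simp
      also have "\<dots> = (\<Sum>n<K. (cmod (coef (F i) n))\<^sup>2) * hermite_mass 0" by (rule sum_distrib_right[symmetric])
      also have "\<dots> \<le> 1 * hermite_mass 0"
        using hermite_mass_pos[of 0] i by (intro mult_right_mono sum_coef_le F) auto
      finally show "(\<Sum>n<K. (cmod (coef (F i) n))\<^sup>2 * hermite_mass n) \<le> hermite_mass 0" by simp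
      show "(\<Sum>n<K. (cmod (coef (F 5) n))\<^sup>2 * hermite_mass n) \<le> hermite_mass 0 * e\<^sup>2"
        unfolding e_def by (intro local_mass_high high F) simp
    qed auto
    also have "\<dots> = ennreal (A ^ 4 * e / 2 * (pi / 2 * hermite_mass 0) + A ^ 4 / (2 * e) * (pi / 2 * (hermite_mass 0 * e\<^sup>2)))"
      using A(1) e hermite_mass_pos[of 0] by (intro ennreal_mult_add) auto
    also have "A ^ 4 * e / 2 * (pi / 2 * hermite_mass 0) + A ^ 4 / (2 * e) * (pi / 2 * (hermite_mass 0 * e\<^sup>2)) = pi / 12 * (D * e)"
      using e by (simp add: D_def power2_eq_square field_simps)
    finally have "pi / 12 * cmod (six_trunc K F) \<le> pi / 12 * (D * e)"
      using \<open>D \<ge> 0\<close> e by simp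
    then show "cmod (six_trunc K F) \<le> D * decay_rate N" by (simp add: e_def)
  qed
qed

section \<open>Homogeneity and additivity in each slot\<close>

lemma six_trunc_scale:
  assumes "\<And>i. i < 6 \<Longrightarrow> F i = of_real (a i) *\<^sub>C G i"
  shows "six_trunc K F = of_real (\<Prod>i<6. a i) * six_trunc K G"
proof -
  have "(\<Prod>i<6. slot_conj i (coef (F i) (\<nu> i))) = of_real (\<Prod>i<6. a i) * (\<Prod>i<6. slot_conj i (coef (G i) (\<nu> i)))" for \<nu>
    using assms by (simp add: of_real_prod prod.distrib[symmetric])
  then show ?thesis
    unfolding six_trunc_def sum_distrib_left by (intro sum.cong refl) (simp add: mult_ac)
qed

text \<open>A zero slot does no harm: \<open>inverse 0 = 0\<close> normalises it to the zero vector,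
  and the factorisation remains correct.\<close>

lemma six_trunc_le_of_unit:
  assumes "cmod (six_trunc K (\<lambda>i. of_real (inverse (norm (F i))) *\<^sub>C F i)) \<le> D"
  shows "cmod (six_trunc K F) \<le> D * (\<Prod>i<6. norm (F i))"
proof -
  have eq: "six_trunc K F = of_real (\<Prod>i<6. norm (F i)) * six_trunc K (\<lambda>i. of_real (inverse (norm (F i))) *\<^sub>C F i)"
  proof (rule six_trunc_scale)
    fix i
    show "F i = complex_of_real (norm (F i)) *\<^sub>C of_real (inverse (norm (F i))) *\<^sub>C F i"
      by (cases "F i = 0") (auto simp: scaleC_scaleC simp flip: scaleR_L2_eq)
  qed
  have P: "(\<Prod>i<6. norm (F i)) \<ge> 0" by (intro prod_nonneg) auto
  show ?thesis
    unfolding eq norm_mult norm_of_real abs_of_nonneg[OF P]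
    using mult_right_mono[OF assms P] by (simp only: mult.commute)
qed

lemma norm_normalise: "norm (complex_of_real (inverse (norm f)) *\<^sub>C f) \<le> 1"
  by (cases "f = 0") (auto simp: norm_scaleC norm_inverse)

lemma six_trunc_bound: "cmod (six_trunc K F) \<le> six_const * (\<Prod>i<6. norm (F i))"
  by (intro six_trunc_le_of_unit six_trunc_bound_unit norm_normalise)

lemma six_trunc_small:
  obtains D where "D \<ge> 0" "\<And>K F N i. i < 5 \<Longrightarrow>
     (\<And>j. j < 5 \<Longrightarrow> j \<noteq> i \<Longrightarrow> low_modes M (F j)) \<Longrightarrow> high_modes N (F 5) \<Longrightarrow>
     cmod (six_trunc K F) \<le> D * decay_rate N * (\<Prod>i<6. norm (F i))"
proof -
  obtain D where D: "D \<ge> 0" "\<And>K F N i. i < 5 \<Longrightarrow> (\<And>j. j < 6 \<Longrightarrow> norm (F j) \<le> 1) \<Longrightarrow>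
     (\<And>j. j < 5 \<Longrightarrow> j \<noteq> i \<Longrightarrow> low_modes M (F j)) \<Longrightarrow> high_modes N (F 5) \<Longrightarrow>
     cmod (six_trunc K F) \<le> D * decay_rate N"
    using six_trunc_small_unit by blast
  show ?thesis
  proof (rule that[OF D(1)])
    fix K F N and i :: nat
    assume "i < 5" "\<And>j. j < 5 \<Longrightarrow> j \<noteq> i \<Longrightarrow> low_modes M (F j)" "high_modes N (F 5)"
    then show "cmod (six_trunc K F) \<le> D * decay_rate N * (\<Prod>i<6. norm (F i))"
      by (intro six_trunc_le_of_unit D(2)[of i] norm_normalise) (auto simp: low_modes_def high_modes_def)
  qed
qed

lemma prod_slot_upd:
  fixes g :: "nat \<Rightarrow> 'a \<Rightarrow> 'b::comm_monoid_mult"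
  assumes "i < k"
  shows "(\<Prod>j<k. g j ((F(i := z)) j)) = g i z * (\<Prod>j\<in>{..<k} - {i}. g j (F j))"
proof -
  have "(\<Prod>j<k. g j ((F(i := z)) j)) = g i ((F(i := z)) i) * (\<Prod>j\<in>{..<k} - {i}. g j ((F(i := z)) j))"
    using assms by (intro prod.remove) auto
  also have "(\<Prod>j\<in>{..<k} - {i}. g j ((F(i := z)) j)) = (\<Prod>j\<in>{..<k} - {i}. g j (F j))"
    by (intro prod.cong) auto
  finally show ?thesis by simp
qed

lemma six_trunc_add:
  assumes "i < 6"
  shows "six_trunc K (F(i := x + y)) = six_trunc K (F(i := x)) + six_trunc K (F(i := y))"
proof -
  have "(\<Prod>j<6. slot_conj j (coef ((F(i := x + y)) j) (\<nu> j)))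
     = (\<Prod>j<6. slot_conj j (coef ((F(i := x)) j) (\<nu> j))) + (\<Prod>j<6. slot_conj j (coef ((F(i := y)) j) (\<nu> j)))" for \<nu>
    unfolding prod_slot_upd[OF assms, of "\<lambda>j z. slot_conj j (coef z (\<nu> j))"] by (simp add: ring_distribs)
  then show ?thesis
    unfolding six_trunc_def distrib_left[symmetric] sum.distrib[symmetric]
    by (intro arg_cong2[where f="(*)"] sum.cong refl) (simp add: ring_distribs)
qed

lemma six_trunc_slot_scale:
  assumes "i < 6"
  shows "six_trunc K (F(i := c *\<^sub>C x)) = slot_conj i c * six_trunc K (F(i := x))"
proof -
  have "(\<Prod>j<6. slot_conj j (coef ((F(i := c *\<^sub>C x)) j) (\<nu> j)))
     = slot_conj i c * (\<Prod>j<6. slot_conj j (coef ((F(i := x)) j) (\<nu> j)))" for \<nu>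
    unfolding prod_slot_upd[OF assms, of "\<lambda>j z. slot_conj j (coef z (\<nu> j))"] by (simp add: mult.assoc)
  then show ?thesis
    unfolding six_trunc_def sum_distrib_left
    by (intro sum.cong refl) (simp add: mult_ac)
qed

text \<open>The hybrids carry \<open>G\<close> in the slots below \<open>j\<close> and
  \<open>F\<close> above. The number \<open>k\<close> of exchanged slots varies: 6 for the whole
  form, 5 when the test slot is held fixed.\<close>

lemma telescope_slots:
  fixes T :: "(nat \<Rightarrow> L2) \<Rightarrow> complex"
  assumes add: "\<And>F i x y. i < k \<Longrightarrow> T (F(i := x + y)) = T (F(i := x)) + T (F(i := y))"
    and eq: "\<And>i. i \<ge> k \<Longrightarrow> F i = G i"
  shows "T F - T G = (\<Sum>j<k. T ((\<lambda>i. if i < j then G i else F i)(j := F j - G j)))"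
proof -
  define H where "H j = (\<lambda>i. if i < j then G i else F i)" for j
  have "T (H j) - T (H (Suc j)) = T ((H j)(j := F j - G j))" if "j < k" for j
  proof -
    have "T ((H j)(j := (F j - G j) + G j)) = T ((H j)(j := F j - G j)) + T ((H j)(j := G j))"
      by (rule add[OF that])
    moreover have "(H j)(j := (F j - G j) + G j) = H j" by (auto simp: H_def)
    moreover have "(H j)(j := G j) = H (Suc j)" by (auto simp: H_def less_Suc_eq)
    ultimately show ?thesis by simp
  qed
  then have "(\<Sum>j<k. T ((H j)(j := F j - G j))) = (\<Sum>j<k. T (H j) - T (H (Suc j)))"
    by (intro sum.cong) auto
  also have "\<dots> = T (H 0) - T (H k)" by (rule sum_lessThan_telescope')
  also have "H 0 = F" by (simp add: H_def)
  also have "H k = G" using eq by (auto simp: H_def fun_eq_iff)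
  finally have *: "(\<Sum>j<k. T ((H j)(j := F j - G j))) = T F - T G" .
  show ?thesis using *[unfolded H_def] by (rule sym)
qed

section \<open>Removing the truncation\<close>

definition mode_cut :: "nat \<Rightarrow> L2 \<Rightarrow> L2" where
  "mode_cut K = multiplier (\<lambda>n. if n < K then 1 else 0)"

lemma coef_mode_cut [simp]: "coef (mode_cut K f) n = (if n < K then coef f n else 0)"
  unfolding mode_cut_def by (subst coef_multiplier[of _ 1]) auto

lemma norm_mode_cut: "norm (mode_cut K f) \<le> norm f"
  unfolding mode_cut_def by (rule order_trans[OF norm_multiplier[of _ 1]]) auto

lemma mode_cut_eq: "mode_cut K f = (\<Sum>n<K. coef f n *\<^sub>C hermite_L2 n)"
  by (rule L2_eqI) (simp add: coef_sum coef_hermite_L2 if_distrib cong: if_cong)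

lemma mode_cut_tendsto: "(\<lambda>K. mode_cut K f) \<longlonglongrightarrow> f"
  unfolding mode_cut_eq using coef_sums[of f] by (simp add: sums_def)

lemma six_trunc_cut:
  assumes "K \<le> L"
  shows "six_trunc L (\<lambda>i. mode_cut K (F i)) = six_trunc K F"
proof -
  let ?t = "\<lambda>\<nu>. if resonant \<nu> then (\<Prod>i<6. slot_conj i (coef (mode_cut K (F i)) (\<nu> i))) * of_real (hermite_six \<nu>) else 0"
  have "(\<Sum>\<nu>\<in>six_modes L. ?t \<nu>) = (\<Sum>\<nu>\<in>six_modes K. ?t \<nu>)"
  proof (rule sum.mono_neutral_right)
    show "finite (six_modes L)" by (rule finite_six_modes)
    show "six_modes K \<subseteq> six_modes L" using assms by (intro PiE_mono) auto
    show "\<forall>\<nu>\<in>six_modes L - six_modes K. ?t \<nu> = 0"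
    proof
      fix \<nu> assume \<nu>: "\<nu> \<in> six_modes L - six_modes K"
      then obtain i where "i < 6" "\<not> \<nu> i < K" by (auto simp: PiE_iff)
      then have "(\<Prod>i<6. slot_conj i (coef (mode_cut K (F i)) (\<nu> i))) = 0"
        by (intro prod_zero) (auto intro!: bexI[of _ i])
      then show "?t \<nu> = 0" by simp
    qed
  qed
  also have "\<dots> = (\<Sum>\<nu>\<in>six_modes K. if resonant \<nu> then (\<Prod>i<6. slot_conj i (coef (F i) (\<nu> i))) * of_real (hermite_six \<nu>) else 0)"
  proof (rule sum.cong[OF refl])
    fix \<nu> assume \<nu>: "\<nu> \<in> six_modes K"
    then have "(\<Prod>i<6. slot_conj i (coef (mode_cut K (F i)) (\<nu> i))) = (\<Prod>i<6. slot_conj i (coef (F i) (\<nu> i)))"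
      by (intro prod.cong) (auto simp: PiE_iff)
    then show "?t \<nu> = (if resonant \<nu> then (\<Prod>i<6. slot_conj i (coef (F i) (\<nu> i))) * of_real (hermite_six \<nu>) else 0)" by simp
  qed
  finally show ?thesis unfolding six_trunc_def by simp
qed

lemma six_trunc_outside:
  assumes "\<And>i. i < 6 \<Longrightarrow> F i = G i" shows "six_trunc K F = six_trunc K G"
proof -
  have eq: "(\<Prod>i<6. slot_conj i (coef (F i) (\<nu> i))) = (\<Prod>i<6. slot_conj i (coef (G i) (\<nu> i)))" for \<nu>
    using assms by (intro prod.cong) auto
  show ?thesis unfolding six_trunc_def eq by (rule refl)
qed

definition six :: "(nat \<Rightarrow> L2) \<Rightarrow> complex" where
  "six F = lim (\<lambda>K. six_trunc K F)"

lemma prod_norm_slot_le: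
  fixes H :: "nat \<Rightarrow> L2"
  assumes "j < k" "\<And>i. i < k \<Longrightarrow> norm (H i) \<le> R"
  shows "(\<Prod>i<k. norm ((H(j := z)) i)) \<le> norm z * R ^ (k - 1)"
proof -
  have "(\<Prod>i<k. norm ((H(j := z)) i)) = norm z * (\<Prod>i\<in>{..<k} - {j}. norm (H i))"
    by (rule prod_slot_upd[OF assms(1)])
  also have "\<dots> \<le> norm z * (\<Prod>i\<in>{..<k} - {j}. R)"
    using assms by (intro mult_left_mono prod_mono) auto
  also have "(\<Prod>i\<in>{..<k} - {j}. R) = R ^ (k - 1)" using assms(1) by simp
  finally show ?thesis .
qed

text \<open>Truncating the form at \<open>K\<close> equals applying a longer truncation to vectors
  cut at \<open>K\<close>. Two truncations thus differ by replacing each slot by its cut version,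
  and the uniform bound makes the sequence Cauchy.\<close>

lemma six_trunc_tendsto: "(\<lambda>K. six_trunc K F) \<longlonglongrightarrow> six F"
proof -
  define R where "R = (\<Sum>i<6. norm (F i))"
  have R: "norm (F i) \<le> R" if "i < 6" for i unfolding R_def using that by (intro member_le_sum) auto
  define e where "e K = six_const * R ^ 5 * (\<Sum>j<6. norm (F j - mode_cut K (F j)))" for K
  have e: "e \<longlonglongrightarrow> six_const * R ^ 5 * (\<Sum>j<(6::nat). norm (F j - F j))"
    unfolding e_def[abs_def] by (intro tendsto_intros mode_cut_tendsto)
  have le: "cmod (six_trunc L F - six_trunc K F) \<le> e K" if "K \<le> L" for K L
  proof -
    define G where "G i = (if i < 6 then mode_cut K (F i) else F i)" for i
    have "six_trunc K F = six_trunc L G"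
      using six_trunc_cut[OF that, of F] six_trunc_outside[of G "\<lambda>i. mode_cut K (F i)" L] by (simp add: G_def)
    then have "six_trunc L F - six_trunc K F = (\<Sum>j<6. six_trunc L ((\<lambda>i. if i < j then G i else F i)(j := F j - G j)))"
      by (simp only:) (rule telescope_slots, rule six_trunc_add, assumption, simp add: G_def)
    also have "cmod \<dots> \<le> (\<Sum>j<6. six_const * (norm (F j - mode_cut K (F j)) * R ^ 5))"
    proof (rule order_trans[OF norm_sum sum_mono])
      fix j :: nat assume j: "j \<in> {..<6}"
      have "cmod (six_trunc L ((\<lambda>i. if i < j then G i else F i)(j := F j - G j)))
          \<le> six_const * (\<Prod>i<6. norm (((\<lambda>i. if i < j then G i else F i)(j := F j - G j)) i))"
        by (rule six_trunc_bound)
      also have "\<dots> \<le> six_const * (norm (F j - G j) * R ^ (6 - 1))"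
        using j R six_const_pos
        by (intro mult_left_mono prod_norm_slot_le) (auto simp: G_def intro: order_trans[OF norm_mode_cut])
      finally show "cmod (six_trunc L ((\<lambda>i. if i < j then G i else F i)(j := F j - G j)))
         \<le> six_const * (norm (F j - mode_cut K (F j)) * R ^ 5)" using j by (simp add: G_def)
    qed
    also have "\<dots> = e K" by (simp add: e_def sum_distrib_left mult_ac)
    finally show ?thesis .
  qed
  have "Cauchy (\<lambda>K. six_trunc K F)"
  proof (rule metric_CauchyI)
    fix \<epsilon> :: real assume "\<epsilon> > 0"
    then have "eventually (\<lambda>K. e K < \<epsilon> / 2) sequentially" using e by (intro order_tendstoD(2)) auto
    then obtain N where N: "e N < \<epsilon> / 2" by (auto simp: eventually_sequentially)
    have "dist (six_trunc m F) (six_trunc n F) < \<epsilon>" if "m \<ge> N" "n \<ge> N" for m n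
    proof -
      have "dist (six_trunc m F) (six_trunc n F) \<le> dist (six_trunc m F) (six_trunc N F) + dist (six_trunc n F) (six_trunc N F)"
        by (rule dist_triangle2)
      also have "\<dots> \<le> e N + e N" unfolding dist_norm using le that by (intro add_mono) auto
      finally show ?thesis using N by simp
    qed
    then show "\<exists>M. \<forall>m\<ge>M. \<forall>n\<ge>M. dist (six_trunc m F) (six_trunc n F) < \<epsilon>" by blast
  qed
  then show ?thesis unfolding six_def by (simp add: Cauchy_convergent_iff convergent_LIMSEQ_iff)
qed

lemma six_eqI: "(\<lambda>K. six_trunc K F) \<longlonglongrightarrow> l \<Longrightarrow> six F = l"
  using six_trunc_tendsto LIMSEQ_unique by blast

lemma six_add: "i < 6 \<Longrightarrow> six (F(i := x + y)) = six (F(i := x)) + six (F(i := y))"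
  by (rule six_eqI) (simp only: six_trunc_add, intro tendsto_intros six_trunc_tendsto)

lemma six_slot_scale: "i < 6 \<Longrightarrow> six (F(i := c *\<^sub>C x)) = slot_conj i c * six (F(i := x))"
  by (rule six_eqI) (simp only: six_trunc_slot_scale, intro tendsto_intros six_trunc_tendsto)

lemma six_leI:
  assumes "\<And>K. cmod (six_trunc K F) \<le> B" shows "cmod (six F) \<le> B"
  by (rule LIMSEQ_le_const2[OF tendsto_norm[OF six_trunc_tendsto]]) (use assms in blast)

lemma six_bound: "cmod (six F) \<le> six_const * (\<Prod>i<6. norm (F i))"
  by (rule six_leI) (rule six_trunc_bound)

lemma six_small:
  obtains D where "D \<ge> 0" "\<And>F N i. i < 5 \<Longrightarrow>
     (\<And>j. j < 5 \<Longrightarrow> j \<noteq> i \<Longrightarrow> low_modes M (F j)) \<Longrightarrow> high_modes N (F 5) \<Longrightarrow>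
     cmod (six F) \<le> D * decay_rate N * (\<Prod>i<6. norm (F i))"
  using six_trunc_small[of M] six_leI by metis

text \<open>Resonance bounds the index in slot 5 by the sum of the three plain indices, which stays
  below \<open>3 * M\<close> when each of them is below \<open>M\<close>.\<close>

lemma six_high_zero:
  assumes low: "\<And>j. j < 3 \<Longrightarrow> low_modes M (F j)" and high: "high_modes (3 * M) (F 5)"
  shows "six F = 0"
proof (rule six_eqI)
  have "six_trunc K F = 0" for K
  proof -
    have "(\<Prod>i<6. slot_conj i (coef (F i) (\<nu> i))) = 0" if "resonant \<nu>" for \<nu>
    proof (cases "\<nu> 0 < M \<and> \<nu> 1 < M \<and> \<nu> 2 < M")
      case True
      then have "\<nu> 5 < 3 * M" using that by (auto simp: resonant_def)
      then have "coef (F 5) (\<nu> 5) = 0" using high by (simp add: high_modes_def)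
      then show ?thesis by (intro prod_zero bexI[of _ 5]) auto
    next
      case False
      have "\<exists>j<3. M \<le> \<nu> j"
      proof (rule ccontr)
        assume "\<not> (\<exists>j<3. M \<le> \<nu> j)"
        then have "\<nu> j < M" if "j < 3" for j using that by (meson not_le)
        from this[of 0] this[of 1] this[of 2] show False using False by simp
      qed
      then obtain j where j: "j < 3" "\<nu> j \<ge> M" by blast
      then have "coef (F j) (\<nu> j) = 0" using low[of j] by (simp add: low_modes_def)
      then show ?thesis using j by (intro prod_zero bexI[of _ j]) auto
    qed
    then show ?thesis unfolding six_trunc_def by (simp add: sum.neutral)
  qed
  then show "(\<lambda>K. six_trunc K F) \<longlonglongrightarrow> 0" by simp
qed

text \<open>Up to the scalar \<open>e^(-\<mu>)\<close> this is \<open>e^(-\<mu> H)\<close>. Dropping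
  the scalar is consistent because there are as many plain as conjugated slots.\<close>

definition dilate :: "real \<Rightarrow> L2 \<Rightarrow> L2" where
  "dilate r = multiplier (\<lambda>n. of_real (r ^ n))"

lemma coef_dilate: "0 \<le> r \<Longrightarrow> r \<le> 1 \<Longrightarrow> coef (dilate r f) n = of_real (r ^ n) * coef f n"
  unfolding dilate_def by (rule coef_multiplier[of _ 1]) (simp add: power_le_one norm_power)

lemma norm_dilate: "0 \<le> r \<Longrightarrow> r \<le> 1 \<Longrightarrow> norm (dilate r f) \<le> norm f"
  unfolding dilate_def by (rule order_trans[OF norm_multiplier[of _ 1]]) (auto simp: power_le_one norm_power)

text \<open>The resonance condition makes the form invariant under the complex-time flow
  \<open>e\<^bsup>-\<mu>H\<^esup>\<close>, \<open>r = e\<^bsup>-2\<mu>\<^esup>\<close>: this replaces the regularised exponential weights of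
  the usual bootstrap argument.\<close>

lemma six_dilate:
  assumes r: "0 \<le> r" "r \<le> 1"
  shows "six (\<lambda>i. if i < 3 then dilate r (F i) else F i) = six (\<lambda>i. if i < 3 then F i else dilate r (F i))"
proof -
  have eq: "(\<Prod>i<6. slot_conj i (coef (if i < 3 then dilate r (F i) else F i) (\<nu> i)))
     = (\<Prod>i<6. slot_conj i (coef (if i < 3 then F i else dilate r (F i)) (\<nu> i)))" if res: "resonant \<nu>" for \<nu>
  proof -
    have "(\<Prod>i<6. slot_conj i (coef (if i < 3 then dilate r (F i) else F i) (\<nu> i)))
        = of_real (r ^ (\<nu> 0 + \<nu> 1 + \<nu> 2)) * (\<Prod>i<6. slot_conj i (coef (F i) (\<nu> i)))"
      unfolding six_expand by (simp add: coef_dilate[OF r] power_add mult_ac flip: of_real_power)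
    moreover have "(\<Prod>i<6. slot_conj i (coef (if i < 3 then F i else dilate r (F i)) (\<nu> i)))
        = of_real (r ^ (\<nu> 3 + \<nu> 4 + \<nu> 5)) * (\<Prod>i<6. slot_conj i (coef (F i) (\<nu> i)))"
      unfolding six_expand by (simp add: coef_dilate[OF r] power_add mult_ac flip: of_real_power)
    ultimately show ?thesis using res by (simp add: resonant_def)
  qed
  have "six_trunc K (\<lambda>i. if i < 3 then dilate r (F i) else F i) = six_trunc K (\<lambda>i. if i < 3 then F i else dilate r (F i))" for K
    unfolding six_trunc_def
  proof (intro arg_cong2[where f="(*)"] sum.cong refl)
    fix \<nu> :: "nat \<Rightarrow> nat"
    show "(if resonant \<nu> then (\<Prod>i<6. slot_conj i (coef (if i < 3 then dilate r (F i) else F i) (\<nu> i))) * of_real (hermite_six \<nu>) else 0)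
      = (if resonant \<nu> then (\<Prod>i<6. slot_conj i (coef (if i < 3 then F i else dilate r (F i)) (\<nu> i))) * of_real (hermite_six \<nu>) else 0)"
    proof (cases "resonant \<nu>")
      case True
      show ?thesis unfolding eq[OF True] by (rule refl)
    qed (simp only: if_False)
  qed
  then show ?thesis by (simp add: six_def)
qed

section \<open>The quintic operator\<close>

text \<open>Duality without completing a functional: on the vector \<open>g\<close> whose
  coefficients are the values of \<open>\<phi>\<close> on the modes \<open>n \<ge> N\<close>,
  antilinearity makes \<open>\<phi> g\<close> equal to the squared norm of \<open>g\<close>, and the
  bound on \<open>\<phi>\<close> then limits that norm.\<close>

lemma antilinear_coef_sum_le:
  fixes \<phi> :: "L2 \<Rightarrow> complex"
  assumes add: "\<And>x y. \<phi> (x + y) = \<phi> x + \<phi> y" and scale: "\<And>c x. \<phi> (c *\<^sub>C x) = cnj c * \<phi> x"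
    and bound: "\<And>g. high_modes N g \<Longrightarrow> cmod (\<phi> g) \<le> B * norm g" and B: "B \<ge> 0"
  shows "(\<Sum>n<K. (cmod (if n < N then 0 else \<phi> (hermite_L2 n)))\<^sup>2) \<le> B\<^sup>2"
proof -
  define c where "c n = (if n < N then 0 else \<phi> (hermite_L2 n))" for n
  define g where "g = (\<Sum>n<K. c n *\<^sub>C hermite_L2 n)"
  have zero: "\<phi> 0 = 0" using add[of 0 0] by simp
  have "\<phi> g = (\<Sum>n<K. \<phi> (c n *\<^sub>C hermite_L2 n))"
    unfolding g_def by (induction K) (simp_all add: zero add)
  also have "\<dots> = (\<Sum>n<K. complex_of_real ((cmod (c n))\<^sup>2))"
    by (intro sum.cong refl) (simp add: scale c_def mult_cnj_cmod)
  finally have "cmod (\<phi> g) = (\<Sum>n<K. (cmod (c n))\<^sup>2)"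
    by (simp only: of_real_sum[symmetric] norm_of_real) (simp add: sum_nonneg)
  also have "\<dots> = (norm g)\<^sup>2" unfolding g_def by (simp add: norm_sum_hermite_square)
  finally have "cmod (\<phi> g) = (norm g)\<^sup>2" .
  moreover have "high_modes N g"
    unfolding high_modes_def g_def coef_sum by (auto simp: coef_hermite_L2 c_def intro!: sum.neutral)
  ultimately have "(norm g)\<^sup>2 \<le> B * norm g"
    using bound[of g] by simp
  then have "norm g \<le> B" using B by (cases "norm g = 0") (simp_all add: power2_eq_square)
  then have "(norm g)\<^sup>2 \<le> B\<^sup>2" by (intro power_mono) auto
  then show ?thesis unfolding g_def norm_sum_hermite_square[OF finite_lessThan] c_def .
qed

text \<open>The vector representing the form as an antilinear functional of slot 5; whatever
  \<open>F\<close> holds in that slot is overwritten.\<close>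

definition six_op :: "(nat \<Rightarrow> L2) \<Rightarrow> L2" where
  "six_op F = synth (\<lambda>n. six (F(5 := hermite_L2 n)))"

lemma coef_six_op: "coef (six_op F) n = six (F(5 := hermite_L2 n))"
  unfolding six_op_def
proof (rule coef_synth)
  define B where "B = six_const * (\<Prod>i\<in>{..<6} - {5}. norm (F i))"
  have B: "B \<ge> 0" unfolding B_def using six_const_pos by (intro mult_nonneg_nonneg prod_nonneg) auto
  have "(\<Sum>n<K. (cmod (if n < 0 then 0 else six (F(5 := hermite_L2 n))))\<^sup>2) \<le> B\<^sup>2" for K
  proof (rule antilinear_coef_sum_le[OF _ _ _ B])
    show "six (F(5 := x + y)) = six (F(5 := x)) + six (F(5 := y))" for x y by (rule six_add) simp
    show "six (F(5 := c *\<^sub>C x)) = cnj c * six (F(5 := x))" for c x by (subst six_slot_scale) (simp_all add: slot_conj_def)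
    show "cmod (six (F(5 := g))) \<le> B * norm g" for g
      using six_bound[of "F(5 := g)"] prod_slot_upd[of 5 6 "\<lambda>_. norm" F g] by (simp add: B_def mult_ac)
  qed
  then have "(\<Sum>n<K. (cmod (six (F(5 := hermite_L2 n))))\<^sup>2) \<le> B\<^sup>2" for K by simp
  then show "summable (\<lambda>n. (cmod (six (F(5 := hermite_L2 n))))\<^sup>2)"
  proof (intro bounded_imp_summable[of _ "B\<^sup>2"])
    show "(\<Sum>k\<le>n. (cmod (six (F(5 := hermite_L2 k))))\<^sup>2) \<le> B\<^sup>2"
      if "\<And>K. (\<Sum>n<K. (cmod (six (F(5 := hermite_L2 n))))\<^sup>2) \<le> B\<^sup>2" for n
      unfolding lessThan_Suc_atMost[symmetric] by (rule that)
  qed simp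
qed

section \<open>The nonlinearity on bounded functions\<close>

text \<open>Completeness of Lebesgue measure is used here. It later gives measurability of the full
  integrand of \<open>T6\<close>, known only as an almost everywhere limit.\<close>

lemma borel_measurable_lebesgue_AE_eq:
  fixes f g :: "real \<Rightarrow> 'a::topological_space"
  assumes f: "f \<in> borel_measurable lebesgue" and eq: "AE x in lebesgue. f x = g x"
  shows "g \<in> borel_measurable lebesgue"
proof (rule measurableI)
  fix S :: "'a set" assume S: "S \<in> sets borel"
  show "g -` S \<inter> space lebesgue \<in> sets lebesgue"
  proof (rule completion.in_sets_AE)
    show "f -` S \<inter> space lebesgue \<in> sets lebesgue" using f S by (rule measurable_sets)
    show "AE x in lebesgue. (x \<in> f -` S \<inter> space lebesgue) \<longleftrightarrow> (x \<in> g -` S \<inter> space lebesgue)"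
      using eq by eventually_elim auto
  qed simp
qed simp

lemma borel_measurable_AE_limit:
  fixes f :: "nat \<Rightarrow> real \<Rightarrow> 'a::{banach, second_countable_topology}"
  assumes f: "\<And>i. f i \<in> borel_measurable lebesgue" and lim: "AE x in lebesgue. (\<lambda>i. f i x) \<longlonglongrightarrow> g x"
  shows "g \<in> borel_measurable lebesgue"
proof (rule borel_measurable_lebesgue_AE_eq)
  show "(\<lambda>x. lim (\<lambda>i. f i x)) \<in> borel_measurable lebesgue"
    by (rule borel_measurable_lim_metric) (rule f)
  show "AE x in lebesgue. lim (\<lambda>i. f i x) = g x"
    using lim by eventually_elim (rule limI)
qed

definition quintic_fun :: "complex \<Rightarrow> complex" where
  "quintic_fun z = of_real (cmod z ^ 4) * z"

lemma quintic_fun_lipschitz: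
  assumes "cmod a \<le> B" "cmod b \<le> B"
  shows "cmod (quintic_fun a - quintic_fun b) \<le> 5 * B ^ 4 * cmod (a - b)"
proof -
  define x y where "x = cmod a" and "y = cmod b"
  have xy: "0 \<le> x" "x \<le> B" "0 \<le> y" "y \<le> B" and B: "B \<ge> 0"
    using assms order_trans[OF norm_ge_zero assms(1)] by (auto simp: x_def y_def)
  have d: "\<bar>x - y\<bar> \<le> cmod (a - b)" unfolding x_def y_def by (rule norm_triangle_ineq3)
  have "\<bar>x ^ 4 - y ^ 4\<bar> = \<bar>x - y\<bar> * \<bar>x ^ 3 + x\<^sup>2 * y + x * y\<^sup>2 + y ^ 3\<bar>"
    unfolding abs_mult[symmetric] by (rule arg_cong[where f=abs]) (simp add: algebra_simps eval_nat_numeral)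
  also have "\<dots> \<le> cmod (a - b) * (4 * B ^ 3)"
  proof (rule mult_mono[OF d])
    have "0 \<le> x ^ 3 + x\<^sup>2 * y + x * y\<^sup>2 + y ^ 3" using xy by simp
    moreover have "x ^ 3 + x\<^sup>2 * y + x * y\<^sup>2 + y ^ 3 \<le> B ^ 3 + B\<^sup>2 * B + B * B\<^sup>2 + B ^ 3"
      using xy by (intro add_mono mult_mono power_mono) auto
    moreover have "B ^ 3 + B\<^sup>2 * B + B * B\<^sup>2 + B ^ 3 = 4 * B ^ 3" by (simp add: eval_nat_numeral)
    ultimately show "\<bar>x ^ 3 + x\<^sup>2 * y + x * y\<^sup>2 + y ^ 3\<bar> \<le> 4 * B ^ 3"
      by (simp only: abs_of_nonneg)
  qed auto
  finally have q: "\<bar>x ^ 4 - y ^ 4\<bar> \<le> cmod (a - b) * (4 * B ^ 3)" .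
  have "quintic_fun a - quintic_fun b = of_real (x ^ 4) * (a - b) + of_real (x ^ 4 - y ^ 4) * b"
    by (simp add: quintic_fun_def x_def y_def algebra_simps)
  then have "cmod (quintic_fun a - quintic_fun b) \<le> cmod (of_real (x ^ 4) * (a - b)) + cmod (of_real (x ^ 4 - y ^ 4) * b)"
    by (simp only: norm_triangle_ineq)
  also have "\<dots> = x ^ 4 * cmod (a - b) + \<bar>x ^ 4 - y ^ 4\<bar> * y"
    unfolding norm_mult norm_of_real y_def[symmetric] using xy(1) by simp
  also have "\<dots> \<le> B ^ 4 * cmod (a - b) + (cmod (a - b) * (4 * B ^ 3)) * B"
    using xy q B by (intro add_mono mult_mono power_mono) auto
  also have "\<dots> = 5 * B ^ 4 * cmod (a - b)" by (simp add: eval_nat_numeral algebra_simps)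
  finally show ?thesis .
qed

lemma square_integrable_bound:
  assumes f: "square_integrable f" and g: "g \<in> borel_measurable lebesgue"
    and le: "AE x in lebesgue. cmod (g x) \<le> C * cmod (f x)"
  shows "square_integrable g"
  unfolding square_integrable_def
proof
  note [measurable] = g
  show "integrable lebesgue (\<lambda>x. (cmod (g x))\<^sup>2)"
  proof (rule Bochner_Integration.integrable_bound)
    show "integrable lebesgue (\<lambda>x. C\<^sup>2 * (cmod (f x))\<^sup>2)" using f by (simp add: square_integrable_def)
    show "AE x in lebesgue. norm ((cmod (g x))\<^sup>2) \<le> norm (C\<^sup>2 * (cmod (f x))\<^sup>2)"
      using le
    proof eventually_elim
      case (elim x)
      from power_mono[OF this norm_ge_zero, of 2] show ?case by (simp add: power_mult_distrib)
    qed
  qed measurable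
qed (rule g)

lemma norm_abs_L2_le:
  assumes f: "square_integrable f" and g: "square_integrable g" and C: "C \<ge> 0"
    and le: "AE x in lebesgue. cmod (g x) \<le> C * cmod (f x)"
  shows "norm (abs_L2 g) \<le> C * norm (abs_L2 f)"
proof -
  have "(norm (abs_L2 g))\<^sup>2 \<le> integral\<^sup>L lebesgue (\<lambda>x. C\<^sup>2 * (cmod (f x))\<^sup>2)"
    unfolding norm_abs_L2_sq[OF g]
  proof (rule integral_mono_AE)
    show "AE x in lebesgue. (cmod (g x))\<^sup>2 \<le> C\<^sup>2 * (cmod (f x))\<^sup>2"
      using le
    proof eventually_elim
      case (elim x)
      from power_mono[OF this norm_ge_zero, of 2] show ?case by (simp add: power_mult_distrib)
    qed
  qed (use f g in \<open>auto simp: square_integrable_def\<close>)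
  also have "\<dots> = (C * norm (abs_L2 f))\<^sup>2" by (simp add: norm_abs_L2_sq[OF f] power_mult_distrib)
  finally show ?thesis by (rule power2_le_imp_le) (use C in simp)
qed

lemma quintic_abs_L2:
  assumes u: "square_integrable u" and B: "AE x in lebesgue. cmod (u x) \<le> B" "B \<ge> 0"
  shows "square_integrable (\<lambda>x. quintic_fun (u x))" "quintic (abs_L2 u) = abs_L2 (\<lambda>x. quintic_fun (u x))"
proof -
  note [measurable] = square_integrable_measurable[OF u]
  have m: "(\<lambda>x. quintic_fun (u x)) \<in> borel_measurable lebesgue" unfolding quintic_fun_def by measurable
  show si: "square_integrable (\<lambda>x. quintic_fun (u x))"
  proof (rule square_integrable_bound[OF u m, of "B ^ 4"])
    show "AE x in lebesgue. cmod (quintic_fun (u x)) \<le> B ^ 4 * cmod (u x)"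
      using B(1) by eventually_elim (auto simp: quintic_fun_def norm_mult norm_power intro!: mult_right_mono power_mono)
  qed
  have "L2_rel u u" using u by (simp add: L2_rel_def)
  from quintic.abs_eq[OF this] si show "quintic (abs_L2 u) = abs_L2 (\<lambda>x. quintic_fun (u x))"
    by (simp add: quintic_fun_def)
qed

text \<open>A pointwise bound attached to a class. On such classes \<open>quintic\<close> takes its
  nonlinear branch rather than the default value, and it is Lipschitz in norm.\<close>

definition L2_bounded :: "real \<Rightarrow> L2 \<Rightarrow> bool" where
  "L2_bounded B f \<longleftrightarrow> (\<exists>u. square_integrable u \<and> abs_L2 u = f \<and> (AE x in lebesgue. cmod (u x) \<le> B))"

lemma quintic_lipschitz:
  assumes f: "L2_bounded B f" and g: "L2_bounded B g" and B: "B \<ge> 0"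
  shows "norm (quintic f - quintic g) \<le> 5 * B ^ 4 * norm (f - g)"
proof -
  obtain u where u: "square_integrable u" "abs_L2 u = f" "AE x in lebesgue. cmod (u x) \<le> B"
    using f by (auto simp: L2_bounded_def)
  obtain v where v: "square_integrable v" "abs_L2 v = g" "AE x in lebesgue. cmod (v x) \<le> B"
    using g by (auto simp: L2_bounded_def)
  note qu = quintic_abs_L2[OF u(1,3) B] and qv = quintic_abs_L2[OF v(1,3) B]
  have "norm (abs_L2 (\<lambda>x. quintic_fun (u x) - quintic_fun (v x))) \<le> 5 * B ^ 4 * norm (abs_L2 (\<lambda>x. u x - v x))"
  proof (rule norm_abs_L2_le)
    show "AE x in lebesgue. cmod (quintic_fun (u x) - quintic_fun (v x)) \<le> 5 * B ^ 4 * cmod (u x - v x)"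
      using u(3) v(3) by eventually_elim (rule quintic_fun_lipschitz)
  qed (use u v qu qv B in \<open>auto intro: square_integrable_diff\<close>)
  then show ?thesis
    using u v qu qv by (simp add: abs_L2_diff[symmetric])
qed

lemma quintic_zero: "quintic 0 = 0" and L2_bounded_zero: "B \<ge> 0 \<Longrightarrow> L2_bounded B 0"
proof -
  show "quintic 0 = 0"
    using quintic_abs_L2(2)[OF square_integrable_zero, of 0] by (simp add: zero_L2.abs_eq quintic_fun_def zero_L2_def)
  show "L2_bounded B 0" if "B \<ge> 0"
    unfolding L2_bounded_def using that square_integrable_zero by (intro exI[of _ "\<lambda>_. 0"]) (auto simp: zero_L2.abs_eq zero_L2_def)
qed

lemma quintic_norm_le:
  assumes f: "L2_bounded B f" and B: "B \<ge> 0"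
  shows "norm (quintic f) \<le> 5 * B ^ 4 * norm f"
  using quintic_lipschitz[OF f L2_bounded_zero[OF B] B] by (simp add: quintic_zero)

text \<open>The excess of the modulus of the limit over \<open>B\<close> is dominated pointwise by
  the distance to each approximant, so its norm is zero.\<close>

lemma L2_bounded_limit:
  assumes f: "\<And>j. L2_bounded B (f j)" and lim: "f \<longlonglongrightarrow> g" and B: "B \<ge> 0"
  shows "L2_bounded B g"
proof -
  define v where "v = rep_L2 g"
  have v: "square_integrable v" "abs_L2 v = g" by (simp_all add: v_def rep_L2)
  note [measurable] = square_integrable_measurable[OF v(1)]
  define w where "w x = complex_of_real (max 0 (cmod (v x) - B))" for x
  have wm: "w \<in> borel_measurable lebesgue" unfolding w_def[abs_def] by measurable
  have w: "square_integrable w"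
    by (rule square_integrable_bound[OF v(1) wm, of 1]) (use B in \<open>auto simp: w_def\<close>)
  have "norm (abs_L2 w) \<le> norm (g - f j)" for j
  proof -
    obtain u where u: "square_integrable u" "abs_L2 u = f j" "AE x in lebesgue. cmod (u x) \<le> B"
      using f by (auto simp: L2_bounded_def)
    have "norm (abs_L2 w) \<le> 1 * norm (abs_L2 (\<lambda>x. v x - u x))"
    proof (rule norm_abs_L2_le)
      show "AE x in lebesgue. cmod (w x) \<le> 1 * cmod (v x - u x)"
        using u(3)
      proof eventually_elim
        case (elim x)
        then show ?case using norm_triangle_ineq2[of "v x" "u x"] by (simp add: w_def)
      qed
    qed (use u v w in \<open>auto intro: square_integrable_diff\<close>)
    then show ?thesis using u v by (simp add: abs_L2_diff[symmetric])
  qed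
  moreover have "(\<lambda>j. norm (g - f j)) \<longlonglongrightarrow> norm (g - g)" by (intro tendsto_intros lim)
  ultimately have "norm (abs_L2 w) \<le> 0" by (intro LIMSEQ_le_const[of "\<lambda>j. norm (g - f j)"]) auto
  then have "abs_L2 w = abs_L2 (\<lambda>_. 0)" by (simp add: zero_L2.abs_eq zero_L2_def)
  from abs_L2_eqD[OF w square_integrable_zero this] have "AE x in lebesgue. cmod (v x) \<le> B"
    by eventually_elim (simp add: w_def max_def split: if_splits)
  then show ?thesis using v unfolding L2_bounded_def by blast
qed

section \<open>Truncated solutions as elements of \<open>L\<^sup>2\<close>\<close>

lemma abs_L2_hermite_sum:
  "square_integrable (\<lambda>x. \<Sum>n<K. c n * of_real (hermite_fun n x)) \<and>
   abs_L2 (\<lambda>x. \<Sum>n<K. c n * of_real (hermite_fun n x)) = (\<Sum>n<K. c n *\<^sub>C hermite_L2 n)"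
proof (induction K)
  case 0
  then show ?case using square_integrable_zero by (simp add: zero_L2.abs_eq zero_L2_def)
next
  case (Suc K)
  have h: "square_integrable (\<lambda>x. c K * of_real (hermite_fun K x))"
    by (intro square_integrable_mult_const square_integrable_hermite_fun)
  have "abs_L2 (\<lambda>x. c K * of_real (hermite_fun K x)) = c K *\<^sub>C hermite_L2 K"
    unfolding hermite_L2_def by (subst scaleC_L2.abs_eq) (simp_all add: L2_rel_def square_integrable_hermite_fun)
  then show ?case
    using Suc h square_integrable_add[OF conjunct1[OF Suc] h] plus_L2.abs_eq[of "\<lambda>x. \<Sum>n<K. c n * of_real (hermite_fun n x)" "\<lambda>x. c K * of_real (hermite_fun K x)"]
    by (simp add: L2_rel_def)
qed

lemma wave_L2:
  "square_integrable (wave K f s)" "abs_L2 (wave K f s) = osc_propagator s (mode_cut K f)"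
proof -
  have eq: "wave K f s = (\<lambda>x. \<Sum>n<K. (coef f n * phase s n) * of_real (hermite_fun n x))"
    by (rule ext) (simp add: hermite_wave_def)
  show "square_integrable (wave K f s)" unfolding eq by (rule conjunct1[OF abs_L2_hermite_sum])
  have "abs_L2 (wave K f s) = (\<Sum>n<K. (coef f n * phase s n) *\<^sub>C hermite_L2 n)"
    unfolding eq by (rule conjunct2[OF abs_L2_hermite_sum])
  also have "\<dots> = osc_propagator s (mode_cut K f)"
    by (rule L2_eqI) (simp add: coef_sum coef_hermite_L2 mult.commute if_distrib cong: if_cong)
  finally show "abs_L2 (wave K f s) = osc_propagator s (mode_cut K f)" .
qed

lemma wave_L2_bounded:
  assumes "\<And>x. cmod (wave K f s x) \<le> B"
  shows "L2_bounded B (osc_propagator s (mode_cut K f))"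
  unfolding L2_bounded_def using wave_L2[of K f s] assms by (intro exI[of _ "wave K f s"]) auto

definition flow_term :: "L2 \<Rightarrow> real \<Rightarrow> L2" where
  "flow_term f s = osc_propagator (- s) (quintic (osc_propagator s f))"

lemma T6_eq: "T6 f = (12 / pi) *\<^sub>R integral\<^sup>L lebesgue (\<lambda>s. indicator time_window s *\<^sub>R flow_term f s)"
  by (simp add: T6_def flow_term_def set_lebesgue_integral_def)

text \<open>This provides the measurability in time of the truncated integrand. The change of the
  inner state is controlled by the Lipschitz bound, the change of the outer propagator by strong
  continuity at a fixed vector.\<close>

lemma continuous_flow_term: "continuous_on UNIV (flow_term (mode_cut K f))"
proof -
  let ?v = "\<lambda>s. osc_propagator s (mode_cut K f)"
  obtain B where B: "B \<ge> 0" "\<And>s x. cmod (wave K f s x) \<le> B" using hermite_wave_bounded by blast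
  have bd: "L2_bounded B (?v s)" for s using B by (intro wave_L2_bounded)
  have "(flow_term (mode_cut K f) \<longlongrightarrow> flow_term (mode_cut K f) s) (at s)" for s
  proof -
    have osc: "((\<lambda>t. osc_propagator t g) \<longlongrightarrow> osc_propagator t0 g) (at t0)" for g t0
      using continuous_osc[of g] by (simp add: continuous_on_def)
    have osc': "((\<lambda>t. osc_propagator (- t) g) \<longlongrightarrow> osc_propagator (- s) g) (at s)" for g
    proof -
      have "continuous_on UNIV (\<lambda>t. osc_propagator (- t) g)"
        by (rule continuous_on_compose2[OF continuous_osc]) (auto intro!: continuous_intros)
      then show ?thesis by (simp add: continuous_on_def)
    qed
    have "((\<lambda>t. 5 * B ^ 4 * norm (?v t - ?v s) + norm (osc_propagator (- t) (quintic (?v s)) - osc_propagator (- s) (quintic (?v s)))) \<longlongrightarrow>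
      5 * B ^ 4 * norm (?v s - ?v s) + norm (osc_propagator (- s) (quintic (?v s)) - osc_propagator (- s) (quintic (?v s)))) (at s)"
      by (intro tendsto_intros osc osc')
    then have lim0: "((\<lambda>t. 5 * B ^ 4 * norm (?v t - ?v s) + norm (osc_propagator (- t) (quintic (?v s)) - osc_propagator (- s) (quintic (?v s)))) \<longlongrightarrow> 0) (at s)"
      by simp
    have "norm (flow_term (mode_cut K f) t - flow_term (mode_cut K f) s) \<le>
       5 * B ^ 4 * norm (?v t - ?v s) + norm (osc_propagator (- t) (quintic (?v s)) - osc_propagator (- s) (quintic (?v s)))" for t
    proof -
      have "flow_term (mode_cut K f) t - flow_term (mode_cut K f) s
         = osc_propagator (- t) (quintic (?v t) - quintic (?v s)) + (osc_propagator (- t) (quintic (?v s)) - osc_propagator (- s) (quintic (?v s)))"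
        by (simp add: flow_term_def osc_diff)
      also have "norm \<dots> \<le> norm (quintic (?v t) - quintic (?v s)) + norm (osc_propagator (- t) (quintic (?v s)) - osc_propagator (- s) (quintic (?v s)))"
        by (rule order_trans[OF norm_triangle_ineq]) simp
      finally show ?thesis using quintic_lipschitz[OF bd bd B(1), of t s] by linarith
    qed
    then have "((\<lambda>t. flow_term (mode_cut K f) t - flow_term (mode_cut K f) s) \<longlongrightarrow> 0) (at s)"
      by (intro Lim_null_comparison[OF always_eventually lim0]) blast
    then show ?thesis by (rule Lim_null[THEN iffD2])
  qed
  then show ?thesis by (simp add: continuous_on_def)
qed

lemma borel_measurable_flow_term:
  "(\<lambda>s. indicator time_window s *\<^sub>R flow_term (mode_cut K f) s) \<in> borel_measurable lebesgue"
proof -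
  have [measurable]: "flow_term (mode_cut K f) \<in> borel_measurable borel"
    by (intro borel_measurable_continuous_onI continuous_flow_term)
  show ?thesis by (rule borel_imp_lebesgue_measurable) measurable
qed

text \<open>The outer propagator acts on the coefficient by a conjugate phase, which is absorbed
  into the conjugated wave of the test mode in slot 5. The condition \<open>n < K\<close> keeps that
  mode inside the truncation.\<close>

lemma coef_quintic_wave:
  assumes n: "n < K"
  shows "coef (flow_term (mode_cut K f) s) n = integral\<^sup>L lborel (wave_six K ((\<lambda>_. f)(5 := hermite_L2 n)) s)"
proof -
  obtain B where B: "B \<ge> 0" "\<And>s x. cmod (wave K f s x) \<le> B" using hermite_wave_bounded by blast
  have q: "square_integrable (\<lambda>x. quintic_fun (wave K f s x))"
    "quintic (abs_L2 (wave K f s)) = abs_L2 (\<lambda>x. quintic_fun (wave K f s x))"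
    by (rule quintic_abs_L2[OF wave_L2(1) _ B(1)]; use B in auto)+
  have "coef (flow_term (mode_cut K f) s) n = phase (- s) n * integral\<^sup>L lebesgue (\<lambda>x. quintic_fun (wave K f s x) * of_real (hermite_fun n x))"
    by (simp add: flow_term_def wave_L2(2)[symmetric] q(2) coef_abs_L2[OF q(1)])
  also have "integral\<^sup>L lebesgue (\<lambda>x. quintic_fun (wave K f s x) * of_real (hermite_fun n x))
      = integral\<^sup>L lborel (\<lambda>x. quintic_fun (wave K f s x) * of_real (hermite_fun n x))"
    unfolding quintic_fun_def
    by (intro integral_lebesgue_eq_lborel borel_measurable_continuous_onI continuous_intros)
  also have "phase (- s) n * \<dots> = integral\<^sup>L lborel (\<lambda>x. phase (- s) n * (quintic_fun (wave K f s x) * of_real (hermite_fun n x)))"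
    by simp
  also have "\<dots> = integral\<^sup>L lborel (wave_six K ((\<lambda>_. f)(5 := hermite_L2 n)) s)"
  proof (rule Bochner_Integration.integral_cong[OF refl])
    fix x
    let ?w = "wave K f s x"
    have "wave K (hermite_L2 n) s x = phase s n * of_real (hermite_fun n x)"
      unfolding hermite_wave_def using n by (simp add: coef_hermite_L2 if_distrib[of "\<lambda>z. z * _"] cong: if_cong)
    moreover have "phase (- s) n = cnj (phase s n)" by (simp add: phase_def exp_cnj)
    moreover have "quintic_fun ?w = ?w * ?w * ?w * cnj ?w * cnj ?w"
    proof -
      have "complex_of_real (cmod ?w ^ 4) = (?w * cnj ?w) * (?w * cnj ?w)"
        unfolding mult_cnj_cmod by (simp flip: power_add)
      then show ?thesis by (simp only: quintic_fun_def mult_ac)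
    qed
    ultimately show "phase (- s) n * (quintic_fun ?w * of_real (hermite_fun n x)) = wave_six K ((\<lambda>_. f)(5 := hermite_L2 n)) s x"
      unfolding wave_six_def six_expand slot_conj_def by (simp add: mult_ac)
  qed
  finally show ?thesis .
qed

lemma integrable_lebesgue_window:
  fixes g :: "real \<Rightarrow> L2"
  assumes "(\<lambda>s. indicator time_window s *\<^sub>R g s) \<in> borel_measurable lebesgue" "\<And>s. norm (g s) \<le> C"
  shows "integrable lebesgue (\<lambda>s. indicator time_window s *\<^sub>R g s)"
proof (rule Bochner_Integration.integrable_bound[OF _ assms(1)])
  show "integrable lebesgue (\<lambda>s. C * indicator time_window s :: real)"
    by (intro integrable_mult_right integrable_real_indicator) (auto simp: emeasure_lborel_Icc_eq)
  show "AE s in lebesgue. norm (indicator time_window s *\<^sub>R g s) \<le> norm (C * indicator time_window s :: real)"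
    using assms(2) by (auto simp: indicator_def intro: order_trans[OF _ abs_ge_self])
qed

text \<open>On a truncated vector the integrand is uniformly bounded in norm, hence Bochner
  integrable on the window, and the bounded functional \<open>coef\<close> passes under the
  integral.\<close>

lemma coef_T6_mode_cut:
  assumes n: "n < K"
  shows "coef (T6 (mode_cut K f)) n = six_trunc K ((\<lambda>_. f)(5 := hermite_L2 n))"
proof -
  let ?F = "(\<lambda>_. f)(5 := hermite_L2 n)"
  let ?I = "\<lambda>s. indicator time_window s *\<^sub>R flow_term (mode_cut K f) s"
  obtain B where B: "B \<ge> 0" "\<And>s x. cmod (wave K f s x) \<le> B" using hermite_wave_bounded by blast
  have "norm (flow_term (mode_cut K f) s) \<le> 5 * B ^ 4 * norm (mode_cut K f)" for s
    using quintic_norm_le[OF wave_L2_bounded[of K f s B] B(1)] B(2) by (simp add: flow_term_def)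
  then have i: "integrable lebesgue ?I"
    by (intro integrable_lebesgue_window borel_measurable_flow_term)
  have "coef (T6 (mode_cut K f)) n = of_real (12 / pi) * coef (integral\<^sup>L lebesgue ?I) n"
    unfolding T6_eq scaleR_L2_eq by simp
  also have "coef (integral\<^sup>L lebesgue ?I) n = integral\<^sup>L lebesgue (\<lambda>s. coef (?I s) n)"
    by (rule integral_bounded_linear[OF bounded_linear_coef i, symmetric])
  also have "(\<lambda>s. coef (?I s) n) = (\<lambda>s. indicator time_window s *\<^sub>R integral\<^sup>L lborel (wave_six K ?F s))"
    by (rule ext) (simp add: scaleR_L2_eq coef_quintic_wave[OF n] scaleR_conv_of_real)
  also have "integral\<^sup>L lebesgue \<dots> = integral\<^sup>L lborel \<dots>"
    using borel_measurable_has_bochner_integral[OF six_trunc_integral[of K ?F]]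
    by (intro integral_lebesgue_eq_lborel) simp
  also have "\<dots> = of_real (pi / 12) * six_trunc K ?F"
    by (rule has_bochner_integral_integral_eq[OF six_trunc_integral])
  finally show ?thesis by simp
qed

section \<open>Passage to the limit in the nonlinearity\<close>

lemma wave_mode_cut: "K \<le> L \<Longrightarrow> wave L (mode_cut K f) s x = wave K f s x"
  unfolding hermite_wave_def by (rule sum.mono_neutral_cong_right) auto

lemma wave_diff: "wave K (f - g) s x = wave K f s x - wave K g s x"
  by (simp add: hermite_wave_def ring_distribs sum_subtractf)

lemma power4_add_le: "(x + y) ^ 4 \<le> 8 * (x ^ 4 + y ^ 4)" for x y :: real
proof -
  have "(x + y)\<^sup>2 \<le> 2 * (x\<^sup>2 + y\<^sup>2)" using sum_squares_bound[of x y] by (simp add: power2_sum)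
  then have "((x + y)\<^sup>2)\<^sup>2 \<le> (2 * (x\<^sup>2 + y\<^sup>2))\<^sup>2" by (intro power_mono) auto
  also have "\<dots> = 4 * (x\<^sup>2 + y\<^sup>2)\<^sup>2" by (simp only: power_mult_distrib) simp
  also have "\<dots> \<le> 4 * (2 * ((x\<^sup>2)\<^sup>2 + (y\<^sup>2)\<^sup>2))"
    using sum_squares_bound[of "x\<^sup>2" "y\<^sup>2"] by (simp add: power2_sum)
  finally show ?thesis by (simp flip: power_mult)
qed

lemma strichartz_L2:
  "(\<integral>\<^sup>+s. ennreal (indicator {-2..2} s * wave_sup K (coef f) s ^ 4) \<partial>lborel) \<le> ennreal (1568 * norm f ^ 4)"
proof (rule order_trans[OF strichartz])
  have "(\<Sum>n<K. (cmod (coef f n))\<^sup>2)\<^sup>2 \<le> ((norm f)\<^sup>2)\<^sup>2"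
    by (intro power_mono bessel sum_nonneg) auto
  then show "ennreal (1568 * (\<Sum>n<K. (cmod (coef f n))\<^sup>2)\<^sup>2) \<le> ennreal (1568 * norm f ^ 4)"
    by (intro ennreal_leI) (simp flip: power_mult)
qed

text \<open>Along a rapidly convergent subsequence of truncations, the telescoping differences are
  summable in \<open>L\<^sup>4\<^sub>t L\<^sup>\<infinity>\<^sub>x\<close>.\<close>

lemma wave_maximal:
  obtains \<kappa> :: "nat \<Rightarrow> nat" and D :: "real \<Rightarrow> real" where "\<And>j. j \<le> \<kappa> j" "\<And>s. D s \<ge> 0"
    "integrable lborel (\<lambda>s. indicator {-2..2} s * D s)"
    "AE s in lborel. s \<in> {-2..2} \<longrightarrow> (\<exists>B\<ge>0. B ^ 4 \<le> D s \<and> (\<forall>j x. cmod (wave (\<kappa> j) f s x) \<le> B))"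
proof -
  have "\<exists>K\<ge>j. norm (f - mode_cut K f) \<le> (1/4) ^ j" for j :: nat
  proof -
    have "(\<lambda>K. norm (f - mode_cut K f)) \<longlonglongrightarrow> norm (f - f)" by (intro tendsto_intros mode_cut_tendsto)
    then have "\<forall>\<^sub>F K in sequentially. norm (f - mode_cut K f) < (1/4) ^ j" by (intro order_tendstoD(2)) auto
    then have "\<forall>\<^sub>F K in sequentially. norm (f - mode_cut K f) < (1/4) ^ j \<and> K \<ge> j"
      using eventually_ge_at_top[of j] by eventually_elim simp
    then show ?thesis by (auto simp: eventually_sequentially intro: less_imp_le)
  qed
  then obtain \<kappa> where \<kappa>: "\<And>j. j \<le> \<kappa> j" "\<And>j. norm (f - mode_cut (\<kappa> j) f) \<le> (1/4) ^ j" by metis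
  define d where "d j = mode_cut (\<kappa> (Suc j)) f - mode_cut (\<kappa> j) f" for j
  have nd: "norm (d j) \<le> 2 * (1/4) ^ j" for j
  proof -
    have "norm (d j) = norm ((f - mode_cut (\<kappa> j) f) - (f - mode_cut (\<kappa> (Suc j)) f))" by (simp add: d_def)
    also have "\<dots> \<le> (1/4) ^ j + (1/4) ^ Suc j"
      by (rule order_trans[OF norm_triangle_ineq4]) (intro add_mono \<kappa>(2))
    also have "\<dots> \<le> 2 * (1/4) ^ j" by simp
    finally show ?thesis .
  qed
  \<comment> \<open>The chosen indices need not increase; the maximum is a length at which both
    truncations are represented.\<close>
  define L where "L j = max (\<kappa> j) (\<kappa> (Suc j))" for j
  define S where "S j = wave_sup (L j) (coef (d j))" for j
  define S0 where "S0 = wave_sup (\<kappa> 0) (coef f)"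
  have S_nonneg: "S j s \<ge> 0" "S0 s \<ge> 0" for j s unfolding S_def S0_def by (rule wave_sup_nonneg)+
  have [measurable]: "S j \<in> borel_measurable borel" "S0 \<in> borel_measurable borel" for j
    unfolding S_def S0_def by measurable
  have step: "cmod (wave (\<kappa> (Suc j)) f s x - wave (\<kappa> j) f s x) \<le> S j s" for j s x
    using hermite_wave_le_sup[of "L j" "coef (d j)" s x]
    by (simp add: S_def d_def wave_diff wave_mode_cut L_def)
  \<comment> \<open>The increments have norm of order \<open>4^(-j)\<close>, so their fourth powers
    in time are of order \<open>256^(-j)\<close>. The weight \<open>16^j\<close> leaves a summable
    \<open>16^(-j)\<close> and yet, for almost every time, forces \<open>S j s\<close> to decay like
    \<open>2^(-j)\<close>. The constant below is \<open>16 * 1568\<close>.\<close>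
  define W where "W s = (\<Sum>j. ennreal (16 ^ j) * ennreal (indicator {-2..2} s * S j s ^ 4))" for s
  have [measurable]: "W \<in> borel_measurable borel" unfolding W_def[abs_def] by measurable
  have "(\<integral>\<^sup>+s. W s \<partial>lborel) = (\<Sum>j. \<integral>\<^sup>+s. ennreal (16 ^ j) * ennreal (indicator {-2..2} s * S j s ^ 4) \<partial>lborel)"
    unfolding W_def by (rule nn_integral_suminf) measurable
  also have "\<dots> \<le> (\<Sum>j. ennreal (25088 * (1/16) ^ j))"
  proof (intro suminf_le summableI)
    fix j
    have "(\<integral>\<^sup>+s. ennreal (16 ^ j) * ennreal (indicator {-2..2} s * S j s ^ 4) \<partial>lborel)
       = ennreal (16 ^ j) * (\<integral>\<^sup>+s. ennreal (indicator {-2..2} s * S j s ^ 4) \<partial>lborel)"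
      by (rule nn_integral_cmult) measurable
    also have "\<dots> \<le> ennreal (16 ^ j) * ennreal (1568 * norm (d j) ^ 4)"
      unfolding S_def by (intro mult_left_mono strichartz_L2) simp
    also have "\<dots> \<le> ennreal (16 ^ j) * ennreal (1568 * (2 * (1/4) ^ j) ^ 4)"
      using nd[of j] by (intro mult_left_mono ennreal_leI power_mono) auto
    also have "\<dots> = ennreal (25088 * (1/16) ^ j)"
    proof -
      have p: "((1/4 :: real) ^ j) ^ 4 = ((1/4) ^ 4) ^ j" by (metis mult.commute power_mult)
      have "(16::real) ^ j * (1568 * (2 * (1/4) ^ j) ^ 4) = 25088 * (16 ^ j * ((1/4) ^ 4) ^ j)"
        unfolding power_mult_distrib p by simp
      also have "\<dots> = 25088 * (1/16) ^ j"
        unfolding power_mult_distrib[symmetric] by (simp add: eval_nat_numeral)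
      finally show ?thesis by (simp flip: ennreal_mult)
    qed
    finally show "(\<integral>\<^sup>+s. ennreal (16 ^ j) * ennreal (indicator {-2..2} s * S j s ^ 4) \<partial>lborel) \<le> ennreal (25088 * (1/16) ^ j)" .
  qed
  also have "\<dots> = ennreal (\<Sum>j. 25088 * (1/16) ^ j)"
    by (intro suminf_ennreal2 summable_mult summable_geometric) auto
  finally have W: "(\<integral>\<^sup>+s. W s \<partial>lborel) < \<infinity>" by (rule le_less_trans) simp
  have W_fin: "AE s in lborel. W s \<noteq> \<infinity>"
    using W by (intro nn_integral_PInf_AE) auto
  \<comment> \<open>The bound reached below is \<open>B = S0 s + 2 * b\<close> with
    \<open>b ^ 4\<close> the value of \<open>W\<close>; then
    \<open>B ^ 4 \<le> 8 * (S0 s ^ 4 + 16 * b ^ 4)\<close>, which explains 8 and 128.\<close>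
  define D where "D s = 8 * S0 s ^ 4 + 128 * enn2real (W s)" for s
  have [measurable]: "D \<in> borel_measurable borel" unfolding D_def[abs_def] by measurable
  show ?thesis
  proof (rule that[of \<kappa> D])
    show "j \<le> \<kappa> j" for j by (rule \<kappa>(1))
    show "D s \<ge> 0" for s unfolding D_def using S_nonneg by simp
    show "integrable lborel (\<lambda>s. indicator {-2..2} s * D s)"
    proof (rule integrableI_nonneg)
      have "ennreal (indicator {-2..2} s * D s) \<le> ennreal 8 * ennreal (indicator {-2..2} s * S0 s ^ 4) + ennreal 128 * W s" for s
      proof -
        have "ennreal (indicator {-2..2} s * D s) \<le> ennreal (8 * (indicator {-2..2} s * S0 s ^ 4) + 128 * enn2real (W s))"
          by (intro ennreal_leI) (auto simp: D_def indicator_def)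
        also have "\<dots> = ennreal 8 * ennreal (indicator {-2..2} s * S0 s ^ 4) + ennreal 128 * ennreal (enn2real (W s))"
          using S_nonneg by (intro ennreal_mult_add[symmetric]) auto
        also have "\<dots> \<le> ennreal 8 * ennreal (indicator {-2..2} s * S0 s ^ 4) + ennreal 128 * W s"
          by (intro add_left_mono mult_left_mono) (auto simp: ennreal_enn2real_if)
        finally show ?thesis .
      qed
      then have "(\<integral>\<^sup>+s. ennreal (indicator {-2..2} s * D s) \<partial>lborel)
         \<le> (\<integral>\<^sup>+s. ennreal 8 * ennreal (indicator {-2..2} s * S0 s ^ 4) + ennreal 128 * W s \<partial>lborel)"
        by (rule nn_integral_mono)
      also have "\<dots> = ennreal 8 * (\<integral>\<^sup>+s. ennreal (indicator {-2..2} s * S0 s ^ 4) \<partial>lborel) + ennreal 128 * (\<integral>\<^sup>+s. W s \<partial>lborel)"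
        by (subst nn_integral_add) (measurable, simp add: nn_integral_cmult)
      also have "\<dots> < \<infinity>"
      proof -
        have "(\<integral>\<^sup>+s. ennreal (indicator {-2..2} s * S0 s ^ 4) \<partial>lborel) < \<infinity>"
          unfolding S0_def by (rule le_less_trans[OF strichartz_L2]) simp
        then show ?thesis using W by (simp add: ennreal_mult_less_top ennreal_add_less_top)
      qed
      finally show "(\<integral>\<^sup>+s. ennreal (indicator {-2..2} s * D s) \<partial>lborel) < \<infinity>" .
    qed (use S_nonneg in \<open>auto simp: D_def\<close>)
    show "AE s in lborel. s \<in> {-2..2} \<longrightarrow> (\<exists>B\<ge>0. B ^ 4 \<le> D s \<and> (\<forall>j x. cmod (wave (\<kappa> j) f s x) \<le> B))"
      using W_fin
    proof eventually_elim
      case (elim s)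
      show ?case
      proof
        assume s: "s \<in> {-2..2}"
        define w where "w = enn2real (W s)"
        have w: "w \<ge> 0" "W s = ennreal w" using elim by (simp_all add: w_def less_top)
        define b where "b = root 4 w"
        have b: "b \<ge> 0" "b ^ 4 = w" using w(1) by (simp_all add: b_def)
        have Sb: "S j s \<le> b * (1/2) ^ j" for j
        proof -
          have "(\<Sum>i\<in>{j}. ennreal (16 ^ i) * ennreal (indicator {-2..2} s * S i s ^ 4)) \<le> W s"
            unfolding W_def by (intro sum_le_suminf summableI) auto
          then have "ennreal (16 ^ j * S j s ^ 4) \<le> ennreal w"
            using s by (simp add: w(2) ennreal_mult'')
          then have "16 ^ j * S j s ^ 4 \<le> w" using w(1) by simp
          then have "S j s ^ 4 \<le> w * (1 / 16 ^ j)" by (simp add: field_simps)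
          also have "\<dots> = (b * (1/2) ^ j) ^ 4"
          proof -
            have "((1/2 :: real) ^ j) ^ 4 = ((1/2) ^ 4) ^ j" by (metis mult.commute power_mult)
            also have "\<dots> = 1 / 16 ^ j" by (simp add: power_one_over eval_nat_numeral)
            finally show ?thesis by (simp only: power_mult_distrib b(2))
          qed
          finally have "S j s ^ 4 \<le> (b * (1/2) ^ j) ^ 4" .
          then show ?thesis using S_nonneg(1)[of j s] b(1) by (subst (asm) power_mono_iff) auto
        qed
        define B where "B = S0 s + 2 * b"
        have "cmod (wave (\<kappa> j) f s x) \<le> S0 s + (\<Sum>i<j. b * (1/2) ^ i)" for j x
        proof (induction j)
          case 0
          then show ?case by (simp add: S0_def hermite_wave_le_sup)
        next
          case (Suc j)
          have "cmod (wave (\<kappa> (Suc j)) f s x) \<le> cmod (wave (\<kappa> j) f s x) + cmod (wave (\<kappa> (Suc j)) f s x - wave (\<kappa> j) f s x)"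
            by (rule norm_triangle_sub)
          then show ?case using Suc step[of j s x] Sb[of j] by simp
        qed
        moreover have "(\<Sum>i<j. b * (1/2) ^ i) \<le> 2 * b" for j
        proof -
          have "(\<Sum>i<j. (1/2 :: real) ^ i) \<le> (\<Sum>i. (1/2) ^ i)" by (intro sum_le_suminf summable_geometric) auto
          also have "\<dots> = 2" by (simp add: suminf_geometric)
          finally show ?thesis using b(1) by (simp add: sum_distrib_left[symmetric] mult_left_mono mult.commute[of 2])
        qed
        ultimately have "cmod (wave (\<kappa> j) f s x) \<le> B" for j x
          unfolding B_def by (meson add_left_mono order_trans)
        moreover have "B ^ 4 \<le> D s"
          using power4_add_le[of "S0 s" "2 * b"] b(2) by (simp add: B_def D_def w_def power_mult_distrib)
        moreover have "B \<ge> 0" using S_nonneg b by (simp add: B_def)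
        ultimately show "\<exists>B\<ge>0. B ^ 4 \<le> D s \<and> (\<forall>j x. cmod (wave (\<kappa> j) f s x) \<le> B)" by blast
      qed
    qed
  qed
qed

text \<open>Dominated convergence in time along the subsequence of \<open>wave_maximal\<close>. At
  almost every time all truncations share one pointwise bound; it survives in the limit, so the
  nonlinearity converges there instead of meeting its default value, and its fourth power yields the
  integrable majorant.\<close>

lemma coef_T6: "coef (T6 f) n = six ((\<lambda>_. f)(5 := hermite_L2 n))"
proof -
  obtain \<kappa> :: "nat \<Rightarrow> nat" and D :: "real \<Rightarrow> real" where \<kappa>: "\<And>j. j \<le> \<kappa> j" and D0: "\<And>s. D s \<ge> 0"
    and D: "integrable lborel (\<lambda>s. indicator {-2..2} s * D s)"
    and B: "AE s in lborel. s \<in> {-2..2} \<longrightarrow> (\<exists>B\<ge>0. B ^ 4 \<le> D s \<and> (\<forall>j x. cmod (wave (\<kappa> j) f s x) \<le> B))"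
    using wave_maximal[of f] by blast
  let ?f = "\<lambda>j. mode_cut (\<kappa> j) f"
  let ?I = "\<lambda>g s. indicator time_window s *\<^sub>R flow_term g s"
  have \<kappa>_top: "filterlim \<kappa> at_top sequentially"
    by (rule filterlim_at_top_mono[OF filterlim_ident]) (use \<kappa> in auto)
  have f: "?f \<longlonglongrightarrow> f" by (rule filterlim_compose[OF mode_cut_tendsto \<kappa>_top])
  have good: "AE s in lebesgue. s \<in> {-2..2} \<longrightarrow> (\<exists>B\<ge>0. B ^ 4 \<le> D s \<and> (\<forall>j x. cmod (wave (\<kappa> j) f s x) \<le> B))"
    by (rule AE_completion[OF B])
  have lim: "AE s in lebesgue. (\<lambda>j. ?I (?f j) s) \<longlonglongrightarrow> ?I f s"
    using good
  proof eventually_elim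
    case (elim s)
    show ?case
    proof (cases "s \<in> time_window")
      case True
      then obtain B where B: "B \<ge> 0" "\<And>j x. cmod (wave (\<kappa> j) f s x) \<le> B" using elim time_window_subset by blast
      let ?v = "\<lambda>g. osc_propagator s g"
      have vlim: "(\<lambda>j. ?v (?f j)) \<longlonglongrightarrow> ?v f"
      proof (rule metric_tendsto_imp_tendsto[OF f])
        show "\<forall>\<^sub>F j in sequentially. dist (?v (?f j)) (?v f) \<le> dist (?f j) f"
          by (simp add: dist_norm osc_diff[symmetric])
      qed
      have bj: "L2_bounded B (?v (?f j))" for j using B(2) by (intro wave_L2_bounded)
      have bf: "L2_bounded B (?v f)" by (rule L2_bounded_limit[OF bj vlim B(1)])
      have "(\<lambda>j. flow_term (?f j) s) \<longlonglongrightarrow> flow_term f s"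
      proof (rule Lim_null[THEN iffD2], rule Lim_null_comparison[OF always_eventually])
        show "\<forall>j. norm (flow_term (?f j) s - flow_term f s) \<le> 5 * B ^ 4 * norm (?v (?f j) - ?v f)"
        proof
          fix j
          have "norm (flow_term (?f j) s - flow_term f s) = norm (quintic (?v (?f j)) - quintic (?v f))"
            by (simp add: flow_term_def osc_diff[symmetric])
          also have "\<dots> \<le> 5 * B ^ 4 * norm (?v (?f j) - ?v f)" by (rule quintic_lipschitz[OF bj bf B(1)])
          finally show "norm (flow_term (?f j) s - flow_term f s) \<le> 5 * B ^ 4 * norm (?v (?f j) - ?v f)" .
        qed
        have "(\<lambda>j. 5 * B ^ 4 * norm (?v (?f j) - ?v f)) \<longlonglongrightarrow> 5 * B ^ 4 * norm (?v f - ?v f)"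
          by (intro tendsto_intros vlim)
        then show "(\<lambda>j. 5 * B ^ 4 * norm (?v (?f j) - ?v f)) \<longlonglongrightarrow> 0" by simp
      qed
      then show ?thesis by (intro tendsto_intros)
    qed simp
  qed
  have Ilim: "(\<lambda>j. integral\<^sup>L lebesgue (?I (?f j))) \<longlonglongrightarrow> integral\<^sup>L lebesgue (?I f)"
  proof (rule integral_dominated_convergence[where w="\<lambda>s. 5 * norm f * (indicator {-2..2} s * D s)"])
    show "?I f \<in> borel_measurable lebesgue"
      by (rule borel_measurable_AE_limit[OF borel_measurable_flow_term lim])
    show "?I (?f j) \<in> borel_measurable lebesgue" for j by (rule borel_measurable_flow_term)
    have "integrable lebesgue (\<lambda>s. indicator {-2..2} s * D s)"
      using D borel_measurable_integrable[OF D] by (subst integrable_lebesgue_iff_lborel) auto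
    then show "integrable lebesgue (\<lambda>s. 5 * norm f * (indicator {-2..2} s * D s))" by (rule integrable_mult_right)
    show "AE s in lebesgue. norm (?I (?f j) s) \<le> 5 * norm f * (indicator {-2..2} s * D s)" for j
      using good
    proof eventually_elim
      case (elim s)
      show ?case
      proof (cases "s \<in> time_window")
        case True
        then have s2: "s \<in> {-2..2}" using time_window_subset by blast
        then obtain B where B: "B \<ge> 0" "B ^ 4 \<le> D s" "\<And>j x. cmod (wave (\<kappa> j) f s x) \<le> B" using elim by blast
        have "norm (?I (?f j) s) = norm (quintic (osc_propagator s (?f j)))" using True by (simp add: flow_term_def)
        also have "\<dots> \<le> 5 * B ^ 4 * norm (?f j)"
          using quintic_norm_le[OF wave_L2_bounded[of "\<kappa> j" f s B] B(1)] B(3) by simp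
        also have "\<dots> \<le> 5 * D s * norm f" using B D0[of s] norm_mode_cut by (intro mult_mono) auto
        finally show ?thesis using s2 by (simp add: mult_ac)
      qed (use D0[of s] in auto)
    qed
  qed (rule lim)
  have "(\<lambda>j. coef (T6 (?f j)) n) \<longlonglongrightarrow> coef (T6 f) n"
    unfolding T6_eq by (intro bounded_linear.tendsto[OF bounded_linear_coef] tendsto_intros Ilim)
  moreover have "(\<lambda>j. coef (T6 (?f j)) n) \<longlonglongrightarrow> six ((\<lambda>_. f)(5 := hermite_L2 n))"
  proof (rule Lim_transform_eventually)
    show "(\<lambda>j. six_trunc (\<kappa> j) ((\<lambda>_. f)(5 := hermite_L2 n))) \<longlonglongrightarrow> six ((\<lambda>_. f)(5 := hermite_L2 n))"
      by (rule filterlim_compose[OF six_trunc_tendsto \<kappa>_top])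
    show "\<forall>\<^sub>F j in sequentially. six_trunc (\<kappa> j) ((\<lambda>_. f)(5 := hermite_L2 n)) = coef (T6 (?f j)) n"
      using eventually_gt_at_top[of n]
      by eventually_elim (rule coef_T6_mode_cut[symmetric], use \<kappa> less_le_trans in blast)
  qed
  ultimately show ?thesis by (rule LIMSEQ_unique)
qed

lemma T6_eq_six_op: "T6 f = six_op (\<lambda>_. f)"
  by (rule L2_eqI) (simp add: coef_T6 coef_six_op)

section \<open>The case of frequency zero\<close>

lemma six_outside: "(\<And>i. i < 6 \<Longrightarrow> F i = G i) \<Longrightarrow> six F = six G"
  unfolding six_def using six_trunc_outside[of F G] by simp

lemma six_last_slot_bound: "cmod (six (F(5 := g))) \<le> six_const * norm g * (\<Prod>i<5. norm (F i))"
proof -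
  have "{..<6} - {5} = {..<5::nat}" by auto
  then show ?thesis
    using six_bound[of "F(5 := g)"] prod_slot_upd[of 5 6 "\<lambda>_. norm" F g] by (simp add: mult.assoc)
qed

lemma wave_six_diag: "wave_six K (\<lambda>_. f) s x = of_real (cmod (wave K f s x) ^ 6)"
proof -
  have "wave_six K (\<lambda>_. f) s x = (wave K f s x * cnj (wave K f s x)) ^ 3"
    unfolding wave_six_def six_expand slot_conj_def by (simp add: eval_nat_numeral mult_ac)
  then show ?thesis unfolding mult_cnj_cmod by (simp flip: power_mult)
qed

text \<open>On the diagonal the form is six times the Hamiltonian of the truncated vector, so no
  cancellation is lost in taking its modulus.\<close>

lemma wave_sixth_integral:
  "(\<integral>\<^sup>+s. \<integral>\<^sup>+x. ennreal (indicator time_window s * cmod (wave K f s x) ^ 6) \<partial>lborel \<partial>lborel)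
     = ennreal (pi / 12 * cmod (six_trunc K (\<lambda>_. f)))"
proof -
  define Z where "Z s = integral\<^sup>L lborel (\<lambda>x. cmod (wave K f s x) ^ 6)" for s
  have i: "integrable lborel (\<lambda>x. cmod (wave K f s x) ^ 6)" and Zc: "integral\<^sup>L lborel (wave_six K (\<lambda>_. f) s) = of_real (Z s)" for s
  proof -
    have "integrable lborel (wave_six K (\<lambda>_. f) s)"
      using integrable.intros[OF wave_six_space_integral] .
    then have "integrable lborel (\<lambda>x. complex_of_real (cmod (wave K f s x) ^ 6))"
      by (simp only: wave_six_diag[abs_def])
    then show "integrable lborel (\<lambda>x. cmod (wave K f s x) ^ 6)"
      by (subst (asm) complex_of_real_integrable_eq)
    show "integral\<^sup>L lborel (wave_six K (\<lambda>_. f) s) = of_real (Z s)"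
      unfolding Z_def wave_six_diag[abs_def] by (rule integral_complex_of_real)
  qed
  have Z0: "Z s \<ge> 0" for s unfolding Z_def by (intro Bochner_Integration.integral_nonneg) simp
  have h: "has_bochner_integral lborel (\<lambda>s. complex_of_real (indicator time_window s * Z s)) (of_real (pi / 12) * six_trunc K (\<lambda>_. f))"
    using six_trunc_integral[of K "\<lambda>_. f"] unfolding Zc by (simp add: scaleR_conv_of_real)
  then have ih: "integrable lborel (\<lambda>s. indicator time_window s * Z s)"
    using integrable.intros complex_of_real_integrable_eq by blast
  have eq: "of_real (pi / 12) * six_trunc K (\<lambda>_. f) = complex_of_real (integral\<^sup>L lborel (\<lambda>s. indicator time_window s * Z s))"
    using has_bochner_integral_integral_eq[OF h] by (simp only: integral_complex_of_real)
  have I0: "integral\<^sup>L lborel (\<lambda>s. indicator time_window s * Z s) \<ge> 0"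
    using Z0 by (intro Bochner_Integration.integral_nonneg) simp
  have "cmod (of_real (pi / 12) * six_trunc K (\<lambda>_. f)) = integral\<^sup>L lborel (\<lambda>s. indicator time_window s * Z s)"
    unfolding eq norm_of_real using I0 by simp
  then have c: "pi / 12 * cmod (six_trunc K (\<lambda>_. f)) = integral\<^sup>L lborel (\<lambda>s. indicator time_window s * Z s)"
    unfolding norm_mult norm_of_real by simp
  have "(\<integral>\<^sup>+s. \<integral>\<^sup>+x. ennreal (indicator time_window s * cmod (wave K f s x) ^ 6) \<partial>lborel \<partial>lborel)
     = (\<integral>\<^sup>+s. ennreal (indicator time_window s * Z s) \<partial>lborel)"
  proof (rule nn_integral_cong)
    fix s
    have "(\<integral>\<^sup>+x. ennreal (cmod (wave K f s x) ^ 6) \<partial>lborel) = ennreal (Z s)"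
      unfolding Z_def by (intro nn_integral_eq_integral i) simp
    then show "(\<integral>\<^sup>+x. ennreal (indicator time_window s * cmod (wave K f s x) ^ 6) \<partial>lborel) = ennreal (indicator time_window s * Z s)"
      by (simp add: indicator_def)
  qed
  also have "\<dots> = ennreal (integral\<^sup>L lborel (\<lambda>s. indicator time_window s * Z s))"
    using Z0 by (intro nn_integral_eq_integral ih) simp
  finally show ?thesis unfolding c .
qed

text \<open>Young's inequality \<open>p q^2 \<le> p^3 + q^3\<close> with
  \<open>p = l^2 |w|^2\<close> and \<open>q = exp (- x\<^sup>2 / 2) / l\<close>. The free parameter
  \<open>l\<close> makes the term without the form arbitrarily small.\<close>

lemma local_mass_le_six:
  assumes l: "l > 0"
  shows "pi / 2 * (\<Sum>n<K. (cmod (coef f n))\<^sup>2 * hermite_mass n)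
     \<le> l ^ 6 * (pi / 12 * cmod (six_trunc K (\<lambda>_. f))) + 1 / l ^ 3 * (pi / 2 * sqrt (pi / (3/2)))"
proof -
  let ?w = "\<lambda>s x. cmod (wave K f s x)"
  have young: "p * q\<^sup>2 \<le> p ^ 3 + q ^ 3" if "p \<ge> 0" "q \<ge> 0" for p q :: real
  proof (cases "p \<le> q")
    case True
    then have "p * q\<^sup>2 \<le> q * q\<^sup>2" by (intro mult_right_mono) auto
    also have "q * q\<^sup>2 = q ^ 3" by (simp add: eval_nat_numeral)
    finally show ?thesis using that by (simp add: add_increasing)
  next
    case False
    then have "p * q\<^sup>2 \<le> p * p\<^sup>2" using that by (intro mult_left_mono power_mono) auto
    also have "p * p\<^sup>2 = p ^ 3" by (simp add: eval_nat_numeral)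
    finally show ?thesis using that by (simp add: add_increasing2)
  qed
  have pw: "exp (- x\<^sup>2) * (?w s x)\<^sup>2 \<le> l ^ 6 * ?w s x ^ 6 + 1 / l ^ 3 * exp (- (3/2 * x\<^sup>2))" for s x
  proof -
    define v where "v = exp (- (x\<^sup>2 / 2))"
    have v: "v\<^sup>2 = exp (- x\<^sup>2)" "v ^ 3 = exp (- (3/2 * x\<^sup>2))"
      by (simp_all add: v_def flip: exp_of_nat_mult)
    have "exp (- x\<^sup>2) * (?w s x)\<^sup>2 = (l\<^sup>2 * (?w s x)\<^sup>2) * (v / l)\<^sup>2"
      using l by (simp add: v(1) power_divide)
    also have "\<dots> \<le> (l\<^sup>2 * (?w s x)\<^sup>2) ^ 3 + (v / l) ^ 3"
      using l by (intro young) (auto simp: v_def)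
    also have "\<dots> = l ^ 6 * ?w s x ^ 6 + 1 / l ^ 3 * exp (- (3/2 * x\<^sup>2))"
      by (simp add: power_mult_distrib power_divide v(2) flip: power_mult)
    finally show ?thesis .
  qed
  have m1: "(\<lambda>(s, x). ennreal (indicator time_window s * ?w s x ^ 6)) \<in> borel_measurable (lborel \<Otimes>\<^sub>M lborel)"
    unfolding hermite_wave_def by measurable
  have m2: "(\<lambda>s. \<integral>\<^sup>+x. ennreal (indicator time_window s * ?w s x ^ 6) \<partial>lborel) \<in> borel_measurable lborel"
    using lborel.borel_measurable_nn_integral_fst[OF m1] by simp
  have m3: "(\<lambda>x. ennreal (indicator time_window s * ?w s x ^ 6)) \<in> borel_measurable lborel" for s
    unfolding hermite_wave_def by measurable
  have gi: "(\<integral>\<^sup>+x. ennreal (exp (- (3/2 * x\<^sup>2))) \<partial>lborel) = ennreal (sqrt (pi / (3/2)))"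
    using gauss_has_integral[of "3/2"] by (subst nn_integral_eq_integral) (auto simp: has_bochner_integral_iff)
  have wi: "(\<integral>\<^sup>+s. ennreal (indicator time_window s) \<partial>lborel) = ennreal (pi / 2)"
    by (simp add: ennreal_indicator emeasure_lborel_Icc_eq)
  have "ennreal (pi / 2 * (\<Sum>n<K. (cmod (coef f n))\<^sup>2 * hermite_mass n))
     = (\<integral>\<^sup>+s. \<integral>\<^sup>+x. ennreal (indicator time_window s * (exp (- x\<^sup>2) * (?w s x)\<^sup>2)) \<partial>lborel \<partial>lborel)"
    by (rule hermite_wave_local_mass[symmetric])
  also have "\<dots> \<le> (\<integral>\<^sup>+s. \<integral>\<^sup>+x. ennreal (l ^ 6) * ennreal (indicator time_window s * ?w s x ^ 6)
       + ennreal (1 / l ^ 3 * indicator time_window s) * ennreal (exp (- (3/2 * x\<^sup>2))) \<partial>lborel \<partial>lborel)"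
  proof (intro nn_integral_mono)
    fix s x
    have "ennreal (indicator time_window s * (exp (- x\<^sup>2) * (?w s x)\<^sup>2))
       \<le> ennreal (l ^ 6 * (indicator time_window s * ?w s x ^ 6) + (1 / l ^ 3 * indicator time_window s) * exp (- (3/2 * x\<^sup>2)))"
      using pw[of x s] by (intro ennreal_leI) (auto simp: indicator_def)
    also have "\<dots> = ennreal (l ^ 6) * ennreal (indicator time_window s * ?w s x ^ 6)
       + ennreal (1 / l ^ 3 * indicator time_window s) * ennreal (exp (- (3/2 * x\<^sup>2)))"
      using l by (intro ennreal_mult_add[symmetric]) auto
    finally show "ennreal (indicator time_window s * (exp (- x\<^sup>2) * (?w s x)\<^sup>2)) \<le> \<dots>" .
  qed
  also have "\<dots> = ennreal (l ^ 6) * (\<integral>\<^sup>+s. \<integral>\<^sup>+x. ennreal (indicator time_window s * ?w s x ^ 6) \<partial>lborel \<partial>lborel)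
       + (\<integral>\<^sup>+s. ennreal (1 / l ^ 3) * ennreal (sqrt (pi / (3/2))) * ennreal (indicator time_window s) \<partial>lborel)"
  proof -
    have "(\<integral>\<^sup>+x. ennreal (l ^ 6) * ennreal (indicator time_window s * ?w s x ^ 6)
       + ennreal (1 / l ^ 3 * indicator time_window s) * ennreal (exp (- (3/2 * x\<^sup>2))) \<partial>lborel)
       = ennreal (l ^ 6) * (\<integral>\<^sup>+x. ennreal (indicator time_window s * ?w s x ^ 6) \<partial>lborel)
         + ennreal (1 / l ^ 3) * ennreal (sqrt (pi / (3/2))) * ennreal (indicator time_window s)" for s
    proof -
      note [measurable] = m3[of s]
      have 1: "(\<integral>\<^sup>+x. ennreal (l ^ 6) * ennreal (indicator time_window s * ?w s x ^ 6) \<partial>lborel)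
          = ennreal (l ^ 6) * (\<integral>\<^sup>+x. ennreal (indicator time_window s * ?w s x ^ 6) \<partial>lborel)"
        by (rule nn_integral_cmult[OF m3])
      have 2: "(\<integral>\<^sup>+x. ennreal (1 / l ^ 3 * indicator time_window s) * ennreal (exp (- (3/2 * x\<^sup>2))) \<partial>lborel)
          = ennreal (1 / l ^ 3 * indicator time_window s) * ennreal (sqrt (pi / (3/2)))"
        unfolding gi[symmetric] by (rule nn_integral_cmult) measurable
      have 3: "ennreal (1 / l ^ 3 * indicator time_window s) = ennreal (1 / l ^ 3) * ennreal (indicator time_window s)"
        using l by (intro ennreal_mult) auto
      show ?thesis
        by (subst nn_integral_add) (measurable, simp only: 1 2, simp only: 3 mult_ac)
    qed
    then show ?thesis using m2 by (simp add: nn_integral_add nn_integral_cmult)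
  qed
  also have "\<dots> = ennreal (l ^ 6) * ennreal (pi / 12 * cmod (six_trunc K (\<lambda>_. f))) + ennreal (1 / l ^ 3) * ennreal (pi / 2 * sqrt (pi / (3/2)))"
  proof -
    have "(\<integral>\<^sup>+s. ennreal (1 / l ^ 3) * ennreal (sqrt (pi / (3/2))) * ennreal (indicator time_window s) \<partial>lborel)
       = ennreal (1 / l ^ 3) * ennreal (sqrt (pi / (3/2))) * ennreal (pi / 2)"
      by (subst nn_integral_cmult) (simp_all only: wi, measurable)
    also have "\<dots> = ennreal (1 / l ^ 3) * ennreal (pi / 2 * sqrt (pi / (3/2)))"
      unfolding mult.assoc by (subst ennreal_mult[symmetric]) (auto simp: mult.commute)
    finally show ?thesis unfolding wave_sixth_integral by simp
  qed
  also have "\<dots> = ennreal (l ^ 6 * (pi / 12 * cmod (six_trunc K (\<lambda>_. f))) + 1 / l ^ 3 * (pi / 2 * sqrt (pi / (3/2))))"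
    using l by (intro ennreal_mult_add) auto
  finally show ?thesis
    using l by (subst (asm) ennreal_le_iff) (auto intro!: add_nonneg_nonneg)
qed

lemma six_op_zero_imp_zero:
  assumes zero: "six_op (\<lambda>_. f) = 0"
  shows "f = 0"
proof (rule coef_eq_zero_imp_zero)
  fix n0
  have z: "six ((\<lambda>_. f)(5 := hermite_L2 n)) = 0" for n
    using coef_six_op[of "\<lambda>_. f" n] zero by simp
  \<comment> \<open>Slot 5 is antilinear, so vanishing on Hermite functions extends to every cut of
    \<open>f\<close>; continuity then reaches \<open>f\<close> itself, which makes the diagonal
    value zero.\<close>
  have zcut: "six ((\<lambda>_. f)(5 := mode_cut K f)) = 0" for K
  proof (induction K)
    case 0
    have eq: "mode_cut 0 f = 0 *\<^sub>C f" unfolding mode_cut_eq by simp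
    show ?case unfolding eq by (subst six_slot_scale) simp_all
  next
    case (Suc K)
    have eq: "mode_cut (Suc K) f = mode_cut K f + coef f K *\<^sub>C hermite_L2 K" unfolding mode_cut_eq by simp
    have "six ((\<lambda>_. f)(5 := mode_cut K f + coef f K *\<^sub>C hermite_L2 K))
      = six ((\<lambda>_. f)(5 := mode_cut K f)) + six ((\<lambda>_. f)(5 := coef f K *\<^sub>C hermite_L2 K))"
      by (rule six_add) simp
    also have "six ((\<lambda>_. f)(5 := coef f K *\<^sub>C hermite_L2 K)) = slot_conj 5 (coef f K) * six ((\<lambda>_. f)(5 := hermite_L2 K))"
      by (rule six_slot_scale) simp
    finally show ?case unfolding eq z Suc by simp
  qed
  have "cmod (six (\<lambda>_. f)) \<le> six_const * norm (f - mode_cut K f) * norm f ^ 5" for K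
  proof -
    have eq: "(\<lambda>_::nat. f) = (\<lambda>_. f)(5 := (f - mode_cut K f) + mode_cut K f)" by (simp add: fun_eq_iff)
    have "six (\<lambda>_. f) = six ((\<lambda>_. f)(5 := (f - mode_cut K f) + mode_cut K f))"
      by (rule arg_cong[OF eq])
    also have "\<dots> = six ((\<lambda>_. f)(5 := f - mode_cut K f)) + six ((\<lambda>_. f)(5 := mode_cut K f))"
      by (rule six_add) simp
    finally have "six (\<lambda>_. f) = six ((\<lambda>_. f)(5 := f - mode_cut K f))" unfolding zcut by simp
    then show ?thesis using six_last_slot_bound[of "\<lambda>_. f" "f - mode_cut K f"] by simp
  qed
  moreover have "(\<lambda>K. six_const * norm (f - mode_cut K f) * norm f ^ 5) \<longlonglongrightarrow> six_const * norm (f - f) * norm f ^ 5"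
    by (intro tendsto_intros mode_cut_tendsto)
  ultimately have "cmod (six (\<lambda>_. f)) \<le> 0" by (intro LIMSEQ_le_const[of "\<lambda>K. six_const * norm (f - mode_cut K f) * norm f ^ 5"]) auto
  then have lim: "(\<lambda>K. six_trunc K (\<lambda>_. f)) \<longlonglongrightarrow> 0" using six_trunc_tendsto[of "\<lambda>_. f"] by simp
  \<comment> \<open>A positive multiple of the squared modulus of one coefficient. It is bounded by
    a multiple of \<open>l^(-3)\<close> for every \<open>l > 0\<close>, so it vanishes.\<close>
  define m where "m = pi / 2 * ((cmod (coef f n0))\<^sup>2 * hermite_mass n0)"
  have "m \<le> 1 / l ^ 3 * (pi / 2 * sqrt (pi / (3/2)))" if l: "l > 0" for l
  proof (rule LIMSEQ_le_const)
    have "(\<lambda>K. l ^ 6 * (pi / 12 * cmod (six_trunc K (\<lambda>_. f))) + 1 / l ^ 3 * (pi / 2 * sqrt (pi / (3/2))))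
        \<longlonglongrightarrow> l ^ 6 * (pi / 12 * cmod 0) + 1 / l ^ 3 * (pi / 2 * sqrt (pi / (3/2)))"
      by (intro tendsto_intros lim)
    then show "(\<lambda>K. l ^ 6 * (pi / 12 * cmod (six_trunc K (\<lambda>_. f))) + 1 / l ^ 3 * (pi / 2 * sqrt (pi / (3/2))))
        \<longlonglongrightarrow> 1 / l ^ 3 * (pi / 2 * sqrt (pi / (3/2)))" by simp
    have mK: "m \<le> pi / 2 * (\<Sum>n<K. (cmod (coef f n))\<^sup>2 * hermite_mass n)" if "K > n0" for K
      unfolding m_def using that less_imp_le[OF hermite_mass_pos]
      by (intro mult_left_mono member_le_sum) auto
    show "\<exists>N. \<forall>K\<ge>N. m \<le> l ^ 6 * (pi / 12 * cmod (six_trunc K (\<lambda>_. f))) + 1 / l ^ 3 * (pi / 2 * sqrt (pi / (3/2)))"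
      by (intro exI[of _ "Suc n0"] allI impI order_trans[OF mK local_mass_le_six[OF l]]) simp
  qed
  moreover have "((\<lambda>l::real. 1 / l ^ 3 * (pi / 2 * sqrt (pi / (3/2)))) \<longlongrightarrow> 0) at_top" by real_asymp
  ultimately have "m \<le> 0"
    by (intro tendsto_lowerbound[of "\<lambda>l::real. 1 / l ^ 3 * (pi / 2 * sqrt (pi / (3/2)))" 0 at_top])
       (auto intro!: eventually_mono[OF eventually_gt_at_top[of 0]])
  then show "coef f n0 = 0"
    using hermite_mass_pos[of n0] pi_gt_zero by (auto simp: m_def mult_le_0_iff not_le)
qed

section \<open>Contraction estimates on the high modes\<close>

lemma six_op_slot_add:
  assumes "i < 5"
  shows "six ((F(i := x + y))(5 := g)) = six ((F(i := x))(5 := g)) + six ((F(i := y))(5 := g))"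
proof -
  have "(F(i := z))(5 := g) = (F(5 := g))(i := z)" for z using assms by (simp add: fun_upd_twist)
  then show ?thesis using six_add[of i "F(5 := g)" x y] assms by simp
qed

lemma prod_two_special:
  fixes a b c :: real
  assumes "k < 5" "j < 5" "k \<noteq> j"
  shows "(\<Prod>i<(5::nat). if i = k then a else if i = j then b else c) = a * b * c ^ 3"
proof -
  have "{..<5::nat} = insert k (insert j ({..<5} - {k, j}))" using assms by auto
  moreover have "(\<Prod>i\<in>insert k (insert j ({..<5::nat} - {k, j})). if i = k then a else if i = j then b else c)
     = a * (b * (\<Prod>i\<in>{..<5::nat} - {k, j}. if i = k then a else if i = j then b else c))"
    using assms by (subst prod.insert; simp)+
  moreover have "(\<Prod>i\<in>{..<5::nat} - {k, j}. if i = k then a else if i = j then b else c) = (\<Prod>i\<in>{..<5::nat} - {k, j}. c)"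
    by (intro prod.cong) auto
  moreover have "card ({..<5::nat} - {k, j}) = 3" using assms by (simp add: card_Diff_insert)
  ultimately show ?thesis by (simp add: mult.assoc)
qed

lemma prod_one_special:
  fixes b c :: real
  assumes "j < 5"
  shows "(\<Prod>i<(5::nat). if i = j then b else c) = b * c ^ 4"
proof -
  have "(\<Prod>i<(5::nat). if i = j then b else c) = b * (\<Prod>i\<in>{..<5::nat} - {j}. if i = j then b else c)"
    using assms by (subst prod.remove[of _ j]) auto
  also have "(\<Prod>i\<in>{..<5::nat} - {j}. if i = j then b else c) = (\<Prod>i\<in>{..<5::nat} - {j}. c)"
    by (intro prod.cong) auto
  also have "\<dots> = c ^ 4" using assms by simp
  finally show ?thesis .
qed

definition near_low :: "nat \<Rightarrow> real \<Rightarrow> real \<Rightarrow> (nat \<Rightarrow> L2) \<Rightarrow> (nat \<Rightarrow> L2) \<Rightarrow> bool" where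
  "near_low M R e A F \<longleftrightarrow> (\<forall>i<5. low_modes M (A i) \<and> norm (A i) \<le> R \<and> norm (F i - A i) \<le> e)"

text \<open>The gain constant as a predicate, since it depends on \<open>M\<close>: it must be fixed
  after \<open>M\<close> and before \<open>N\<close>.\<close>

definition six_gain :: "nat \<Rightarrow> real \<Rightarrow> bool" where
  "six_gain M D \<longleftrightarrow> D \<ge> 0 \<and> (\<forall>F N i. i < 5 \<longrightarrow> (\<forall>j<5. j \<noteq> i \<longrightarrow> low_modes M (F j)) \<longrightarrow> high_modes N (F 5) \<longrightarrow>
       cmod (six F) \<le> D * decay_rate N * (\<Prod>i<6. norm (F i)))"

lemma six_gainD:
  assumes "six_gain M D"
  shows "D \<ge> 0"
    and "i < 5 \<Longrightarrow> (\<And>j. j < 5 \<Longrightarrow> j \<noteq> i \<Longrightarrow> low_modes M (F j)) \<Longrightarrow> high_modes N (F 5) \<Longrightarrow>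
       cmod (six F) \<le> D * decay_rate N * (\<Prod>i<6. norm (F i))"
  using assms unfolding six_gain_def by blast+

lemma six_gain_exists: obtains D where "six_gain M D"
proof -
  obtain D where "D \<ge> 0" "\<And>F N i. i < 5 \<Longrightarrow> (\<And>j. j < 5 \<Longrightarrow> j \<noteq> i \<Longrightarrow> low_modes M (F j)) \<Longrightarrow> high_modes N (F 5) \<Longrightarrow>
       cmod (six F) \<le> D * decay_rate N * (\<Prod>i<6. norm (F i))"
    using six_small[of M] by metis
  then show thesis by (intro that[of D]) (auto simp: six_gain_def)
qed

text \<open>With the vectors \<open>A\<close> in place of \<open>F\<close> the gain for low modes
  applies, slot \<open>j\<close> being free. The replacement is telescoped, each exchanged slot
  costing a factor \<open>e\<close>.\<close>

lemma six_near_low: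
  assumes D: "six_gain M D"
    and near: "near_low M R e A F" and e: "0 \<le> e" "e \<le> R" and g: "high_modes N g" and j: "j < 5"
  shows "cmod (six ((F(j := d))(5 := g))) \<le> (D * decay_rate N * R ^ 4 + 40 * six_const * e * R ^ 3) * norm d * norm g"
proof -
  have A: "low_modes M (A i)" "norm (A i) \<le> R" "norm (F i - A i) \<le> e" if "i < 5" for i
    using near that by (auto simp: near_low_def)
  have F: "norm (F i) \<le> 2 * R" if "i < 5" for i
  proof -
    have "norm (F i) \<le> norm (A i) + norm (F i - A i)" by (rule norm_triangle_sub)
    then show ?thesis using A[OF that] e by linarith
  qed
  have R: "R \<ge> 0" using e by linarith
  define A' where "A' = (\<lambda>i. if i < 5 then A i else F i)"
  have low: "cmod (six ((A'(j := d))(5 := g))) \<le> D * decay_rate N * (R ^ 4 * norm d * norm g)"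
  proof -
    have "cmod (six ((A'(j := d))(5 := g))) \<le> D * decay_rate N * (\<Prod>i<6. norm (((A'(j := d))(5 := g)) i))"
      using j g by (intro six_gainD(2)[OF D, of j]) (auto simp: A'_def A)
    also have "(\<Prod>i<6. norm (((A'(j := d))(5 := g)) i)) = norm g * (\<Prod>i\<in>{..<6} - {5}. norm ((A'(j := d)) i))"
      by (rule prod_slot_upd) simp
    also have "{..<6} - {5} = {..<5::nat}" by auto
    also have "D * decay_rate N * (norm g * (\<Prod>i<5. norm ((A'(j := d)) i))) \<le> D * decay_rate N * (norm g * (norm d * R ^ 4))"
    proof (intro mult_left_mono)
      have "(\<Prod>i<5. norm ((A'(j := d)) i)) \<le> (\<Prod>i<5. if i = j then norm d else R)"
        by (intro prod_mono) (auto simp: A'_def A)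
      also have "\<dots> = norm d * R ^ 4" by (rule prod_one_special[OF j])
      finally show "(\<Prod>i<5. norm ((A'(j := d)) i)) \<le> norm d * R ^ 4" .
    qed (use six_gainD(1)[OF D] decay_rate_pos[of N] in auto)
    also have "\<dots> = D * decay_rate N * (R ^ 4 * norm d * norm g)" by (simp only: mult_ac)
    finally show ?thesis .
  qed
  let ?T = "\<lambda>F. six (F(5 := g))"
  let ?X = "\<lambda>k. (\<lambda>i. if i < k then (A'(j := d)) i else (F(j := d)) i)(k := (F(j := d)) k - (A'(j := d)) k)"
  have "?T (F(j := d)) - ?T (A'(j := d)) = (\<Sum>k<5. ?T (?X k))"
    by (rule telescope_slots) (use j in \<open>auto simp: six_op_slot_add A'_def simp del: fun_upd_apply\<close>, simp add: A'_def)
  \<comment> \<open>The exchange in slot \<open>j\<close> contributes zero; counting it as well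
    gives five terms with \<open>(2 * R)^3\<close> each, hence the constant 40.\<close>
  also have "cmod \<dots> \<le> (\<Sum>k<(5::nat). six_const * norm g * (e * norm d * (2 * R) ^ 3))"
  proof (rule order_trans[OF norm_sum sum_mono])
    fix k :: nat assume k: "k \<in> {..<5}"
    have "cmod (?T (?X k)) \<le> six_const * norm g * (\<Prod>i<5. norm (?X k i))"
      by (rule six_last_slot_bound)
    also have "\<dots> \<le> six_const * norm g * (e * norm d * (2 * R) ^ 3)"
    proof (rule mult_left_mono)
      show "(\<Prod>i<5. norm (?X k i)) \<le> e * norm d * (2 * R) ^ 3"
      proof (cases "k = j")
        case True
        then have "norm (?X k j) = 0" by simp
        moreover have "j \<in> {..<5}" using j by simp
        ultimately have "(\<Prod>i<5. norm (?X k i)) = 0" by (intro prod_zero finite_lessThan) (rule bexI)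
        moreover have "0 \<le> e * norm d * (2 * R) ^ 3" using e R by simp
        ultimately show ?thesis by (simp only:)
      next
        case False
        have "(\<Prod>i<5. norm (?X k i)) \<le> (\<Prod>i<5. if i = k then e else if i = j then norm d else 2 * R)"
        proof (rule prod_mono)
          fix i :: nat assume i: "i \<in> {..<5}"
          then have "norm (A i) \<le> 2 * R" using A(2)[of i] R by simp
          then show "0 \<le> norm (?X k i) \<and> norm (?X k i) \<le> (if i = k then e else if i = j then norm d else 2 * R)"
            using i k F[of i] A(3)[of i] False by (auto simp: A'_def)
        qed
        also have "\<dots> = e * norm d * (2 * R) ^ 3" using k j False by (intro prod_two_special) auto
        finally show ?thesis .
      qed
    qed (use six_const_pos in simp)
    finally show "cmod (?T (?X k)) \<le> six_const * norm g * (e * norm d * (2 * R) ^ 3)" .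
  qed
  also have "\<dots> = 40 * six_const * e * R ^ 3 * norm d * norm g" by (simp add: power_mult_distrib)
  finally have "cmod (?T (F(j := d)) - ?T (A'(j := d))) \<le> 40 * six_const * e * R ^ 3 * norm d * norm g" .
  then show ?thesis
    using low norm_triangle_sub[of "?T (F(j := d))" "?T (A'(j := d))"] by (simp add: algebra_simps)
qed

definition high_part :: "nat \<Rightarrow> L2 \<Rightarrow> L2" where
  "high_part N = multiplier (\<lambda>n. if n < N then 0 else 1)"

lemma coef_high_part [simp]: "coef (high_part N f) n = (if n < N then 0 else coef f n)"
  unfolding high_part_def by (subst coef_multiplier[of _ 1]) auto

text \<open>Each hybrid of \<open>F\<close> and \<open>G\<close> is again close to the same low
  vectors, so every term of the telescoped difference has the small factor; the five terms give the
  5.\<close>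

lemma six_op_near_low_diff:
  assumes D: "six_gain M D"
    and F: "near_low M R e A F" and G: "near_low M R e A G" and e: "0 \<le> e" "e \<le> R"
    and d: "\<And>i. i < 5 \<Longrightarrow> norm (F i - G i) \<le> d" "d \<ge> 0"
  shows "norm (high_part N (six_op F) - high_part N (six_op G))
     \<le> 5 * (D * decay_rate N * R ^ 4 + 40 * six_const * e * R ^ 3) * d"
proof -
  let ?q = "D * decay_rate N * R ^ 4 + 40 * six_const * e * R ^ 3"
  have q: "?q \<ge> 0" using six_gainD(1)[OF D] decay_rate_pos[of N] six_const_pos e by (intro add_nonneg_nonneg mult_nonneg_nonneg) auto
  define G' where "G' = (\<lambda>i. if i < 5 then G i else F i)"
  have GG: "six (G(5 := g)) = six (G'(5 := g))" for g by (rule six_outside) (auto simp: G'_def)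
  define \<phi> where "\<phi> g = six (F(5 := g)) - six (G'(5 := g))" for g
  have bound: "cmod (\<phi> g) \<le> (5 * ?q * d) * norm g" if g: "high_modes N g" for g
  proof -
    let ?H = "\<lambda>j i. if i < j then G' i else F i"
    have "\<phi> g = (\<Sum>j<5. six (((?H j)(j := F j - G' j))(5 := g)))"
      unfolding \<phi>_def by (rule telescope_slots) (auto simp: six_op_slot_add G'_def simp del: fun_upd_apply)
    also have "cmod \<dots> \<le> (\<Sum>j<(5::nat). ?q * d * norm g)"
    proof (rule order_trans[OF norm_sum sum_mono])
      fix j :: nat assume j: "j \<in> {..<5}"
      have "near_low M R e A (?H j)" using F G by (auto simp: near_low_def G'_def)
      then have "cmod (six (((?H j)(j := F j - G' j))(5 := g))) \<le> ?q * norm (F j - G' j) * norm g"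
        by (rule six_near_low[OF D _ e g]) (use j in \<open>simp_all only: lessThan_iff\<close>)
      also have "\<dots> \<le> ?q * d * norm g"
        using j d(1)[of j] q by (intro mult_right_mono mult_left_mono) (auto simp: G'_def)
      finally show "cmod (six (((?H j)(j := F j - G' j))(5 := g))) \<le> ?q * d * norm g" .
    qed
    also have "\<dots> = (5 * ?q * d) * norm g" by simp
    finally show ?thesis .
  qed
  have add: "\<phi> (x + y) = \<phi> x + \<phi> y" for x y
    unfolding \<phi>_def by (simp add: six_add del: fun_upd_apply)
  have scale: "\<phi> (c *\<^sub>C x) = cnj c * \<phi> x" for c x
    unfolding \<phi>_def by (simp add: six_slot_scale slot_conj_def algebra_simps del: fun_upd_apply)
  show ?thesis
  proof (rule norm_le_coefI)
    show "5 * ?q * d \<ge> 0" using q d(2) by simp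
    fix K
    have "(\<Sum>n<K. (cmod (if n < N then 0 else \<phi> (hermite_L2 n)))\<^sup>2) \<le> (5 * ?q * d)\<^sup>2"
      using q d(2) by (intro antilinear_coef_sum_le add scale bound) auto
    moreover have "coef (high_part N (six_op F) - high_part N (six_op G)) n = (if n < N then 0 else \<phi> (hermite_L2 n))" for n
      by (simp add: coef_six_op \<phi>_def GG)
    ultimately show "(\<Sum>n<K. (cmod (coef (high_part N (six_op F) - high_part N (six_op G)) n))\<^sup>2) \<le> (5 * ?q * d)\<^sup>2"
      by simp
  qed
qed

lemma dilate_diff: "0 \<le> r \<Longrightarrow> r \<le> 1 \<Longrightarrow> dilate r (f - g) = dilate r f - dilate r g"
  by (rule L2_eqI) (simp add: coef_dilate algebra_simps)

text \<open>Removing the factor \<open>e\<^bsup>-\<mu>H\<^esup>\<close> from a stationary wave \<open>e\<^bsup>-\<mu>H\<^esup> y\<close> leaves the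
  unchanged quintic operator with \<open>e\<^bsup>-2\<mu>H\<^esup>\<close> in the conjugated slots, that is \<open>t = r\<^sup>2\<close> below.\<close>

definition twisted :: "real \<Rightarrow> L2 \<Rightarrow> nat \<Rightarrow> L2" where
  "twisted t y i = (if i < 3 then y else dilate t y)"

lemma near_low_twisted:
  assumes "low_modes M a" "norm a \<le> R" "norm (y - a) \<le> e" "0 \<le> t" "t \<le> 1"
  shows "near_low M R e (twisted t a) (twisted t y)"
  using assms norm_dilate[of t "y - a"] norm_dilate[of t a]
  by (auto simp: near_low_def twisted_def dilate_diff[symmetric] low_modes_def coef_dilate)

lemma six_op_low_high_part: "low_modes M a \<Longrightarrow> 3 * M \<le> N \<Longrightarrow> high_part N (six_op (twisted t a)) = 0"
proof (rule L2_eqI)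
  fix n
  assume a: "low_modes M a" and N: "3 * M \<le> N"
  have "six ((twisted t a)(5 := hermite_L2 n)) = 0" if "n \<ge> N"
    using a N that by (intro six_high_zero[of M]) (auto simp: twisted_def high_modes_def coef_hermite_L2)
  then show "coef (high_part N (six_op (twisted t a))) n = coef 0 n" by (simp add: coef_six_op)
qed

text \<open>The high part of the operator vanishes at the low vector \<open>a\<close>, so the size
  of the image is itself a difference estimate. Since \<open>b + \<kappa>\<close> is within
  \<open>3 * \<eta>\<close> of \<open>a\<close>, the factor \<open>1/4\<close> leaves
  \<open>3/4 * \<eta>\<close>, and the ball is preserved.\<close>

lemma twisted_contraction:
  assumes D: "six_gain M D"
    and eta: "\<eta> > 0" "3 * \<eta> \<le> R" and N: "3 * M \<le> N"
    and small: "5 * (D * decay_rate N * R ^ 4 + 40 * six_const * (3 * \<eta>) * R ^ 3) \<le> \<bar>\<omega>\<bar> / 4" and \<omega>: "\<omega> \<noteq> 0"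
    and a: "low_modes M a" "norm a \<le> R" and b: "norm (b - a) \<le> 2 * \<eta>" and t: "0 \<le> t" "t \<le> 1"
  defines "\<Psi> \<equiv> \<lambda>\<kappa>. (1 / \<omega>) *\<^sub>R high_part N (six_op (twisted t (b + \<kappa>)))"
  shows "norm \<kappa> \<le> \<eta> \<Longrightarrow> norm (\<Psi> \<kappa>) \<le> \<eta>"
    and "norm \<kappa> \<le> \<eta> \<Longrightarrow> norm \<kappa>' \<le> \<eta> \<Longrightarrow> norm (\<Psi> \<kappa> - \<Psi> \<kappa>') \<le> (1/4) * norm (\<kappa> - \<kappa>')"
proof -
  let ?q = "5 * (D * decay_rate N * R ^ 4 + 40 * six_const * (3 * \<eta>) * R ^ 3)"
  have near: "near_low M R (3 * \<eta>) (twisted t a) (twisted t (b + \<kappa>))" if "norm \<kappa> \<le> \<eta>" for \<kappa>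
  proof (rule near_low_twisted[OF a _ t])
    have "norm (b + \<kappa> - a) = norm ((b - a) + \<kappa>)" by (simp add: algebra_simps)
    also have "\<dots> \<le> 3 * \<eta>" using norm_triangle_ineq[of "b - a" \<kappa>] b that by linarith
    finally show "norm (b + \<kappa> - a) \<le> 3 * \<eta>" .
  qed
  have diff: "norm (twisted t x i - twisted t y i) \<le> norm (x - y)" for x y i
    using norm_dilate[OF t, of "x - y"] by (simp add: twisted_def dilate_diff[OF t, symmetric])
  have div: "norm ((1 / \<omega>) *\<^sub>R v) \<le> (1/4) * d" if "norm v \<le> ?q * d" "d \<ge> 0" for v :: L2 and d
  proof -
    have "norm v \<le> (\<bar>\<omega>\<bar> / 4) * d" using that small by (meson mult_right_mono order_trans)
    then show ?thesis using \<omega> by (simp add: field_simps)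
  qed
  {
    assume \<kappa>: "norm \<kappa> \<le> \<eta>"
    have "near_low M R (3 * \<eta>) (twisted t a) (twisted t a)"
      using eta by (intro near_low_twisted a t) auto
    then have "norm (high_part N (six_op (twisted t (b + \<kappa>))) - high_part N (six_op (twisted t a))) \<le> ?q * norm (b + \<kappa> - a)"
      using eta by (intro six_op_near_low_diff[OF D near[OF \<kappa>]] diff) auto
    then have "norm (\<Psi> \<kappa>) \<le> (1/4) * norm (b + \<kappa> - a)"
      unfolding \<Psi>_def six_op_low_high_part[OF a(1) N] by (intro div) auto
    also have "norm (b + \<kappa> - a) \<le> 3 * \<eta>"
    proof -
      have "norm (b + \<kappa> - a) = norm ((b - a) + \<kappa>)" by (simp add: algebra_simps)
      then show ?thesis using norm_triangle_ineq[of "b - a" \<kappa>] b \<kappa> by linarith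
    qed
    finally show "norm (\<Psi> \<kappa>) \<le> \<eta>" using eta by simp
  }
  {
    assume \<kappa>: "norm \<kappa> \<le> \<eta>" "norm \<kappa>' \<le> \<eta>"
    have "norm (high_part N (six_op (twisted t (b + \<kappa>))) - high_part N (six_op (twisted t (b + \<kappa>')))) \<le> ?q * norm ((b + \<kappa>) - (b + \<kappa>'))"
      using eta by (intro six_op_near_low_diff[OF D near[OF \<kappa>(1)] near[OF \<kappa>(2)]] diff) auto
    then have "norm ((1 / \<omega>) *\<^sub>R (high_part N (six_op (twisted t (b + \<kappa>))) - high_part N (six_op (twisted t (b + \<kappa>'))))) \<le> (1/4) * norm (\<kappa> - \<kappa>')"
      by (intro div) auto
    then show "norm (\<Psi> \<kappa> - \<Psi> \<kappa>') \<le> (1/4) * norm (\<kappa> - \<kappa>')"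
      unfolding \<Psi>_def by (simp add: scaleR_diff_right)
  }
qed

text \<open>Moving the three plain factors \<open>r\<close> to the conjugated side gives
  \<open>r^2\<close> in slots 3 and 4, which already carry one \<open>r\<close>, and
  \<open>r^n\<close> from the test mode in slot 5.\<close>

lemma twisted_dilate_fixed:
  assumes r: "0 \<le> r" "r \<le> 1"
  shows "six ((twisted 1 (dilate r y))(5 := hermite_L2 n)) = of_real (r ^ n) * six ((twisted (r\<^sup>2) y)(5 := hermite_L2 n))"
proof -
  have one: "dilate 1 g = g" for g by (rule L2_eqI) (simp add: coef_dilate)
  have sq: "dilate r (dilate r g) = dilate (r\<^sup>2) g" for g
    using r by (intro L2_eqI) (simp add: coef_dilate power_le_one flip: power_mult_distrib power_add, simp add: power2_eq_square power_mult_distrib)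
  have h: "dilate r (hermite_L2 n) = of_real (r ^ n) *\<^sub>C hermite_L2 n"
    using r by (intro L2_eqI) (simp add: coef_dilate coef_hermite_L2)
  define F :: "nat \<Rightarrow> L2" where "F = (\<lambda>i. if i < 3 then y else if i < 5 then dilate r y else hermite_L2 n)"
  have "six ((twisted 1 (dilate r y))(5 := hermite_L2 n)) = six (\<lambda>i. if i < 3 then dilate r (F i) else F i)"
    by (rule six_outside) (auto simp: F_def twisted_def one)
  also have "\<dots> = six (\<lambda>i. if i < 3 then F i else dilate r (F i))" by (rule six_dilate[OF r])
  also have "\<dots> = six ((twisted (r\<^sup>2) y)(5 := of_real (r ^ n) *\<^sub>C hermite_L2 n))"
    by (rule six_outside) (auto simp: F_def twisted_def sq h)
  also have "\<dots> = of_real (r ^ n) * six ((twisted (r\<^sup>2) y)(5 := hermite_L2 n))"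
    by (subst six_slot_scale) (simp_all add: slot_conj_def)
  finally show ?thesis .
qed

section \<open>Geometric decay of the Hermite coefficients\<close>

lemma contraction_ball:
  fixes \<Psi> :: "L2 \<Rightarrow> L2"
  assumes \<eta>: "\<eta> > 0"
    and into: "\<And>\<kappa>. norm \<kappa> \<le> \<eta> \<Longrightarrow> norm (\<Psi> \<kappa>) \<le> \<eta>"
    and contr: "\<And>\<kappa> \<kappa>'. norm \<kappa> \<le> \<eta> \<Longrightarrow> norm \<kappa>' \<le> \<eta> \<Longrightarrow> norm (\<Psi> \<kappa> - \<Psi> \<kappa>') \<le> (1/4) * norm (\<kappa> - \<kappa>')"
  shows "\<exists>!\<kappa>. norm \<kappa> \<le> \<eta> \<and> \<Psi> \<kappa> = \<kappa>"
proof -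
  have "\<exists>!\<kappa>. \<kappa> \<in> cball 0 \<eta> \<and> \<Psi> \<kappa> = \<kappa>"
  proof (rule Banach_fix[OF complete_eq_closed[THEN iffD2, OF closed_cball], where c = "1/4"])
    show "cball (0::L2) \<eta> \<noteq> {}" using \<eta> by simp
    show "\<Psi> ` cball 0 \<eta> \<subseteq> cball 0 \<eta>" using into by auto
    show "dist (\<Psi> x) (\<Psi> y) \<le> 1/4 * dist x y" if "x \<in> cball 0 \<eta>" "y \<in> cball 0 \<eta>" for x y
      using contr[of x y] that by (simp add: dist_norm)
  qed auto
  then show ?thesis by simp
qed

text \<open>The order of choices matters: \<open>\<eta>\<close> depends only on
  \<open>\<omega>\<close> and \<open>R\<close>, then \<open>M\<close> makes the tail of
  \<open>f\<close> small, \<open>D\<close> belongs to \<open>M\<close>, \<open>N\<close> beats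
  \<open>D\<close>, and \<open>r\<close> is adapted to \<open>N\<close> at the end.\<close>

lemma geometric_decay_of_eigen:
  assumes \<omega>: "\<omega> \<noteq> 0" and eq: "\<And>n. of_real \<omega> * coef f n = six ((\<lambda>_. f)(5 := hermite_L2 n))"
  obtains C r where "0 < r" "r < 1" "C \<ge> 0" "\<And>n. cmod (coef f n) \<le> C * r ^ n"
proof -
  \<comment> \<open>Twice the norm, because dividing the low modes by \<open>r^n\<close> may double
    them.\<close>
  define R where "R = 2 * norm f + 1"
  have R: "R \<ge> 1" "norm f \<le> R" "2 * norm f \<le> R" by (simp_all add: R_def)
  \<comment> \<open>The first bound keeps \<open>3 * \<eta>\<close> below \<open>R\<close>; the
    second makes \<open>5 * 40 * 3 = 600\<close> times \<open>six_const * \<eta> * R ^ 3\<close> at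
    most an eighth of \<open>\<bar>\<omega>\<bar>\<close>, leaving the other eighth for the term
    with \<open>decay_rate N\<close>.\<close>
  define \<eta> where "\<eta> = min (R / 3) (\<bar>\<omega>\<bar> / (4800 * six_const * R ^ 3))"
  have p: "4800 * six_const * R ^ 3 > 0" using R six_const_pos by simp
  have \<eta>: "\<eta> > 0" "3 * \<eta> \<le> R" using R \<omega> p by (auto simp: \<eta>_def)
  have "\<eta> \<le> \<bar>\<omega>\<bar> / (4800 * six_const * R ^ 3)" by (simp add: \<eta>_def)
  then have \<eta>3: "4800 * six_const * R ^ 3 * \<eta> \<le> \<bar>\<omega>\<bar>" using p by (simp add: pos_le_divide_eq mult_ac)
  obtain M where M: "norm (mode_cut M f - f) \<le> \<eta>"
    using tendstoD[OF mode_cut_tendsto \<eta>(1), of f]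
    by (auto simp: eventually_sequentially dist_norm intro: less_imp_le)
  obtain D where D: "six_gain M D" using six_gain_exists .
  have "(\<lambda>N. 5 * (D * decay_rate N * R ^ 4)) \<longlonglongrightarrow> 5 * (D * 0 * R ^ 4)"
    by (intro tendsto_intros decay_rate_tendsto)
  then have "\<forall>\<^sub>F N in sequentially. 5 * (D * decay_rate N * R ^ 4) < \<bar>\<omega>\<bar> / 8"
    by (rule order_tendstoD(2)) (use \<omega> in simp)
  then obtain N where N: "3 * M \<le> N" "5 * (D * decay_rate N * R ^ 4) < \<bar>\<omega>\<bar> / 8"
    unfolding eventually_sequentially by (metis nle_le)
  have small: "5 * (D * decay_rate N * R ^ 4 + 40 * six_const * (3 * \<eta>) * R ^ 3) \<le> \<bar>\<omega>\<bar> / 4"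
    using N(2) \<eta>3 by (simp add: algebra_simps)
  \<comment> \<open>Bernoulli's inequality gives \<open>r ^ N \<ge> 1 / 2\<close> for this value, so
    the inverse powers below \<open>N\<close> are at most 2.\<close>
  define r :: real where "r = 1 - 1 / (2 * (real N + 1))"
  have r: "0 < r" "r < 1" by (auto simp: r_def field_simps)
  have rN: "r ^ N \<ge> 1 / 2"
  proof -
    have "1 + real N * (r - 1) \<le> (1 + (r - 1)) ^ N"
      by (rule Bernoulli_inequality) (use r in simp)
    moreover have "real N * (r - 1) \<ge> - (1 / 2)" by (simp add: r_def field_simps)
    ultimately show ?thesis by simp
  qed
  have rn: "r ^ n \<ge> 1 / 2" if "n \<le> N" for n
    by (rule order_trans[OF rN power_decreasing[OF that]]) (use r in auto)
  have inv: "cmod (of_real (1 / r ^ n)) \<le> 2" if "n < N" for n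
    using rn[of n] that r by (simp add: norm_divide norm_power field_simps)
  have MN: "M \<le> N" using N by simp
  define mb ma where "mb n = (if n < N then complex_of_real (1 / r ^ n) else 0)"
    and "ma n = (if n < M then complex_of_real (1 / r ^ n) else 0)" for n
  have m2: "cmod (mb n) \<le> 2" "cmod (ma n) \<le> 2" for n
    using inv[of n] MN by (auto simp: mb_def ma_def simp del: of_real_divide)
  define b a where "b = multiplier mb f" and "a = multiplier ma f"
  have cb: "coef b n = mb n * coef f n" and ca: "coef a n = ma n * coef f n" for n
    unfolding b_def a_def using m2 by (auto intro: coef_multiplier)
  have a: "low_modes M a" "norm a \<le> R"
    using order_trans[OF norm_multiplier[of ma, OF m2(2)] R(3)] by (auto simp: low_modes_def ca ma_def) (simp add: a_def)
  have "b - a = multiplier mb (f - mode_cut M f)"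
    using MN by (intro L2_eqI) (auto simp: cb ca coef_multiplier[of mb, OF m2(1)] ma_def mb_def)
  then have ba: "norm (b - a) \<le> 2 * \<eta>"
    using norm_multiplier[of mb, OF m2(1), of "f - mode_cut M f"] M by (simp add: norm_minus_commute)
  let ?\<Psi> = "\<lambda>t b \<kappa>. (1 / \<omega>) *\<^sub>R high_part N (six_op (twisted t (b + \<kappa>)))"
  have t: "0 \<le> r\<^sup>2" "r\<^sup>2 \<le> 1" using r by (auto simp: power_le_one)
  have "\<exists>!\<kappa>. norm \<kappa> \<le> \<eta> \<and> ?\<Psi> (r\<^sup>2) b \<kappa> = \<kappa>"
    by (rule contraction_ball[OF \<eta>(1)]) (rule twisted_contraction[OF D \<eta> N(1) small \<omega> a ba t]; assumption)+
  then obtain \<kappa> where \<kappa>: "norm \<kappa> \<le> \<eta>" "?\<Psi> (r\<^sup>2) b \<kappa> = \<kappa>" by blast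
  have a1: "low_modes M (mode_cut M f)" "norm (mode_cut M f) \<le> R"
    using order_trans[OF norm_mode_cut R(2)] by (auto simp: low_modes_def)
  have "mode_cut N f - mode_cut M f = mode_cut N (f - mode_cut M f)"
    using MN by (intro L2_eqI) auto
  then have b1: "norm (mode_cut N f - mode_cut M f) \<le> 2 * \<eta>"
    using norm_mode_cut[of N "f - mode_cut M f"] M \<eta> by (simp add: norm_minus_commute)
  have uniq: "\<exists>!\<kappa>. norm \<kappa> \<le> \<eta> \<and> ?\<Psi> 1 (mode_cut N f) \<kappa> = \<kappa>"
    by (rule contraction_ball[OF \<eta>(1)]) (rule twisted_contraction[OF D \<eta> N(1) small \<omega> a1 b1 zero_le_one order_refl]; assumption)+
  have k: "norm (high_part N f) \<le> \<eta>"
  proof -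
    have "high_part N f = high_part N (f - mode_cut M f)" using MN by (intro L2_eqI) auto
    also have "norm \<dots> \<le> 1 * norm (f - mode_cut M f)"
      unfolding high_part_def by (rule norm_multiplier) simp
    finally show ?thesis using M by (simp add: norm_minus_commute)
  qed
  have k\<Psi>: "?\<Psi> 1 (mode_cut N f) (high_part N f) = high_part N f"
  proof (rule L2_eqI)
    fix n
    have s: "mode_cut N f + high_part N f = f" by (rule L2_eqI) simp
    have d1: "dilate 1 f = f" by (rule L2_eqI) (simp add: coef_dilate)
    have "twisted 1 f = (\<lambda>_. f)" by (rule ext) (simp add: twisted_def d1)
    then show "coef (?\<Psi> 1 (mode_cut N f) (high_part N f)) n = coef (high_part N f) n"
      using \<omega> unfolding s by (simp add: scaleR_L2_eq coef_six_op flip: eq)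
  qed
  have "norm (dilate r \<kappa>) \<le> \<eta>" using norm_dilate[of r \<kappa>] r \<kappa> by simp
  moreover have "?\<Psi> 1 (mode_cut N f) (dilate r \<kappa>) = dilate r \<kappa>"
  proof (rule L2_eqI)
    fix n
    \<comment> \<open>A fixed point has no modes below \<open>N\<close>, so the dilation of
      \<open>b + \<kappa>\<close> restores the true low modes of \<open>f\<close> and affects
      \<open>\<kappa>\<close> only above \<open>N\<close>.\<close>
    have s: "mode_cut N f + dilate r \<kappa> = dilate r (b + \<kappa>)"
    proof (rule L2_eqI)
      have "coef \<kappa> n = 0" if "n < N" for n
      proof -
        have "coef \<kappa> n = coef (?\<Psi> (r\<^sup>2) b \<kappa>) n" by (simp only: \<kappa>(2))
        also have "\<dots> = 0" using that by (simp add: scaleR_L2_eq)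
        finally show ?thesis .
      qed
      then show "coef (mode_cut N f + dilate r \<kappa>) n = coef (dilate r (b + \<kappa>)) n" for n
        using r by (simp add: coef_dilate cb mb_def)
    qed
    have "coef (?\<Psi> 1 (mode_cut N f) (dilate r \<kappa>)) n = of_real (r ^ n) * coef (?\<Psi> (r\<^sup>2) b \<kappa>) n"
      unfolding s using twisted_dilate_fixed[of r "b + \<kappa>" n] r by (simp add: scaleR_L2_eq coef_six_op)
    also have "\<dots> = coef (dilate r \<kappa>) n" unfolding \<kappa>(2) using r by (simp add: coef_dilate)
    finally show "coef (?\<Psi> 1 (mode_cut N f) (dilate r \<kappa>)) n = coef (dilate r \<kappa>) n" .
  qed
  \<comment> \<open>Both vectors are fixed points of the undilated map in the same ball. Uniqueness
    transfers the factor \<open>r^n\<close> to the high modes of \<open>f\<close>.\<close>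
  ultimately have eqk: "high_part N f = dilate r \<kappa>" using uniq k k\<Psi> by blast
  show thesis
  proof (rule that[of r "2 * norm f + norm \<kappa>"])
    fix n
    show "cmod (coef f n) \<le> (2 * norm f + norm \<kappa>) * r ^ n"
    proof (cases "n < N")
      case True
      have "cmod (coef f n) \<le> norm f * 1" using norm_coef_le by simp
      also have "\<dots> \<le> norm f * (2 * r ^ n)" using rn[of n] True by (intro mult_left_mono) auto
      also have "\<dots> \<le> (2 * norm f + norm \<kappa>) * r ^ n" using r by (simp add: algebra_simps)
      finally show ?thesis .
    next
      case False
      then have "coef f n = of_real (r ^ n) * coef \<kappa> n"
        using arg_cong[OF eqk, of "\<lambda>x. coef x n"] r by (simp add: coef_dilate)
      then have "cmod (coef f n) = cmod (coef \<kappa> n) * r ^ n" using r by (simp add: norm_mult norm_power)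
      also have "\<dots> \<le> (2 * norm f + norm \<kappa>) * r ^ n"
        using r by (intro mult_right_mono add_increasing norm_coef_le) auto
      finally show ?thesis .
    qed
  qed (use r in auto)
qed

lemma geometric_decay:
  assumes eq: "\<omega> *\<^sub>R f = T6 f"
  obtains C r where "0 < r" "r < 1" "C \<ge> 0" "\<And>n. cmod (coef f n) \<le> C * r ^ n"
proof (cases "\<omega> = 0")
  case True
  then have "six_op (\<lambda>_. f) = 0" using eq by (simp add: T6_eq_six_op)
  then have "f = 0" by (rule six_op_zero_imp_zero)
  then show thesis by (intro that[of "1/2" 0]) auto
next
  case False
  show thesis
  proof (rule geometric_decay_of_eigen[OF False])
    show "of_real \<omega> * coef f n = six ((\<lambda>_. f)(5 := hermite_L2 n))" for n
      using arg_cong[OF eq, of "\<lambda>g. coef g n"] by (simp add: scaleR_L2_eq coef_T6 del: fun_upd_apply)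
  qed (rule that)
qed

section \<open>Hermite series with geometrically decaying coefficients\<close>

definition hermite_term :: "nat \<Rightarrow> complex \<Rightarrow> complex" where
  "hermite_term n z = hermite_complex n z / of_real (hermite_norm n) * exp (- z\<^sup>2 / 2)"

definition hermite_series :: "(nat \<Rightarrow> complex) \<Rightarrow> complex \<Rightarrow> complex" where
  "hermite_series d z = (\<Sum>n. d n * hermite_term n z)"

lemma hermite_term_of_real: "hermite_term n (of_real x) = of_real (hermite_fun n x)"
  unfolding hermite_term_def hermite_fun_eq hermite_gauss_def hermite_complex_of_real
  by (simp flip: exp_of_real)

lemma holomorphic_hermite_term: "hermite_term n holomorphic_on S"
  unfolding hermite_term_def[abs_def]
  by (intro holomorphic_intros holomorphic_hermite_complex) (simp_all add: hermite_norm_pos)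

lemma sqrt_power_square: "r \<ge> 0 \<Longrightarrow> (sqrt r ^ n)\<^sup>2 = r ^ n"
  by (simp add: power2_eq_square flip: power_mult_distrib)

lemma hermite_term_bound:
  assumes r: "0 < r" "r < 1"
  shows "cmod (hermite_term n z) \<le> inverse (sqrt r ^ n) * (sqrt (cmod (mehler_fun z (cnj z) (of_real r))) * cmod (exp (- z\<^sup>2 / 2)))"
proof -
  define w :: real where "w = 2 ^ n * fact n"
  have w: "w > 0" by (simp add: w_def)
  \<comment> \<open>The normalising constant is \<open>sqrt w\<close> times the fourth root of
    \<open>pi\<close>; that root exceeds 1 and may be dropped.\<close>
  have "1 \<le> sqrt (sqrt pi)" using pi_gt3 by simp
  then have hn: "hermite_norm n \<ge> sqrt w" "hermite_norm n > 0"
    using w by (simp_all add: hermite_norm_def w_def real_sqrt_mult)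
  have sq: "inverse (r ^ n) = (inverse (sqrt r ^ n))\<^sup>2"
    using r by (simp add: power_inverse sqrt_power_square)
  have "(cmod (hermite_complex n z))\<^sup>2 / w \<le> inverse (r ^ n) * cmod (mehler_fun z (cnj z) (of_real r))"
    unfolding w_def by (rule hermite_complex_square_le[OF r])
  then have "sqrt ((cmod (hermite_complex n z))\<^sup>2 / w) \<le> sqrt (inverse (r ^ n) * cmod (mehler_fun z (cnj z) (of_real r)))"
    by (rule real_sqrt_le_mono)
  then have h: "cmod (hermite_complex n z) / sqrt w \<le> inverse (sqrt r ^ n) * sqrt (cmod (mehler_fun z (cnj z) (of_real r)))"
    unfolding sq using r by (simp add: real_sqrt_divide real_sqrt_mult)
  have "cmod (hermite_complex n z) / hermite_norm n \<le> cmod (hermite_complex n z) / sqrt w"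
    using hn w by (intro divide_left_mono) auto
  then have "cmod (hermite_complex n z) / hermite_norm n * cmod (exp (- z\<^sup>2 / 2))
      \<le> inverse (sqrt r ^ n) * sqrt (cmod (mehler_fun z (cnj z) (of_real r))) * cmod (exp (- z\<^sup>2 / 2))"
    using h by (intro mult_right_mono) (auto intro: order_trans)
  then show ?thesis using hn by (simp add: hermite_term_def norm_mult norm_divide mult_ac)
qed

lemma abs_hermite_fun_le:
  assumes r: "0 < r" "r < 1"
  shows "\<bar>hermite_fun n x\<bar> \<le> inverse (sqrt r ^ n) * (sqrt (1 / sqrt (pi * (1 - r\<^sup>2))) * exp (- ((1 - r) / (2 * (1 + r)) * x\<^sup>2)))"
    (is "_ \<le> ?B")
proof (rule power2_le_imp_le)
  have "?B\<^sup>2 = inverse (r ^ n) * (exp (- (x\<^sup>2 * ((1 - r) / (1 + r)))) / sqrt (pi * (1 - r\<^sup>2)))"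
  proof -
    have 1: "(inverse (sqrt r ^ n))\<^sup>2 = inverse (r ^ n)"
      using r by (simp add: power_inverse sqrt_power_square)
    have 2: "(sqrt (1 / sqrt (pi * (1 - r\<^sup>2))))\<^sup>2 = 1 / sqrt (pi * (1 - r\<^sup>2))"
      using r by (intro real_sqrt_pow2) (simp add: power_le_one)
    have 3: "(exp (- ((1 - r) / (2 * (1 + r)) * x\<^sup>2)))\<^sup>2 = exp (- (x\<^sup>2 * ((1 - r) / (1 + r))))"
      using r by (simp flip: exp_double) (simp add: field_simps)
    show ?thesis unfolding power_mult_distrib 1 2 3 by simp
  qed
  then show "\<bar>hermite_fun n x\<bar>\<^sup>2 \<le> ?B\<^sup>2" using hermite_fun_square_le[OF r, of n x] by simp
  show "0 \<le> ?B" using r by (simp add: power_le_one)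
qed

section \<open>Termwise bounds and integrals of a decaying Hermite series\<close>

context
  fixes d :: "nat \<Rightarrow> complex" and C r :: real
  assumes r: "0 < r" "r < 1" and C: "C \<ge> 0" and d: "\<And>n. cmod (d n) \<le> C * r ^ n"
begin

lemma sqrt_ratio: "0 < sqrt r" "sqrt r < 1" "summable (\<lambda>n. K * sqrt r ^ n)" for K :: real
  using r by (auto intro!: summable_mult summable_geometric)

text \<open>The decay \<open>r^n\<close> is spent in two halves: one \<open>sqrt r ^ n\<close> pays
  for the growth in Mehler's bound with the same \<open>r\<close>, the other leaves a convergent
  geometric series.\<close>

lemma decaying_coef_mult_le:
  assumes "cmod y \<le> inverse (sqrt r ^ n) * B" "B \<ge> 0"
  shows "cmod (d n * y) \<le> C * B * sqrt r ^ n"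
proof -
  have "r ^ n = sqrt r ^ n * sqrt r ^ n" using r by (simp flip: power_mult_distrib)
  moreover have "cmod (d n * y) \<le> (C * r ^ n) * (inverse (sqrt r ^ n) * B)"
    unfolding norm_mult using assms d[of n] C r by (intro mult_mono) auto
  ultimately show ?thesis using r by (simp add: mult_ac)
qed

text \<open>The growth factor in \<open>hermite_term_bound\<close> is continuous in
  \<open>z\<close>, hence bounded on each closed disc, and the partial sums converge uniformly
  there.\<close>

lemma holomorphic_hermite_series: "hermite_series d holomorphic_on UNIV"
proof (rule holomorphic_uniform_sequence[where f = "\<lambda>n z. \<Sum>i<n. d i * hermite_term i z"])
  show "(\<lambda>z. \<Sum>i<n. d i * hermite_term i z) holomorphic_on UNIV" for n
    by (intro holomorphic_intros holomorphic_hermite_term)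
  fix z0 :: complex
  define G where "G z = sqrt (cmod (mehler_fun z (cnj z) (of_real r))) * cmod (exp (- z\<^sup>2 / 2))" for z
  have "r\<^sup>2 < 1" using r by (simp add: abs_square_less_1)
  then have "complex_of_real (r\<^sup>2) \<noteq> of_real 1" unfolding of_real_eq_iff by simp
  then have "1 - (complex_of_real r)\<^sup>2 \<noteq> 0" by simp
  then have "continuous_on (cball z0 1) G"
    unfolding G_def mehler_fun_def by (intro continuous_intros) auto
  then have "bounded (G ` cball z0 1)" by (intro compact_imp_bounded compact_continuous_image) auto
  then obtain B where "\<forall>y\<in>G ` cball z0 1. norm y \<le> B" unfolding bounded_iff by blast
  then have B: "G z \<le> B" if "z \<in> cball z0 1" for z using that abs_le_D1 by fastforce
  have "uniform_limit (cball z0 1) (\<lambda>n z. \<Sum>i<n. d i * hermite_term i z) (hermite_series d) sequentially"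
    unfolding hermite_series_def[abs_def]
  proof (rule Weierstrass_m_test)
    fix n z assume z: "z \<in> cball z0 1"
    have "cmod (d n * hermite_term n z) \<le> C * G z * sqrt r ^ n"
      unfolding G_def by (intro decaying_coef_mult_le hermite_term_bound[OF r]) simp
    also have "\<dots> \<le> C * B * sqrt r ^ n"
      using B[OF z] C r by (intro mult_right_mono mult_left_mono) auto
    finally show "cmod (d n * hermite_term n z) \<le> C * B * sqrt r ^ n" .
  qed (rule sqrt_ratio)
  then show "\<exists>e>0. cball z0 e \<subseteq> UNIV \<and> uniform_limit (cball z0 e) (\<lambda>n z. \<Sum>i<n. d i * hermite_term i z) (hermite_series d) sequentially"
    by (intro exI[of _ 1]) auto
qed simp

lemma continuous_hermite_series: "continuous_on UNIV (\<lambda>x. hermite_series d (complex_of_real x))"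
  by (rule continuous_on_compose2[OF holomorphic_on_imp_continuous_on[OF holomorphic_hermite_series] continuous_on_of_real_id]) simp

lemma borel_measurable_hermite_series [measurable]:
  "(\<lambda>x. hermite_series d (complex_of_real x)) \<in> borel_measurable borel"
  by (rule borel_measurable_continuous_onI[OF continuous_hermite_series])

definition gauss_amp :: real where "gauss_amp = C * sqrt (1 / sqrt (pi * (1 - r\<^sup>2)))"

text \<open>Depends on \<open>r\<close> only. Any other sequence with the same geometric bound, such
  as that of the Fourier transform, has the same Gaussian rate.\<close>

definition gauss_rate :: real where "gauss_rate = (1 - r) / (2 * (1 + r))"

lemma gauss_rate_pos: "gauss_rate > 0" using r by (simp add: gauss_rate_def)

lemma gauss_amp_nonneg: "gauss_amp \<ge> 0"
  using r C by (simp add: gauss_amp_def power_le_one)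

lemma hermite_series_term_le:
  "cmod (d n * of_real (hermite_fun n x)) \<le> gauss_amp * exp (- (gauss_rate * x\<^sup>2)) * sqrt r ^ n"
  using decaying_coef_mult_le[of "of_real (hermite_fun n x)" n "sqrt (1 / sqrt (pi * (1 - r\<^sup>2))) * exp (- (gauss_rate * x\<^sup>2))"]
    abs_hermite_fun_le[OF r, of n x] r
  by (simp add: gauss_amp_def gauss_rate_def mult.assoc power_le_one del: of_real_mult)

lemma hermite_series_le:
  "cmod (hermite_series d (of_real x)) \<le> gauss_amp / (1 - sqrt r) * exp (- (gauss_rate * x\<^sup>2))"
proof -
  have "cmod (hermite_series d (of_real x)) \<le> (\<Sum>n. gauss_amp * exp (- (gauss_rate * x\<^sup>2)) * sqrt r ^ n)"
    unfolding hermite_series_def hermite_term_of_real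
    by (rule norm_suminf_le[OF hermite_series_term_le sqrt_ratio(3)])
  also have "\<dots> = gauss_amp * exp (- (gauss_rate * x\<^sup>2)) * (1 / (1 - sqrt r))"
    using sqrt_ratio by (subst suminf_mult) (auto simp: suminf_geometric intro!: summable_geometric)
  finally show ?thesis by simp
qed

lemma square_integrable_hermite_series: "square_integrable (\<lambda>x. hermite_series d (of_real x))"
  unfolding square_integrable_def
proof
  show "(\<lambda>x. hermite_series d (of_real x)) \<in> borel_measurable lebesgue"
    by (rule borel_imp_lebesgue_measurable) measurable
  have "integrable lborel (\<lambda>x. (cmod (hermite_series d (of_real x)))\<^sup>2)"
  proof (rule Bochner_Integration.integrable_bound)
    show "integrable lborel (\<lambda>x::real. (gauss_amp / (1 - sqrt r))\<^sup>2 * exp (- (2 * gauss_rate * x\<^sup>2)))"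
      using gauss_has_integral[of "2 * gauss_rate"] gauss_rate_pos
      by (intro integrable_mult_right) (auto simp: has_bochner_integral_iff)
    have "(cmod (hermite_series d (of_real x)))\<^sup>2 \<le> (gauss_amp / (1 - sqrt r))\<^sup>2 * exp (- (2 * gauss_rate * x\<^sup>2))" for x
    proof -
      have "(exp (- (gauss_rate * x\<^sup>2)))\<^sup>2 = exp (- (2 * gauss_rate * x\<^sup>2))" by (simp flip: exp_double)
      then show ?thesis
        using power_mono[OF hermite_series_le[of x] norm_ge_zero, of 2] unfolding power_mult_distrib by simp
    qed
    then show "AE x in lborel. norm ((cmod (hermite_series d (of_real x)))\<^sup>2)
        \<le> norm ((gauss_amp / (1 - sqrt r))\<^sup>2 * exp (- (2 * gauss_rate * x\<^sup>2)))" for x by simp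
  qed measurable
  then show "integrable lebesgue (\<lambda>x. (cmod (hermite_series d (of_real x)))\<^sup>2)"
    by (subst integrable_lebesgue_iff_lborel) measurable
qed

text \<open>One termwise integration for two purposes: with a Hermite function for \<open>e\<close>
  it recovers the coefficients, with an exponential it computes the Fourier transform.\<close>

lemma hermite_series_integral:
  assumes e [measurable]: "e \<in> borel_measurable borel" and B: "\<And>x. cmod (e x) \<le> B"
  shows "(\<lambda>n. d n * integral\<^sup>L lborel (\<lambda>x. e x * of_real (hermite_fun n x))) sums
     integral\<^sup>L lborel (\<lambda>x. e x * hermite_series d (of_real x))"
proof -
  let ?g = "\<lambda>x::real. exp (- (gauss_rate * x\<^sup>2))"
  define f where "f n x = e x * (d n * of_real (hermite_fun n x))" for n x
  have [measurable]: "f n \<in> borel_measurable borel" for n unfolding f_def by measurable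
  have B0: "B \<ge> 0" using B[of 0] norm_ge_zero order_trans by blast
  have f: "cmod (f n x) \<le> (B * gauss_amp * ?g x) * sqrt r ^ n" for n x
  proof -
    have "cmod (f n x) \<le> B * (gauss_amp * ?g x * sqrt r ^ n)"
      unfolding f_def norm_mult[of "e x"] by (intro mult_mono B hermite_series_term_le B0) simp
    then show ?thesis by (simp add: mult_ac)
  qed
  have ig: "integrable lborel ?g"
    using gauss_has_integral[OF gauss_rate_pos] by (simp add: has_bochner_integral_iff)
  have ib: "integrable lborel (\<lambda>x. (B * gauss_amp * ?g x) * sqrt r ^ n)" for n
    using ig by simp
  have fi: "integrable lborel (f n)" for n
    using f gauss_amp_nonneg B0 r by (intro Bochner_Integration.integrable_bound[OF ib[of n]]) auto
  have "(\<lambda>n. integral\<^sup>L lborel (f n)) sums integral\<^sup>L lborel (\<lambda>x. \<Sum>n. f n x)"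
  proof (rule sums_integral[OF fi])
    show "AE x in lborel. summable (\<lambda>n. norm (f n x))"
      using f by (intro AE_I2 summable_comparison_test'[OF sqrt_ratio(3)]) auto
    have "(LINT x|lborel. norm (f n x)) \<le> (B * gauss_amp * integral\<^sup>L lborel ?g) * sqrt r ^ n" for n
      using integral_mono[OF integrable_norm[OF fi[of n]] ib[of n]] f by simp
    then show "summable (\<lambda>n. LINT x|lborel. norm (f n x))"
      by (intro summable_comparison_test'[OF sqrt_ratio(3)]) (simp add: Bochner_Integration.integral_nonneg)
  qed
  moreover have "integral\<^sup>L lborel (f n) = d n * integral\<^sup>L lborel (\<lambda>x. e x * of_real (hermite_fun n x))" for n
    unfolding f_def by (subst integral_mult_right_zero[symmetric]) (simp add: mult_ac)
  moreover have "(\<Sum>n. f n x) = e x * hermite_series d (of_real x)" for x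
    unfolding f_def hermite_series_def hermite_term_of_real
    by (rule suminf_mult)
       (rule summable_comparison_test'[OF sqrt_ratio(3)], rule hermite_series_term_le)
  ultimately show ?thesis by simp
qed

lemma coef_hermite_series: "coef (abs_L2 (\<lambda>x. hermite_series d (of_real x))) m = d m"
proof -
  let ?h = "\<lambda>n x. complex_of_real (hermite_fun n x)"
  have [measurable]: "?h n \<in> borel_measurable borel" for n by measurable
  have "cmod (?h m x) \<le> inverse (sqrt r ^ m) * sqrt (1 / sqrt (pi * (1 - r\<^sup>2)))" for x
  proof -
    have "inverse (sqrt r ^ m) * (sqrt (1 / sqrt (pi * (1 - r\<^sup>2))) * exp (- ((1 - r) / (2 * (1 + r)) * x\<^sup>2)))
      \<le> inverse (sqrt r ^ m) * (sqrt (1 / sqrt (pi * (1 - r\<^sup>2))) * 1)"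
      using r by (intro mult_left_mono) (auto simp: power_le_one)
    then show ?thesis using abs_hermite_fun_le[OF r, of m x] by simp
  qed
  then have "(\<lambda>n. d n * integral\<^sup>L lborel (\<lambda>x. ?h m x * ?h n x)) sums
     integral\<^sup>L lborel (\<lambda>x. ?h m x * hermite_series d (of_real x))"
    by (intro hermite_series_integral) measurable
  also have "integral\<^sup>L lborel (\<lambda>x. ?h m x * hermite_series d (of_real x)) = coef (abs_L2 (\<lambda>x. hermite_series d (of_real x))) m"
    unfolding coef_abs_L2[OF square_integrable_hermite_series]
    by (subst integral_lebesgue_eq_lborel) (simp_all add: mult.commute)
  also have "(\<lambda>n. d n * integral\<^sup>L lborel (\<lambda>x. ?h m x * ?h n x)) = (\<lambda>n. if n = m then d n else 0)"
  proof
    fix n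
    have "integral\<^sup>L lborel (\<lambda>x. ?h m x * ?h n x) = coef (hermite_L2 m) n"
      unfolding hermite_L2_def coef_abs_L2[OF square_integrable_hermite_fun]
      by (subst integral_lebesgue_eq_lborel) measurable
    then show "d n * integral\<^sup>L lborel (\<lambda>x. ?h m x * ?h n x) = (if n = m then d n else 0)"
      by (simp add: coef_hermite_L2)
  qed
  finally show ?thesis using sums_unique2[OF _ sums_single[of m d]] by blast
qed

lemma fourier_hermite_series:
  "fourier (\<lambda>x. hermite_series d (of_real x)) \<xi> = hermite_series (\<lambda>n. d n * (- \<i>) ^ n) (of_real \<xi>)"
proof -
  define e where "e x = exp (- (\<i> * complex_of_real (x * \<xi>)))" for x
  have [measurable]: "e \<in> borel_measurable borel"
    unfolding e_def by (intro borel_measurable_continuous_onI continuous_intros)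
  have "cmod (e x) \<le> 1" for x by (simp add: e_def)
  then have s: "(\<lambda>n. d n * integral\<^sup>L lborel (\<lambda>x. e x * of_real (hermite_fun n x))) sums
     integral\<^sup>L lborel (\<lambda>x. e x * hermite_series d (of_real x))"
    by (intro hermite_series_integral) measurable
  have t: "integral\<^sup>L lborel (\<lambda>x. e x * of_real (hermite_fun n x)) = of_real (sqrt (2 * pi)) * ((- \<i>) ^ n * of_real (hermite_fun n \<xi>))" for n
  proof -
    have "integral\<^sup>L lborel (\<lambda>x. e x * of_real (hermite_fun n x)) = integral\<^sup>L lborel (\<lambda>x. (e x * of_real (hermite_gauss n x)) / of_real (hermite_norm n))"
      by (simp add: hermite_fun_eq)
    also have "\<dots> = fourier_hermite n \<xi> / of_real (hermite_norm n)"
      unfolding fourier_hermite_def e_def by (rule integral_divide_zero)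
    finally show ?thesis by (simp add: fourier_hermite_eq hermite_fun_eq)
  qed
  have "(\<lambda>n. of_real (1 / sqrt (2 * pi)) * (d n * integral\<^sup>L lborel (\<lambda>x. e x * of_real (hermite_fun n x)))) sums
     (of_real (1 / sqrt (2 * pi)) * integral\<^sup>L lborel (\<lambda>x. e x * hermite_series d (of_real x)))"
    by (rule sums_mult[OF s])
  also have "(\<lambda>n. of_real (1 / sqrt (2 * pi)) * (d n * integral\<^sup>L lborel (\<lambda>x. e x * of_real (hermite_fun n x))))
     = (\<lambda>n. d n * (- \<i>) ^ n * of_real (hermite_fun n \<xi>))"
    unfolding t by (rule ext) simp
  also have "of_real (1 / sqrt (2 * pi)) * integral\<^sup>L lborel (\<lambda>x. e x * hermite_series d (of_real x))
     = fourier (\<lambda>x. hermite_series d (of_real x)) \<xi>"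
    unfolding fourier_def e_def[symmetric] by (subst integral_lebesgue_eq_lborel) measurable
  finally show ?thesis unfolding hermite_series_def hermite_term_of_real by (simp add: sums_iff)
qed

end

lemma fourier_cong_AE:
  assumes "f \<in> borel_measurable lebesgue" "g \<in> borel_measurable lebesgue" "AE x in lebesgue. f x = g x"
  shows "fourier f \<xi> = fourier g \<xi>"
proof -
  have e: "(\<lambda>x. exp (- (\<i> * complex_of_real (x * \<xi>)))) \<in> borel_measurable lebesgue"
    by (intro borel_imp_lebesgue_measurable borel_measurable_continuous_onI continuous_intros)
  have "(LINT x|lebesgue. exp (- (\<i> * of_real (x * \<xi>))) * f x) = (LINT x|lebesgue. exp (- (\<i> * of_real (x * \<xi>))) * g x)"
    using assms(3) by (intro integral_cong_AE borel_measurable_times e assms) (auto elim: eventually_mono)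
  then show ?thesis by (simp add: fourier_def)
qed

lemma in_LinftyI:
  assumes [measurable]: "f \<in> borel_measurable lebesgue" and "AE x in lebesgue. cmod (f x) \<le> K"
  shows "in_Linfty f"
proof -
  have "esssup lebesgue (\<lambda>x. ereal (cmod (f x))) \<le> ereal K"
    using assms(2) by (intro esssup_I) auto
  then show ?thesis using assms(1) by (auto simp: in_Linfty_def intro: le_less_trans)
qed

theorem corollary3p18:
  fixes \<phi> :: "real \<Rightarrow> complex" and \<omega> :: real
  assumes "square_integrable \<phi>"
    and "\<omega> *\<^sub>R abs_L2 \<phi> = T6 (abs_L2 \<phi>)"
  shows "(\<exists>\<alpha>>0. \<exists>\<beta>>0.
            in_Linfty (\<lambda>x. \<phi> x * of_real (exp (\<alpha> * x\<^sup>2))) \<and>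
            in_Linfty (\<lambda>\<xi>. fourier \<phi> \<xi> * of_real (exp (\<beta> * \<xi>\<^sup>2)))) \<and>
         (\<exists>F. F holomorphic_on UNIV \<and> (AE x in lebesgue. F (of_real x) = \<phi> x))"
proof -
  obtain C r where r: "0 < r" "r < 1" and C: "C \<ge> 0" and c: "\<And>n. cmod (coef (abs_L2 \<phi>) n) \<le> C * r ^ n"
    by (rule geometric_decay[OF assms(2)]) (rule that)
  let ?F = "hermite_series (coef (abs_L2 \<phi>))" and ?G = "hermite_series (\<lambda>n. coef (abs_L2 \<phi>) n * (- \<i>) ^ n)"
  \<comment> \<open>The factors \<open>(- \<i>) ^ n\<close> are unimodular, so the transformed
    series obeys the same bound, and one rate serves as both \<open>\<alpha>\<close> and
    \<open>\<beta>\<close>.\<close>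
  have c': "cmod (coef (abs_L2 \<phi>) n * (- \<i>) ^ n) \<le> C * r ^ n" for n
    using c[of n] by (simp add: norm_mult norm_power)
  note meas = square_integrable_measurable[OF assms(1)]
    borel_imp_lebesgue_measurable[OF borel_measurable_hermite_series[OF r C c]]
  have "abs_L2 (\<lambda>x. ?F (of_real x)) = abs_L2 \<phi>"
    by (rule L2_eqI) (rule coef_hermite_series[OF r C c])
  then have ae: "AE x in lebesgue. ?F (of_real x) = \<phi> x"
    by (rule abs_L2_eqD[OF square_integrable_hermite_series[OF r C c] assms(1)])
  have "fourier \<phi> \<xi> = fourier (\<lambda>x. ?F (of_real x)) \<xi>" for \<xi>
    using ae by (intro fourier_cong_AE meas) (auto elim: eventually_mono)
  then have four: "fourier \<phi> = (\<lambda>\<xi>. ?G (of_real \<xi>))"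
    using fourier_hermite_series[OF r C c] by auto
  define K where "K = gauss_amp C r / (1 - sqrt r)"
  have le: "cmod (w * of_real (exp (gauss_rate r * x\<^sup>2))) \<le> K"
    if "cmod w \<le> K * exp (- (gauss_rate r * x\<^sup>2))" for w x
    using mult_right_mono[OF that, of "exp (gauss_rate r * x\<^sup>2)"] by (simp add: norm_mult mult.assoc flip: exp_add)
  have ex: "(\<lambda>x. complex_of_real (exp (gauss_rate r * x\<^sup>2))) \<in> borel_measurable lebesgue"
    by (intro borel_imp_lebesgue_measurable borel_measurable_continuous_onI continuous_intros)
  have "in_Linfty (\<lambda>x. \<phi> x * of_real (exp (gauss_rate r * x\<^sup>2)))"
  proof (rule in_LinftyI)
    show "AE x in lebesgue. cmod (\<phi> x * of_real (exp (gauss_rate r * x\<^sup>2))) \<le> K"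
      using ae
    proof eventually_elim
      case (elim x)
      show ?case using hermite_series_le[OF r C c, of x] unfolding elim K_def[symmetric] by (rule le)
    qed
  qed (intro borel_measurable_times meas ex)
  moreover have "in_Linfty (\<lambda>\<xi>. fourier \<phi> \<xi> * of_real (exp (gauss_rate r * \<xi>\<^sup>2)))"
    unfolding four
  proof (rule in_LinftyI)
    show "AE x in lebesgue. cmod (?G (of_real x) * of_real (exp (gauss_rate r * x\<^sup>2))) \<le> K"
      using hermite_series_le[OF r C c'] unfolding K_def[symmetric] by (intro AE_I2 le)
  qed (intro borel_measurable_times ex borel_imp_lebesgue_measurable borel_measurable_hermite_series[OF r C c'])
  moreover have "?F holomorphic_on UNIV" by (rule holomorphic_hermite_series[OF r C c])
  moreover have "gauss_rate r > 0" by (rule gauss_rate_pos[OF r C c])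
  ultimately show ?thesis using ae by blast
qed

end
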